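(* Let $P$ be a planar, symmetric or cyclic operad (in sets) with a nice grading $\psi$ such that any two operations with the same multiset of input colours and the same output colour have the same grading. Let $\mathcal V(P)$ be the image of the canonical discrete opfibration $\mathrm{Tw}(P)\to\mathcal U(P)$. Then $\mathcal V(P)$ can be endowed with the degree map that sends an object to the common grading of the operations in the fibre over it, and the orthogonal factorization system $(R_-,R_+)$ on $\mathcal U(P)$ restricts to $\mathcal V(P)$. This gives a generalized Reedy structure for $\mathcal V(P)$ if and only if all operations of $P$ of grading $0$ have arity $1$ and the category $P(\psi=0)$ of these operations is a groupoid. In this case the discrete opfibration $\mathrm{Tw}(P)\to\mathcal V(P)$ is a map of generalized Reedy categories (it preserves the degree and the classes $R_-$, $R_+$).
   Context: Symmetric and planar operads are coloured operads in sets with identity operations (planar: no symmetric group actions). Cyclic operads are single-coloured: symmetric operads $P$ whose $S_n$-action on $P(n)$ extends compatibly to an $S_{n+1}$-action; an element of $P(n)$ has arity $n$ and legs $0,\dots,n$ ($0$ is the output), and any leg of one element can be glued to any leg of another, provided the result has at least one leg. **Twisted arrow category, symmetric case** ($P$ is $C$-coloured). Objects: operations of $P$. A morphism with source $p\in P(c_1,\dots,c_n;c_0)$ is (uniquely, this is its canonical representative) a tuple $f=(q_0;q_1,\dots,q_n;\lambda)$, where $q_0\in P$ has arity $m_0\ge 1$ and first input colour $c_0$, $q_i\in P$ ($1\le i\le n$) has arity $m_i\ge 0$ and output colour $c_i$, and $\lambda$ is a bijection from the set of leaves $\{(i,k):1\le i\le n,1\le k\le m_i\}\cup\{(0,k):2\le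 k\le m_0\}$ onto $\{1,\dots,N\}$ with $k\mapsto\lambda(i,k)$ increasing for each fixed $i$. The target is the operation $t$ with $t(x_1,\dots,x_N)=q_0\bigl(p(q_1(x_{\lambda(1,1)},\dots,x_{\lambda(1,m_1)}),\dots,q_n(x_{\lambda(n,1)},\dots)),x_{\lambda(0,2)},\dots,x_{\lambda(0,m_0)}\bigr)$. The operations $q_0,\dots,q_n$ are the non-source vertices. The planar order of leaves is $(1,1),\dots,(n,m_n),(0,2),\dots,(0,m_0)$; the permutation on leaves is trivial if $\lambda$ numbers leaves in planar order. The composite of $f:p\to t$ with $g=(r_0;r_1,\dots,r_N;\mu):t\to u$ has upper vertices $q_i(r_{\lambda(i,1)},\dots,r_{\lambda(i,m_i)})$ and lower vertex $r_0\circ_1 q_0(\mathrm{id},r_{\lambda(0,2)},\dots,r_{\lambda(0,m_0)})$, with leaves numbered by $\mu$, and with inputs of each vertex (other than the first input of the lower one) then permuted so that the numbers increase. **Planar case.** The same, but a morphism from $p$ is a tuple $(q_0,i;q_1,\dots,q_n)$, where the $i$-th input of $q_0$ has colour $c_0$, with target $q_0\circ_i p(q_1,\dots,q_n)$; the permutation on leaves is trivial. **Cyclic case.** Objects: elements of all $P(n)$, $n\geq 0$. A morphism from $p\in P(n)$ is a tuple $(q_0,\dots,q_n;\lambda)$ with $q_j\in P(m_j)$, $\sum_j m_j\geq 1$, and $\lambda$ a bijection from $\{(j,k):0\le j\le n,1\le k\le m_j\}$ onto $\{0,\dots,N\}$ increasing in $k$ for each $j$; its target is obtained by gluing leg $0$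 of $q_j$ to leg $j$ of $p$ for all $j$ and numbering the remaining legs by $\lambda$. All $q_j$ are non-source vertices. The permutation on leaves is trivial if $\lambda$ is order-preserving for the lexicographic order. **Enveloping category $\mathcal U(P)$.** Objects are the profiles $(c_1,\dots,c_n;c_0)$ of colours (in the cyclic case, the integers $n\ge 0$). Morphisms from a profile $(c_1,\dots,c_n;c_0)$ are: in the symmetric case, the tuples $(q_0;q_1,\dots,q_n;\lambda)$, where $q_0\in P$ has arity $m_0\ge 1$ and first input colour $c_0$, $q_i\in P$ ($1\le i\le n$) has arity $m_i\ge 0$ and output colour $c_i$, and $\lambda$ is a bijection from $\{(i,k):1\le i\le n,1\le k\le m_i\}\cup\{(0,k):2\le k\le m_0\}$ onto $\{1,\dots,N\}$ with $k\mapsto\lambda(i,k)$ increasing for each fixed $i$; in the planar case, the tuples $(q_0,i;q_1,\dots,q_n)$, where the $i$-th input of $q_0$ has colour $c_0$ and $q_j$ has output colour $c_j$ for $1\le j\le n$; in the cyclic case (morphisms from $n$), the tuples $(q_0,\dots,q_n;\lambda)$ with $q_j\in P(m_j)$, $\sum_j m_j\geq 1$, and $\lambda$ a bijection from $\{(j,k):0\le j\le n,1\le k\le m_j\}$ onto $\{0,\dots,N\}$ increasing in $k$ for each $j$; the source vertex is unmarked; the target is the resulting profile; tuples are composed by the same rule as in $\mathrm{Tw}(P)$ (this rule involves only the non-source vertices and the numberings of leaves, and not the source operation). The canonical discrete opfibration $\mathrm{Tw}(P)\to\mathcal U(P)$ sends an operation to its profile and a tuple to the same tuple. Its image $\mathcal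 V(P)$ is the full subcategory on the profiles of operations of $P$. **Grading.** A grading $\psi$ assigns to each operation an integer with $\psi(p\circ_i q)=\psi(p)+\psi(q)$, $\psi(\mathrm{id}_c)=0$, $\psi(p^\sigma)=\psi(p)$. It is nice if $\psi(p)\ge -1$ for all $p$, operations of grading $-1$ have arity $0$, and units of binary operations (arity $0$ operations $e$ such that $m\circ_1 e$ or $m\circ_2 e$ is an identity for some binary $m$) have grading $-1$. If all operations of grading $0$ are unary, $P(\psi=0)$ is the category whose objects are colours and whose morphisms are the operations of grading $0$. **The classes** (in $\mathrm{Tw}(P)$ or $\mathcal U(P)$). $R_{\psi=-1}$: morphisms whose canonical representative has trivial permutation on leaves and whose non-source vertices are identities or operations of grading $-1$. $R_{\psi\ge0}$: morphisms all of whose non-source vertices have grading $\ge 0$. With $I$ the class of all isomorphisms, $R_-=I\circ R_{\psi=-1}$ and $R_+=R_{\psi\geq 0}\circ I=R_{\psi\ge 0}$. **Generalized Reedy structure** on a category $\mathcal C$: subcategories $R_-,R_+$ and a degree map from objects to an ordinal (here $\{-1,0,1,\dots\}\cong\omega$) such that (1) $(R_-,R_+)$ is an orthogonal factorization system (both contain all isomorphisms; each morphism factors as $r\circ l$ with $l\in R_-$, $r\in R_+$, uniquely up to unique isomorphism of factorizations); (2) non-isomorphisms in $R_-$ decrease degree; (3) non-isomorphisms in $R_+$ increase degree; (4) isomorphisms preserve degree; (5) if $f\in R_-$, $\theta$ is an isomorphism and $\theta\circ f=f$, then $\theta=\mathrm{id}$. On $\mathrm{Tw}(P)$ the degree map is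 $\psi$. *)

theory Defs
  imports "HOL-Combinatorics.Permutations" "HOL-Library.Multiset" "HOL-Library.FuncSet"
begin

section \<open>Categories, factorization systems, generalized Reedy structures\<close>

text \<open>Hom-sets for different pairs of objects may overlap: a morphism is an element of
  \<open>Hom C a b\<close> together with \<open>a\<close> and \<open>b\<close>. Accordingly a class of morphisms is a family
  \<open>R a b \<subseteq> Hom C a b\<close>. \<open>Cmp C g f\<close> is \<open>g\<close> after \<open>f\<close>.\<close>

record ('a, 'm) cat =
  Obj :: "'a set"
  Hom :: "'a \<Rightarrow> 'a \<Rightarrow> 'm set"
  Idm :: "'a \<Rightarrow> 'm"
  Cmp :: "'m \<Rightarrow> 'm \<Rightarrow> 'm"

definition category :: "('a, 'm) cat \<Rightarrow> bool" where
  "category C \<longleftrightarrow>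
     (\<forall>a\<in>Obj C. Idm C a \<in> Hom C a a) \<and>
     (\<forall>a\<in>Obj C. \<forall>b\<in>Obj C. \<forall>c\<in>Obj C. \<forall>f\<in>Hom C a b. \<forall>g\<in>Hom C b c. Cmp C g f \<in> Hom C a c) \<and>
     (\<forall>a\<in>Obj C. \<forall>b\<in>Obj C. \<forall>f\<in>Hom C a b. Cmp C f (Idm C a) = f \<and> Cmp C (Idm C b) f = f) \<and>
     (\<forall>a\<in>Obj C. \<forall>b\<in>Obj C. \<forall>c\<in>Obj C. \<forall>d\<in>Obj C.
        \<forall>f\<in>Hom C a b. \<forall>g\<in>Hom C b c. \<forall>h\<in>Hom C c d. Cmp C h (Cmp C g f) = Cmp C (Cmp C h g) f)"

definition Isos :: "('a, 'm) cat \<Rightarrow> 'a \<Rightarrow> 'a \<Rightarrow> 'm set" where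
  "Isos C a b = {f \<in> Hom C a b. \<exists>g\<in>Hom C b a. Cmp C g f = Idm C a \<and> Cmp C f g = Idm C b}"

definition groupoid :: "('a, 'm) cat \<Rightarrow> bool" where
  "groupoid C \<longleftrightarrow> category C \<and> (\<forall>a\<in>Obj C. \<forall>b\<in>Obj C. Hom C a b \<subseteq> Isos C a b)"

definition full_subcategory :: "('a, 'm) cat \<Rightarrow> 'a set \<Rightarrow> ('a, 'm) cat" where
  "full_subcategory C A = C\<lparr>Obj := A\<rparr>"

definition subcategory_with_isos :: "('a, 'm) cat \<Rightarrow> ('a \<Rightarrow> 'a \<Rightarrow> 'm set) \<Rightarrow> bool" where
  "subcategory_with_isos C R \<longleftrightarrow>
     (\<forall>a\<in>Obj C. \<forall>b\<in>Obj C. Isos C a b \<subseteq> R a b \<and> R a b \<subseteq> Hom C a b) \<and>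
     (\<forall>a\<in>Obj C. \<forall>b\<in>Obj C. \<forall>c\<in>Obj C. \<forall>f\<in>R a b. \<forall>g\<in>R b c. Cmp C g f \<in> R a c)"

definition orthogonal_factorization_system ::
  "('a, 'm) cat \<Rightarrow> ('a \<Rightarrow> 'a \<Rightarrow> 'm set) \<Rightarrow> ('a \<Rightarrow> 'a \<Rightarrow> 'm set) \<Rightarrow> bool" where
  "orthogonal_factorization_system C L R \<longleftrightarrow>
     category C \<and> subcategory_with_isos C L \<and> subcategory_with_isos C R \<and>
     (\<forall>a\<in>Obj C. \<forall>b\<in>Obj C. \<forall>f\<in>Hom C a b.
        (\<exists>c\<in>Obj C. \<exists>l\<in>L a c. \<exists>r\<in>R c b. Cmp C r l = f) \<and>
        (\<forall>c\<in>Obj C. \<forall>c'\<in>Obj C. \<forall>l\<in>L a c. \<forall>r\<in>R c b. \<forall>l'\<in>L a c'. \<forall>r'\<in>R c' b.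
           Cmp C r l = f \<and> Cmp C r' l' = f \<longrightarrow>
           (\<exists>!\<theta>. \<theta> \<in> Isos C c c' \<and> Cmp C \<theta> l = l' \<and> Cmp C r' \<theta> = r)))"

text \<open>The degrees take values in the ordinal \<open>{-1, 0, 1, \<dots>}\<close>.\<close>

definition generalized_reedy ::
  "('a, 'm) cat \<Rightarrow> ('a \<Rightarrow> 'a \<Rightarrow> 'm set) \<Rightarrow> ('a \<Rightarrow> 'a \<Rightarrow> 'm set) \<Rightarrow> ('a \<Rightarrow> int) \<Rightarrow> bool" where
  "generalized_reedy C Rm Rp deg \<longleftrightarrow>
     (\<forall>a\<in>Obj C. -1 \<le> deg a) \<and>
     orthogonal_factorization_system C Rm Rp \<and>
     (\<forall>a\<in>Obj C. \<forall>b\<in>Obj C. \<forall>f \<in> Rm a b - Isos C a b. deg b < deg a) \<and>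
     (\<forall>a\<in>Obj C. \<forall>b\<in>Obj C. \<forall>f \<in> Rp a b - Isos C a b. deg a < deg b) \<and>
     (\<forall>a\<in>Obj C. \<forall>b\<in>Obj C. \<forall>f \<in> Isos C a b. deg a = deg b) \<and>
     (\<forall>a\<in>Obj C. \<forall>b\<in>Obj C. \<forall>f \<in> Rm a b. \<forall>\<theta> \<in> Isos C b b. Cmp C \<theta> f = f \<longrightarrow> \<theta> = Idm C b)"

definition is_functor ::
  "('a, 'm) cat \<Rightarrow> ('b, 'n) cat \<Rightarrow> ('a \<Rightarrow> 'b) \<Rightarrow> ('m \<Rightarrow> 'n) \<Rightarrow> bool" where
  "is_functor C D Fo Fm \<longleftrightarrow>
     category C \<and> category D \<and>
     (\<forall>a\<in>Obj C. Fo a \<in> Obj D \<and> Fm (Idm C a) = Idm D (Fo a)) \<and>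
     (\<forall>a\<in>Obj C. \<forall>b\<in>Obj C. \<forall>f\<in>Hom C a b. Fm f \<in> Hom D (Fo a) (Fo b)) \<and>
     (\<forall>a\<in>Obj C. \<forall>b\<in>Obj C. \<forall>c\<in>Obj C. \<forall>f\<in>Hom C a b. \<forall>g\<in>Hom C b c.
        Fm (Cmp C g f) = Cmp D (Fm g) (Fm f))"

definition discrete_opfibration ::
  "('a, 'm) cat \<Rightarrow> ('b, 'n) cat \<Rightarrow> ('a \<Rightarrow> 'b) \<Rightarrow> ('m \<Rightarrow> 'n) \<Rightarrow> bool" where
  "discrete_opfibration C D Fo Fm \<longleftrightarrow>
     is_functor C D Fo Fm \<and>
     (\<forall>a\<in>Obj C. \<forall>y\<in>Obj D. \<forall>g\<in>Hom D (Fo a) y.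
        \<exists>!(b, f). b \<in> Obj C \<and> f \<in> Hom C a b \<and> Fo b = y \<and> Fm f = g)"

definition generalized_reedy_map ::
  "('a, 'm) cat \<Rightarrow> ('a \<Rightarrow> 'a \<Rightarrow> 'm set) \<Rightarrow> ('a \<Rightarrow> 'a \<Rightarrow> 'm set) \<Rightarrow> ('a \<Rightarrow> int) \<Rightarrow>
   ('b, 'n) cat \<Rightarrow> ('b \<Rightarrow> 'b \<Rightarrow> 'n set) \<Rightarrow> ('b \<Rightarrow> 'b \<Rightarrow> 'n set) \<Rightarrow> ('b \<Rightarrow> int) \<Rightarrow>
   ('a \<Rightarrow> 'b) \<Rightarrow> ('m \<Rightarrow> 'n) \<Rightarrow> bool" where
  "generalized_reedy_map C Rm Rp deg D Sm Sp deg' Fo Fm \<longleftrightarrow>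
     generalized_reedy C Rm Rp deg \<and> generalized_reedy D Sm Sp deg' \<and> is_functor C D Fo Fm \<and>
     (\<forall>a\<in>Obj C. deg' (Fo a) = deg a) \<and>
     (\<forall>a\<in>Obj C. \<forall>b\<in>Obj C. Fm ` Rm a b \<subseteq> Sm (Fo a) (Fo b) \<and> Fm ` Rp a b \<subseteq> Sp (Fo a) (Fo b))"


section \<open>Operads\<close>

text \<open>\<open>plug P p [q\<^sub>1, \<dots>, q\<^sub>n]\<close> is the full composite \<open>p(q\<^sub>1, \<dots>, q\<^sub>n)\<close>. Inputs are numbered
  from 1, so input \<open>i\<close> has colour \<open>ins P p ! (i - 1)\<close>.\<close>

record ('c, 'o) operad =
  Cols :: "'c set"
  Ops :: "'o set"
  ins :: "'o \<Rightarrow> 'c list"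
  out :: "'o \<Rightarrow> 'c"
  ident :: "'c \<Rightarrow> 'o"
  plug :: "'o \<Rightarrow> 'o list \<Rightarrow> 'o"

text \<open>The action is normalized so that input \<open>j\<close> of \<open>p\<close> becomes input \<open>\<sigma> j\<close> of \<open>act P \<sigma> p\<close>, that is,
  \<open>(act P \<sigma> p)(x\<^sub>1, \<dots>, x\<^sub>n) = p(x\<^bsub>\<sigma> 1\<^esub>, \<dots>, x\<^bsub>\<sigma> n\<^esub>)\<close>; this is a left action.\<close>

record ('c, 'o) sym_operad = "('c, 'o) operad" +
  act :: "(nat \<Rightarrow> nat) \<Rightarrow> 'o \<Rightarrow> 'o"

definition arity :: "('c, 'o, 'z) operad_scheme \<Rightarrow> 'o \<Rightarrow> nat" where
  "arity P p = length (ins P p)"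

definition composable :: "('c, 'o, 'z) operad_scheme \<Rightarrow> 'o \<Rightarrow> 'o list \<Rightarrow> bool" where
  "composable P p qs \<longleftrightarrow> p \<in> Ops P \<and> set qs \<subseteq> Ops P \<and> map (out P) qs = ins P p"

text \<open>The partial composite \<open>p \<circ>\<^sub>i q\<close>.\<close>

definition pcomp :: "('c, 'o, 'z) operad_scheme \<Rightarrow> 'o \<Rightarrow> nat \<Rightarrow> 'o \<Rightarrow> 'o" where
  "pcomp P p i q = plug P p ((map (ident P) (ins P p))[i - 1 := q])"

locale planar_operad =
  fixes P :: "('c, 'o, 'z) operad_scheme"
  assumes colours: "p \<in> Ops P \<Longrightarrow> out P p \<in> Cols P \<and> set (ins P p) \<subseteq> Cols P"
    and ident: "c \<in> Cols P \<Longrightarrow> ident P c \<in> Ops P \<and> ins P (ident P c) = [c] \<and> out P (ident P c) = c"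
    and plug: "composable P p qs \<Longrightarrow>
      plug P p qs \<in> Ops P \<and> ins P (plug P p qs) = concat (map (ins P) qs) \<and>
      out P (plug P p qs) = out P p"
    and unit: "p \<in> Ops P \<Longrightarrow>
      plug P (ident P (out P p)) [p] = p \<and> plug P p (map (ident P) (ins P p)) = p"
    and assoc: "\<lbrakk>composable P p qs; list_all2 (composable P) qs rss\<rbrakk> \<Longrightarrow>
      plug P (plug P p qs) (concat rss) = plug P p (map2 (plug P) qs rss)"

text \<open>\<open>place [a\<^sub>1, \<dots>, a\<^sub>n]\<close> is the map \<open>j \<mapsto> a\<^sub>j\<close> on \<open>{1..n}\<close>, and \<open>place0\<close> is the analogue for lists
  indexed from 0. Both are the identity elsewhere.\<close>

definition place :: "nat list \<Rightarrow> nat \<Rightarrow> nat" where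
  "place xs j = (if 1 \<le> j \<and> j \<le> length xs then xs ! (j - 1) else j)"

definition place0 :: "nat list \<Rightarrow> nat \<Rightarrow> nat" where
  "place0 xs j = (if j < length xs then xs ! j else j)"

text \<open>The number, among the inputs of \<open>p(q\<^sub>1, \<dots>, q\<^sub>n)\<close>, of input \<open>k\<close> of \<open>q\<^sub>b\<close> (\<open>qs = [q\<^sub>1, \<dots>, q\<^sub>n]\<close>).\<close>

definition input_pos :: "('c, 'o, 'z) operad_scheme \<Rightarrow> 'o list \<Rightarrow> nat \<Rightarrow> nat \<Rightarrow> nat" where
  "input_pos P qs b k = (\<Sum>q\<leftarrow>take (b - 1) qs. arity P q) + k"

locale symmetric_operad = planar_operad P
  for P :: "('c, 'o, 'z) sym_operad_scheme" +
  assumes act: "\<lbrakk>p \<in> Ops P; \<sigma> permutes {1..arity P p}\<rbrakk> \<Longrightarrow>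
      act P \<sigma> p \<in> Ops P \<and> out P (act P \<sigma> p) = out P p \<and> arity P (act P \<sigma> p) = arity P p \<and>
      (\<forall>i\<in>{1..arity P p}. ins P (act P \<sigma> p) ! (\<sigma> i - 1) = ins P p ! (i - 1))"
    and act_id: "p \<in> Ops P \<Longrightarrow> act P id p = p"
    and act_comp: "\<lbrakk>p \<in> Ops P; \<sigma> permutes {1..arity P p}; \<tau> permutes {1..arity P p}\<rbrakk> \<Longrightarrow>
      act P \<sigma> (act P \<tau> p) = act P (\<sigma> \<circ> \<tau>) p"
    and equivariance_outer:
      "\<lbrakk>p \<in> Ops P; \<sigma> permutes {1..arity P p}; composable P (act P \<sigma> p) qs\<rbrakk> \<Longrightarrow>
      plug P (act P \<sigma> p) qs =
        act P (place (concat (map (\<lambda>a. map (input_pos P qs (\<sigma> a)) [1..<Suc (arity P (qs ! (\<sigma> a - 1)))])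
                                  [1..<Suc (arity P p)])))
          (plug P p (map (\<lambda>a. qs ! (\<sigma> a - 1)) [1..<Suc (arity P p)]))"
    and equivariance_inner:
      "\<lbrakk>composable P p qs; \<And>b. b \<in> {1..length qs} \<Longrightarrow> \<tau>s b permutes {1..arity P (qs ! (b - 1))}\<rbrakk> \<Longrightarrow>
      plug P p (map (\<lambda>b. act P (\<tau>s b) (qs ! (b - 1))) [1..<Suc (length qs)]) =
        act P (place (concat (map (\<lambda>b. map (\<lambda>k. input_pos P qs b (\<tau>s b k)) [1..<Suc (arity P (qs ! (b - 1)))])
                                  [1..<Suc (length qs)])))
          (plug P p qs)"

text \<open>The rotation of the legs \<open>0, \<dots>, n\<close>.\<close>

definition rot :: "nat \<Rightarrow> nat \<Rightarrow> nat" where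
  "rot n j = (if j < n then Suc j else if j = n then 0 else j)"

text \<open>In a cyclic operad \<open>act P \<sigma> p\<close> is also meaningful for permutations of all legs \<open>0, \<dots>, n\<close>: leg \<open>j\<close>
  of \<open>p\<close> becomes leg \<open>\<sigma> j\<close> of \<open>act P \<sigma> p\<close>. Since the symmetric group on the inputs and \<open>rot n\<close> generate
  all permutations of the legs, it suffices to state the compatibility with composition for
  \<open>rot n\<close> (Getzler-Kapranov). The case of \<open>rot_last\<close> where \<open>q\<close> has arity 0 follows from \<open>rot_inner\<close> and
  the equivariance under permutations of the inputs.\<close>

locale cyclic_operad = symmetric_operad P
  for P :: "(unit, 'o, 'z) sym_operad_scheme" +
  assumes single_coloured: "Cols P = {()}"
    and cyc_act: "\<lbrakk>p \<in> Ops P; \<sigma> permutes {0..arity P p}\<rbrakk> \<Longrightarrow>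
      act P \<sigma> p \<in> Ops P \<and> arity P (act P \<sigma> p) = arity P p"
    and cyc_act_comp: "\<lbrakk>p \<in> Ops P; \<sigma> permutes {0..arity P p}; \<tau> permutes {0..arity P p}\<rbrakk> \<Longrightarrow>
      act P \<sigma> (act P \<tau> p) = act P (\<sigma> \<circ> \<tau>) p"
    and rot_ident: "act P (rot 1) (ident P ()) = ident P ()"
    and rot_inner: "\<lbrakk>p \<in> Ops P; q \<in> Ops P; 1 \<le> i; i < arity P p\<rbrakk> \<Longrightarrow>
      act P (rot (arity P p + arity P q - 1)) (pcomp P p i q) =
        pcomp P (act P (rot (arity P p)) p) (Suc i) q"
    and rot_last: "\<lbrakk>p \<in> Ops P; q \<in> Ops P; 1 \<le> arity P p; 1 \<le> arity P q\<rbrakk> \<Longrightarrow>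
      act P (rot (arity P p + arity P q - 1)) (pcomp P p (arity P p) q) =
        pcomp P (act P (rot (arity P q)) q) 1 (act P (rot (arity P p)) p)"


section \<open>Gradings\<close>

definition planar_grading :: "('c, 'o, 'z) operad_scheme \<Rightarrow> ('o \<Rightarrow> int) \<Rightarrow> bool" where
  "planar_grading P \<psi> \<longleftrightarrow>
     (\<forall>c\<in>Cols P. \<psi> (ident P c) = 0) \<and>
     (\<forall>p\<in>Ops P. \<forall>q\<in>Ops P. \<forall>i\<in>{1..arity P p}. out P q = ins P p ! (i - 1) \<longrightarrow>
        \<psi> (pcomp P p i q) = \<psi> p + \<psi> q)"

definition symmetric_grading :: "('c, 'o, 'z) sym_operad_scheme \<Rightarrow> ('o \<Rightarrow> int) \<Rightarrow> bool" where
  "symmetric_grading P \<psi> \<longleftrightarrow> planar_grading P \<psi> \<and>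
     (\<forall>p\<in>Ops P. \<forall>\<sigma>. \<sigma> permutes {1..arity P p} \<longrightarrow> \<psi> (act P \<sigma> p) = \<psi> p)"

definition cyclic_grading :: "(unit, 'o, 'z) sym_operad_scheme \<Rightarrow> ('o \<Rightarrow> int) \<Rightarrow> bool" where
  "cyclic_grading P \<psi> \<longleftrightarrow> planar_grading P \<psi> \<and>
     (\<forall>p\<in>Ops P. \<forall>\<sigma>. \<sigma> permutes {0..arity P p} \<longrightarrow> \<psi> (act P \<sigma> p) = \<psi> p)"

definition nice :: "('c, 'o, 'z) operad_scheme \<Rightarrow> ('o \<Rightarrow> int) \<Rightarrow> bool" where
  "nice P \<psi> \<longleftrightarrow>
     (\<forall>p\<in>Ops P. -1 \<le> \<psi> p) \<and>
     (\<forall>p\<in>Ops P. \<psi> p = -1 \<longrightarrow> arity P p = 0) \<and>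
     (\<forall>e\<in>Ops P. \<forall>m\<in>Ops P. \<forall>i\<in>{1, 2}. \<forall>c\<in>Cols P.
        arity P e = 0 \<and> arity P m = 2 \<and> out P e = ins P m ! (i - 1) \<and> pcomp P m i e = ident P c
        \<longrightarrow> \<psi> e = -1)"

definition grading_depends_on_colours :: "('c, 'o, 'z) operad_scheme \<Rightarrow> ('o \<Rightarrow> int) \<Rightarrow> bool" where
  "grading_depends_on_colours P \<psi> \<longleftrightarrow>
     (\<forall>p\<in>Ops P. \<forall>q\<in>Ops P. mset (ins P p) = mset (ins P q) \<and> out P p = out P q \<longrightarrow> \<psi> p = \<psi> q)"

text \<open>The category \<open>P(\<psi> = 0)\<close> of unary operations of grading 0.\<close>

definition grading0_cat :: "('c, 'o, 'z) operad_scheme \<Rightarrow> ('o \<Rightarrow> int) \<Rightarrow> ('c, 'o) cat" where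
  "grading0_cat P \<psi> =
     \<lparr>Obj = Cols P,
      Hom = (\<lambda>c d. {p \<in> Ops P. \<psi> p = 0 \<and> ins P p = [c] \<and> out P p = d}),
      Idm = ident P,
      Cmp = (\<lambda>q p. plug P q [p])\<rparr>"

definition grading0_groupoid :: "('c, 'o, 'z) operad_scheme \<Rightarrow> ('o \<Rightarrow> int) \<Rightarrow> bool" where
  "grading0_groupoid P \<psi> \<longleftrightarrow>
     (\<forall>p\<in>Ops P. \<psi> p = 0 \<longrightarrow> arity P p = 1) \<and> groupoid (grading0_cat P \<psi>)"


section \<open>Twisted arrow categories and enveloping categories\<close>

text \<open>A profile \<open>(c\<^sub>1, \<dots>, c\<^sub>n; c\<^sub>0)\<close> is the pair \<open>([c\<^sub>1, \<dots>, c\<^sub>n], c\<^sub>0)\<close>.\<close>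

definition profile :: "('c, 'o, 'z) operad_scheme \<Rightarrow> 'o \<Rightarrow> 'c list \<times> 'c" where
  "profile P p = (ins P p, out P p)"

definition Profiles :: "('c, 'o, 'z) operad_scheme \<Rightarrow> ('c list \<times> 'c) set" where
  "Profiles P = {(cs, c0). set cs \<subseteq> Cols P \<and> c0 \<in> Cols P}"

subsection \<open>Planar case\<close>

text \<open>The tuple \<open>(q\<^sub>0, i; q\<^sub>1, \<dots>, q\<^sub>n)\<close> is the pair \<open>([q\<^sub>0, \<dots>, q\<^sub>n], i)\<close>.\<close>

type_synonym 'o pl_mor = "'o list \<times> nat"

fun pl_tuple :: "('c, 'o, 'z) operad_scheme \<Rightarrow> 'c list \<times> 'c \<Rightarrow> 'o pl_mor \<Rightarrow> bool" where
  "pl_tuple P (cs, c0) (qs, i) \<longleftrightarrow>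
     length qs = Suc (length cs) \<and> set qs \<subseteq> Ops P \<and>
     1 \<le> i \<and> i \<le> arity P (qs ! 0) \<and> ins P (qs ! 0) ! (i - 1) = c0 \<and>
     (\<forall>j\<in>{1..length cs}. out P (qs ! j) = cs ! (j - 1))"

fun pl_target :: "('c, 'o, 'z) operad_scheme \<Rightarrow> 'o \<Rightarrow> 'o pl_mor \<Rightarrow> 'o" where
  "pl_target P p (qs, i) = pcomp P (qs ! 0) i (plug P p (tl qs))"

fun pl_target_profile :: "('c, 'o, 'z) operad_scheme \<Rightarrow> 'o pl_mor \<Rightarrow> 'c list \<times> 'c" where
  "pl_target_profile P (qs, i) =
     (take (i - 1) (ins P (qs ! 0)) @ concat (map (ins P) (tl qs)) @ drop i (ins P (qs ! 0)),
      out P (qs ! 0))"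

text \<open>The number, among the inputs of the target, of input \<open>k\<close> of \<open>q\<^sub>j\<close> (for \<open>(j, k) \<noteq> (0, i)\<close>): the first
  \<open>i - 1\<close> inputs of \<open>q\<^sub>0\<close> come first, then those of \<open>q\<^sub>1, \<dots>, q\<^sub>n\<close>, then the remaining ones of \<open>q\<^sub>0\<close>.\<close>

fun pl_num :: "('c, 'o, 'z) operad_scheme \<Rightarrow> 'o pl_mor \<Rightarrow> nat \<Rightarrow> nat \<Rightarrow> nat" where
  "pl_num P (qs, i) j k =
     (if j = 0 then (if k < i then k else k - 1 + (\<Sum>a\<in>{1..<length qs}. arity P (qs ! a)))
      else i - 1 + (\<Sum>a\<in>{1..<j}. arity P (qs ! a)) + k)"

definition pl_id :: "('c, 'o, 'z) operad_scheme \<Rightarrow> 'c list \<times> 'c \<Rightarrow> 'o pl_mor" where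
  "pl_id P = (\<lambda>(cs, c0). (map (ident P) (c0 # cs), 1))"

fun pl_comp :: "('c, 'o, 'z) operad_scheme \<Rightarrow> 'o pl_mor \<Rightarrow> 'o pl_mor \<Rightarrow> 'o pl_mor" where
  "pl_comp P (rs, i') (qs, i) =
     (let num = pl_num P (qs, i);
          upper = (\<lambda>j. plug P (qs ! j) (map (\<lambda>k. rs ! num j k) [1..<Suc (arity P (qs ! j))]));
          lower = pcomp P (rs ! 0) i'
            (plug P (qs ! 0) (map (\<lambda>k. if k = i then ident P (ins P (qs ! 0) ! (i - 1)) else rs ! num 0 k)
                                  [1..<Suc (arity P (qs ! 0))]))
      in (lower # map upper [1..<length qs], i' + (\<Sum>k\<in>{1..<i}. arity P (rs ! k))))"

definition pl_Tw :: "('c, 'o, 'z) operad_scheme \<Rightarrow> ('o, 'o pl_mor) cat" where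
  "pl_Tw P =
     \<lparr>Obj = Ops P,
      Hom = (\<lambda>p t. {f. pl_tuple P (profile P p) f \<and> pl_target P p f = t}),
      Idm = (\<lambda>p. pl_id P (profile P p)),
      Cmp = pl_comp P\<rparr>"

definition pl_U :: "('c, 'o, 'z) operad_scheme \<Rightarrow> ('c list \<times> 'c, 'o pl_mor) cat" where
  "pl_U P =
     \<lparr>Obj = Profiles P,
      Hom = (\<lambda>x y. {f. pl_tuple P x f \<and> pl_target_profile P f = y}),
      Idm = pl_id P,
      Cmp = pl_comp P\<rparr>"

definition pl_trivial :: "('c, 'o, 'z) operad_scheme \<Rightarrow> 'o pl_mor \<Rightarrow> bool" where
  "pl_trivial P f \<longleftrightarrow> True"

subsection \<open>Numberings of leaves\<close>

text \<open>In the symmetric and cyclic cases the tuple \<open>(q\<^sub>0, \<dots>, q\<^sub>n; \<lambda>)\<close> is the pair \<open>([q\<^sub>0, \<dots>, q\<^sub>n], \<lambda>)\<close>, where \<open>\<lambda>\<close> is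
  \<open>undefined\<close> outside the set of leaves, so that equal tuples are equal pairs.\<close>

type_synonym 'o num_mor = "'o list \<times> (nat \<times> nat \<Rightarrow> nat)"

definition numbering :: "(nat \<times> nat) list \<Rightarrow> nat set \<Rightarrow> (nat \<times> nat \<Rightarrow> nat) \<Rightarrow> bool" where
  "numbering xs A lam \<longleftrightarrow>
     bij_betw lam (set xs) A \<and> lam \<in> extensional (set xs) \<and>
     (\<forall>i k k'. (i, k) \<in> set xs \<and> (i, k') \<in> set xs \<and> k < k' \<longrightarrow> lam (i, k) < lam (i, k'))"

text \<open>If the inputs of an operation carry the distinct numbers \<open>xs\<close>, then acting by \<open>place (ranks xs)\<close>
  permutes the inputs so that the numbers become \<open>sort xs\<close>.\<close>

definition ranks :: "nat list \<Rightarrow> nat list" where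
  "ranks xs = map (\<lambda>x. card {y \<in> set xs. y \<le> x}) xs"

text \<open>When \<open>r\<^sub>0, \<dots>, r\<^sub>N\<close> with numbering \<open>\<mu>\<close> is composed with \<open>q\<^sub>0, \<dots>, q\<^sub>n\<close> with numbering \<open>\<lambda>\<close>, these are the numbers
  of the leaves lying over the inputs \<open>ks\<close> of \<open>q\<^sub>i\<close>, in planar order.\<close>

definition leaf_nums :: "('c, 'o, 'z) operad_scheme \<Rightarrow> 'o num_mor \<Rightarrow> 'o num_mor \<Rightarrow> nat \<Rightarrow> nat list \<Rightarrow> nat list" where
  "leaf_nums P g f i ks =
     concat (map (\<lambda>k. map (\<lambda>l. snd g (snd f (i, k), l)) [1..<Suc (arity P (fst g ! snd f (i, k)))]) ks)"

definition upper_vertex :: "('c, 'o, 'z) sym_operad_scheme \<Rightarrow> 'o num_mor \<Rightarrow> 'o num_mor \<Rightarrow> nat \<Rightarrow> 'o" where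
  "upper_vertex P g f i =
     (let ks = [1..<Suc (arity P (fst f ! i))]
      in act P (place (ranks (leaf_nums P g f i ks)))
           (plug P (fst f ! i) (map (\<lambda>k. fst g ! snd f (i, k)) ks)))"

subsection \<open>Symmetric case\<close>

definition sym_leaves :: "('c, 'o, 'z) operad_scheme \<Rightarrow> 'o list \<Rightarrow> (nat \<times> nat) list" where
  "sym_leaves P qs =
     concat (map (\<lambda>i. map (\<lambda>k. (i, k)) [1..<Suc (arity P (qs ! i))]) [1..<length qs]) @
     map (\<lambda>k. (0, k)) [2..<Suc (arity P (qs ! 0))]"

fun sym_tuple :: "('c, 'o, 'z) operad_scheme \<Rightarrow> 'c list \<times> 'c \<Rightarrow> 'o num_mor \<Rightarrow> bool" where
  "sym_tuple P (cs, c0) (qs, lam) \<longleftrightarrow>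
     length qs = Suc (length cs) \<and> set qs \<subseteq> Ops P \<and>
     1 \<le> arity P (qs ! 0) \<and> ins P (qs ! 0) ! 0 = c0 \<and>
     (\<forall>i\<in>{1..length cs}. out P (qs ! i) = cs ! (i - 1)) \<and>
     numbering (sym_leaves P qs) {1..length (sym_leaves P qs)} lam"

fun sym_target :: "('c, 'o, 'z) sym_operad_scheme \<Rightarrow> 'o \<Rightarrow> 'o num_mor \<Rightarrow> 'o" where
  "sym_target P p (qs, lam) =
     act P (place (map lam (sym_leaves P qs))) (pcomp P (qs ! 0) 1 (plug P p (tl qs)))"

fun sym_has_target_profile :: "('c, 'o, 'z) operad_scheme \<Rightarrow> 'o num_mor \<Rightarrow> 'c list \<times> 'c \<Rightarrow> bool" where
  "sym_has_target_profile P (qs, lam) (ds, d0) \<longleftrightarrow>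
     d0 = out P (qs ! 0) \<and> length ds = length (sym_leaves P qs) \<and>
     (\<forall>(i, k)\<in>set (sym_leaves P qs). ds ! (lam (i, k) - 1) = ins P (qs ! i) ! (k - 1))"

definition sym_id :: "('c, 'o, 'z) operad_scheme \<Rightarrow> 'c list \<times> 'c \<Rightarrow> 'o num_mor" where
  "sym_id P = (\<lambda>(cs, c0). (map (ident P) (c0 # cs), restrict fst ({1..length cs} \<times> {1})))"

definition sym_lower_nums :: "('c, 'o, 'z) operad_scheme \<Rightarrow> 'o num_mor \<Rightarrow> 'o num_mor \<Rightarrow> nat list" where
  "sym_lower_nums P g f =
     leaf_nums P g f 0 [2..<Suc (arity P (fst f ! 0))] @
     map (\<lambda>l. snd g (0, l)) [2..<Suc (arity P (fst g ! 0))]"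

text \<open>The first input of the lower vertex is not a leaf and stays in place.\<close>

definition sym_lower_vertex :: "('c, 'o, 'z) sym_operad_scheme \<Rightarrow> 'o num_mor \<Rightarrow> 'o num_mor \<Rightarrow> 'o" where
  "sym_lower_vertex P g f =
     act P (place (1 # map Suc (ranks (sym_lower_nums P g f))))
       (pcomp P (fst g ! 0) 1
          (plug P (fst f ! 0)
             (ident P (ins P (fst f ! 0) ! 0) #
              map (\<lambda>k. fst g ! snd f (0, k)) [2..<Suc (arity P (fst f ! 0))])))"

definition sym_comp :: "('c, 'o, 'z) sym_operad_scheme \<Rightarrow> 'o num_mor \<Rightarrow> 'o num_mor \<Rightarrow> 'o num_mor" where
  "sym_comp P g f =
     (let vs = sym_lower_vertex P g f # map (upper_vertex P g f) [1..<length (fst f)]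
      in (vs, restrict
           (\<lambda>(i, k). if i = 0 then sort (sym_lower_nums P g f) ! (k - 2)
                     else sort (leaf_nums P g f i [1..<Suc (arity P (fst f ! i))]) ! (k - 1))
           (set (sym_leaves P vs))))"

definition sym_Tw :: "('c, 'o, 'z) sym_operad_scheme \<Rightarrow> ('o, 'o num_mor) cat" where
  "sym_Tw P =
     \<lparr>Obj = Ops P,
      Hom = (\<lambda>p t. {f. sym_tuple P (profile P p) f \<and> sym_target P p f = t}),
      Idm = (\<lambda>p. sym_id P (profile P p)),
      Cmp = sym_comp P\<rparr>"

definition sym_U :: "('c, 'o, 'z) sym_operad_scheme \<Rightarrow> ('c list \<times> 'c, 'o num_mor) cat" where
  "sym_U P =
     \<lparr>Obj = Profiles P,
      Hom = (\<lambda>x y. {f. sym_tuple P x f \<and> sym_has_target_profile P f y}),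
      Idm = sym_id P,
      Cmp = sym_comp P\<rparr>"

definition sym_trivial :: "('c, 'o, 'z) operad_scheme \<Rightarrow> 'o num_mor \<Rightarrow> bool" where
  "sym_trivial P f \<longleftrightarrow>
     map (snd f) (sym_leaves P (fst f)) = [1..<Suc (length (sym_leaves P (fst f)))]"

subsection \<open>Cyclic case\<close>

definition cyc_leaves :: "('c, 'o, 'z) operad_scheme \<Rightarrow> 'o list \<Rightarrow> (nat \<times> nat) list" where
  "cyc_leaves P qs =
     concat (map (\<lambda>j. map (\<lambda>k. (j, k)) [1..<Suc (arity P (qs ! j))]) [0..<length qs])"

fun cyc_tuple :: "('c, 'o, 'z) operad_scheme \<Rightarrow> nat \<Rightarrow> 'o num_mor \<Rightarrow> bool" where
  "cyc_tuple P n (qs, lam) \<longleftrightarrow>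
     length qs = Suc n \<and> set qs \<subseteq> Ops P \<and> 1 \<le> (\<Sum>q\<leftarrow>qs. arity P q) \<and>
     numbering (cyc_leaves P qs) {0..<length (cyc_leaves P qs)} lam"

text \<open>The gluing of leg 0 of \<open>q\<^sub>j\<close> to leg \<open>j\<close> of \<open>p\<close> for all \<open>j\<close>, expressed through the operadic composition.
  Take the least \<open>j\<close> for which \<open>q\<^sub>j\<close> has a leg 1. Interchanging the legs 0 and \<open>j\<close> of \<open>p\<close>, and the legs 0
  and 1 of \<open>q\<^sub>j\<close>, makes the gluing a rooted composite with \<open>q\<^sub>j\<close> at the bottom, whose output is leg 1 of
  the original \<open>q\<^sub>j\<close>; \<open>legs\<close> lists the remaining legs in the order (starting with the output) in
  which they occur in this composite. By the axioms of a cyclic operad any other way to compute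
  the gluing gives the same result.\<close>

fun cyc_target :: "('c, 'o, 'z) sym_operad_scheme \<Rightarrow> 'o \<Rightarrow> 'o num_mor \<Rightarrow> 'o" where
  "cyc_target P p (qs, lam) =
     (let j = (LEAST j. j < length qs \<and> 1 \<le> arity P (qs ! j));
          s = transpose 0 j;
          legs = (j, 1) #
            concat (map (\<lambda>i. map (\<lambda>k. (s i, k)) [1..<Suc (arity P (qs ! s i))]) [1..<length qs]) @
            map (\<lambda>k. (j, k)) [2..<Suc (arity P (qs ! j))]
      in act P (place0 (map lam legs))
           (pcomp P (act P (transpose 0 1) (qs ! j)) 1
              (plug P (act P s p) (map (\<lambda>i. qs ! s i) [1..<length qs]))))"

definition cyc_id :: "(unit, 'o, 'z) operad_scheme \<Rightarrow> nat \<Rightarrow> 'o num_mor" where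
  "cyc_id P n = (replicate (Suc n) (ident P ()), restrict fst ({0..n} \<times> {1}))"

text \<open>Here no vertex is distinguished, and all of them are composed like the upper vertices in
  the symmetric case.\<close>

definition cyc_comp :: "(unit, 'o, 'z) sym_operad_scheme \<Rightarrow> 'o num_mor \<Rightarrow> 'o num_mor \<Rightarrow> 'o num_mor" where
  "cyc_comp P g f =
     (let vs = map (upper_vertex P g f) [0..<length (fst f)]
      in (vs, restrict
           (\<lambda>(j, k). sort (leaf_nums P g f j [1..<Suc (arity P (fst f ! j))]) ! (k - 1))
           (set (cyc_leaves P vs))))"

definition cyc_Tw :: "(unit, 'o, 'z) sym_operad_scheme \<Rightarrow> ('o, 'o num_mor) cat" where
  "cyc_Tw P =
     \<lparr>Obj = Ops P,
      Hom = (\<lambda>p t. {f. cyc_tuple P (arity P p) f \<and> cyc_target P p f = t}),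
      Idm = (\<lambda>p. cyc_id P (arity P p)),
      Cmp = cyc_comp P\<rparr>"

definition cyc_U :: "(unit, 'o, 'z) sym_operad_scheme \<Rightarrow> (nat, 'o num_mor) cat" where
  "cyc_U P =
     \<lparr>Obj = UNIV,
      Hom = (\<lambda>n N. {f. cyc_tuple P n f \<and> length (cyc_leaves P (fst f)) = Suc N}),
      Idm = cyc_id P,
      Cmp = cyc_comp P\<rparr>"

definition cyc_trivial :: "('c, 'o, 'z) operad_scheme \<Rightarrow> 'o num_mor \<Rightarrow> bool" where
  "cyc_trivial P f \<longleftrightarrow>
     map (snd f) (cyc_leaves P (fst f)) = [0..<length (cyc_leaves P (fst f))]"

subsection \<open>The image of the projection\<close>

text \<open>\<open>V_of U P pr\<close> is the full subcategory of \<open>U\<close> on the profiles \<open>pr p\<close> of the operations \<open>p\<close> of \<open>P\<close>, and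
  \<open>fibre_degree P \<psi> pr x\<close> is the common grading of the operations in the fibre over \<open>x\<close>.\<close>

definition V_of :: "('b, 'm) cat \<Rightarrow> ('c, 'o, 'z) operad_scheme \<Rightarrow> ('o \<Rightarrow> 'b) \<Rightarrow> ('b, 'm) cat" where
  "V_of U P pr = full_subcategory U (pr ` Ops P)"

definition fibre_degree :: "('c, 'o, 'z) operad_scheme \<Rightarrow> ('o \<Rightarrow> int) \<Rightarrow> ('o \<Rightarrow> 'b) \<Rightarrow> 'b \<Rightarrow> int" where
  "fibre_degree P \<psi> pr x = (THE d. \<forall>p\<in>Ops P. pr p = x \<longrightarrow> \<psi> p = d)"

subsection \<open>The classes\<close>

text \<open>In all cases the non-source vertices of a tuple \<open>f\<close> are the elements of \<open>fst f\<close>. The parameter \<open>triv\<close>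
  says whether the permutation on leaves of a tuple is trivial.\<close>

definition R_minus_one ::
  "('c, 'o, 'z) operad_scheme \<Rightarrow> ('o \<Rightarrow> int) \<Rightarrow> ('o list \<times> 'l \<Rightarrow> bool) \<Rightarrow> ('a, 'o list \<times> 'l) cat \<Rightarrow>
   'a \<Rightarrow> 'a \<Rightarrow> ('o list \<times> 'l) set" where
  "R_minus_one P \<psi> triv C a b =
     {f \<in> Hom C a b. triv f \<and> (\<forall>q \<in> set (fst f). q \<in> ident P ` Cols P \<or> \<psi> q = -1)}"

definition R_minus ::
  "('c, 'o, 'z) operad_scheme \<Rightarrow> ('o \<Rightarrow> int) \<Rightarrow> ('o list \<times> 'l \<Rightarrow> bool) \<Rightarrow> ('a, 'o list \<times> 'l) cat \<Rightarrow>
   'a \<Rightarrow> 'a \<Rightarrow> ('o list \<times> 'l) set" where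
  "R_minus P \<psi> triv C a b =
     {Cmp C \<theta> f |c \<theta> f. c \<in> Obj C \<and> f \<in> R_minus_one P \<psi> triv C a c \<and> \<theta> \<in> Isos C c b}"

definition R_plus ::
  "('o \<Rightarrow> int) \<Rightarrow> ('a, 'o list \<times> 'l) cat \<Rightarrow> 'a \<Rightarrow> 'a \<Rightarrow> ('o list \<times> 'l) set" where
  "R_plus \<psi> C a b = {f \<in> Hom C a b. \<forall>q \<in> set (fst f). 0 \<le> \<psi> q}"

end

(* A tuple is encoded as the family of its vertices, each labelled by the numbers of its leaves, up to
   simultaneous permutation of inputs and labels. Composition of tuples is then substitution of labelled
   operations, and associativity of U(P) is associativity of substitution. Operations of grading -1 have
   arity 0, so a tuple is factored by splitting off its nullary vertices of grading -1. They only delete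
   leaves, so the left factor can be cancelled and the factorization is unique up to the invertible unary
   vertices, which are the isomorphisms. The degree of the target is the degree of the source plus the
   gradings of the vertices. Hence the Reedy axioms reduce to the statement that a vertex of grading 0 is
   invertible, and conversely a non-invertible operation of grading 0 is the vertex of a morphism in
   R_+ of V(P) which preserves the degree without being an isomorphism.

   In the cyclic case the target is a rooted composite with respect to one leaf of one vertex. The axioms
   for rotations show that the root can be moved across a gluing, so that the choice of the leaf is
   immaterial; composites of tuples are compared after choosing the same leaf on both sides. *)

theory Submission
  imports Defs
begin

section \<open>Substitution of labelled operations\<close>

text \<open>Tuples are compared by strict equality, yet every composition has to sort the inputs
  again, which spoils direct arguments. The remedy is to state the laws for unsorted labelled
  operations, where they hold up to an equivalence, and to compare sorted composites with unsorted
  ones. Planar operads need no sorting, but their labels must respect the plane; a predicate on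
  layouts records this, so that one abstract development covers the three cases. Legs of an object
  are counted from 0 throughout, and vertex i is glued to leg i of the source. If there is a lower
  vertex, the label 0 names its glued input instead of the output of the target, so that the labels
  are 0, ..., N in each case.

  Both classes turn out to be conditions on single vertices: R_+ asks for grading \<ge> 0, and R_-
  for being invertible or of grading -1. Such conditions read the same in U(P), V(P) and Tw(P), so
  the factorization is proved once, in U(P), and lifted along the discrete opfibrations.\<close>

context planar_operad
begin

text \<open>Labels name the inputs, and \<open>\<kappa>\<close> colours the names. The colouring is
  a parameter because one vertex is typed by several colourings in the course of a
  composition.\<close>

definition wt :: "(nat \<Rightarrow> 'c) \<Rightarrow> 'c \<Rightarrow> 'o \<times> nat list \<Rightarrow> bool" where
  "wt \<kappa> c X \<longleftrightarrow> fst X \<in> Ops P \<and> out P (fst X) = c \<and> map \<kappa> (snd X) = ins P (fst X)"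

text \<open>Substitution along names: with \<open>unit_op\<close> as unit this is a Kleisli
  composition, so the operad axioms become unit and associativity laws free of positions.\<close>

definition subst :: "'o \<times> nat list \<Rightarrow> (nat \<Rightarrow> 'o \<times> nat list) \<Rightarrow> 'o \<times> nat list" where
  "subst X F = (plug P (fst X) (map (\<lambda>x. fst (F x)) (snd X)), concat (map (\<lambda>x. snd (F x)) (snd X)))"

definition unit_op :: "(nat \<Rightarrow> 'c) \<Rightarrow> nat \<Rightarrow> 'o \<times> nat list" where
  "unit_op \<kappa> x = (ident P (\<kappa> x), [x])"

lemma fst_unit_op [simp]: "fst (unit_op \<kappa> x) = ident P (\<kappa> x)"
  and snd_unit_op [simp]: "snd (unit_op \<kappa> x) = [x]"
  by (simp_all add: unit_op_def)

lemma snd_subst [simp]: "snd (subst X F) = concat (map (\<lambda>x. snd (F x)) (snd X))"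
  by (simp add: subst_def)

lemma wt_arity: "wt \<kappa> c X \<Longrightarrow> arity P (fst X) = length (snd X)"
  by (metis arity_def length_map wt_def)

lemma wt_cong: "wt \<kappa> c X \<Longrightarrow> (\<And>x. x \<in> set (snd X) \<Longrightarrow> \<kappa> x = \<kappa>' x) \<Longrightarrow> wt \<kappa>' c X"
  unfolding wt_def by (metis map_eq_conv)

lemma wt_out_unique: "wt \<kappa> c X \<Longrightarrow> wt \<kappa>' c' X \<Longrightarrow> c = c'"
  by (auto simp: wt_def)

lemma wt_ins_unique: "wt \<kappa> c X \<Longrightarrow> wt \<kappa>' c' X \<Longrightarrow> x \<in> set (snd X) \<Longrightarrow> \<kappa> x = \<kappa>' x"
  unfolding wt_def by (metis map_eq_conv)

lemma wt_composable:
  "wt \<kappa> c X \<Longrightarrow> (\<And>x. x \<in> set (snd X) \<Longrightarrow> wt \<kappa>' (\<kappa> x) (F x)) \<Longrightarrow>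
   composable P (fst X) (map (\<lambda>x. fst (F x)) (snd X))"
  unfolding composable_def wt_def by (auto simp: comp_def cong: map_cong)

lemma wt_subst:
  assumes "wt \<kappa> c X" "\<And>x. x \<in> set (snd X) \<Longrightarrow> wt \<kappa>' (\<kappa> x) (F x)"
  shows "wt \<kappa>' c (subst X F)"
proof -
  have e: "map (\<lambda>x. map \<kappa>' (snd (F x))) (snd X) = map (\<lambda>x. ins P (fst (F x))) (snd X)"
    using assms(2) by (auto simp: wt_def)
  show ?thesis
    using plug[OF wt_composable[OF assms]] assms(1)
    by (simp add: wt_def subst_def map_concat comp_def e)
qed

lemma wt_unit: "\<kappa> x \<in> Cols P \<Longrightarrow> wt \<kappa> (\<kappa> x) (unit_op \<kappa> x)"
  using ident by (simp add: wt_def)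

lemma wt_unit': "\<kappa> x = c \<Longrightarrow> \<kappa>' x = c \<Longrightarrow> c \<in> Cols P \<Longrightarrow> wt \<kappa> c (unit_op \<kappa>' x)"
  using ident by (simp add: wt_def)

lemma subst_cong:
  "(\<And>x. x \<in> set (snd X) \<Longrightarrow> F x = F' x) \<Longrightarrow> subst X F = subst X F'"
  unfolding subst_def by (auto intro!: arg_cong[where f = "plug P (fst X)"] arg_cong[where f = concat])

lemma subst_assoc:
  assumes "wt \<kappa> c X" "\<And>x. x \<in> set (snd X) \<Longrightarrow> wt \<kappa>' (\<kappa> x) (F x)"
    "\<And>x y. x \<in> set (snd X) \<Longrightarrow> y \<in> set (snd (F x)) \<Longrightarrow> wt \<kappa>'' (\<kappa>' y) (G y)"
  shows "subst (subst X F) G = subst X (\<lambda>x. subst (F x) G)"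
proof -
  have 1: "list_all2 (composable P) (map (\<lambda>x. fst (F x)) (snd X))
           (map (\<lambda>x. map (\<lambda>y. fst (G y)) (snd (F x))) (snd X))"
    using wt_composable[OF assms(2), of _ "\<kappa>''" G] assms(3)
    by (simp add: list.rel_map) (rule list.rel_refl_strong, blast)
  have "map2 (plug P) (map (\<lambda>x. fst (F x)) (snd X)) (map (\<lambda>x. map (\<lambda>y. fst (G y)) (snd (F x))) (snd X))
     = map (\<lambda>x. plug P (fst (F x)) (map (\<lambda>y. fst (G y)) (snd (F x)))) (snd X)"
    by (auto intro: nth_equalityI)
  moreover have "concat (concat (map h xs)) = concat (map (\<lambda>x. concat (h x)) xs)"
    for h :: "nat \<Rightarrow> nat list list" and xs
    by (induction xs) auto
  ultimately show ?thesis
    using assoc[OF wt_composable[OF assms(1,2)] 1] by (simp add: subst_def map_concat comp_def)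
qed

lemma subst_unit: "wt \<kappa> c X \<Longrightarrow> subst X (unit_op \<kappa>) = X"
proof -
  assume X: "wt \<kappa> c X"
  have "map (\<lambda>x. ident P (\<kappa> x)) (snd X) = map (ident P) (map \<kappa> (snd X))" by simp
  then have "plug P (fst X) (map (\<lambda>x. ident P (\<kappa> x)) (snd X)) = fst X"
    using X unit unfolding wt_def by metis
  then show ?thesis by (simp add: subst_def)
qed

lemma subst_unit': "wt \<kappa> c X \<Longrightarrow> (\<And>x. x \<in> set (snd X) \<Longrightarrow> F x = unit_op \<kappa> x) \<Longrightarrow> subst X F = X"
  using subst_cong[of X F "unit_op \<kappa>"] subst_unit by metis

lemma unit_subst: "wt \<kappa>' (\<kappa> x) (F x) \<Longrightarrow> subst (unit_op \<kappa> x) F = F x"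
  using unit[of "fst (F x)"] by (simp add: subst_def wt_def)

lemma nullary_subst: "wt \<kappa> c X \<Longrightarrow> snd X = [] \<Longrightarrow> subst X F = X"
  by (rule subst_unit') auto

end

section \<open>Gradings and full composites\<close>

context planar_operad
begin

text \<open>Gradings and rotations are controlled by axioms on partial composites only. Filling one
  slot of a full composite by an identity isolates the partial composite that inserts
  \<open>q\<close>; its position is one more than the number of inputs contributed by
  \<open>qs1\<close>.\<close>

lemma plug_split:
  assumes "composable P p (qs1 @ q # qs2)"
  shows "plug P p (qs1 @ q # qs2) =
    pcomp P (plug P p (qs1 @ ident P (out P q) # qs2)) (Suc (\<Sum>r\<leftarrow>qs1. arity P r)) q"
    and "composable P p (qs1 @ ident P (out P q) # qs2)"
proof -
  let ?qs = "qs1 @ ident P (out P q) # qs2"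
  have q: "q \<in> Ops P" "out P q \<in> Cols P" and qs: "set qs1 \<subseteq> Ops P" "set qs2 \<subseteq> Ops P"
    using assms colours by (auto simp: composable_def)
  show c: "composable P p ?qs"
    using assms ident[OF q(2)] by (simp add: composable_def)
  \<comment> \<open>Identities over every vertex but the one to be inserted: associativity then has
    the two-step composite on one side and the full one on the other.\<close>
  define rss where "rss = map (\<lambda>r. map (ident P) (ins P r)) qs1 @ [q] #
     map (\<lambda>r. map (ident P) (ins P r)) qs2"
  have *: "composable P r (map (ident P) (ins P r))" if "r \<in> Ops P" for r
    using that colours[OF that] ident by (auto simp: composable_def intro!: map_idI)
  have 1: "list_all2 (composable P) ?qs rss"
    unfolding rss_def using qs q ident[OF q(2)] *
    by (auto intro!: list_all2_appendI simp: list.rel_map composable_def[of P "ident P _"] list.rel_refl_strong subset_iff)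
  have "map2 (plug P) qs (map (\<lambda>r. map (ident P) (ins P r)) qs) = qs" if "set qs \<subseteq> Ops P" for qs
    using that unit by (induction qs) auto
  then have 2: "map2 (plug P) ?qs rss = qs1 @ q # qs2"
    using qs q unit unfolding rss_def by simp
  have len: "length (concat (map (ins P) qs1)) = (\<Sum>r\<leftarrow>qs1. arity P r)"
    by (induction qs1) (auto simp: arity_def)
  have "concat (map (\<lambda>r. map (ident P) (ins P r)) qs) = map (ident P) (concat (map (ins P) qs))" for qs
    by (simp add: map_concat comp_def)
  then have "concat rss = (map (ident P) (ins P (plug P p ?qs)))[(\<Sum>r\<leftarrow>qs1. arity P r) := q]"
    using plug[OF c] ident[OF q(2)] unfolding rss_def by (simp add: list_update_append len)
  then show "plug P p (qs1 @ q # qs2) = pcomp P (plug P p ?qs) (Suc (\<Sum>r\<leftarrow>qs1. arity P r)) q"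
    using assoc[OF c 1] 2 by (simp add: pcomp_def)
qed

lemma grading_plug:
  assumes g: "planar_grading P \<psi>" and c: "composable P p qs"
  shows "\<psi> (plug P p qs) = \<psi> p + (\<Sum>q\<leftarrow>qs. \<psi> q)"
proof -
  \<comment> \<open>A tail of identities is allowed so that the induction can trade the last
    operation for an identity by \<open>plug_split\<close>.\<close>
  have "composable P p (qs @ map (ident P) cs) \<Longrightarrow> set cs \<subseteq> Cols P \<Longrightarrow>
    \<psi> (plug P p (qs @ map (ident P) cs)) = \<psi> p + (\<Sum>q\<leftarrow>qs. \<psi> q)" for qs cs
  proof (induction qs arbitrary: cs rule: rev_induct)
    case Nil
    have p: "p \<in> Ops P" and cs: "set cs \<subseteq> Cols P" "map (out P) (map (ident P) cs) = ins P p"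
      using Nil by (auto simp: composable_def)
    have "map (out P) (map (ident P) cs) = cs"
      using cs(1) ident by (induction cs) auto
    with cs p unit[OF p] show ?case by simp
  next
    case (snoc q qs)
    let ?r = "plug P p (qs @ ident P (out P q) # map (ident P) cs)"
    have c: "composable P p (qs @ q # map (ident P) cs)" using snoc.prems by simp
    note s = plug_split[OF c]
    have q: "q \<in> Ops P" "out P q \<in> Cols P" using c colours by (auto simp: composable_def)
    have "?r \<in> Ops P" and i: "ins P ?r = concat (map (ins P) (qs @ ident P (out P q) # map (ident P) cs))"
      using plug[OF s(2)] by auto
    have l: "length (concat (map (ins P) qs)) = (\<Sum>r\<leftarrow>qs. arity P r)"
      by (induction qs) (auto simp: arity_def)
    have "ins P ?r ! (\<Sum>r\<leftarrow>qs. arity P r) = out P q" "(\<Sum>r\<leftarrow>qs. arity P r) < arity P ?r"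
      using ident[OF q(2)] unfolding arity_def[of P ?r] i
      by (simp_all add: l[symmetric] nth_append)
    then have "\<psi> (pcomp P ?r (Suc (\<Sum>r\<leftarrow>qs. arity P r)) q) = \<psi> ?r + \<psi> q"
      using g \<open>?r \<in> Ops P\<close> q unfolding planar_grading_def by auto
    moreover have "\<psi> ?r = \<psi> p + (\<Sum>q\<leftarrow>qs. \<psi> q)"
      using snoc.IH[of "out P q # cs"] s(2) q snoc.prems(2) by simp
    ultimately show ?case using s(1) by simp
  qed
  from this[of qs "[]"] c show ?thesis by simp
qed

lemma grading_subst:
  assumes "planar_grading P \<psi>" "wt \<kappa> c X" "\<And>x. x \<in> set (snd X) \<Longrightarrow> wt \<kappa>' (\<kappa> x) (F x)"
  shows "\<psi> (fst (subst X F)) = \<psi> (fst X) + (\<Sum>x\<leftarrow>snd X. \<psi> (fst (F x)))"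
  using grading_plug[OF assms(1) wt_composable[OF assms(2,3)]] by (simp add: subst_def comp_def)

end

section \<open>Renumbering of labelled operations\<close>

lemma concat_nth_block:
  assumes "b < length xss" "k < length (xss ! b)"
  shows "concat xss ! ((\<Sum>xs\<leftarrow>take b xss. length xs) + k) = xss ! b ! k"
    and "(\<Sum>xs\<leftarrow>take b xss. length xs) + k < length (concat xss)"
  using assms
proof (induction xss arbitrary: b)
  case (Cons xs xss)
  { case 1 then show ?case using Cons.IH(1)[of "b - 1"] by (cases b) (auto simp: nth_append)}
  { case 2 then show ?case using Cons.IH(2)[of "b - 1"] by (cases b) auto}
qed auto

lemma concat_block_exists:
  assumes "i < length (concat xss)"
  obtains b k where "b < length xss" "k < length (xss ! b)" "i = (\<Sum>xs\<leftarrow>take b xss. length xs) + k"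
  using assms
proof (induction xss arbitrary: i thesis)
  case (Cons xs xss)
  show ?case
  proof (cases "i < length xs")
    case True
    then show ?thesis using Cons.prems(1)[of 0 i] by simp
  next
    case False
    then have "i - length xs < length (concat xss)" using Cons.prems(2) by simp
    then obtain b k where "b < length xss" "k < length (xss ! b)"
      "i - length xs = (\<Sum>xs\<leftarrow>take b xss. length xs) + k" using Cons.IH by blast
    then show ?thesis using Cons.prems(1)[of "Suc b" k] False by simp
  qed
qed auto

lemma place_permutes:
  assumes "length xs = n" "set xs = {1..n}"
  shows "place xs permutes {1..n}"
proof -
  have d: "distinct xs" using assms by (intro card_distinct) simp
  have "bij_betw (\<lambda>j. xs ! (j - 1)) {1..n} {1..n}"
  proof (rule bij_betw_imageI)
    show "inj_on (\<lambda>j. xs ! (j - 1)) {1..n}"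
      using d assms(1) by (auto simp: inj_on_def nth_eq_iff_index_eq)
    have "(\<lambda>j. xs ! (j - 1)) ` {1..n} = (\<lambda>j. xs ! j) ` {..<n}"
    proof -
      have "(\<lambda>j. j - 1) ` {1..n} = {..<n}" by (auto simp: image_iff intro!: bexI[of _ "Suc _"])
      then show ?thesis by (metis image_image)
    qed
    then show "(\<lambda>j. xs ! (j - 1)) ` {1..n} = {1..n}"
      using assms by (metis (no_types, lifting) lessThan_atLeast0 list.set_map map_nth set_upt)
  qed
  then have "bij_betw (place xs) {1..n} {1..n}"
    by (rule bij_betw_cong[THEN iffD1, rotated]) (auto simp: place_def assms)
  then show ?thesis
    by (rule bij_imp_permutes) (auto simp: place_def assms)
qed

lemma length_ranks [simp]: "length (ranks xs) = length xs"
  by (simp add: ranks_def)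

lemma ranks_sorted:
  assumes "sorted xs" "distinct xs"
  shows "ranks xs = [1..<Suc (length xs)]"
proof (rule nth_equalityI)
  fix i assume "i < length (ranks xs)"
  then have i: "i < length xs" by simp
  have "{y \<in> set xs. y \<le> xs ! i} = (\<lambda>j. xs ! j) ` {..i}"
  proof -
    have "xs ! j \<le> xs ! i \<longleftrightarrow> j \<le> i" if "j < length xs" for j
      using assms i that by (metis linorder_le_cases nth_eq_iff_index_eq order_antisym sorted_nth_mono)
    then show ?thesis using i by (auto simp: in_set_conv_nth image_iff) (metis le_less_trans)
  qed
  moreover have "inj_on (\<lambda>j. xs ! j) {..i}"
    using assms i by (auto simp: inj_on_def nth_eq_iff_index_eq)
  ultimately show "ranks xs ! i = [1..<Suc (length xs)] ! i"
    using i unfolding ranks_def by (simp add: card_image del: upt_Suc)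
qed (simp del: upt_Suc)

lemma set_ranks:
  assumes "distinct xs" shows "set (ranks xs) = {1..length xs}"
proof -
  have "set (ranks xs) = (\<lambda>x. card {y \<in> set xs. y \<le> x}) ` set xs" by (simp add: ranks_def)
  \<comment> \<open>A rank depends only on the set of entries, so the list may be sorted
    first.\<close>
  also have "\<dots> = set (ranks (sort xs))" by (simp add: ranks_def)
  finally show ?thesis using assms by (simp add: ranks_sorted atLeastLessThanSuc_atLeastAtMost del: upt_Suc)
qed

lemma sort_ranks_nth:
  assumes "distinct xs" "i < length xs"
  shows "sort xs ! (ranks xs ! i - 1) = xs ! i"
proof -
  obtain j where j: "j < length xs" "xs ! i = sort xs ! j"
    using assms by (metis in_set_conv_nth length_sort nth_mem set_sort)
  have "ranks xs ! i = ranks (sort xs) ! j" using assms j by (simp add: ranks_def)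
  then show ?thesis using assms j ranks_sorted[of "sort xs"] by (simp del: upt_Suc)
qed

section \<open>Relabelling and its normal forms\<close>

context symmetric_operad
begin

text \<open>For distinct labels a class of this relation is an operation whose inputs are indexed by
  the set of labels, in no order. In that form composition needs no block permutations.\<close>

definition relab :: "'o \<times> nat list \<Rightarrow> 'o \<times> nat list \<Rightarrow> bool" where
  "relab X Y \<longleftrightarrow> (\<exists>\<sigma>. \<sigma> permutes {1..arity P (fst X)} \<and> fst Y = act P \<sigma> (fst X) \<and>
     length (snd Y) = length (snd X) \<and> (\<forall>i\<in>{1..arity P (fst X)}. snd Y ! (\<sigma> i - 1) = snd X ! (i - 1)))"

text \<open>The member of the class with increasing labels; it mirrors the requirement that the
  numbering of a tuple increases along each vertex.\<close>

definition nrm :: "'o \<times> nat list \<Rightarrow> 'o \<times> nat list" where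
  "nrm X = (act P (place (ranks (snd X))) (fst X), sort (snd X))"

lemma relab_refl: "fst X \<in> Ops P \<Longrightarrow> relab X X"
  unfolding relab_def using act_id permutes_id by (intro exI[of _ id]) auto

lemma perm_range: "\<sigma> permutes {1..n::nat} \<Longrightarrow> i < n \<Longrightarrow> \<sigma> (Suc i) - 1 < n \<and> Suc (\<sigma> (Suc i) - 1) = \<sigma> (Suc i)"
  using permutes_in_image[of \<sigma> "{1..n}" "Suc i"] by auto

lemma relab_sym:
  assumes "wt \<kappa> c X" "relab X Y" shows "relab Y X"
proof -
  from assms(2) obtain \<sigma> where s: "\<sigma> permutes {1..arity P (fst X)}" "fst Y = act P \<sigma> (fst X)"
     "length (snd Y) = length (snd X)" "\<forall>i\<in>{1..arity P (fst X)}. snd Y ! (\<sigma> i - 1) = snd X ! (i - 1)"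
    unfolding relab_def by blast
  have X: "fst X \<in> Ops P" using assms(1) by (simp add: wt_def)
  have a: "arity P (fst Y) = arity P (fst X)" using act[OF X s(1)] s(2) by simp
  have i: "inv \<sigma> permutes {1..arity P (fst X)}" using s(1) permutes_inv by blast
  have "act P (inv \<sigma>) (fst Y) = fst X"
    using act_comp[OF X i s(1)] s(2) act_id[OF X] permutes_inv_o(2)[OF s(1)] by simp
  moreover have "snd X ! (inv \<sigma> i - 1) = snd Y ! (i - 1)" if "i \<in> {1..arity P (fst X)}" for i
    using s(4)[rule_format, of "inv \<sigma> i"] that permutes_in_image[OF i] permutes_inverses(1)[OF s(1)] by simp
  ultimately show ?thesis unfolding relab_def using i a s(3) by auto
qed

lemma relab_trans:
  assumes "fst X \<in> Ops P" "relab X Y" "relab Y Z" shows "relab X Z"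
proof -
  from assms(2) obtain \<sigma> where s: "\<sigma> permutes {1..arity P (fst X)}" "fst Y = act P \<sigma> (fst X)"
     "length (snd Y) = length (snd X)" "\<forall>i\<in>{1..arity P (fst X)}. snd Y ! (\<sigma> i - 1) = snd X ! (i - 1)"
    unfolding relab_def by blast
  have a: "arity P (fst Y) = arity P (fst X)" using act[OF assms(1) s(1)] s(2) by simp
  from assms(3) obtain \<tau> where t: "\<tau> permutes {1..arity P (fst X)}" "fst Z = act P \<tau> (fst Y)"
     "length (snd Z) = length (snd Y)" "\<forall>i\<in>{1..arity P (fst X)}. snd Z ! (\<tau> i - 1) = snd Y ! (i - 1)"
    unfolding relab_def a by blast
  have "snd Z ! ((\<tau> \<circ> \<sigma>) i - 1) = snd X ! (i - 1)" if "i \<in> {1..arity P (fst X)}" for i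
    using that t(4) s(4) permutes_in_image[OF s(1), of i] by auto
  then show ?thesis unfolding relab_def
    using permutes_compose[OF s(1) t(1)] s t act_comp[OF assms(1) t(1) s(1)] by (intro exI[of _ "\<tau> \<circ> \<sigma>"]) auto
qed

lemma perm_list_eq:
  assumes "\<sigma> permutes {1..n}" "length xs = n" "length ys = n"
    "\<forall>i\<in>{1..n}. ys ! (\<sigma> i - 1) = xs ! (i - 1)"
  shows "xs = map (\<lambda>i. ys ! (\<sigma> (Suc i) - 1)) [0..<n]" "mset ys = mset xs"
proof -
  show e: "xs = map (\<lambda>i. ys ! (\<sigma> (Suc i) - 1)) [0..<n]"
    using assms by (auto intro!: nth_equalityI)
  have "bij_betw (\<lambda>i. \<sigma> (Suc i) - 1) {0..<n} {0..<n}"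
  proof -
    have "bij_betw Suc {0..<n} {1..n}"
      by (rule bij_betwI[where g = "\<lambda>i. i - 1"]) auto
    moreover have "bij_betw (\<lambda>i. i - 1) {1..n} {0..<n}"
      by (rule bij_betwI[where g = Suc]) auto
    ultimately have "bij_betw ((\<lambda>i. i - 1) \<circ> \<sigma> \<circ> Suc) {0..<n} {0..<n}"
      using permutes_imp_bij[OF assms(1)] by (meson bij_betw_trans)
    then show ?thesis by (simp add: comp_def)
  qed
  then have "image_mset (\<lambda>i. \<sigma> (Suc i) - 1) (mset_set {0..<n}) = mset_set {0..<n}"
    using bij_betw_def image_mset_mset_set by metis
  then have "image_mset (\<lambda>i. ys ! (\<sigma> (Suc i) - 1)) (mset_set {0..<n}) = image_mset (\<lambda>i. ys ! i) (mset_set {0..<n})"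
    by (metis (no_types, lifting) image_mset.compositionality comp_def image_mset_cong)
  then have "mset xs = image_mset (\<lambda>i. ys ! i) (mset_set {0..<n})"
    unfolding e by simp
  also have "\<dots> = mset ys" using assms(3) by (metis map_nth mset_map mset_upt)
  finally show "mset ys = mset xs" by simp
qed

lemma relab_wt:
  assumes X: "wt \<kappa> c X" and r: "relab X Y"
  shows "wt \<kappa> c Y" "mset (snd Y) = mset (snd X)"
proof -
  from r obtain \<sigma> where s: "\<sigma> permutes {1..arity P (fst X)}" "fst Y = act P \<sigma> (fst X)"
     "length (snd Y) = length (snd X)" "\<forall>i\<in>{1..arity P (fst X)}. snd Y ! (\<sigma> i - 1) = snd X ! (i - 1)"
    unfolding relab_def by blast
  have o: "fst X \<in> Ops P" using X by (simp add: wt_def)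
  note a = act[OF o s(1), folded s(2)]
  have l: "length (snd X) = arity P (fst X)" using wt_arity[OF X] by simp
  show "mset (snd Y) = mset (snd X)"
    using perm_list_eq(2)[OF s(1)] s(3,4) l by simp
  have "map \<kappa> (snd Y) = ins P (fst Y)"
  proof (rule nth_equalityI)
    show "length (map \<kappa> (snd Y)) = length (ins P (fst Y))"
      using a s(3) l by (simp add: arity_def)
    fix k assume "k < length (map \<kappa> (snd Y))"
    then have k: "Suc k \<in> {1..arity P (fst X)}" using s(3) l by simp
    define i where "i = inv \<sigma> (Suc k)"
    have i: "i \<in> {1..arity P (fst X)}" "\<sigma> i = Suc k"
      using k permutes_in_image[OF permutes_inv[OF s(1)]] permutes_inverses(1)[OF s(1)] unfolding i_def by auto
    have "snd Y ! k = snd X ! (i - 1)" "ins P (fst Y) ! k = ins P (fst X) ! (i - 1)"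
      using s(4) a i by force+
    moreover have "\<kappa> (snd X ! (i - 1)) = ins P (fst X) ! (i - 1)"
      using X i l unfolding wt_def by (metis One_nat_def Suc_le_eq Suc_pred atLeastAtMost_iff nth_map)
    ultimately show "map \<kappa> (snd Y) ! k = ins P (fst Y) ! k"
      using k s(3) l by simp
  qed
  then show "wt \<kappa> c Y" using a X by (auto simp: wt_def)
qed

text \<open>Distinct labels leave no freedom: a permutation that carries a list of distinct labels
  to itself is the identity.\<close>

lemma relab_unique:
  assumes X: "wt \<kappa> c X" and r: "relab X Y" and d: "distinct (snd X)" and e: "snd X = snd Y"
  shows "X = Y"
proof -
  from r obtain \<sigma> where s: "\<sigma> permutes {1..arity P (fst X)}" "fst Y = act P \<sigma> (fst X)"
     "\<forall>i\<in>{1..arity P (fst X)}. snd Y ! (\<sigma> i - 1) = snd X ! (i - 1)"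
    unfolding relab_def by blast
  have "\<sigma> i = i" for i
  proof (cases "i \<in> {1..arity P (fst X)}")
    case True
    then have i: "\<sigma> i \<in> {1..arity P (fst X)}" using permutes_in_image[OF s(1), of i] by simp
    with True have "\<sigma> i - 1 < length (snd Y)" "i - 1 < length (snd Y)"
      using wt_arity[OF X] e by auto
    moreover have "snd Y ! (\<sigma> i - 1) = snd Y ! (i - 1)" using s(3) True e by metis
    ultimately have "\<sigma> i - 1 = i - 1"
      using e d by (metis nth_eq_iff_index_eq)
    then show ?thesis using True i by auto
  next
    case False then show ?thesis using s(1) by (simp add: permutes_def)
  qed
  then have "\<sigma> = id" by auto
  then show ?thesis using s(2) e act_id X by (simp add: wt_def prod_eq_iff)
qed

lemma relab_nrm:
  assumes X: "wt \<kappa> c X" and d: "distinct (snd X)"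
  shows "relab X (nrm X)"
  unfolding relab_def nrm_def using place_permutes[of "ranks (snd X)"] wt_arity[OF X] set_ranks[OF d]
    sort_ranks_nth[OF d]
  by (intro exI[of _ "place (ranks (snd X))"]) (auto simp: place_def)

lemma nrm_sorted:
  assumes X: "wt \<kappa> c X" and d: "distinct (snd X)" "sorted (snd X)"
  shows "nrm X = X"
proof -
  have "place [1..<Suc n] = id" for n by (auto simp: place_def simp del: upt_Suc)
  then show ?thesis
    using X act_id d by (simp add: nrm_def ranks_sorted wt_def prod_eq_iff sorted_sort_id del: upt_Suc)
qed

text \<open>The two normal forms are related and carry the same sorted labels, so
  \<open>relab_unique\<close> identifies them. This is the passage from the relation to strict
  equality.\<close>

lemma relab_nrm_eq:
  assumes X: "wt \<kappa> c X" and d: "distinct (snd X)" and r: "relab X Y"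
  shows "nrm X = nrm Y"
proof -
  have Y: "wt \<kappa> c Y" "distinct (snd Y)" "sort (snd X) = sort (snd Y)"
    using relab_wt[OF X r] d mset_eq_imp_distinct_iff by (auto intro: properties_for_sort)
  have o: "fst X \<in> Ops P" "fst Y \<in> Ops P" "fst (nrm X) \<in> Ops P"
    using X Y relab_wt(1)[OF X relab_nrm[OF X d]] by (auto simp: wt_def)
  have "relab (nrm X) (nrm Y)"
    using relab_trans[OF o(3) relab_sym[OF X relab_nrm[OF X d]]] relab_trans[OF o(1) r relab_nrm[OF Y(1,2)]]
    by blast
  then show ?thesis
    using relab_unique[OF relab_wt(1)[OF X relab_nrm[OF X d]], of "nrm Y"] d Y(2,3) by (simp add: nrm_def)
qed

text \<open>This is \<open>equivariance_inner\<close> read on labels. The axiom gives a permutation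
  of all inputs as a list of positions; the work is to see that it moves the labels in the same way,
  block by block.\<close>

lemma relab_subst_inner:
  assumes X: "wt \<kappa> c X" and F: "\<And>x. x \<in> set (snd X) \<Longrightarrow> wt \<kappa>' (\<kappa> x) (F x)"
    and r: "\<And>x. x \<in> set (snd X) \<Longrightarrow> relab (F x) (F' x)"
  shows "relab (subst X F) (subst X F')"
proof -
  define xs n qs where "xs = snd X" and "n = length xs" and "qs = map (\<lambda>x. fst (F x)) xs"
  have "\<forall>x\<in>set xs. \<exists>\<sigma>. \<sigma> permutes {1..arity P (fst (F x))} \<and> fst (F' x) = act P \<sigma> (fst (F x)) \<and>
     length (snd (F' x)) = length (snd (F x)) \<and>
     (\<forall>i\<in>{1..arity P (fst (F x))}. snd (F' x) ! (\<sigma> i - 1) = snd (F x) ! (i - 1))"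
    using r unfolding relab_def xs_def by simp
  from bchoice[OF this] obtain \<tau> where "\<forall>x\<in>set xs. \<tau> x permutes {1..arity P (fst (F x))} \<and>
     fst (F' x) = act P (\<tau> x) (fst (F x)) \<and> length (snd (F' x)) = length (snd (F x)) \<and>
     (\<forall>i\<in>{1..arity P (fst (F x))}. snd (F' x) ! (\<tau> x i - 1) = snd (F x) ! (i - 1))" by blast
  then have t: "\<And>x. x \<in> set xs \<Longrightarrow> \<tau> x permutes {1..arity P (fst (F x))}"
     "\<And>x. x \<in> set xs \<Longrightarrow> fst (F' x) = act P (\<tau> x) (fst (F x))"
     "\<And>x. x \<in> set xs \<Longrightarrow> length (snd (F' x)) = length (snd (F x))"
     "\<And>x i. x \<in> set xs \<Longrightarrow> i \<in> {1..arity P (fst (F x))} \<Longrightarrow> snd (F' x) ! (\<tau> x i - 1) = snd (F x) ! (i - 1)"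
    by blast+
  have ar: "arity P (fst (F x)) = length (snd (F x))" if "x \<in> set xs" for x
    using wt_arity F that unfolding xs_def by blast
  define \<tau>s where "\<tau>s b = \<tau> (xs ! (b - 1))" for b
  have qs: "qs ! (b - 1) = fst (F (xs ! (b - 1)))" if "b \<in> {1..n}" for b
    using that unfolding qs_def n_def by (cases b) auto
  have mem: "xs ! (b - 1) \<in> set xs" if "b \<in> {1..n}" for b using that unfolding n_def by (cases b) auto
  have c: "composable P (fst X) qs" using wt_composable[OF X F] by (simp add: qs_def xs_def)
  \<comment> \<open>\<open>LL\<close> holds the positions of the axiom, grouped in the same blocks
    as the label lists \<open>G\<close> and \<open>G'\<close> below, so that an input is a pair of a
    block and an index inside it.\<close>
  define LL where "LL = map (\<lambda>b. map (\<lambda>k. input_pos P qs b (\<tau>s b k)) [1..<Suc (arity P (qs ! (b - 1)))])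
      [1..<Suc (length qs)]"
  define G G' where "G = map (\<lambda>x. snd (F x)) xs" and "G' = map (\<lambda>x. snd (F' x)) xs"
  define N where "N = length (concat G)"
  have "map (\<lambda>x. fst (F' x)) xs = map (\<lambda>b. act P (\<tau>s b) (qs ! (b - 1))) [1..<Suc (length qs)]"
    using t(2) by (intro nth_equalityI) (auto simp: qs_def \<tau>s_def simp del: upt_Suc)
  then have fst: "fst (subst X F') = act P (place (concat LL)) (plug P (fst X) qs)"
    using equivariance_inner[OF c, of \<tau>s] t(1) mem qs
    by (simp add: LL_def subst_def xs_def[symmetric] \<tau>s_def n_def qs_def del: upt_Suc)
  have lens: "map length G' = map length G" "map (arity P) qs = map length G"
    using t(3) ar by (auto simp: qs_def G_def G'_def)
  have pos: "input_pos P qs (Suc b) (Suc k) = Suc ((\<Sum>xs\<leftarrow>take b G. length xs) + k)" for b k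
    using lens(2) by (simp add: input_pos_def flip: take_map)
  have pos': "(\<Sum>xs\<leftarrow>take b G'. length xs) = (\<Sum>xs\<leftarrow>take b G. length xs)" for b
    using arg_cong[OF lens(1), of "\<lambda>l. sum_list (take b l)"] unfolding take_map .
  have LL: "length LL = n" "\<And>b. b < n \<Longrightarrow> length (LL ! b) = length (G ! b)"
    "\<And>b k. b < n \<Longrightarrow> k < length (G ! b) \<Longrightarrow> LL ! b ! k = input_pos P qs (Suc b) (\<tau> (xs ! b) (Suc k))"
    using ar by (auto simp: qs_def n_def \<tau>s_def LL_def G_def simp del: upt_Suc)
  have mll: "map length LL = map length G"
    using LL(1,2) by (intro nth_equalityI) (auto simp: G_def n_def)
  have posL: "(\<Sum>xs\<leftarrow>take b LL. length xs) = (\<Sum>xs\<leftarrow>take b G. length xs)" for b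
    using arg_cong[OF mll, of "\<lambda>l. sum_list (take b l)"] unfolding take_map .
  have lenL: "length (concat LL) = N" unfolding N_def length_concat mll ..
  have tb: "\<tau> (xs ! b) (Suc k) - 1 < length (G ! b)" "Suc (\<tau> (xs ! b) (Suc k) - 1) = \<tau> (xs ! b) (Suc k)"
    if "b < n" "k < length (G ! b)" for b k
    using perm_range[OF t(1)[of "xs ! b"], of k] that ar by (auto simp: n_def G_def)
  \<comment> \<open>Blocks and indices count from 0, arguments and values of \<open>place\<close>
    from 1.\<close>
  have Lpos: "(concat LL) ! ((\<Sum>xs\<leftarrow>take b G. length xs) + k) = Suc ((\<Sum>xs\<leftarrow>take b G. length xs) + (\<tau> (xs ! b) (Suc k) - 1))"
    if "b < n" "k < length (G ! b)" for b k
  proof -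
    have "concat LL ! ((\<Sum>xs\<leftarrow>take b G. length xs) + k) = LL ! b ! k"
      using concat_nth_block(1)[of b LL k] that LL(1,2) posL by simp
    also have "\<dots> = input_pos P qs (Suc b) (Suc (\<tau> (xs ! b) (Suc k) - 1))"
      using LL(3) that tb by simp
    finally show ?thesis unfolding pos .
  qed
  have "set (concat LL) \<subseteq> {1..N}"
  proof
    fix v assume "v \<in> set (concat LL)"
    then obtain i where i: "i < N" "v = (concat LL) ! i" using lenL by (metis in_set_conv_nth)
    obtain b k where "b < length G" "k < length (G ! b)" "i = (\<Sum>xs\<leftarrow>take b G. length xs) + k"
      using concat_block_exists[of i G] i(1) unfolding N_def by blast
    then show "v \<in> {1..N}"
      using i Lpos[of b k] tb[of b k] concat_nth_block(2)[of b G "\<tau> (xs ! b) (Suc k) - 1"]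
      by (simp add: n_def G_def N_def G'_def)
  qed
  moreover have "{1..N} \<subseteq> set (concat LL)"
  proof
    fix v assume "v \<in> {1..N}"
    then have "v - 1 < N" by auto
    then obtain b k where b: "b < length G" "k < length (G ! b)" "v - 1 = (\<Sum>xs\<leftarrow>take b G. length xs) + k"
      using concat_block_exists[of _ G] unfolding N_def by blast
    then have bn: "b < n" "xs ! b \<in> set xs" by (auto simp: n_def G_def)
    have kk: "Suc k \<in> {1..arity P (fst (F (xs ! b)))}" using b ar bn by (simp add: n_def G_def N_def G'_def)
    define k' where "k' = inv (\<tau> (xs ! b)) (Suc k) - 1"
    have "inv (\<tau> (xs ! b)) (Suc k) \<in> {1..arity P (fst (F (xs ! b)))}"
      using permutes_in_image[OF permutes_inv[OF t(1)[OF bn(2)]]] kk by blast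
    then have k': "k' < length (G ! b)" "\<tau> (xs ! b) (Suc k') = Suc k"
      using permutes_inverses(1)[OF t(1)[OF bn(2)]] ar[OF bn(2)] bn b unfolding k'_def by (auto simp: G_def n_def)
    have "(concat LL) ! ((\<Sum>xs\<leftarrow>take b G. length xs) + k') = v"
      using Lpos[OF bn(1) k'(1)] k'(2) b(3) \<open>v \<in> {1..N}\<close> by auto
    then show "v \<in> set (concat LL)" using concat_nth_block(2)[OF b(1) k'(1)] lenL by (metis N_def nth_mem)
  qed
  ultimately have perm: "place (concat LL) permutes {1..N}" using place_permutes[OF lenL] by blast
  have arN: "arity P (fst (subst X F)) = N"
    using wt_arity[OF wt_subst[OF X F]] by (simp add: xs_def G_def N_def)
  show ?thesis unfolding relab_def
  proof (intro exI[of _ "place (concat LL)"] conjI ballI)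
    show "length (snd (subst X F')) = length (snd (subst X F))"
      using lens(1) by (simp add: xs_def[symmetric] length_concat comp_def G_def G'_def cong: map_cong)
    fix i assume "i \<in> {1..arity P (fst (subst X F))}"
    then have "i - 1 < N" "i \<ge> 1" using arN by auto
    then obtain b k where b: "b < length G" "k < length (G ! b)" "i - 1 = (\<Sum>xs\<leftarrow>take b G. length xs) + k"
      using concat_block_exists[of _ G] unfolding N_def by blast
    then have bn: "b < n" "xs ! b \<in> set xs" by (auto simp: n_def G_def)
    have "place (concat LL) i = (concat LL) ! (i - 1)" using \<open>i - 1 < N\<close> \<open>i \<ge> 1\<close> lenL unfolding place_def by auto
    also have "\<dots> = Suc ((\<Sum>xs\<leftarrow>take b G'. length xs) + (\<tau> (xs ! b) (Suc k) - 1))"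
      using Lpos[OF bn(1) b(2)] b(3) pos' by simp
    finally have "concat G' ! (place (concat LL) i - 1) = snd (F' (xs ! b)) ! (\<tau> (xs ! b) (Suc k) - 1)"
      using concat_nth_block(1)[of b G' "\<tau> (xs ! b) (Suc k) - 1"] tb[OF bn(1) b(2)] bn t(3)
      by (simp add: n_def G_def N_def G'_def)
    also have "\<dots> = snd (F (xs ! b)) ! k"
      using t(4)[OF bn(2), of "Suc k"] b bn ar by (simp add: n_def G_def N_def G'_def)
    also have "\<dots> = concat G ! (i - 1)" using concat_nth_block(1)[OF b(1,2)] b bn by (simp add: n_def G_def N_def G'_def)
    finally show "snd (subst X F') ! (place (concat LL) i - 1) = snd (subst X F) ! (i - 1)" by (simp add: xs_def G_def G'_def)
  qed (use perm arN fst in \<open>simp_all add: subst_def qs_def xs_def\<close>)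
qed

text \<open>The counterpart for \<open>equivariance_outer\<close>: blocks move as a whole, block
  \<open>a\<close> of \<open>X\<close> becoming block \<open>\<sigma> a\<close> of \<open>Y\<close>,
  with the order inside each block kept.\<close>

lemma relab_subst_outer:
  assumes X: "wt \<kappa> c X" and F: "\<And>x. x \<in> set (snd X) \<Longrightarrow> wt \<kappa>' (\<kappa> x) (F x)" and r: "relab X Y"
  shows "relab (subst X F) (subst Y F)"
proof -
  from r obtain \<sigma> where s: "\<sigma> permutes {1..arity P (fst X)}" "fst Y = act P \<sigma> (fst X)"
     "length (snd Y) = length (snd X)" "\<forall>i\<in>{1..arity P (fst X)}. snd Y ! (\<sigma> i - 1) = snd X ! (i - 1)"
    unfolding relab_def by blast
  have Y: "wt \<kappa> c Y" and sX: "set (snd Y) = set (snd X)"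
    using relab_wt[OF X r] by (auto dest: mset_eq_setD)
  have o: "fst X \<in> Ops P" using X by (simp add: wt_def)
  define n where "n = length (snd X)"
  have n: "arity P (fst X) = n" "length (snd Y) = n" using wt_arity[OF X] s(3) by (simp_all add: n_def)
  note s = s[unfolded n]
  define qs where "qs = map (\<lambda>x. fst (F x)) (snd Y)"
  have ar: "arity P (fst (F x)) = length (snd (F x))" if "x \<in> set (snd X)" for x
    using wt_arity F that by blast
  have c: "composable P (act P \<sigma> (fst X)) qs"
    using wt_composable[OF Y, of \<kappa>' F] F sX s(2) by (simp add: qs_def)
  have sb: "\<sigma> (Suc a) - 1 < n" "Suc (\<sigma> (Suc a) - 1) = \<sigma> (Suc a)" if "a < n" for a
    using perm_range[OF s(1) that] by auto
  have XY: "snd X ! a = snd Y ! (\<sigma> (Suc a) - 1)" if "a < n" for a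
    using s(4)[rule_format, of "Suc a"] that by simp
  have q: "qs ! (\<sigma> (Suc a) - 1) = fst (F (snd X ! a))" if "a < n" for a
    using XY[OF that] sb[OF that] n by (simp add: qs_def)
  define LL where "LL = map (\<lambda>a. map (input_pos P qs (\<sigma> a)) [1..<Suc (arity P (qs ! (\<sigma> a - 1)))])
      [1..<Suc (arity P (fst X))]"
  define G G' where "G = map (\<lambda>x. snd (F x)) (snd X)" and "G' = map (\<lambda>x. snd (F x)) (snd Y)"
  define N where "N = length (concat G)"
  have m: "map (\<lambda>a. qs ! (\<sigma> a - 1)) [1..<Suc (arity P (fst X))] = map (\<lambda>x. fst (F x)) (snd X)"
    using q n by (intro nth_equalityI) (auto simp: n_def simp del: upt_Suc)
  have fst: "fst (subst Y F) = act P (place (concat LL)) (plug P (fst X) (map (\<lambda>x. fst (F x)) (snd X)))"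
    using equivariance_outer[OF o s(1)[folded n(1)] c] m s(2) by (simp add: subst_def qs_def LL_def del: upt_Suc)
  have GL: "length G' = n" using n by (simp add: G'_def)
  have "map (arity P) qs = map length G'" using ar sX by (auto simp: qs_def G'_def)
  then have pos: "input_pos P qs (Suc b) (Suc k) = Suc ((\<Sum>xs\<leftarrow>take b G'. length xs) + k)" for b k
    by (simp add: input_pos_def flip: take_map)
  have LL: "length LL = n" "\<And>b. b < n \<Longrightarrow> length (LL ! b) = length (G ! b)"
    "\<And>b k. b < n \<Longrightarrow> k < length (G ! b) \<Longrightarrow> LL ! b ! k = input_pos P qs (\<sigma> (Suc b)) (Suc k)"
  proof -
    have l: "arity P (qs ! (\<sigma> (Suc b) - 1)) = length (G ! b)" if "b < n" for b
      using ar q[OF that] that by (simp add: G_def n_def)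
    show "length LL = n" "\<And>b. b < n \<Longrightarrow> length (LL ! b) = length (G ! b)"
      "\<And>b k. b < n \<Longrightarrow> k < length (G ! b) \<Longrightarrow> LL ! b ! k = input_pos P qs (\<sigma> (Suc b)) (Suc k)"
      using l n(1) by (auto simp: LL_def simp del: upt_Suc)
  qed
  have mll: "map length LL = map length G"
    using LL(1,2) by (intro nth_equalityI) (auto simp: G_def n_def)
  have posL: "(\<Sum>xs\<leftarrow>take b LL. length xs) = (\<Sum>xs\<leftarrow>take b G. length xs)" for b
    using arg_cong[OF mll, of "\<lambda>l. sum_list (take b l)"] unfolding take_map .
  have lenL: "length (concat LL) = N" unfolding N_def length_concat mll ..
  have GG: "G ! a = G' ! (\<sigma> (Suc a) - 1)" if "a < n" for a
    using XY[OF that] sb[OF that] that n by (simp add: n_def G_def G'_def)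
  have Lpos: "(concat LL) ! ((\<Sum>xs\<leftarrow>take a G. length xs) + k) = Suc ((\<Sum>xs\<leftarrow>take (\<sigma> (Suc a) - 1) G'. length xs) + k)"
    if "a < n" "k < length (G ! a)" for a k
  proof -
    have "concat LL ! ((\<Sum>xs\<leftarrow>take a G. length xs) + k) = LL ! a ! k"
      using concat_nth_block(1)[of a LL k] that LL(1,2) posL by simp
    also have "\<dots> = input_pos P qs (Suc (\<sigma> (Suc a) - 1)) (Suc k)"
      using LL(3) that sb by simp
    finally show ?thesis unfolding pos .
  qed
  have N': "length (concat G') = N"
  proof -
    have "mset (map (\<lambda>x. length (snd (F x))) (snd Y)) = mset (map (\<lambda>x. length (snd (F x))) (snd X))"
      using relab_wt(2)[OF X r] by simp
    from arg_cong[OF this, of sum_mset] show ?thesis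
      by (simp add: length_concat comp_def sum_mset_sum_list G_def G'_def N_def del: mset_map)
  qed
  have "set (concat LL) \<subseteq> {1..N}"
  proof
    fix v assume "v \<in> set (concat LL)"
    then obtain i where i: "i < N" "v = (concat LL) ! i" using lenL by (metis in_set_conv_nth)
    obtain b k where b: "b < length G" "k < length (G ! b)" "i = (\<Sum>xs\<leftarrow>take b G. length xs) + k"
      using concat_block_exists[of i G] i(1) unfolding N_def by blast
    then have bn: "b < n" by (simp add: n_def G_def N_def G'_def)
    show "v \<in> {1..N}"
      using i b Lpos[OF bn b(2)] sb[OF bn] GG[OF bn] N' GL concat_nth_block(2)[of "\<sigma> (Suc b) - 1" G' k]
      by simp
  qed
  moreover have "{1..N} \<subseteq> set (concat LL)"
  proof
    fix v assume "v \<in> {1..N}"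
    then have "v - 1 < length (concat G')" using N' by auto
    then obtain b k where b: "b < length G'" "k < length (G' ! b)" "v - 1 = (\<Sum>xs\<leftarrow>take b G'. length xs) + k"
      using concat_block_exists[of _ G'] by blast
    define a where "a = inv \<sigma> (Suc b) - 1"
    have "inv \<sigma> (Suc b) \<in> {1..n}"
      using permutes_in_image[OF permutes_inv[OF s(1)]] b n by (simp add: G'_def)
    then have a: "a < n" "\<sigma> (Suc a) - 1 = b"
      using permutes_inverses(1)[OF s(1)] unfolding a_def by auto
    have "(concat LL) ! ((\<Sum>xs\<leftarrow>take a G. length xs) + k) = v"
      using Lpos[OF a(1), of k] GG[OF a(1)] a(2) b \<open>v \<in> {1..N}\<close> by auto
    moreover have "a < length G" "k < length (G ! a)"
      using a GG[OF a(1)] b by (simp_all add: n_def G_def)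
    ultimately show "v \<in> set (concat LL)" using concat_nth_block(2)[of a G k] lenL by (metis N_def nth_mem)
  qed
  ultimately have perm: "place (concat LL) permutes {1..N}" using place_permutes[OF lenL] by blast
  have arN: "arity P (fst (subst X F)) = N"
    using wt_arity[OF wt_subst[OF X F]] by (simp add: N_def G_def)
  show ?thesis unfolding relab_def
  proof (intro exI[of _ "place (concat LL)"] conjI ballI)
    fix i assume "i \<in> {1..arity P (fst (subst X F))}"
    then have "i - 1 < N" "i \<ge> 1" using arN by auto
    then obtain b k where b: "b < length G" "k < length (G ! b)" "i - 1 = (\<Sum>xs\<leftarrow>take b G. length xs) + k"
      using concat_block_exists[of _ G] unfolding N_def by blast
    then have bn: "b < n" by (simp add: n_def G_def N_def G'_def)
    have "place (concat LL) i = (concat LL) ! (i - 1)" using \<open>i - 1 < N\<close> \<open>i \<ge> 1\<close> lenL unfolding place_def by auto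
    also have "\<dots> = Suc ((\<Sum>xs\<leftarrow>take (\<sigma> (Suc b) - 1) G'. length xs) + k)"
      using Lpos[OF bn b(2)] b(3) by simp
    finally have "concat G' ! (place (concat LL) i - 1) = G' ! (\<sigma> (Suc b) - 1) ! k"
      using concat_nth_block(1)[of "\<sigma> (Suc b) - 1" G' k] sb[OF bn] GG[OF bn] b(2) GL
      by simp
    also have "\<dots> = concat G ! (i - 1)" using concat_nth_block(1)[OF b(1,2)] b GG[OF bn] by simp
    finally show "snd (subst Y F) ! (place (concat LL) i - 1) = snd (subst X F) ! (i - 1)" by (simp add: G_def G'_def)
  qed (use perm arN fst N' in \<open>simp_all add: subst_def G_def G'_def N_def\<close>)
qed

lemma relab_subst:
  assumes X: "wt \<kappa> c X" and F: "\<And>x. x \<in> set (snd X) \<Longrightarrow> wt \<kappa>' (\<kappa> x) (F x)" and r: "relab X Y"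
    and r': "\<And>x. x \<in> set (snd X) \<Longrightarrow> relab (F x) (F' x)"
  shows "relab (subst X F) (subst Y F')"
proof (rule relab_trans[OF _ relab_subst_inner[OF X F r'] relab_subst_outer[OF X _ r]])
  show "fst (subst X F) \<in> Ops P" using wt_subst[OF X F] by (simp add: wt_def)
  show "wt \<kappa>' (\<kappa> x) (F' x)" if "x \<in> set (snd X)" for x
    using relab_wt(1)[OF F r'] that by blast
qed

end

section \<open>Morphisms as families of labelled operations\<close>

lemma mset_concat_map_cong:
  "mset ws = mset ws' \<Longrightarrow> mset (concat (map h ws)) = mset (concat (map h ws'))"
  by (metis mset_concat mset_map sum_mset_sum_list)

lemma concat_map_eq_singletons: "(\<And>x. x \<in> set xs \<Longrightarrow> f x = [x]) \<Longrightarrow> concat (map f xs) = xs"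
  by (induction xs) auto

text \<open>A tuple is encoded by its list of vertices, each vertex labelled by the numbers of its leaves. The
  set \<open>D\<close> of lower vertices is \<open>{0}\<close> in the symmetric and planar cases, and then the marked input of vertex 0
  carries the label 0; it is empty in the cyclic case. Operations are labelled up to the equivalence \<open>E\<close>, with normal forms \<open>nrm\<close>.
  The predicate \<open>lay\<close> restricts the labellings in the planar case.\<close>

locale labelled_families = planar_operad P
  for P :: "('c, 'o, 'z) operad_scheme" +
  fixes E :: "'o \<times> nat list \<Rightarrow> 'o \<times> nat list \<Rightarrow> bool"
    and nrm :: "'o \<times> nat list \<Rightarrow> 'o \<times> nat list"
    and \<psi> :: "'o \<Rightarrow> int"
    and D :: "nat set"
    and objs :: "'a set"
    and siz :: "'a \<Rightarrow> nat"
    and col :: "'a \<Rightarrow> nat \<Rightarrow> 'c"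
    and lay :: "nat list list \<Rightarrow> bool"
  assumes lower: "i \<in> D \<Longrightarrow> i = 0"
    and E_refl: "wt \<kappa> c X \<Longrightarrow> E X X"
    and E_sym: "wt \<kappa> c X \<Longrightarrow> E X Y \<Longrightarrow> E Y X"
    and E_trans: "wt \<kappa> c X \<Longrightarrow> E X Y \<Longrightarrow> E Y Z \<Longrightarrow> E X Z"
    and E_wt: "wt \<kappa> c X \<Longrightarrow> E X Y \<Longrightarrow> wt \<kappa> c Y"
    and E_mset: "wt \<kappa> c X \<Longrightarrow> E X Y \<Longrightarrow> mset (snd Y) = mset (snd X)"
    and E_grading: "wt \<kappa> c X \<Longrightarrow> E X Y \<Longrightarrow> \<psi> (fst Y) = \<psi> (fst X)"
    and E_subst: "wt \<kappa> c X \<Longrightarrow> (\<And>x. x \<in> set (snd X) \<Longrightarrow> wt \<kappa>' (\<kappa> x) (F x)) \<Longrightarrow> E X Y \<Longrightarrow>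
      (\<And>x. x \<in> set (snd X) \<Longrightarrow> E (F x) (F' x)) \<Longrightarrow> E (subst X F) (subst Y F')"
    and E_nrm: "wt \<kappa> c X \<Longrightarrow> distinct (snd X) \<Longrightarrow> E X (nrm X)"
    and nrm_E: "wt \<kappa> c X \<Longrightarrow> distinct (snd X) \<Longrightarrow> E X Y \<Longrightarrow> nrm X = nrm Y"
    and nrm_sorted: "wt \<kappa> c X \<Longrightarrow> distinct (snd X) \<Longrightarrow> sorted (snd X) \<Longrightarrow> nrm X = X"
    and grading: "planar_grading P \<psi>"
    and grading_ge: "p \<in> Ops P \<Longrightarrow> -1 \<le> \<psi> p"
    and grading_minus1: "p \<in> Ops P \<Longrightarrow> \<psi> p = -1 \<Longrightarrow> arity P p = 0"
    and obj_cols: "x \<in> objs \<Longrightarrow> i \<le> siz x \<Longrightarrow> col x i \<in> Cols P"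
    and obj_exists: "(\<And>i. i \<le> n \<Longrightarrow> \<gamma> i \<in> Cols P) \<Longrightarrow> \<exists>x\<in>objs. siz x = n \<and> (\<forall>i\<le>n. col x i = \<gamma> i)"
    and obj_unique: "x \<in> objs \<Longrightarrow> y \<in> objs \<Longrightarrow> siz x = siz y \<Longrightarrow> (\<And>i. i \<le> siz y \<Longrightarrow> col x i = col y i) \<Longrightarrow> x = y"
begin

text \<open>Leg 0 of an object is its output. The label 0 of a lower vertex is its gluing with the
  source and has the colour of the output of the source; every other label is a leg of the
  target.\<close>

definition vcol :: "'a \<Rightarrow> 'a \<Rightarrow> nat \<Rightarrow> nat \<Rightarrow> 'c" where
  "vcol x y i = (if i \<in> D then (col y)(0 := col x 0) else col y)"

definition vout :: "'a \<Rightarrow> 'a \<Rightarrow> nat \<Rightarrow> 'c" where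
  "vout x y i = (if i \<in> D then col y 0 else col x i)"

text \<open>Each label from 0 to \<open>siz y\<close> occurs exactly once. With a lower vertex, the
  label 0 is spent on the marked input while the output of the target needs no label, which keeps
  the count uniform.\<close>

definition mor :: "'a \<Rightarrow> 'a \<Rightarrow> ('o \<times> nat list) list \<Rightarrow> bool" where
  "mor x y L \<longleftrightarrow> length L = Suc (siz x) \<and>
     (\<forall>i\<le>siz x. wt (vcol x y i) (vout x y i) (L ! i) \<and> nrm (L ! i) = L ! i) \<and>
     mset (concat (map snd L)) = mset [0..<Suc (siz y)] \<and>
     (0 \<in> D \<longrightarrow> 0 \<in> set (snd (L ! 0))) \<and> lay (map snd L)"

text \<open>What goes onto the lower vertex of the first factor: its marked input stays open for the
  source.\<close>

definition star :: "'a \<Rightarrow> ('o \<times> nat list) list \<Rightarrow> nat \<Rightarrow> 'o \<times> nat list" where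
  "star x G w = (if w = 0 then unit_op (col x) 0 else G ! w)"

text \<open>Upper vertices of the second factor sit on vertices of the first, whereas the lower
  vertex of the second lies below that of the first, which is plugged into its marked input.
  Normalization is left to \<open>cmp\<close>.\<close>

definition vert :: "'a \<Rightarrow> 'a \<Rightarrow> ('o \<times> nat list) list \<Rightarrow> ('o \<times> nat list) list \<Rightarrow> nat \<Rightarrow> 'o \<times> nat list" where
  "vert x z G F i =
     (if i \<in> D then subst (G ! 0) (\<lambda>v. if v = 0 then subst (F ! 0) (star x G) else unit_op (col z) v)
      else subst (F ! i) ((!) G))"

definition cmp :: "'a \<Rightarrow> 'a \<Rightarrow> ('o \<times> nat list) list \<Rightarrow> ('o \<times> nat list) list \<Rightarrow> ('o \<times> nat list) list" where
  "cmp x z G F = map (\<lambda>i. nrm (vert x z G F i)) [0..<Suc (siz x)]"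

definition idm :: "'a \<Rightarrow> ('o \<times> nat list) list" where
  "idm x = map (unit_op (col x)) [0..<Suc (siz x)]"

section \<open>Typing and uniqueness of labels\<close>

lemma mor_len: "mor x y L \<Longrightarrow> length L = Suc (siz x)"
  and mor_wt: "mor x y L \<Longrightarrow> i \<le> siz x \<Longrightarrow> wt (vcol x y i) (vout x y i) (L ! i)"
  and mor_nrm: "mor x y L \<Longrightarrow> i \<le> siz x \<Longrightarrow> nrm (L ! i) = L ! i"
  and mor_mset: "mor x y L \<Longrightarrow> mset (concat (map snd L)) = mset [0..<Suc (siz y)]"
  and mor_lay: "mor x y L \<Longrightarrow> lay (map snd L)"
  and mor_0: "mor x y L \<Longrightarrow> 0 \<in> D \<Longrightarrow> 0 \<in> set (snd (L ! 0))"
  unfolding mor_def by blast+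

lemma mor_wt_upper:
  "mor x y L \<Longrightarrow> i \<le> siz x \<Longrightarrow> i \<notin> D \<Longrightarrow> wt (col y) (col x i) (L ! i)"
  using mor_wt[of x y L i] by (auto simp: vcol_def vout_def)

lemma mor_wt_lower: "mor x y L \<Longrightarrow> 0 \<in> D \<Longrightarrow> wt ((col y)(0 := col x 0)) (col y 0) (L ! 0)"
  using mor_wt[of x y L 0] by (auto simp: vcol_def vout_def)

lemma mor_distinct_all: "mor x y L \<Longrightarrow> distinct (concat (map snd L))"
  using mset_eq_imp_distinct_iff[OF mor_mset] by simp

lemma mor_set: "mor x y L \<Longrightarrow> set (concat (map snd L)) = {0..siz y}"
  using mset_eq_setD[OF mor_mset] by (auto simp del: upt_Suc)

lemma mor_distinct: "mor x y L \<Longrightarrow> i \<le> siz x \<Longrightarrow> distinct (snd (L ! i))"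
  using mor_distinct_all[of x y L] mor_len[of x y L] by (auto simp: distinct_concat_iff)

lemma mor_label: "mor x y L \<Longrightarrow> i \<le> siz x \<Longrightarrow> w \<in> set (snd (L ! i)) \<Longrightarrow> w \<le> siz y"
  using mor_set[of x y L] mor_len[of x y L] nth_mem[of i L] by auto

lemma mor_label_exists:
  assumes "mor x y L" "w \<le> siz y"
  obtains i where "i \<le> siz x" "w \<in> set (snd (L ! i))"
proof -
  have "w \<in> set (concat (map snd L))" using mor_set[OF assms(1)] assms(2) by simp
  then obtain X where "X \<in> set L" "w \<in> set (snd X)" by auto
  then show ?thesis using that mor_len[OF assms(1)] by (metis in_set_conv_nth less_Suc_eq_le)
qed

lemma mor_label_unique:
  assumes "mor x y L" "i \<le> siz x" "j \<le> siz x" "w \<in> set (snd (L ! i))" "w \<in> set (snd (L ! j))"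
  shows "i = j"
proof -
  have *: "distinct (concat (map snd L)) \<Longrightarrow> i < length L \<Longrightarrow> j < length L \<Longrightarrow> i < j \<Longrightarrow>
      w \<in> set (snd (L ! i)) \<Longrightarrow> w \<notin> set (snd (L ! j))" for i j
  proof (induction L arbitrary: i j)
    case (Cons X L)
    then show ?case by (cases i; cases j) (auto, meson disjoint_iff UN_I nth_mem)
  qed simp
  show ?thesis
    using *[OF mor_distinct_all[OF assms(1)], of i j] *[OF mor_distinct_all[OF assms(1)], of j i]
      assms mor_len[OF assms(1)] by (metis le_imp_less_Suc linorder_neqE_nat)
qed

text \<open>The marked label sits in vertex 0 and occurs once. Consequently only upper vertices of a
  second factor are plugged into upper vertices of the first.\<close>

lemma mor_nz:
  assumes L: "mor x y L" and i: "i \<le> siz x" "i \<notin> D" and w: "w \<in> set (snd (L ! i))"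
  shows "w \<notin> D"
proof
  assume "w \<in> D"
  then have "w = 0" "0 \<in> D" using lower[of w] by auto
  then have "i = 0" using mor_label_unique[OF L i(1) _ w] mor_0[OF L] by simp
  then show False using i(2) \<open>0 \<in> D\<close> by simp
qed

lemma mor_split:
  assumes "mor x y L" "0 \<in> D"
  obtains l r where "snd (L ! 0) = l @ 0 # r" "0 \<notin> set l" "0 \<notin> set r"
  using mor_0[OF assms] mor_distinct[OF assms(1), of 0]
  by (metis split_list_first distinct.simps(2) distinct_append le0)

lemma wt_star:
  assumes F: "mor x y F" and G: "mor y z G" and x: "x \<in> objs" and D: "0 \<in> D" and w: "w \<in> set (snd (F ! 0))"
  shows "wt ((col z)(0 := col x 0)) (((col y)(0 := col x 0)) w) (star x G w)"
proof (cases "w = 0")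
  case True
  then show ?thesis using obj_cols[OF x] by (auto simp: star_def intro!: wt_unit')
next
  case False
  have wy: "w \<le> siz y" using mor_label[OF F _ w] by simp
  have "wt (col z) (col y w) (G ! w)" using mor_wt_upper[OF G wy] False lower[of w] by blast
  moreover have "0 \<notin> set (snd (G ! w))" using mor_nz[OF G wy] lower[of w] False D by blast
  ultimately show ?thesis using False by (auto simp: star_def intro: wt_cong)
qed

lemma wt_lower_arg:
  assumes F: "mor x y F" and G: "mor y z G" and x: "x \<in> objs" and z: "z \<in> objs" and D: "0 \<in> D"
    and v: "v \<in> set (snd (G ! 0))"
  shows "wt ((col z)(0 := col x 0)) (((col z)(0 := col y 0)) v)
    (if v = 0 then subst (F ! 0) (star x G) else unit_op (col z) v)"
proof (cases "v = 0")
  case True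
  then show ?thesis using wt_subst[OF mor_wt_lower[OF F D] wt_star[OF F G x D]] by simp
next
  case False
  then show ?thesis using obj_cols[OF z mor_label[OF G _ v]] by (auto intro!: wt_unit')
qed

lemma wt_upper_arg:
  assumes F: "mor x y F" and G: "mor y z G" and i: "i \<le> siz x" "i \<notin> D" "w \<in> set (snd (F ! i))"
  shows "wt (col z) (col y w) (G ! w)"
  using mor_wt_upper[OF G mor_label[OF F i(1) i(3)]] mor_nz[OF F i] by blast

lemma wt_vert:
  assumes F: "mor x y F" and G: "mor y z G" and x: "x \<in> objs" and z: "z \<in> objs" and i: "i \<le> siz x"
  shows "wt (vcol x z i) (vout x z i) (vert x z G F i)"
proof (cases "i \<in> D")
  case True
  then have "0 \<in> D" using lower by metis
  then show ?thesis
    using wt_subst[OF mor_wt_lower[OF G] wt_lower_arg[OF F G x z]] True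
    by (simp add: vert_def vcol_def vout_def)
next
  case False
  then show ?thesis
    using wt_subst[OF mor_wt_upper[OF F i] wt_upper_arg[OF F G i]]
    by (auto simp: vert_def vcol_def vout_def)
qed

text \<open>The exact order is recorded, not only the multiset, because planar layouts and the lower
  vertex of a symmetric composite are computed from it.\<close>

lemma vert_0_labels:
  assumes F: "mor x y F" and G: "mor y z G" and D: "0 \<in> D"
    and f: "snd (F ! 0) = l' @ 0 # r'" and g: "snd (G ! 0) = l @ 0 # r"
  shows "snd (vert x z G F 0) =
    l @ concat (map (\<lambda>w. snd (G ! w)) l') @ 0 # concat (map (\<lambda>w. snd (G ! w)) r') @ r"
proof -
  have d: "0 \<notin> set l" "0 \<notin> set r" "0 \<notin> set l'" "0 \<notin> set r'"
    using mor_distinct[OF F, of 0] mor_distinct[OF G, of 0] f g by auto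
  have 1: "concat (map (\<lambda>v. snd (if v = 0 then A else unit_op (col z) v)) xs) = xs" if "0 \<notin> set xs" for xs A
    using that by (auto intro!: concat_map_eq_singletons)
  have 2: "map (\<lambda>w. snd (star x G w)) xs = map (\<lambda>w. snd (G ! w)) xs" if "0 \<notin> set xs" for xs
    using that by (auto simp: star_def)
  show ?thesis
    using D f g d by (simp add: vert_def 1 2) (simp add: star_def)
qed

lemma upper_labels:
  assumes F: "mor x y F"
  shows "concat (map (\<lambda>i. snd (vert x z G F i)) [1..<Suc (siz x)]) =
    concat (map (\<lambda>w. snd (G ! w)) (concat (map snd (tl F))))"
proof -
  have "tl F = map ((!) F) [1..<Suc (siz x)]"
    using mor_len[OF F] by (intro nth_equalityI) (auto simp: nth_tl simp del: upt_Suc)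
  moreover have "concat (map (\<lambda>i. snd (vert x z G F i)) is) =
      concat (map (\<lambda>w. snd (G ! w)) (concat (map snd (map ((!) F) is))))" if "0 \<notin> set is" for "is"
    using that
  proof (induction "is")
    case (Cons i "is")
    then have "i \<notin> D" using lower[of i] by auto
    then show ?case using Cons by (simp add: vert_def)
  qed simp
  ultimately show ?thesis by (simp del: upt_Suc)
qed

text \<open>Each label \<open>w\<close> of \<open>F\<close> is replaced by the labels of
  \<open>G ! w\<close>, and each \<open>w\<close> occurs once. With a lower vertex, the label 0 of
  \<open>F\<close> survives and takes the place of the label 0 of \<open>G ! 0\<close>.\<close>

lemma vert_mset:
  assumes F: "mor x y F" and G: "mor y z G"
  shows "mset (concat (map (\<lambda>i. snd (vert x z G F i)) [0..<Suc (siz x)])) = mset [0..<Suc (siz z)]"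
proof -
  have split: "[0..<Suc (siz x)] = 0 # [1..<Suc (siz x)]" by (simp add: upt_rec)
  have F0: "F = F ! 0 # tl F" using mor_len[OF F] by (cases F) auto
  have G0: "G = G ! 0 # tl G" using mor_len[OF G] by (cases G) auto
  have G1: "tl G = map ((!) G) [1..<Suc (siz y)]"
    using mor_len[OF G] by (intro nth_equalityI) (auto simp: nth_tl simp del: upt_Suc)
  define H where "H ws = concat (map (\<lambda>w. snd (G ! w)) ws)" for ws
  have mF: "mset (snd (F ! 0) @ concat (map snd (tl F))) = mset (0 # [1..<Suc (siz y)])"
    using mor_mset[OF F] by (subst (asm) F0) (simp add: upt_rec)
  have mG: "mset (snd (G ! 0) @ H [1..<Suc (siz y)]) = mset [0..<Suc (siz z)]"
    using mor_mset[OF G] unfolding H_def by (subst (asm) G0) (simp add: G1 comp_def del: upt_Suc)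
  show ?thesis
  proof (cases "0 \<in> D")
    case True
    obtain l r where g: "snd (G ! 0) = l @ 0 # r" using mor_split[OF G True] by metis
    obtain l' r' where f: "snd (F ! 0) = l' @ 0 # r'" using mor_split[OF F True] by metis
    have "mset (l' @ r' @ concat (map snd (tl F))) = mset [1..<Suc (siz y)]"
      using mF unfolding f by (simp del: upt_Suc)
    then have "mset (H (l' @ r' @ concat (map snd (tl F)))) = mset (H [1..<Suc (siz y)])"
      unfolding H_def by (rule mset_concat_map_cong)
    then show ?thesis
      unfolding split mG[symmetric]
      using vert_0_labels[OF F G True f g] upper_labels[OF F, of z G] g
      by (simp add: H_def[symmetric] del: upt_Suc mset_upt) (simp add: H_def del: upt_Suc)
  next
    case False
    then have "snd (vert x z G F 0) = H (snd (F ! 0))" by (simp add: vert_def H_def)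
    moreover have "mset (H (snd (F ! 0) @ concat (map snd (tl F)))) = mset (H (0 # [1..<Suc (siz y)]))"
      using mF unfolding H_def by (rule mset_concat_map_cong)
    ultimately show ?thesis
      unfolding split mG[symmetric]
      using upper_labels[OF F, of z G] by (simp add: H_def del: upt_Suc)
  qed
qed

lemma vert_distinct:
  assumes F: "mor x y F" and G: "mor y z G" and i: "i \<le> siz x"
  shows "distinct (snd (vert x z G F i))"
proof -
  have "distinct (concat (map (\<lambda>i. snd (vert x z G F i)) [0..<Suc (siz x)]))"
    using mset_eq_imp_distinct_iff[OF vert_mset[OF F G]] by simp
  then show ?thesis using i by (auto simp: distinct_concat_iff simp del: upt_Suc)
qed

lemma cmp_nth: "i \<le> siz x \<Longrightarrow> cmp x z G F ! i = nrm (vert x z G F i)"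
  unfolding cmp_def by (simp del: upt_Suc)

lemma cmp_E:
  assumes "mor x y F" "mor y z G" "x \<in> objs" "z \<in> objs" "i \<le> siz x"
  shows "E (vert x z G F i) (cmp x z G F ! i)"
  using E_nrm[OF wt_vert[OF assms] vert_distinct[OF assms(1,2,5)]] cmp_nth[OF assms(5)] by simp

lemma nrm_nrm: "wt \<kappa> c X \<Longrightarrow> distinct (snd X) \<Longrightarrow> nrm (nrm X) = nrm X"
  using nrm_E E_nrm by metis

lemma cmp_mor:
  assumes F: "mor x y F" and G: "mor y z G" and x: "x \<in> objs" and z: "z \<in> objs"
    and lay: "lay (map snd (cmp x z G F))"
  shows "mor x z (cmp x z G F)"
  unfolding mor_def
proof (intro conjI impI allI)
  show "length (cmp x z G F) = Suc (siz x)" by (simp add: cmp_def)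
  have m: "mset (snd (cmp x z G F ! i)) = mset (snd (vert x z G F i))" if "i \<le> siz x" for i
    using E_mset[OF wt_vert[OF F G x z that] cmp_E[OF F G x z that]] .
  have "mset (concat (map snd (cmp x z G F))) = (\<Sum>i\<leftarrow>[0..<Suc (siz x)]. mset (snd (cmp x z G F ! i)))"
  proof -
    have "map snd (cmp x z G F) = map (\<lambda>i. snd (cmp x z G F ! i)) [0..<Suc (siz x)]"
      unfolding cmp_def by (intro nth_equalityI) (auto simp del: upt_Suc)
    then show ?thesis by (simp add: mset_concat comp_def del: upt_Suc)
  qed
  also have "\<dots> = (\<Sum>i\<leftarrow>[0..<Suc (siz x)]. mset (snd (vert x z G F i)))"
    using m by (intro arg_cong[where f = sum_list] map_cong) (auto simp del: upt_Suc)
  also have "\<dots> = mset (concat (map (\<lambda>i. snd (vert x z G F i)) [0..<Suc (siz x)]))"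
    by (simp add: mset_concat comp_def del: upt_Suc)
  finally show "mset (concat (map snd (cmp x z G F))) = mset [0..<Suc (siz z)]"
    using vert_mset[OF F G] by simp
  show "0 \<in> set (snd (cmp x z G F ! 0))" if D: "0 \<in> D"
  proof -
    obtain l r where g: "snd (G ! 0) = l @ 0 # r" by (rule mor_split[OF G D])
    obtain l' r' where f: "snd (F ! 0) = l' @ 0 # r'" by (rule mor_split[OF F D])
    show ?thesis using mset_eq_setD[OF m[of 0]] vert_0_labels[OF F G D f g] by simp
  qed
next
  fix i assume i: "i \<le> siz x"
  show "wt (vcol x z i) (vout x z i) (cmp x z G F ! i)"
    using E_wt[OF wt_vert[OF F G x z i] cmp_E[OF F G x z i]] .
  show "nrm (cmp x z G F ! i) = cmp x z G F ! i"
    using nrm_nrm[OF wt_vert[OF F G x z i] vert_distinct[OF F G i]] cmp_nth[OF i] by simp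
qed (fact lay)

text \<open>Vertices of a morphism are fixed by \<open>nrm\<close>, so equality can be tested up to
  \<open>E\<close>.\<close>

lemma mor_eqI:
  assumes "mor x y L" "mor x y' L'" "\<And>i. i \<le> siz x \<Longrightarrow> E (L ! i) (L' ! i)"
  shows "L = L'"
proof (rule nth_equalityI)
  show "length L = length L'" using mor_len assms by metis
  fix i assume "i < length L"
  then have i: "i \<le> siz x" using mor_len[OF assms(1)] by simp
  show "L ! i = L' ! i"
    using nrm_E[OF mor_wt[OF assms(1) i] mor_distinct[OF assms(1) i] assms(3)[OF i]]
      mor_nrm[OF assms(1) i] mor_nrm[OF assms(2) i] by simp
qed

section \<open>Unit and associativity laws\<close>

lemma cmp_idm_right:
  assumes F: "mor x y F" and x: "x \<in> objs" and I: "mor x x (idm x)" and y: "y \<in> objs"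
  shows "cmp x y F (idm x) = F"
proof (rule nth_equalityI)
  show "length (cmp x y F (idm x)) = length F" using mor_len[OF F] by (simp add: cmp_def)
  fix i assume "i < length (cmp x y F (idm x))"
  then have i: "i \<le> siz x" by (simp add: cmp_def)
  have [simp]: "idm x ! i = unit_op (col x) i" if "i \<le> siz x" for i
    using that by (simp add: idm_def del: upt_Suc)
  have "vert x y F (idm x) i = F ! i"
  proof (cases "i \<in> D")
    case True
    have "subst (unit_op (col x) 0) (star x F) = unit_op (col x) 0"
      using unit_subst[of "(col y)(0 := col x 0)" "col x" 0 "star x F"] obj_cols[OF x, of 0]
      by (simp add: star_def wt_unit')
    moreover have "0 \<in> D" "i = 0" using True lower by auto
    ultimately show ?thesis
      using subst_unit'[OF mor_wt_lower[OF F]] by (auto simp: vert_def unit_op_def)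
  next
    case False
    then show ?thesis using i unit_subst[of "col y" "col x" i "(!) F"] mor_wt_upper[OF F i False] by (auto simp: vert_def)
  qed
  then show "cmp x y F (idm x) ! i = F ! i" using cmp_nth[OF i] mor_nrm[OF F i] by simp
qed

lemma cmp_idm_left:
  assumes F: "mor x y F" and x: "x \<in> objs" and y: "y \<in> objs"
  shows "cmp x y (idm y) F = F"
proof (rule nth_equalityI)
  show "length (cmp x y (idm y) F) = length F" using mor_len[OF F] by (simp add: cmp_def)
  fix i assume "i < length (cmp x y (idm y) F)"
  then have i: "i \<le> siz x" by (simp add: cmp_def)
  have [simp]: "idm y ! i = unit_op (col y) i" if "i \<le> siz y" for i
    using that by (simp add: idm_def del: upt_Suc)
  have "vert x y (idm y) F i = F ! i"
  proof (cases "i \<in> D")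
    case True
    then have D: "0 \<in> D" "i = 0" using lower by auto
    have "subst (F ! 0) (star x (idm y)) = F ! 0"
    proof (rule subst_unit'[OF mor_wt_lower[OF F D(1)]])
      fix w assume "w \<in> set (snd (F ! 0))"
      then have "w \<le> siz y" using mor_label[OF F, of 0] by simp
      then show "star x (idm y) w = unit_op ((col y)(0 := col x 0)) w"
        by (cases "w = 0") (simp_all add: star_def unit_op_def[of _ 0], simp add: unit_op_def)
    qed
    then show ?thesis using D unit_subst[of "(col y)(0 := col x 0)" "col y" 0 "\<lambda>v. if v = 0 then F ! 0 else unit_op (col y) v"]
        mor_wt_lower[OF F D(1)] by (simp add: vert_def cong: if_cong)
  next
    case False
    then show ?thesis
      using mor_label[OF F i] by (auto simp: vert_def intro!: subst_unit'[OF mor_wt_upper[OF F i]])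
  qed
  then show "cmp x y (idm y) F ! i = F ! i" using cmp_nth[OF i] mor_nrm[OF F i] by simp
qed

text \<open>Both sides of associativity expand to the same iterated substitution.\<close>

lemma cmp_assoc:
  assumes F: "mor x y F" and G: "mor y z G" and H: "mor z t H"
    and obj: "x \<in> objs" "y \<in> objs" "z \<in> objs" "t \<in> objs"
    and GF: "mor x z (cmp x z G F)" and HG: "mor y t (cmp y t H G)"
    and l: "mor x t (cmp x t H (cmp x z G F))" "mor x t (cmp x t (cmp y t H G) F)"
  shows "cmp x t H (cmp x z G F) = cmp x t (cmp y t H G) F"
proof (rule mor_eqI[OF l])
  fix i assume i: "i \<le> siz x"
  \<comment> \<open>Each side normalizes its inner composite before substituting it.
    \<open>A\<close> is an iterated substitution to which both sides are related by
    congruence.\<close>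
  have "\<exists>A. E A (vert x t H (cmp x z G F) i) \<and> E A (vert x t (cmp y t H G) F i) \<and> wt (vcol x t i) (vout x t i) A"
  proof (cases "i \<in> D")
    case False
    let ?A = "subst (F ! i) (\<lambda>w. subst (G ! w) ((!) H))"
    note wF = mor_wt_upper[OF F i False] and wG = wt_upper_arg[OF F G i False]
    have wle: "w \<le> siz y" "w \<notin> D" if "w \<in> set (snd (F ! i))" for w
      using mor_label[OF F i that] mor_nz[OF F i False that] by auto
    have wH: "wt (col t) (col z v) (H ! v)" if "w \<in> set (snd (F ! i))" "v \<in> set (snd (G ! w))" for v w
      using wt_upper_arg[OF G H wle[OF that(1)] that(2)] .
    have wGH: "wt (col t) (col y w) (subst (G ! w) ((!) H))" if "w \<in> set (snd (F ! i))" for w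
      by (rule wt_subst[OF wG[OF that] wH[OF that]])
    have "E ?A (subst (F ! i) ((!) (cmp y t H G)))"
    proof (rule E_subst[OF wF wGH E_refl[OF wF]])
      fix w assume "w \<in> set (snd (F ! i))"
      then show "E (subst (G ! w) ((!) H)) (cmp y t H G ! w)"
        using cmp_E[OF G H obj(2,4) wle(1)] wle(2) by (simp add: vert_def)
    qed
    moreover have "E (subst (subst (F ! i) ((!) G)) ((!) H)) (subst (cmp x z G F ! i) ((!) H))"
    proof (rule E_subst[OF wt_subst[OF wF wG]])
      show "E (subst (F ! i) ((!) G)) (cmp x z G F ! i)"
        using cmp_E[OF F G obj(1,3) i] False by (simp add: vert_def)
    qed (use wH in \<open>auto intro: E_refl\<close>)
    moreover have "subst (subst (F ! i) ((!) G)) ((!) H) = ?A"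
      by (rule subst_assoc[OF wF wG wH])
    ultimately show ?thesis
      using False wt_subst[OF wF wGH] by (intro exI[of _ ?A]) (auto simp: vert_def vcol_def vout_def)
  next
    case True
    then have D: "0 \<in> D" and [simp]: "i = 0" using lower by auto
    \<comment> \<open>Three storeys: \<open>H ! 0\<close> at the bottom, \<open>G ! 0\<close> on its
      marked input, \<open>F ! 0\<close> on that of \<open>G ! 0\<close>. The other inputs of
      \<open>F ! 0\<close> carry upper vertices of the composite of \<open>G\<close> and
      \<open>H\<close>, and those of \<open>G ! 0\<close> carry vertices of
      \<open>H\<close>.\<close>
    define F' where "F' = subst (F ! 0) (star x (cmp y t H G))"
    define G' where "G' = subst (G ! 0) (\<lambda>w. if w = 0 then F' else H ! w)"
    define A where "A = subst (H ! 0) (\<lambda>v. if v = 0 then G' else unit_op (col t) v)"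
    note wF = mor_wt_lower[OF F D] and wG = mor_wt_lower[OF G D] and wH = mor_wt_lower[OF H D]
    have wF': "wt ((col t)(0 := col x 0)) (col y 0) F'"
      unfolding F'_def by (rule wt_subst[OF wF wt_star[OF F HG obj(1) D]])
    have wGarg: "wt ((col t)(0 := col x 0)) (((col z)(0 := col y 0)) w) (if w = 0 then F' else H ! w)"
      if "w \<in> set (snd (G ! 0))" for w
    proof (cases "w = 0")
      case False
      note wz = mor_label[OF G le0 that]
      have wD: "w \<notin> D" using False lower by blast
      have "wt ((col t)(0 := col x 0)) (col z w) (H ! w)"
        using mor_nz[OF H wz wD] D by (intro wt_cong[OF mor_wt_upper[OF H wz wD]]) auto
      then show ?thesis using False by simp
    qed (use wF' in simp)
    have wG': "wt ((col t)(0 := col x 0)) (col z 0) G'"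
      unfolding G'_def by (rule wt_subst[OF wG wGarg])
    have wHarg: "wt ((col t)(0 := col x 0)) (((col t)(0 := col z 0)) v) (if v = 0 then G' else unit_op (col t) v)"
      if "v \<in> set (snd (H ! 0))" for v
      using wG' wt_lower_arg[OF G H obj(2,4) D that] obj_cols[OF obj(4) mor_label[OF H le0 that]]
      by (auto intro!: wt_unit')
    have wA: "wt ((col t)(0 := col x 0)) (col t 0) A"
      unfolding A_def by (rule wt_subst[OF wH wHarg])
    have "E A (vert x t H (cmp x z G F) 0)"
    proof -
      define K where "K = vert x z G F 0"
      define FG where "FG = subst (F ! 0) (star x G)"
      have K: "K = subst (G ! 0) (\<lambda>w. if w = 0 then FG else unit_op (col z) w)"
        using D unfolding K_def FG_def vert_def by simp
      have wK: "wt ((col z)(0 := col x 0)) (col z 0) K" and EK: "E K (cmp x z G F ! 0)"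
        using wt_vert[OF F G obj(1,3), of 0] cmp_E[OF F G obj(1,3), of 0] D
        by (simp_all add: K_def vcol_def vout_def)
      have sH: "wt ((col t)(0 := col x 0)) (((col z)(0 := col x 0)) v) (star x H v)" if "v \<in> set (snd K)" for v
        using wt_star[OF GF H obj(1) D] that mset_eq_setD[OF E_mset[OF wK EK]] by blast
      have arg: "wt ((col z)(0 := col x 0)) (((col z)(0 := col y 0)) w) (if w = 0 then FG else unit_op (col z) w)"
        if "w \<in> set (snd (G ! 0))" for w
        unfolding FG_def using wt_lower_arg[OF F G obj(1,3) D that] .
      have wFG: "wt ((col z)(0 := col x 0)) (col y 0) FG"
        using arg[of 0] mor_0[OF G D] by simp
      have "set (snd K) = (\<Union>w\<in>set (snd (G ! 0)). if w = 0 then set (snd FG) else {w})"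
        unfolding K by (auto split: if_splits)
      then have sub: "set (snd FG) \<subseteq> set (snd K)"
        "\<And>w. w \<in> set (snd (G ! 0)) \<Longrightarrow> w \<noteq> 0 \<Longrightarrow> w \<in> set (snd K)"
        using mor_0[OF G D] by auto
      have K1: "subst K (star x H) = subst (G ! 0) (\<lambda>w. if w = 0 then subst FG (star x H) else H ! w)"
      proof -
        have "subst K (star x H) = subst (G ! 0) (\<lambda>w. subst (if w = 0 then FG else unit_op (col z) w) (star x H))"
          unfolding K
        proof (rule subst_assoc[OF wG arg])
          fix w v assume "w \<in> set (snd (G ! 0))" "v \<in> set (snd (if w = 0 then FG else unit_op (col z) w))"
          then have "v \<in> set (snd K)" using sub by (auto split: if_splits)
          then show "wt ((col t)(0 := col x 0)) (((col z)(0 := col x 0)) v) (star x H v)" by (rule sH)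
        qed
        also have "\<dots> = subst (G ! 0) (\<lambda>w. if w = 0 then subst FG (star x H) else H ! w)"
        proof (rule subst_cong)
          fix w assume w: "w \<in> set (snd (G ! 0))"
          show "subst (if w = 0 then FG else unit_op (col z) w) (star x H) =
            (if w = 0 then subst FG (star x H) else H ! w)"
            using unit_subst[of "(col t)(0 := col x 0)" "col z" w "star x H"] sH[OF sub(2)[OF w]]
            by (auto simp: star_def)
        qed
        finally show ?thesis .
      qed
      have EF: "E F' (subst FG (star x H))"
      proof -
        have "subst FG (star x H) = subst (F ! 0) (\<lambda>u. subst (star x G u) (star x H))"
          unfolding FG_def
        proof (rule subst_assoc[OF wF wt_star[OF F G obj(1) D]])
          fix w v assume "w \<in> set (snd (F ! 0))" "v \<in> set (snd (star x G w))"
          then have "v \<in> set (snd K)" using sub(1) by (auto simp: FG_def)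
          then show "wt ((col t)(0 := col x 0)) (((col z)(0 := col x 0)) v) (star x H v)" by (rule sH)
        qed
        moreover have "E F' (subst (F ! 0) (\<lambda>u. subst (star x G u) (star x H)))"
          unfolding F'_def
        proof (rule E_subst[OF wF wt_star[OF F HG obj(1) D] E_refl[OF wF]])
          fix u assume u: "u \<in> set (snd (F ! 0))"
          note uy = mor_label[OF F le0 u]
          show "E (star x (cmp y t H G) u) (subst (star x G u) (star x H))"
          proof (cases "u = 0")
            case True
            have "wt (col x) (col x 0) (unit_op (col x) 0)"
              using obj_cols[OF obj(1) le0] by (rule wt_unit)
            moreover have "subst (unit_op (col x) 0) (star x H) = unit_op (col x) 0"
              using unit_subst[of "col x" "col x" 0 "star x H"] calculation by (simp add: star_def)
            ultimately show ?thesis using True E_refl by (simp add: star_def)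
          next
            case False
            then have uD: "u \<notin> D" using lower by blast
            have "subst (G ! u) (star x H) = subst (G ! u) ((!) H)"
              using mor_nz[OF G uy uD] D by (intro subst_cong) (auto simp: star_def)
            moreover have "E (subst (G ! u) ((!) H)) (cmp y t H G ! u)"
              using cmp_E[OF G H obj(2,4) uy] uD by (simp add: vert_def)
            moreover have "wt (col t) (col y u) (subst (G ! u) ((!) H))"
              using wt_vert[OF G H obj(2,4) uy] uD by (simp add: vert_def vcol_def vout_def)
            ultimately show ?thesis using False by (auto simp: star_def intro: E_sym)
          qed
        qed
        ultimately show ?thesis by simp
      qed
      have "E G' (subst K (star x H))"
        unfolding G'_def K1 
      proof (rule E_subst[OF wG wGarg E_refl[OF wG]])
        fix w assume "w \<in> set (snd (G ! 0))"
        then show "E (if w = 0 then F' else H ! w) (if w = 0 then subst FG (star x H) else H ! w)"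
          using EF E_refl[OF wGarg, of w] by (cases "w = 0") auto
      qed
      moreover have "E (subst K (star x H)) (subst (cmp x z G F ! 0) (star x H))"
        using sH by (intro E_subst[OF wK sH EK]) (auto intro: E_refl)
      ultimately have EG: "E G' (subst (cmp x z G F ! 0) (star x H))"
        using E_trans[OF wG'] by blast
      have "vert x t H (cmp x z G F) 0 =
        subst (H ! 0) (\<lambda>v. if v = 0 then subst (cmp x z G F ! 0) (star x H) else unit_op (col t) v)"
        using D by (simp add: vert_def)
      also have "E A \<dots>"
        unfolding A_def
      proof (rule E_subst[OF wH wHarg E_refl[OF wH]])
        fix v assume "v \<in> set (snd (H ! 0))"
        then show "E (if v = 0 then G' else unit_op (col t) v)
          (if v = 0 then subst (cmp x z G F ! 0) (star x H) else unit_op (col t) v)"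
          using EG E_refl[OF wHarg, of v] by (cases "v = 0") auto
      qed
      finally show ?thesis .
    qed
    moreover have "E A (vert x t (cmp y t H G) F 0)"
    proof -
      define K R where "K = vert y t H G 0" and "R v = (if v = 0 then F' else unit_op (col t) v)" for v
      define GH where "GH = subst (G ! 0) (star y H)"
      have K: "K = subst (H ! 0) (\<lambda>v. if v = 0 then GH else unit_op (col t) v)"
        using D unfolding K_def GH_def vert_def by simp
      have wK: "wt ((col t)(0 := col y 0)) (col t 0) K" and EK: "E K (cmp y t H G ! 0)"
        using wt_vert[OF G H obj(2,4), of 0] cmp_E[OF G H obj(2,4), of 0] D
        by (simp_all add: K_def vcol_def vout_def)
      have wR: "wt ((col t)(0 := col x 0)) (((col t)(0 := col y 0)) v) (R v)" if "v \<in> set (snd K)" for v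
        using wt_lower_arg[OF F HG obj(1,4) D] that mset_eq_setD[OF E_mset[OF wK EK]]
        unfolding R_def F'_def by blast
      have "set (snd K) = (\<Union>v\<in>set (snd (H ! 0)). if v = 0 then set (snd GH) else {v})"
        unfolding K by (auto split: if_splits)
      then have sub: "set (snd GH) \<subseteq> set (snd K)"
        "\<And>v. v \<in> set (snd (H ! 0)) \<Longrightarrow> v \<noteq> 0 \<Longrightarrow> v \<in> set (snd K)"
        using mor_0[OF H D] by auto
      have "subst K R = subst (H ! 0) (\<lambda>v. subst (if v = 0 then GH else unit_op (col t) v) R)"
        unfolding K GH_def
      proof (rule subst_assoc[OF wH wt_lower_arg[OF G H obj(2,4) D]])
        fix v u assume "v \<in> set (snd (H ! 0))"
          "u \<in> set (snd (if v = 0 then subst (G ! 0) (star y H) else unit_op (col t) v))"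
        then have "u \<in> set (snd K)" using sub unfolding GH_def by (auto simp del: snd_subst split: if_splits)
        then show "wt ((col t)(0 := col x 0)) (((col t)(0 := col y 0)) u) (R u)" by (rule wR)
      qed
      also have "\<dots> = A"
        unfolding A_def
      proof (rule subst_cong)
        fix v assume v: "v \<in> set (snd (H ! 0))"
        show "subst (if v = 0 then GH else unit_op (col t) v) R =
          (if v = 0 then G' else unit_op (col t) v)"
        proof (cases "v = 0")
          case False
          then show ?thesis
            using unit_subst[of "(col t)(0 := col x 0)" "col t" v R] wR[OF sub(2)[OF v]] by (auto simp: R_def)
        next
          case True
          have "subst GH R = subst (G ! 0) (\<lambda>w. subst (star y H w) R)"
            unfolding GH_def
          proof (rule subst_assoc[OF wG wt_star[OF G H obj(2) D]])
            fix w u assume "w \<in> set (snd (G ! 0))" "u \<in> set (snd (star y H w))"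
            then have "u \<in> set (snd K)" using sub(1) by (auto simp: GH_def)
            then show "wt ((col t)(0 := col x 0)) (((col t)(0 := col y 0)) u) (R u)" by (rule wR)
          qed
          also have "\<dots> = G'"
            unfolding G'_def
          proof (rule subst_cong)
            fix w assume w: "w \<in> set (snd (G ! 0))"
            show "subst (star y H w) R = (if w = 0 then F' else H ! w)"
            proof (cases "w = 0")
              case True
              then show ?thesis
                using unit_subst[of "(col t)(0 := col x 0)" "col y" 0 R] wF' by (simp add: star_def R_def)
            next
              case False
              note wz = mor_label[OF G le0 w]
              have "w \<notin> D" using False lower by blast
              then have "subst (H ! w) R = H ! w"
                using mor_nz[OF H wz] D
                by (intro subst_unit'[OF mor_wt_upper[OF H wz]]) (auto simp: R_def)
              then show ?thesis using False by (simp add: star_def)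
            qed
          qed
          finally show ?thesis using True by simp
        qed
      qed
      finally have KA: "subst K R = A" .
      have "vert x t (cmp y t H G) F 0 = subst (cmp y t H G ! 0) R"
        using D unfolding vert_def R_def F'_def by simp
      moreover have "E (subst K R) (subst (cmp y t H G ! 0) R)"
        using wR by (intro E_subst[OF wK wR EK]) (auto intro: E_refl)
      ultimately show ?thesis using KA by simp
    qed
    ultimately show ?thesis using wA D by (intro exI[of _ A]) (simp add: vcol_def vout_def)
  qed
  then obtain A where A: "E A (vert x t H (cmp x z G F) i)" "E A (vert x t (cmp y t H G) F i)"
    "wt (vcol x t i) (vout x t i) A" by blast
  note 1 = cmp_E[OF GF H obj(1,4) i] and 2 = cmp_E[OF F HG obj(1,4) i]
  show "E (cmp x t H (cmp x z G F) ! i) (cmp x t (cmp y t H G) F ! i)"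
    using E_trans[OF E_wt[OF A(3)] E_sym[OF A(3)] E_trans[OF A(3) A(2) 2]] E_trans[OF A(3) A(1) 1]
    by (meson A(3) E_sym E_trans E_wt)
qed

end

section \<open>Factorizations and isomorphisms of families\<close>

context planar_operad
begin

definition inv_op :: "'o \<Rightarrow> 'o \<Rightarrow> bool" where
  "inv_op q r \<longleftrightarrow> q \<in> Ops P \<and> r \<in> Ops P \<and> ins P q = [out P r] \<and> ins P r = [out P q] \<and>
     plug P q [r] = ident P (out P q) \<and> plug P r [q] = ident P (out P r)"

definition invertible :: "'o \<Rightarrow> bool" where
  "invertible q \<longleftrightarrow> (\<exists>r. inv_op q r)"

lemma inv_op_sym: "inv_op q r \<Longrightarrow> inv_op r q"
  by (auto simp: inv_op_def)

lemma inv_op_ident: "c \<in> Cols P \<Longrightarrow> inv_op (ident P c) (ident P c)"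
  using ident[of c] unit[of "ident P c"] by (auto simp: inv_op_def)

lemma plug_plug1:
  assumes "p \<in> Ops P" "q \<in> Ops P" "r \<in> Ops P" "ins P p = [out P q]" "ins P q = [out P r]"
  shows "plug P (plug P p [q]) [r] = plug P p [plug P q [r]]"
  using assoc[of p "[q]" "[[r]]"] assms by (auto simp: composable_def)

lemma inv_op_plug:
  assumes q: "inv_op q q'" and r: "inv_op r r'" and e: "ins P q = [out P r]"
  shows "inv_op (plug P q [r]) (plug P r' [q'])"
proof -
  note d = q[unfolded inv_op_def] r[unfolded inv_op_def]
  have o: "out P r = out P q'" using e d by simp
  have c: "composable P q [r]" "composable P r' [q']" using d e by (auto simp: composable_def)
  note p = plug[OF c(1)] plug[OF c(2)]
  have "plug P (plug P q [r]) [plug P r' [q']] = plug P q [plug P r [plug P r' [q']]]"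
    using p d e by (intro plug_plug1) auto
  also have "plug P r [plug P r' [q']] = plug P (plug P r [r']) [q']"
    using d o by (intro plug_plug1[symmetric]) auto
  also have "\<dots> = q'" using d o unit[of q'] by simp
  finally have 1: "plug P (plug P q [r]) [plug P r' [q']] = ident P (out P q)" using d by simp
  have "plug P (plug P r' [q']) [plug P q [r]] = plug P r' [plug P q' [plug P q [r]]]"
    using p d e by (intro plug_plug1) auto
  also have "plug P q' [plug P q [r]] = plug P (plug P q' [q]) [r]"
    using d o e by (intro plug_plug1[symmetric]) auto
  also have "\<dots> = r" using d o unit[of r] by simp
  finally show ?thesis using 1 p d by (auto simp: inv_op_def)
qed

end

text \<open>Indices satisfying \<open>Q\<close> are renumbered by the count of such indices before
  them; this numbers the legs that survive in the left factor of a factorization.\<close>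

lemma concat_rank_filter:
  "concat (map (\<lambda>i. if Q i then [length (filter Q [0..<i])] else []) [0..<n]) = [0..<length (filter Q [0..<n])]"
  by (induction n) auto

lemma filter_nth_rank:
  "i < n \<Longrightarrow> Q i \<Longrightarrow> filter Q [0..<n] ! length (filter Q [0..<i]) = i \<and>
    length (filter Q [0..<i]) < length (filter Q [0..<n])"
proof (induction n)
  case (Suc n)
  show ?case
  proof (cases "i < n")
    case True
    then show ?thesis using Suc by (auto simp: nth_append)
  next
    case False
    then show ?thesis using Suc.prems by (auto simp: nth_append less_Suc_eq)
  qed
qed simp

text \<open>Closure properties of layouts, with content only in the planar case: under composition,
  for labels in their natural order (identities and left factors), under regrouping of the same
  labels (right factors), and under inversion of a permutation of legs.\<close>

locale family_category = labelled_families P E nrm \<psi> D objs siz col lay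
  for P :: "('c, 'o, 'z) operad_scheme" and E nrm \<psi> D
    and objs :: "'a set" and siz col lay +
  assumes lay_cmp: "x \<in> objs \<Longrightarrow> y \<in> objs \<Longrightarrow> z \<in> objs \<Longrightarrow> mor x y F \<Longrightarrow> mor y z G \<Longrightarrow>
      lay (map snd (cmp x z G F))"
    and lay_triv: "concat ls = [0..<Suc m] \<Longrightarrow> ls \<noteq> [] \<Longrightarrow> (0 \<in> D \<Longrightarrow> hd ls = [0]) \<Longrightarrow> lay ls"
    and lay_cong: "lay ls \<Longrightarrow> ls \<noteq> [] \<Longrightarrow> ls' \<noteq> [] \<Longrightarrow> (0 \<in> D \<Longrightarrow> hd ls = hd ls') \<Longrightarrow> concat ls = concat ls' \<Longrightarrow> lay ls'"
    and lay_inv: "lay (map (\<lambda>i. [\<pi> i]) [0..<Suc n]) \<Longrightarrow> bij_betw \<pi> {..n} {..n} \<Longrightarrow> (0 \<in> D \<Longrightarrow> \<pi> 0 = 0) \<Longrightarrow>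
      (\<And>i. i \<le> n \<Longrightarrow> \<rho> (\<pi> i) = i) \<Longrightarrow> lay (map (\<lambda>i. [\<rho> i]) [0..<Suc n])"
begin

section \<open>Composition and targets of families\<close>

lemma comp_mor:
  "x \<in> objs \<Longrightarrow> y \<in> objs \<Longrightarrow> z \<in> objs \<Longrightarrow> mor x y F \<Longrightarrow> mor y z G \<Longrightarrow> mor x z (cmp x z G F)"
  using cmp_mor lay_cmp by blast

lemma comp_assoc:
  assumes "x \<in> objs" "y \<in> objs" "z \<in> objs" "t \<in> objs" "mor x y F" "mor y z G" "mor z t H"
  shows "cmp x t H (cmp x z G F) = cmp x t (cmp y t H G) F"
  using assms by (intro cmp_assoc[of x y F z G t H]) (auto intro: comp_mor)

lemma nrm_short: "wt \<kappa> c X \<Longrightarrow> length (snd X) \<le> 1 \<Longrightarrow> nrm X = X"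
  by (rule nrm_sorted) (auto simp: le_Suc_eq length_Suc_conv)

lemma idm_mor:
  assumes x: "x \<in> objs" shows "mor x x (idm x)"
proof -
  have [simp]: "idm x ! i = unit_op (col x) i" if "i \<le> siz x" for i
    using that by (simp add: idm_def del: upt_Suc)
  have wt: "wt (col x) (col x i) (unit_op (col x) i)" if "i \<le> siz x" for i
    using obj_cols[OF x that] by (rule wt_unit)
  have c: "concat (map snd (idm x)) = [0..<Suc (siz x)]"
    unfolding idm_def by (simp add: comp_def del: upt_Suc)
  have "lay (map snd (idm x))"
    by (rule lay_triv[OF c]) (simp_all add: idm_def hd_map upt_rec del: upt_Suc)
  then show ?thesis unfolding mor_def c
    using wt nrm_short[OF wt] lower by (auto simp: vcol_def vout_def idm_def simp del: upt_Suc)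
qed

text \<open>Every leg of the target is a label of some vertex, or the output of the lower one, and
  the operation there fixes its colour. So the target is a function of the source and the
  tuple.\<close>

lemma target_unique:
  assumes F: "mor x y F" and F': "mor x y' F" and y: "y \<in> objs" "y' \<in> objs"
  shows "y = y'"
proof -
  have "length (concat (map snd F)) = Suc (siz y)" "length (concat (map snd F)) = Suc (siz y')"
    using mset_eq_length[OF mor_mset[OF F]] mset_eq_length[OF mor_mset[OF F']] by simp_all
  then have s: "siz y = siz y'" by simp
  have "col y w = col y' w" if wy: "w \<le> siz y'" for w
  proof (cases "w \<in> D")
    case True
    then have "w = 0" "0 \<in> D" using lower by auto
    then show ?thesis using mor_wt_lower[OF F] mor_wt_lower[OF F'] wt_out_unique by blast
  next
    case False
    have "w \<le> siz y" using wy s by simp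
    then obtain i where i: "i \<le> siz x" "w \<in> set (snd (F ! i))" by (rule mor_label_exists[OF F])
    show ?thesis
    proof (cases "i \<in> D \<and> w = 0")
      case True
      then show ?thesis using False lower by blast
    next
      case c: False
      then have "vcol x y i w = col y w" "vcol x y' i w = col y' w" by (auto simp: vcol_def)
      then show ?thesis using wt_ins_unique[OF mor_wt[OF F i(1)] mor_wt[OF F' i(1)] i(2)] by simp
    qed
  qed
  then show ?thesis using obj_unique[OF y s] by blast
qed

subsection \<open>Gradings of composites\<close>

lemma grading_unit: "x \<in> objs \<Longrightarrow> i \<le> siz x \<Longrightarrow> \<psi> (ident P (col x i)) = 0"
  using grading obj_cols by (simp add: planar_grading_def)

lemma grading_upper:
  assumes obj: "x \<in> objs" "z \<in> objs" and F: "mor x y F" and G: "mor y z G" and i: "i \<le> siz x" "i \<notin> D"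
  shows "\<psi> (fst (cmp x z G F ! i)) = \<psi> (fst (F ! i)) + (\<Sum>w\<leftarrow>snd (F ! i). \<psi> (fst (G ! w)))"
proof -
  have "\<psi> (fst (cmp x z G F ! i)) = \<psi> (fst (vert x z G F i))"
    using E_grading[OF wt_vert cmp_E] F G obj i by blast
  then show ?thesis
    using grading_subst[OF grading mor_wt_upper[OF F i] wt_upper_arg[OF F G i]] i(2) by (simp add: vert_def)
qed

lemma grading_lower:
  assumes obj: "x \<in> objs" "y \<in> objs" "z \<in> objs" and F: "mor x y F" and G: "mor y z G" and D: "0 \<in> D"
  shows "\<psi> (fst (cmp x z G F ! 0)) = \<psi> (fst (G ! 0)) + \<psi> (fst (F ! 0)) +
    (\<Sum>w\<leftarrow>snd (F ! 0). if w = 0 then 0 else \<psi> (fst (G ! w)))"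
proof -
  let ?S = "\<Sum>w\<leftarrow>snd (F ! 0). \<psi> (fst (star x G w))"
  have S: "?S = (\<Sum>w\<leftarrow>snd (F ! 0). if w = 0 then 0 else \<psi> (fst (G ! w)))"
    using grading_unit[OF obj(1), of 0] by (intro arg_cong[where f = sum_list] map_cong) (auto simp: star_def)
  have "\<psi> (fst (cmp x z G F ! 0)) = \<psi> (fst (vert x z G F 0))"
    using E_grading[OF wt_vert cmp_E] F G obj by blast
  also have "\<dots> = \<psi> (fst (G ! 0)) +
      (\<Sum>v\<leftarrow>snd (G ! 0). \<psi> (fst (if v = 0 then subst (F ! 0) (star x G) else unit_op (col z) v)))"
    using D grading_subst[OF grading mor_wt_lower[OF G D] wt_lower_arg[OF F G obj(1,3) D]] by (simp add: vert_def)
  also have "(\<Sum>v\<leftarrow>snd (G ! 0). \<psi> (fst (if v = 0 then subst (F ! 0) (star x G) else unit_op (col z) v))) =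
      (\<Sum>v\<leftarrow>snd (G ! 0). if v = 0 then \<psi> (fst (F ! 0)) + ?S else 0)"
    using grading_subst[OF grading mor_wt_lower[OF F D] wt_star[OF F G obj(1) D]]
      grading_unit[OF obj(3)] mor_label[OF G, of 0]
    by (intro arg_cong[where f = sum_list] map_cong) auto
  also have "\<dots> = \<psi> (fst (F ! 0)) + ?S"
  proof -
    obtain l r where g: "snd (G ! 0) = l @ 0 # r" "0 \<notin> set l" "0 \<notin> set r" by (rule mor_split[OF G D])
    have "(\<Sum>v\<leftarrow>xs. if v = 0 then c else (0::int)) = 0" if "0 \<notin> set xs" for xs :: "nat list" and c
      using that by (induction xs) auto
    then show ?thesis using g by simp
  qed
  finally show ?thesis using S by simp
qed

definition nonneg :: "('o \<times> nat list) list \<Rightarrow> bool" where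
  "nonneg L \<longleftrightarrow> (\<forall>X\<in>set L. 0 \<le> \<psi> (fst X))"

lemma nonneg_nth: "mor x y L \<Longrightarrow> nonneg L \<longleftrightarrow> (\<forall>i\<le>siz x. 0 \<le> \<psi> (fst (L ! i)))"
  using mor_len[of x y L] unfolding nonneg_def by (simp add: all_set_conv_all_nth less_Suc_eq_le)

lemma nonneg_cmp:
  assumes obj: "x \<in> objs" "y \<in> objs" "z \<in> objs" and F: "mor x y F" and G: "mor y z G"
    and p: "nonneg F" "nonneg G"
  shows "nonneg (cmp x z G F)"
  unfolding nonneg_nth[OF comp_mor[OF obj F G]]
proof (intro allI impI)
  fix i assume i: "i \<le> siz x"
  note pF = p(1)[unfolded nonneg_nth[OF F], rule_format] and pG = p(2)[unfolded nonneg_nth[OF G], rule_format]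
  have *: "w \<in> set (snd (F ! i)) \<Longrightarrow> 0 \<le> \<psi> (fst (G ! w))" for w
    using pG mor_label[OF F i] by blast
  show "0 \<le> \<psi> (fst (cmp x z G F ! i))"
  proof (cases "i \<in> D")
    case False
    then show ?thesis
      using grading_upper[OF obj(1,3) F G i] pF[OF i] * by (auto intro!: add_nonneg_nonneg sum_list_nonneg)
  next
    case True
    then have "0 \<in> D" "i = 0" using lower by auto
    then show ?thesis
      using grading_lower[OF obj F G] pF[OF i] pG[of 0] *
      by (auto intro!: add_nonneg_nonneg sum_list_nonneg)
  qed
qed

text \<open>Both operations are unary, hence not of grading -1, so their gradings are nonnegative
  with sum 0.\<close>

lemma inv_op_grading: "inv_op q r \<Longrightarrow> \<psi> q = 0"
proof -
  assume i: "inv_op q r"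
  note d = i[unfolded inv_op_def]
  have "\<psi> q \<noteq> -1" "\<psi> r \<noteq> -1" using grading_minus1[of q] grading_minus1[of r] d by (auto simp: arity_def)
  then have "0 \<le> \<psi> q" "0 \<le> \<psi> r" using grading_ge[of q] grading_ge[of r] d by auto
  moreover have "\<psi> (plug P q [r]) = \<psi> q + \<psi> r"
    using grading_plug[OF grading, of q "[r]"] d by (simp add: composable_def)
  moreover have "\<psi> (plug P q [r]) = 0"
    using d grading colours[of q] by (simp add: planar_grading_def)
  ultimately show "\<psi> q = 0" by simp
qed

lemma mor_nullary: "mor x y L \<Longrightarrow> i \<le> siz x \<Longrightarrow> \<psi> (fst (L ! i)) = -1 \<Longrightarrow> snd (L ! i) = []"
  using mor_wt[of x y L i] wt_arity grading_minus1[of "fst (L ! i)"] by (auto simp: wt_def)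

lemma mor_Ops: "mor x y L \<Longrightarrow> i \<le> siz x \<Longrightarrow> fst (L ! i) \<in> Ops P"
  using mor_wt[of x y L i] by (auto simp: wt_def)

subsection \<open>The left class\<close>

text \<open>The list of vertices starts with the lower one, although its leaves come last in the
  planar order of the symmetric case. This does no harm: the lower vertex of such a morphism is an
  identity, and its only label is the marked one.\<close>

definition elementary :: "'a \<Rightarrow> ('o \<times> nat list) list \<Rightarrow> bool" where
  "elementary y L \<longleftrightarrow> concat (map snd L) = [0..<Suc (siz y)] \<and>
     (\<forall>X\<in>set L. fst X \<in> ident P ` Cols P \<or> \<psi> (fst X) = -1)"

text \<open>The lower vertex carries the marked label, so it is never nullary, and it must be an
  identity.\<close>

lemma elementary_vertex:
  assumes L: "mor x y L" and e: "elementary y L" and i: "i \<le> siz x"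
  obtains (minus) "\<psi> (fst (L ! i)) = -1" "snd (L ! i) = []" "i \<notin> D"
  | (unit) w where "L ! i = (ident P (col x i), [w])" "w \<le> siz y" "col y w = col x i" "i \<in> D \<Longrightarrow> w = 0"
proof (cases "\<psi> (fst (L ! i)) = -1")
  case True
  moreover have "i \<notin> D" using mor_nullary[OF L i True] mor_0[OF L] lower[of i] by auto
  ultimately show ?thesis using mor_nullary[OF L i] minus by blast
next
  case False
  then obtain c where c: "c \<in> Cols P" "fst (L ! i) = ident P c"
  proof -
    have "L ! i \<in> set L" using mor_len[OF L] i by simp
    then show ?thesis using e False that unfolding elementary_def by blast
  qed
  note w = mor_wt[OF L i, unfolded wt_def c(2)] and id = ident[OF c(1)]
  then obtain w where s: "snd (L ! i) = [w]" by auto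
  have wy: "w \<le> siz y" using mor_label[OF L i, of w] s by simp
  have w0: "w = 0" if "i \<in> D" using mor_0[OF L] s that lower[OF that] by auto
  have "col x i = c \<and> col y w = c"
  proof (cases "i \<in> D")
    case True
    then show ?thesis using w id s w0 lower[OF True] by (auto simp: vcol_def vout_def)
  next
    case False
    then show ?thesis using w id s by (auto simp: vcol_def vout_def)
  qed
  then show ?thesis using unit[of w] wy w0 s c(2) by (cases "L ! i") auto
qed

lemma elementary_unit:
  assumes "mor x y L" "elementary y L" "i \<le> siz x" and u: "L ! i = (ident P (col x i), [w])"
  shows "col y w = col x i" "i \<in> D \<Longrightarrow> w = 0"
  using assms(1-3) by (cases rule: elementary_vertex; use u in simp)+

text \<open>Identities disappear under substitution, so composing with an elementary family merely
  re-indexes the vertices of \<open>G\<close>.\<close>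

lemma elementary_cmp_unit:
  assumes obj: "x \<in> objs" "z \<in> objs" "y \<in> objs" and L: "mor x z L" and e: "elementary z L" and G: "mor z y G"
    and i: "i \<le> siz x" and u: "L ! i = (ident P (col x i), [w])"
  shows "cmp x y G L ! i = G ! w"
proof -
  have w: "w \<le> siz z" using mor_label[OF L i] u by simp
  have "vert x y G L i = G ! w"
  proof (cases "i \<in> D")
    case False
    have "w \<notin> D" using mor_nz[OF L i False] u by simp
    moreover have "col z w = col x i" using elementary_unit(1)[OF L e i u] .
    ultimately have "wt (col y) (col x i) (G ! w)" using mor_wt_upper[OF G w] by simp
    then show ?thesis
      using unit_subst[of "col y" "\<lambda>_. col x i" w "(!) G"] False u by (simp add: vert_def unit_op_def)
  next
    case True
    then have D: "0 \<in> D" and i0: "i = 0" using lower by auto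
    have w0: "w = 0" "col z 0 = col x 0"
      using elementary_unit[OF L e i u] True i0 by auto
    have "subst (L ! 0) (star x G) = unit_op (col x) 0"
      using unit_subst[of "col x" "col x" 0 "star x G"] wt_unit[of "col x" 0] obj_cols[OF obj(1), of 0] u i0 w0
      by (simp add: star_def unit_op_def)
    then have "vert x y G L 0 = subst (G ! 0) (\<lambda>v. if v = 0 then unit_op (col x) 0 else unit_op (col y) v)"
      using D unfolding vert_def by (simp cong: if_cong)
    also have "\<dots> = G ! 0"
      by (rule subst_unit'[OF mor_wt_lower[OF G D]]) (auto simp: unit_op_def w0)
    finally show ?thesis using i0 w0 by simp
  qed
  then show ?thesis using cmp_nth[OF i] mor_nrm[OF G w] by simp
qed

lemma cmp_nullary:
  assumes L: "mor x z L" and i: "i \<le> siz x" "snd (L ! i) = []"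
  shows "cmp x y G L ! i = L ! i"
proof -
  have "i \<notin> D" using mor_0[OF L] i lower[of i] by auto
  then have "vert x y G L i = L ! i" using nullary_subst[OF mor_wt[OF L i(1)] i(2)] by (simp add: vert_def)
  then show ?thesis using cmp_nth[OF i(1)] mor_nrm[OF L i(1)] by simp
qed

text \<open>Each leg of \<open>z\<close> is the label of an identity in \<open>L\<close>, hence
  every vertex of \<open>G\<close> can be read off the composite. The uniqueness of factorizations
  and the last Reedy axiom come from here.\<close>

lemma elementary_epi:
  assumes obj: "x \<in> objs" "z \<in> objs" "y \<in> objs" and L: "mor x z L" and e: "elementary z L"
    and G: "mor z y G" "mor z y G'" and eq: "cmp x y G L = cmp x y G' L"
  shows "G = G'"
proof (rule nth_equalityI)
  show "length G = length G'" using mor_len G by metis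
  fix w assume "w < length G"
  then have "w \<le> siz z" using mor_len[OF G(1)] by simp
  then obtain i where i: "i \<le> siz x" "w \<in> set (snd (L ! i))" using mor_label_exists[OF L] by metis
  from L e i(1) have "L ! i = (ident P (col x i), [w])"
    by (cases rule: elementary_vertex) (use i(2) in auto)
  then show "G ! w = G' ! w"
    using elementary_cmp_unit[OF obj L e G(1) i(1)] elementary_cmp_unit[OF obj L e G(2) i(1)] eq by metis
qed

text \<open>\<open>ks\<close> lists the vertices that are not of grading -1, and the legs of
  \<open>z\<close> are the legs of \<open>x\<close> under them. \<open>L\<close> has identities at
  \<open>ks\<close> and keeps the other vertices of \<open>F\<close>; \<open>R\<close> consists of
  the vertices at \<open>ks\<close>.\<close>

lemma factorization_exists:
  assumes obj: "x \<in> objs" "y \<in> objs" and F: "mor x y F"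
  shows "\<exists>z\<in>objs. \<exists>L R. mor x z L \<and> elementary z L \<and> mor z y R \<and> nonneg R \<and> set R \<subseteq> set F \<and> cmp x y R L = F"
proof -
  define n where "n = Suc (siz x)"
  define Q where "Q i \<longleftrightarrow> \<psi> (fst (F ! i)) \<noteq> -1" for i
  define ks where "ks = filter Q [0..<n]"
  define rk where "rk i = length (filter Q [0..<i])" for i
  have lenF: "length F = n" using mor_len[OF F] by (simp add: n_def)
  have empty: "snd (F ! i) = []" "i \<notin> D" if "i < n" "\<not> Q i" for i
    using mor_nullary[OF F, of i] that mor_0[OF F] lower[of i] unfolding Q_def n_def by auto
  \<comment> \<open>The vertex carrying the label 0 survives, so \<open>ks\<close> is not empty. An
    object has the leg 0 in any case, whence the length minus 1 for \<open>siz z\<close>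
    below.\<close>
  obtain i0 where "i0 \<le> siz x" "0 \<in> set (snd (F ! i0))" using mor_label_exists[OF F le0] .
  moreover have "Q i0" using calculation empty(1)[of i0] unfolding n_def by force
  ultimately have "i0 \<in> set ks" by (simp add: ks_def n_def del: upt_Suc)
  then have ks: "length ks > 0" by (cases ks) auto
  \<comment> \<open>The lower vertex has an input, so it survives and is vertex 0 of
    \<open>R\<close> again.\<close>
  have D0: "ks ! 0 = 0 \<and> Q 0" if "0 \<in> D"
  proof -
    have "Q 0" using empty(2)[of 0] that by (auto simp: n_def)
    moreover have "[0..<n] = 0 # [1..<n]" using upt_conv_Cons[of 0 n] by (simp add: n_def del: upt_Suc)
    ultimately show ?thesis by (simp add: ks_def)
  qed
  have ksn: "ks ! w < n" "Q (ks ! w)" if "w < length ks" for w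
    using nth_mem[OF that] by (auto simp: ks_def)
  have colk: "col x (ks ! w) \<in> Cols P" if "w < length ks" for w
    using ksn[OF that] obj_cols[OF obj(1)] by (simp add: n_def)
  obtain z where z: "z \<in> objs" "siz z = length ks - 1" "\<forall>w\<le>length ks - 1. col z w = col x (ks ! w)"
    using obj_exists[of "length ks - 1" "\<lambda>w. col x (ks ! w)"] colk ks
    by (metis One_nat_def Suc_pred le_imp_less_Suc)
  have sz: "Suc (siz z) = length ks" using z ks by simp
  have colz: "col z w = col x (ks ! w)" if "w < length ks" for w using z that by simp
  define L where "L = map (\<lambda>i. if Q i then (ident P (col x i), [rk i]) else F ! i) [0..<n]"
  define R where "R = map ((!) F) ks"
  have rk: "ks ! rk i = i" "rk i < length ks" if "i < n" "Q i" for i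
    using filter_nth_rank[of i n Q] that by (simp_all add: ks_def rk_def)
  have L_nth: "L ! i = (if Q i then (ident P (col x i), [rk i]) else F ! i)" if "i < n" for i
    using that by (simp add: L_def)
  have rk0: "rk 0 = 0" by (simp add: rk_def)
  have Llab: "map snd L = map (\<lambda>i. if Q i then [rk i] else []) [0..<n]"
    using empty by (simp add: L_def)
  have Lc: "concat (map snd L) = [0..<Suc (siz z)]"
    unfolding Llab sz rk_def ks_def by (rule concat_rank_filter)
  have Lmor: "mor x z L"
    unfolding mor_def
  proof (intro conjI allI impI)
    fix i assume "i \<le> siz x"
    then have i: "i < n" by (simp add: n_def)
    show wtL: "wt (vcol x z i) (vout x z i) (L ! i)"
    proof (cases "Q i")
      case True
      have "col z (rk i) = col x i" using colz[OF rk(2)[OF i True]] rk(1)[OF i True] by simp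
      moreover have "col x i \<in> Cols P" using obj_cols[OF obj(1)] i by (simp add: n_def)
      ultimately show ?thesis
        using True i ident[of "col x i"] rk0 colz[OF ks] lower[of i] D0
        by (auto simp: L_nth wt_def vcol_def vout_def)
    next
      case False
      then show ?thesis
        using mor_wt[OF F \<open>i \<le> siz x\<close>] empty[OF i False] i by (auto simp: L_nth wt_def vcol_def vout_def)
    qed
    show "nrm (L ! i) = L ! i"
      using nrm_short[OF wtL] empty[OF i] i by (auto simp: L_nth)
  next
    show "0 \<in> set (snd (L ! 0))" if "0 \<in> D" using D0[OF that] rk0 by (simp add: L_nth n_def)
    show "lay (map snd L)"
    proof (rule lay_triv[OF Lc])
      assume "0 \<in> D"
      then have "snd (L ! 0) = [0]" "L \<noteq> []" using D0 rk0 L_nth[of 0] by (auto simp: n_def L_def)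
      then show "hd (map snd L) = [0]" by (simp add: hd_map hd_conv_nth)
    qed (simp add: L_def n_def)
    show "length L = Suc (siz x)" by (simp add: L_def n_def)
    show "mset (concat (map snd L)) = mset [0..<Suc (siz z)]" by (simp only: Lc)
  qed
  have elL: "elementary z L"
    unfolding elementary_def using Lc obj_cols[OF obj(1)]
    by (auto simp: L_def Q_def n_def simp del: upt_Suc)
  have fF: "F = map ((!) F) [0..<n]" using lenF map_nth by metis
  \<comment> \<open>Dropping vertices without labels leaves the concatenation unchanged.\<close>
  have cR: "concat (map snd R) = concat (map snd F)"
  proof -
    have "concat (map (\<lambda>i. snd (F ! i)) (filter Q is)) = concat (map (\<lambda>i. snd (F ! i)) is)"
      if "set is \<subseteq> {0..<n}" for "is"
      using that empty(1) by (induction "is") auto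
    moreover have "map snd F = map (\<lambda>i. snd (F ! i)) [0..<n]"
      using lenF by (intro nth_equalityI) auto
    ultimately show ?thesis by (simp add: R_def ks_def comp_def)
  qed
  have R_nth: "R ! w = F ! (ks ! w)" if "w < length ks" for w using that by (simp add: R_def)
  have ks0: "w = 0" if "w < length ks" "ks ! w \<in> D" for w
  proof -
    have "distinct ks" by (simp add: ks_def)
    moreover have "ks ! w = 0" "0 \<in> D" using that lower[OF that(2)] by auto
    ultimately show ?thesis using D0 ks that by (metis nth_eq_iff_index_eq)
  qed
  have Rmor: "mor z y R"
    unfolding mor_def
  proof (intro conjI allI impI)
    fix w assume "w \<le> siz z"
    then have w: "w < length ks" using sz by simp
    have kx: "ks ! w \<le> siz x" using ksn(1)[OF w] by (simp add: n_def)
    have "w \<in> D \<longleftrightarrow> ks ! w \<in> D" using ks0[OF w] D0 lower[of w] lower[of "ks ! w"] by metis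
    then have "vcol z y w = vcol x y (ks ! w)" "vout z y w = vout x y (ks ! w)"
      using colz[OF w] colz[OF ks] D0 lower[of w] by (auto simp: vcol_def vout_def)
    then show "wt (vcol z y w) (vout z y w) (R ! w)" "nrm (R ! w) = R ! w"
      using mor_wt[OF F kx] mor_nrm[OF F kx] R_nth[OF w] by simp_all
  next
    show "0 \<in> set (snd (R ! 0))" if "0 \<in> D" using D0[OF that] mor_0[OF F that] R_nth[OF ks] by simp
    have ne: "R \<noteq> []" "F \<noteq> []" using ks lenF by (auto simp: R_def n_def)
    show "lay (map snd R)"
    proof (rule lay_cong[OF mor_lay[OF F]])
      show "hd (map snd F) = hd (map snd R)" if "0 \<in> D"
        using D0[OF that] R_nth[OF ks] ne by (simp add: hd_map hd_conv_nth)
    qed (use ne cR in simp_all)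
  qed (simp_all add: cR mor_mset[OF F], simp add: R_def sz)
  have nn: "nonneg R"
    unfolding nonneg_nth[OF Rmor]
  proof (intro allI impI)
    fix w assume "w \<le> siz z"
    then have w: "w < length ks" using sz by simp
    have "ks ! w \<le> siz x" using ksn(1)[OF w] by (simp add: n_def)
    then show "0 \<le> \<psi> (fst (R ! w))"
      using ksn(2)[OF w] grading_ge[OF mor_Ops[OF F]] R_nth[OF w] unfolding Q_def
      by (smt (verit))
  qed
  have "set R \<subseteq> set F" using ksn lenF by (auto simp: R_def in_set_conv_nth[of _ ks])
  moreover have "cmp x y R L = F"
  proof (rule nth_equalityI)
    show "length (cmp x y R L) = length F" using lenF by (simp add: cmp_def n_def)
    fix i assume "i < length (cmp x y R L)"
    then have ix: "i \<le> siz x" by (simp add: cmp_def)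
    then have i: "i < n" by (simp add: n_def)
    show "cmp x y R L ! i = F ! i"
    proof (cases "Q i")
      case True
      then show ?thesis
        using elementary_cmp_unit[OF obj(1) z(1) obj(2) Lmor elL Rmor ix] L_nth[OF i] rk[OF i] R_nth by simp
    next
      case False
      then show ?thesis using cmp_nullary[OF Lmor ix] empty[OF i] L_nth[OF i] by simp
    qed
  qed
  ultimately show ?thesis using z(1) Lmor elL Rmor nn by blast
qed

text \<open>Vertices of \<open>R\<close> have grading at least 0, so a vertex of grading -1 of the
  composite must come from \<open>L\<close>, and at every other place \<open>L\<close> has an
  identity. This fixes the operations of \<open>L\<close> and the number of labels of each; the
  labels are then forced, being in their natural order. Cancelling \<open>L\<close> gives
  \<open>R\<close>.\<close>

lemma factorization_unique:
  assumes obj: "x \<in> objs" "y \<in> objs" "z \<in> objs" "z' \<in> objs"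
    and L: "mor x z L" "elementary z L" and R: "mor z y R" "nonneg R"
    and L': "mor x z' L'" "elementary z' L'" and R': "mor z' y R'" "nonneg R'"
    and eq: "cmp x y R L = cmp x y R' L'"
  shows "z = z'" "L = L'" "R = R'"
proof -
  have *: "fst (L ! i) = (if \<psi> (fst (cmp x y R L ! i)) = -1 then fst (cmp x y R L ! i) else ident P (col x i)) \<and>
      length (snd (L ! i)) = (if \<psi> (fst (cmp x y R L ! i)) = -1 then 0 else 1)"
    if i: "i \<le> siz x" and z: "z \<in> objs" and L: "mor x z L" "elementary z L" and R: "mor z y R" "nonneg R"
    for z i L R
    using L i
  proof (cases rule: elementary_vertex)
    case minus
    then show ?thesis using cmp_nullary[OF L(1) i minus(2)] by simp
  next
    case (unit w)
    then have "cmp x y R L ! i = R ! w" using elementary_cmp_unit[OF obj(1) z obj(2) L R(1) i] by simp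
    then show ?thesis using R(2)[unfolded nonneg_nth[OF R(1)], rule_format, OF unit(2)] unit(1) by simp
  qed
  note 1 = *[OF _ obj(3) L R] and 2 = *[OF _ obj(4) L' R']
  have len: "length L = length L'" using mor_len L(1) L'(1) by metis
  have lens: "length (snd (L ! i)) = length (snd (L' ! i))" "fst (L ! i) = fst (L' ! i)" if "i \<le> siz x" for i
    using 1[OF that] 2[OF that] eq by simp_all
  have ml: "map (\<lambda>X. length (snd X)) L = map (\<lambda>X. length (snd X)) L'"
    using len lens mor_len[OF L(1)] by (intro nth_equalityI) auto
  then have "length (concat (map snd L)) = length (concat (map snd L'))"
    by (simp add: length_concat comp_def)
  then have "concat (map snd L) = concat (map snd L')"
    using L(2) L'(2) unfolding elementary_def by (simp del: upt_Suc)
  then have "map snd L = map snd L'"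
  proof (rule concat_injective)
    show "length (map snd L) = length (map snd L')" using len by simp
    show "\<forall>(x, y)\<in>set (zip (map snd L) (map snd L')). length x = length y"
      using lens mor_len[OF L(1)] len by (auto simp: in_set_zip)
  qed
  then have snds: "snd (L ! i) = snd (L' ! i)" if "i < length L" for i
    using that len by (metis nth_map)
  show "L = L'"
    using len lens(2) mor_len[OF L(1)] snds by (intro nth_equalityI) (auto simp: prod_eq_iff)
  then show z: "z = z'" using target_unique L(1) L'(1) obj by blast
  show "R = R'" using elementary_epi[OF obj(1,3,2) L R(1)] R'(1) eq \<open>L = L'\<close> z by blast
qed

subsection \<open>Isomorphisms\<close>

definition iso_fam :: "'a \<Rightarrow> 'a \<Rightarrow> ('o \<times> nat list) list \<Rightarrow> ('o \<times> nat list) list \<Rightarrow> bool" where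
  "iso_fam x y F G \<longleftrightarrow> mor x y F \<and> mor y x G \<and> cmp x x G F = idm x \<and> cmp y y F G = idm y"

lemma cmp_single:
  assumes obj: "x \<in> objs" "z \<in> objs" and F: "mor x y F" and G: "mor y z G" and i: "i \<le> siz x" "i \<notin> D"
    and u: "snd (F ! i) = [w]" and g: "length (snd (G ! w)) \<le> 1"
  shows "cmp x z G F ! i = (plug P (fst (F ! i)) [fst (G ! w)], snd (G ! w))"
proof -
  have v: "vert x z G F i = (plug P (fst (F ! i)) [fst (G ! w)], snd (G ! w))"
    using i u by (simp add: vert_def subst_def)
  have "nrm (vert x z G F i) = vert x z G F i"
    using g by (intro nrm_short[OF wt_vert[OF F G obj i(1)]]) (simp add: v)
  then show ?thesis using cmp_nth[OF i(1), of z G F] v by simp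
qed

lemma cmp_single_lower:
  assumes obj: "x \<in> objs" "z \<in> objs" and F: "mor x y F" and G: "mor y z G" and D: "0 \<in> D"
    and f: "snd (F ! 0) = [0]" and g: "snd (G ! 0) = [0]"
  shows "cmp x z G F ! 0 = (plug P (fst (G ! 0)) [fst (F ! 0)], [0])"
proof -
  have "subst (F ! 0) (star x G) = F ! 0"
    using f by (intro subst_unit'[OF mor_wt_lower[OF F D]]) (simp add: star_def unit_op_def)
  then have v: "vert x z G F 0 = (plug P (fst (G ! 0)) [fst (F ! 0)], [0])"
    using D f g by (simp add: vert_def) (simp add: subst_def)
  have "nrm (vert x z G F 0) = vert x z G F 0"
    by (rule nrm_short[OF wt_vert[OF F G obj le0]]) (simp add: v)
  then show ?thesis using cmp_nth[OF le0, of x z G F] v by simp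
qed

lemma sum_list_ge_length:
  assumes "\<And>X. X \<in> set L \<Longrightarrow> 1 \<le> (f X :: nat)"
  shows "length L \<le> (\<Sum>X\<leftarrow>L. f X)" "(\<Sum>X\<leftarrow>L. f X) = length L \<Longrightarrow> X \<in> set L \<Longrightarrow> f X = 1"
  using assms
proof (induction L)
  case (Cons Y L)
  { case 1 then show ?case using Cons.IH(1) by (force simp: Suc_le_eq)}
  { case 2
    then have "length L \<le> (\<Sum>X\<leftarrow>L. f X)" "1 \<le> f Y" using Cons.IH(1) by auto
    then have "(\<Sum>X\<leftarrow>L. f X) = length L" "f Y = 1" using 2(1) by auto
    then show ?case using 2 Cons.IH(2) by auto }
qed auto

lemma iso_fam_sym: "iso_fam x y F G \<Longrightarrow> iso_fam y x G F"
  by (auto simp: iso_fam_def)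

lemma idm_nth: "i \<le> siz x \<Longrightarrow> idm x ! i = unit_op (col x) i"
  by (simp add: idm_def del: upt_Suc)

text \<open>A nullary vertex would persist in the composite with \<open>G\<close>, which consists of
  units.\<close>

lemma iso_fam_nonempty:
  assumes i: "iso_fam x y F G" and X: "X \<in> set F"
  shows "1 \<le> length (snd X)"
proof -
  note d = i[unfolded iso_fam_def]
  obtain i where i: "i \<le> siz x" "X = F ! i"
    using X mor_len[of x y F] d by (auto simp: in_set_conv_nth less_Suc_eq_le)
  show ?thesis
  proof (rule ccontr)
    assume "\<not> ?thesis"
    then have "snd (F ! i) = []" using i(2) by (cases "snd (F ! i)") auto
    then have "idm x ! i = F ! i" using cmp_nullary[of x y F i x G] d i(1) by metis
    then show False using idm_nth[OF i(1)] \<open>snd (F ! i) = []\<close> by (metis snd_unit_op list.distinct(1))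
  qed
qed

lemma mor_total: "mor x y F \<Longrightarrow> (\<Sum>X\<leftarrow>F. length (snd X)) = Suc (siz y)"
  using mset_eq_length[OF mor_mset, of x y F] by (simp add: length_concat comp_def)

text \<open>Counting: no vertex of \<open>F\<close> or of \<open>G\<close> is empty, so the two
  objects have equally many legs, and each vertex gets exactly one label.\<close>

lemma iso_fam_single:
  assumes i: "iso_fam x y F G" and X: "X \<in> set F"
  shows "length (snd X) = 1"
proof -
  note d = i[unfolded iso_fam_def] and d' = iso_fam_sym[OF i, unfolded iso_fam_def]
  have "Suc (siz x) \<le> Suc (siz y)"
    using sum_list_ge_length(1)[of F "\<lambda>X. length (snd X)"] iso_fam_nonempty[OF i] mor_total mor_len d by metis
  moreover have "Suc (siz y) \<le> Suc (siz x)"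
    using sum_list_ge_length(1)[of G "\<lambda>X. length (snd X)"] iso_fam_nonempty[OF iso_fam_sym[OF i]] mor_total mor_len d
    by metis
  ultimately have "(\<Sum>X\<leftarrow>F. length (snd X)) = length F"
    using mor_total[of x y F] mor_len[of x y F] d by simp
  then show ?thesis
    using sum_list_ge_length(2)[of F "\<lambda>X. length (snd X)"] iso_fam_nonempty[OF i] X by blast
qed

lemma iso_fam_imp_inv:
  assumes obj: "x \<in> objs" "y \<in> objs" and i: "iso_fam x y F G" and X: "X \<in> set F"
  shows "invertible (fst X)"
proof -
  note d = i[unfolded iso_fam_def]
  have F: "mor x y F" and G: "mor y x G" and FG: "cmp x x G F = idm x" "cmp y y F G = idm y" using d by auto
  obtain i where i: "i \<le> siz x" "X = F ! i"
    using X mor_len[OF F] by (auto simp: in_set_conv_nth less_Suc_eq_le)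
  have sF: "length (snd (F ! i)) = 1" if "i \<le> siz x" for i
    using iso_fam_single[OF assms(3), of "F ! i"] mor_len[OF F] that by simp
  have sG: "length (snd (G ! w)) = 1" if "w \<le> siz y" for w
    using iso_fam_single[OF iso_fam_sym[OF assms(3)], of "G ! w"] mor_len[OF G] that by simp
  show ?thesis
  proof (cases "i \<in> D")
    case False
    obtain w where w: "snd (F ! i) = [w]" using sF[OF i(1)] by (auto simp: length_Suc_conv)
    have wy: "w \<le> siz y" "w \<notin> D" using mor_label[OF F i(1), of w] mor_nz[OF F i(1) False, of w] w by auto
    have 1: "plug P (fst (F ! i)) [fst (G ! w)] = ident P (col x i)" "snd (G ! w) = [i]"
      using cmp_single[OF obj(1) obj(1) F G i(1) False w] sG[OF wy(1)] idm_nth[OF i(1)] FG(1)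
      by (auto simp: unit_op_def)
    have 2: "plug P (fst (G ! w)) [fst (F ! i)] = ident P (col y w)"
      using cmp_single[OF obj(2) obj(2) G F wy 1(2)] sF[OF i(1)] idm_nth[OF wy(1)] FG(2)
      by (auto simp: unit_op_def)
    have "inv_op (fst (F ! i)) (fst (G ! w))"
      using mor_wt_upper[OF F i(1) False] mor_wt_upper[OF G wy] w 1 2 by (auto simp: wt_def inv_op_def)
    then show ?thesis using i(2) by (auto simp: invertible_def)
  next
    case True
    \<comment> \<open>Lower vertices compose in the opposite order, each having only the marked
      label.\<close>
    then have D: "0 \<in> D" and i0: "i = 0" using lower by auto
    have f: "snd (F ! 0) = [0]" using sF[of 0] mor_0[OF F D] by (auto simp: length_Suc_conv)
    have g: "snd (G ! 0) = [0]" using sG[of 0] mor_0[OF G D] by (auto simp: length_Suc_conv)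
    have "inv_op (fst (F ! 0)) (fst (G ! 0))"
      using cmp_single_lower[OF obj(1) obj(1) F G D f g] cmp_single_lower[OF obj(2) obj(2) G F D g f] FG
        idm_nth[of 0 x] idm_nth[of 0 y] mor_wt_lower[OF F D] mor_wt_lower[OF G D] f g
      by (auto simp: wt_def inv_op_def unit_op_def)
    then show ?thesis using i(2) i0 by (auto simp: invertible_def)
  qed
qed

text \<open>Invertible operations are unary, so the labels form a permutation \<open>\<pi>\<close>
  of the legs. The inverse family has the inverse operations as vertices, placed and labelled by
  \<open>\<rho>\<close>, the inverse of \<open>\<pi>\<close>.\<close>

lemma inv_imp_iso_fam:
  assumes obj: "x \<in> objs" "y \<in> objs" and F: "mor x y F" and inv: "\<And>X. X \<in> set F \<Longrightarrow> invertible (fst X)"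
  shows "\<exists>G. iso_fam x y F G"
proof -
  have "\<exists>w. snd (F ! i) = [w]" if "i \<le> siz x" for i
  proof -
    have "invertible (fst (F ! i))" using inv mor_len[OF F] that by simp
    then have "length (snd (F ! i)) = 1"
      using wt_arity[OF mor_wt[OF F that]] by (auto simp: invertible_def inv_op_def arity_def)
    then show ?thesis by (auto simp: length_Suc_conv)
  qed
  then obtain \<pi> where \<pi>: "\<And>i. i \<le> siz x \<Longrightarrow> snd (F ! i) = [\<pi> i]" by metis
  define n where "n = siz x"
  have fF: "map snd F = map (\<lambda>i. [\<pi> i]) [0..<Suc n]"
    using mor_len[OF F] \<pi> by (intro nth_equalityI) (auto simp: n_def less_Suc_eq_le simp del: upt_Suc)
  have c: "concat (map snd F) = map \<pi> [0..<Suc n]"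
    unfolding fF by (rule concat_map_singleton)
  have "length (concat (map snd F)) = Suc (siz y)" using mset_eq_length[OF mor_mset[OF F]] by simp
  then have ny: "siz y = n" unfolding c by simp
  have "set (concat (map snd F)) = {..n}" "distinct (concat (map snd F))"
    using mor_set[OF F] mor_distinct_all[OF F] ny by (auto simp: atLeast0AtMost)
  then have bij: "bij_betw \<pi> {..n} {..n}"
    unfolding c by (auto simp: bij_betw_def distinct_map lessThan_Suc_atMost atLeast0LessThan simp del: upt_Suc)
  define \<rho> where "\<rho> = inv_into {..n} \<pi>"
  have \<rho>: "\<rho> (\<pi> i) = i" if "i \<le> n" for i
    using that bij unfolding \<rho>_def by (simp add: bij_betw_inv_into_left)
  have \<rho>': "\<pi> (\<rho> w) = w" "\<rho> w \<le> n" if "w \<le> n" for w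
    using that bij unfolding \<rho>_def by (auto simp: bij_betw_inv_into_right) (metis atMost_iff bij_betw_def inv_into_into)
  have \<pi>0: "\<pi> 0 = 0" if "0 \<in> D" using mor_0[OF F that] \<pi>[of 0] by simp
  have bij': "bij_betw \<rho> {..n} {..n}" unfolding \<rho>_def using bij by (rule bij_betw_inv_into)
  have "\<exists>r. inv_op (fst (F ! i)) r" if "i \<le> n" for i
    using inv[of "F ! i"] mor_len[OF F] that by (simp add: n_def invertible_def)
  then obtain r where r: "\<And>i. i \<le> n \<Longrightarrow> inv_op (fst (F ! i)) (r i)" by metis
  define G where "G = map (\<lambda>w. (r (\<rho> w), [\<rho> w])) [0..<Suc n]"
  have G_nth: "G ! w = (r (\<rho> w), [\<rho> w])" if "w \<le> n" for w
    using that by (simp add: G_def del: upt_Suc)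
  have \<rho>0: "\<rho> 0 = 0" if "0 \<in> D" using \<rho>[of 0] \<pi>0[OF that] by simp
  have cG: "concat (map snd G) = map \<rho> [0..<Suc n]"
    unfolding G_def by (simp add: comp_def del: upt_Suc)
  have G: "mor y x G"
    unfolding mor_def
  proof (intro conjI allI impI)
    fix w assume "w \<le> siz y"
    then have w: "w \<le> n" using ny by simp
    note i = \<rho>'[OF w]
    have ix: "\<rho> w \<le> siz x" using i by (simp add: n_def)
    note v = r[OF i(2), unfolded inv_op_def]
    show wt: "wt (vcol y x w) (vout y x w) (G ! w)"
    proof (cases "w \<in> D")
      case True
      then have D: "0 \<in> D" "w = 0" using lower by auto
      then show ?thesis using v mor_wt_lower[OF F D(1)] G_nth[OF w] \<pi>[of 0] \<pi>0 \<rho>0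
        by (auto simp: wt_def vcol_def vout_def)
    next
      case False
      then have "\<rho> w \<notin> D" using i \<pi>0 lower by metis
      then show ?thesis
        using False v mor_wt_upper[OF F ix] G_nth[OF w] \<pi>[OF ix] i by (auto simp: wt_def vcol_def vout_def)
    qed
    show "nrm (G ! w) = G ! w" by (rule nrm_short[OF wt]) (simp add: G_nth[OF w])
  next
    show "length G = Suc (siz y)" by (simp add: G_def ny)
    show "mset (concat (map snd G)) = mset [0..<Suc (siz x)]"
    proof (rule set_eq_iff_mset_eq_distinct[THEN iffD1])
      show "distinct (concat (map snd G))" "set (concat (map snd G)) = set [0..<Suc (siz x)]"
        using bij' unfolding cG n_def
        by (auto simp: bij_betw_def distinct_map lessThan_Suc_atMost atLeast0LessThan simp del: upt_Suc)
    qed simp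
    show "0 \<in> set (snd (G ! 0))" if "0 \<in> D" using \<rho>0[OF that] G_nth[of 0] by simp
    have "lay (map (\<lambda>i. [\<rho> i]) [0..<Suc n])"
      using lay_inv[OF mor_lay[OF F, unfolded fF] bij \<pi>0] \<rho> by blast
    then show "lay (map snd G)" unfolding G_def by (simp add: comp_def del: upt_Suc)
  qed
  have 1: "cmp x x G F = idm x"
  proof (rule nth_equalityI)
    fix i assume "i < length (cmp x x G F)"
    then have i: "i \<le> n" "i \<le> siz x" by (simp_all add: cmp_def n_def)
    have pi: "\<pi> i \<le> n" using bij i(1) by (auto simp: bij_betw_def)
    show "cmp x x G F ! i = idm x ! i"
    proof (cases "i \<in> D")
      case True
      then have D: "0 \<in> D" "i = 0" using lower by auto
      have "out P (r 0) = col x 0"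
        using r[of 0] mor_wt_lower[OF F D(1)] \<pi>[of 0] \<pi>0[OF D(1)] by (auto simp: inv_op_def wt_def)
      then show ?thesis
        using cmp_single_lower[OF obj(1) obj(1) F G D(1)] \<pi>[of 0] \<pi>0[OF D(1)] G_nth[of 0] \<rho>0[OF D(1)] r[of 0] D
          idm_nth[OF i(2)]
        by (simp add: inv_op_def unit_op_def)
    next
      case False
      then show ?thesis
        using cmp_single[OF obj(1) obj(1) F G i(2) False \<pi>[OF i(2)]] G_nth[OF pi] \<rho>[OF i(1)] r[OF i(1)]
          idm_nth[OF i(2)] mor_wt_upper[OF F i(2) False]
        by (simp add: inv_op_def unit_op_def wt_def)
    qed
  qed (simp add: cmp_def idm_def)
  have 2: "cmp y y F G = idm y"
  proof (rule nth_equalityI)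
    fix w assume "w < length (cmp y y F G)"
    then have w: "w \<le> n" "w \<le> siz y" using ny by (simp_all add: cmp_def)
    have ri: "\<rho> w \<le> n" "\<rho> w \<le> siz x" using \<rho>'[OF w(1)] by (simp_all add: n_def)
    show "cmp y y F G ! w = idm y ! w"
    proof (cases "w \<in> D")
      case True
      then have D: "0 \<in> D" "w = 0" using lower by auto
      show ?thesis
        using cmp_single_lower[OF obj(2) obj(2) G F D(1)] \<pi>[of 0] \<pi>0[OF D(1)] G_nth[of 0] \<rho>0[OF D(1)] r[of 0] D
          idm_nth[OF w(2)] mor_wt_lower[OF F D(1)]
        by (simp add: inv_op_def unit_op_def wt_def)
    next
      case False
      show ?thesis
        using cmp_single[OF obj(2) obj(2) G F w(2) False, of "\<rho> w"] G_nth[OF w(1)] \<rho>'[OF w(1)] \<pi>[OF ri(2)]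
          r[OF ri(1)] idm_nth[OF w(2)] mor_wt_upper[OF G w(2) False]
        by (simp add: inv_op_def unit_op_def wt_def)
    qed
  qed (simp add: cmp_def idm_def)
  show ?thesis using F G 1 2 unfolding iso_fam_def by blast
qed

text \<open>R_- described vertex by vertex, with no reference to a factorization: isomorphisms have
  invertible vertices, and elementary families have identities or grading -1. The agreement with the
  definition of R_- is \<open>R_minus_C\<close>.\<close>

definition contracting :: "('o \<times> nat list) list \<Rightarrow> bool" where
  "contracting L \<longleftrightarrow> (\<forall>X\<in>set L. invertible (fst X) \<or> \<psi> (fst X) = -1)"

lemma invertible_single:
  assumes "mor x y L" "i \<le> siz x" "invertible (fst (L ! i))"
  obtains w where "snd (L ! i) = [w]" "i \<in> D \<Longrightarrow> w = 0"
proof -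
  have "length (snd (L ! i)) = 1"
    using wt_arity[OF mor_wt[OF assms(1,2)]] assms(3) by (auto simp: invertible_def inv_op_def arity_def)
  then obtain w where w: "snd (L ! i) = [w]" by (auto simp: length_Suc_conv)
  moreover have "w = 0" if "i \<in> D" using mor_0[OF assms(1)] w that lower[OF that] by auto
  ultimately show ?thesis using that by blast
qed

text \<open>An invertible vertex has a single label. So a vertex of the composite is a nullary one
  that was kept, a composite of two invertible ones, or an invertible one applied to one of grading
  -1, which has grading -1 again.\<close>

lemma contracting_cmp:
  assumes obj: "x \<in> objs" "y \<in> objs" "z \<in> objs" and F: "mor x y F" and G: "mor y z G"
    and c: "contracting F" "contracting G"
  shows "contracting (cmp x z G F)"
proof -
  have cF: "invertible (fst (F ! i)) \<or> \<psi> (fst (F ! i)) = -1" if "i \<le> siz x" for i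
    using c(1) mor_len[OF F] that unfolding contracting_def by simp
  have cG: "invertible (fst (G ! i)) \<or> \<psi> (fst (G ! i)) = -1" if "i \<le> siz y" for i
    using c(2) mor_len[OF G] that unfolding contracting_def by simp
  have "invertible (fst (cmp x z G F ! i)) \<or> \<psi> (fst (cmp x z G F ! i)) = -1" if i: "i \<le> siz x" for i
  proof (cases "\<psi> (fst (F ! i)) = -1")
    case True
    then show ?thesis using cmp_nullary[OF F i mor_nullary[OF F i True]] by simp
  next
    case False
    then have u: "invertible (fst (F ! i))" using cF[OF i] by simp
    obtain w where w: "snd (F ! i) = [w]" "i \<in> D \<Longrightarrow> w = 0" by (rule invertible_single[OF F i u]) blast
    have wy: "w \<le> siz y" using mor_label[OF F i, of w] w by simp
    show ?thesis
    proof (cases "i \<in> D")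
      case True
      then have D: "0 \<in> D" "i = 0" using lower by auto
      have "\<psi> (fst (G ! 0)) \<noteq> -1" using mor_nullary[OF G le0] mor_0[OF G D(1)] by auto
      then have v: "invertible (fst (G ! 0))" using cG[OF le0] by simp
      obtain w' where w': "snd (G ! 0) = [w']" "0 \<in> D \<Longrightarrow> w' = 0" by (rule invertible_single[OF G le0 v]) blast
      have "ins P (fst (G ! 0)) = [out P (fst (F ! 0))]"
        using mor_wt_lower[OF F D(1)] mor_wt_lower[OF G D(1)] w' D by (auto simp: wt_def)
      then show ?thesis
        using cmp_single_lower[OF obj(1,3) F G D(1)] w w' D u v inv_op_plug by (fastforce simp: invertible_def)
    next
      case False
      show ?thesis
      proof (cases "\<psi> (fst (G ! w)) = -1")
        case True
        obtain r where "inv_op (fst (F ! i)) r" using u by (auto simp: invertible_def)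
        then show ?thesis
          using grading_upper[OF obj(1,3) F G i False] w True inv_op_grading by simp
      next
        case f: False
        then have v: "invertible (fst (G ! w))" using cG[OF wy] by simp
        obtain w' where w': "snd (G ! w) = [w']" by (rule invertible_single[OF G wy v]) blast
        have "w \<notin> D" using mor_nz[OF F i False] w by simp
        then have "ins P (fst (F ! i)) = [out P (fst (G ! w))]"
          using mor_wt_upper[OF F i False] mor_wt_upper[OF G wy] w by (auto simp: wt_def)
        then show ?thesis
          using cmp_single[OF obj(1,3) F G i False w(1)] w' u v inv_op_plug by (fastforce simp: invertible_def)
      qed
    qed
  qed
  then show ?thesis using mor_len[OF comp_mor[OF obj F G]]
    unfolding contracting_def by (simp add: all_set_conv_all_nth less_Suc_eq_le)
qed

end

section \<open>Enveloping categories and discrete opfibrations over them\<close>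

text \<open>\<open>lab\<close> and \<open>mk\<close> translate between tuples and families and are
  inverse to each other on hom-sets. \<open>triv_iff\<close> is restricted to tuples with vertices
  of the left class, because for others the order of the labels may differ from the planar order of
  the leaves.\<close>

locale enveloping = family_category P E nrm \<psi> D objs siz col lay
  for P :: "('c, 'o, 'z) operad_scheme" and E nrm \<psi> D
    and objs :: "'a set" and siz col lay +
  fixes U :: "('a, 'o list \<times> 'l) cat"
    and lab :: "'o list \<times> 'l \<Rightarrow> ('o \<times> nat list) list"
    and mk :: "('o \<times> nat list) list \<Rightarrow> 'o list \<times> 'l"
    and triv :: "'o list \<times> 'l \<Rightarrow> bool"
  assumes U_obj: "Obj U = objs"
    and hom_lab: "x \<in> objs \<Longrightarrow> y \<in> objs \<Longrightarrow> f \<in> Hom U x y \<Longrightarrow>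
      mor x y (lab f) \<and> mk (lab f) = f \<and> map fst (lab f) = fst f"
    and hom_mk: "x \<in> objs \<Longrightarrow> y \<in> objs \<Longrightarrow> mor x y L \<Longrightarrow> mk L \<in> Hom U x y \<and> lab (mk L) = L"
    and U_cmp: "x \<in> objs \<Longrightarrow> y \<in> objs \<Longrightarrow> z \<in> objs \<Longrightarrow> f \<in> Hom U x y \<Longrightarrow> g \<in> Hom U y z \<Longrightarrow>
      Cmp U g f = mk (cmp x z (lab g) (lab f))"
    and U_idm: "x \<in> objs \<Longrightarrow> Idm U x = mk (idm x)"
    and triv_iff: "x \<in> objs \<Longrightarrow> y \<in> objs \<Longrightarrow> f \<in> Hom U x y \<Longrightarrow>
      (\<And>q. q \<in> set (fst f) \<Longrightarrow> q \<in> ident P ` Cols P \<or> \<psi> q = -1) \<Longrightarrow>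
      triv f \<longleftrightarrow> concat (map snd (lab f)) = [0..<Suc (siz y)]"
begin

section \<open>Vertex conditions on tuples\<close>

definition elem :: "'a \<Rightarrow> 'o list \<times> 'l \<Rightarrow> bool" where
  "elem y f \<longleftrightarrow> triv f \<and> (\<forall>q\<in>set (fst f). q \<in> ident P ` Cols P \<or> \<psi> q = -1)"

definition nneg :: "'o list \<times> 'l \<Rightarrow> bool" where
  "nneg f \<longleftrightarrow> (\<forall>q\<in>set (fst f). 0 \<le> \<psi> q)"

definition contr :: "'o list \<times> 'l \<Rightarrow> bool" where
  "contr f \<longleftrightarrow> (\<forall>q\<in>set (fst f). invertible q \<or> \<psi> q = -1)"

definition invs :: "'o list \<times> 'l \<Rightarrow> bool" where
  "invs f \<longleftrightarrow> (\<forall>q\<in>set (fst f). invertible q)"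

context
  fixes x y :: 'a and f
  assumes x: "x \<in> objs" and y: "y \<in> objs" and f: "f \<in> Hom U x y"
begin

lemma lab_mor: "mor x y (lab f)"
  and mk_lab: "mk (lab f) = f"
  and set_fst: "set (fst f) = fst ` set (lab f)"
  using hom_lab[OF x y f] by (auto simp del: set_map simp flip: set_map)

lemma elem_iff: "elem y f \<longleftrightarrow> elementary y (lab f)"
proof -
  have "(\<forall>q\<in>set (fst f). q \<in> ident P ` Cols P \<or> \<psi> q = -1) \<longleftrightarrow>
      (\<forall>X\<in>set (lab f). fst X \<in> ident P ` Cols P \<or> \<psi> (fst X) = -1)"
    unfolding set_fst by blast
  then show ?thesis using triv_iff[OF x y f] unfolding elem_def elementary_def by blast
qed

lemma nneg_iff: "nneg f \<longleftrightarrow> nonneg (lab f)"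
  unfolding nneg_def nonneg_def set_fst by blast

lemma contr_iff: "contr f \<longleftrightarrow> contracting (lab f)"
  unfolding contr_def contracting_def set_fst by blast

lemma invs_iff: "invs f \<longleftrightarrow> (\<forall>X\<in>set (lab f). invertible (fst X))"
  unfolding invs_def set_fst by blast

end

section \<open>Category laws and factorizations in \<open>U\<close>\<close>

lemma U_idm_hom: "x \<in> objs \<Longrightarrow> Idm U x \<in> Hom U x x"
  and lab_idm: "x \<in> objs \<Longrightarrow> lab (Idm U x) = idm x"
  using hom_mk idm_mor U_idm by simp_all

lemma
  assumes obj: "x \<in> objs" "y \<in> objs" "z \<in> objs" and f: "f \<in> Hom U x y" and g: "g \<in> Hom U y z"
  shows U_comp: "Cmp U g f \<in> Hom U x z"
    and lab_cmp: "lab (Cmp U g f) = cmp x z (lab g) (lab f)"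
  using hom_mk[OF obj(1,3) comp_mor[OF obj lab_mor[OF obj(1,2) f] lab_mor[OF obj(2,3) g]]] U_cmp[OF obj f g]
  by simp_all

lemma lab_inj: "x \<in> objs \<Longrightarrow> y \<in> objs \<Longrightarrow> f \<in> Hom U x y \<Longrightarrow> f' \<in> Hom U x y \<Longrightarrow> lab f = lab f' \<Longrightarrow> f = f'"
  using mk_lab by metis

lemma U_assoc:
  assumes obj: "x \<in> objs" "y \<in> objs" "z \<in> objs" "t \<in> objs"
    and f: "f \<in> Hom U x y" and g: "g \<in> Hom U y z" and h: "h \<in> Hom U z t"
  shows "Cmp U h (Cmp U g f) = Cmp U (Cmp U h g) f"
proof -
  note gf = U_comp[OF obj(1,2,3) f g] and hg = U_comp[OF obj(2,3,4) g h]
  show ?thesis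
    using comp_assoc[OF obj lab_mor[OF obj(1,2) f] lab_mor[OF obj(2,3) g] lab_mor[OF obj(3,4) h]]
    by (intro lab_inj[OF obj(1,4) U_comp[OF obj(1,3,4) gf h] U_comp[OF obj(1,2,4) f hg]])
      (simp add: lab_cmp[OF obj(1,3,4) gf h] lab_cmp[OF obj(1,2,4) f hg] lab_cmp[OF obj(1,2,3) f g]
        lab_cmp[OF obj(2,3,4) g h])
qed

lemma U_unit:
  assumes obj: "x \<in> objs" "y \<in> objs" and f: "f \<in> Hom U x y"
  shows "Cmp U f (Idm U x) = f" "Cmp U (Idm U y) f = f"
proof -
  note m = lab_mor[OF obj f] and i = U_idm_hom[OF obj(1)] U_idm_hom[OF obj(2)]
  show "Cmp U f (Idm U x) = f"
    using cmp_idm_right[OF m obj(1) idm_mor[OF obj(1)] obj(2)]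
    by (intro lab_inj[OF obj U_comp[OF obj(1,1,2) i(1) f] f])
      (simp add: lab_cmp[OF obj(1,1,2) i(1) f] lab_idm[OF obj(1)])
  show "Cmp U (Idm U y) f = f"
    using cmp_idm_left[OF m obj]
    by (intro lab_inj[OF obj U_comp[OF obj(1,2,2) f i(2)] f])
      (simp add: lab_cmp[OF obj(1,2,2) f i(2)] lab_idm[OF obj(2)])
qed

lemma category_U: "category U"
  unfolding category_def U_obj using U_idm_hom U_comp U_unit U_assoc by auto

lemma U_target_unique: "x \<in> objs \<Longrightarrow> y \<in> objs \<Longrightarrow> y' \<in> objs \<Longrightarrow> f \<in> Hom U x y \<Longrightarrow> f \<in> Hom U x y' \<Longrightarrow> y = y'"
  using target_unique lab_mor by blast

text \<open>That \<open>r\<close> has no new vertices matters later: the right factor of a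
  \<open>contr\<close> morphism is again \<open>contr\<close>, hence an isomorphism.\<close>

lemma U_fact:
  assumes obj: "x \<in> objs" "y \<in> objs" and f: "f \<in> Hom U x y"
  shows "\<exists>z\<in>objs. \<exists>l\<in>Hom U x z. \<exists>r\<in>Hom U z y. elem z l \<and> nneg r \<and> set (fst r) \<subseteq> set (fst f) \<and> Cmp U r l = f"
proof -
  obtain z L R where z: "z \<in> objs" and L: "mor x z L" "elementary z L" and R: "mor z y R" "nonneg R"
    and s: "set R \<subseteq> set (lab f)" and c: "cmp x y R L = lab f"
    using factorization_exists[OF obj lab_mor[OF obj f]] by blast
  note l = hom_mk[OF obj(1) z L(1)] and r = hom_mk[OF z obj(2) R(1)]
  have lr: "mk L \<in> Hom U x z" "lab (mk L) = L" "mk R \<in> Hom U z y" "lab (mk R) = R" using l r by auto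
  have "Cmp U (mk R) (mk L) = f"
    using U_cmp[OF obj(1) z obj(2) lr(1,3)] lr c mk_lab[OF obj f] by simp
  moreover have "set (fst (mk R)) \<subseteq> set (fst f)"
    using set_fst[OF z obj(2) lr(3)] set_fst[OF obj f] s lr(4) by auto
  ultimately show ?thesis
    using z lr L R elem_iff[OF obj(1) z lr(1)] nneg_iff[OF z obj(2) lr(3)] by auto
qed

lemma U_fact_unique:
  assumes obj: "x \<in> objs" "y \<in> objs" "z \<in> objs" "z' \<in> objs"
    and l: "l \<in> Hom U x z" "elem z l" and r: "r \<in> Hom U z y" "nneg r"
    and l': "l' \<in> Hom U x z'" "elem z' l'" and r': "r' \<in> Hom U z' y" "nneg r'"
    and eq: "Cmp U r l = Cmp U r' l'"
  shows "z = z'" "l = l'" "r = r'"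
proof -
  have "cmp x y (lab r) (lab l) = cmp x y (lab r') (lab l')"
    using eq lab_cmp[OF obj(1,3,2) l(1) r(1)] lab_cmp[OF obj(1,4,2) l'(1) r'(1)] by simp
  from factorization_unique[OF obj lab_mor[OF obj(1,3) l(1)] _ lab_mor[OF obj(3,2) r(1)] _
      lab_mor[OF obj(1,4) l'(1)] _ lab_mor[OF obj(4,2) r'(1)] _ this]
  have *: "z = z'" "lab l = lab l'" "lab r = lab r'"
    using elem_iff[OF obj(1,3) l(1)] elem_iff[OF obj(1,4) l'(1)] nneg_iff[OF obj(3,2) r(1)]
      nneg_iff[OF obj(4,2) r'(1)] l r l' r' by auto
  then show z: "z = z'" by blast
  show "l = l'" using lab_inj[OF obj(1,3) l(1)] l'(1) *(2) z by simp
  show "r = r'" using lab_inj[OF obj(3,2) r(1)] r'(1) *(3) z by simp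
qed

lemma U_epi:
  assumes obj: "x \<in> objs" "z \<in> objs" "y \<in> objs" and l: "l \<in> Hom U x z" "elem z l"
    and g: "g \<in> Hom U z y" "g' \<in> Hom U z y" and eq: "Cmp U g l = Cmp U g' l"
  shows "g = g'"
proof -
  have "cmp x y (lab g) (lab l) = cmp x y (lab g') (lab l)"
    using eq lab_cmp[OF obj l(1) g(1)] lab_cmp[OF obj l(1) g(2)] by simp
  then have "lab g = lab g'"
    using elementary_epi[OF obj lab_mor[OF obj(1,2) l(1)] _ lab_mor[OF obj(2,3) g(1)] lab_mor[OF obj(2,3) g(2)]]
      elem_iff[OF obj(1,2) l(1)] l(2) by blast
  then show ?thesis using lab_inj[OF obj(2,3) g] by blast
qed

lemma U_iso:
  assumes obj: "x \<in> objs" "y \<in> objs" and f: "f \<in> Hom U x y"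
  shows "(\<exists>g\<in>Hom U y x. Cmp U g f = Idm U x \<and> Cmp U f g = Idm U y) \<longleftrightarrow> invs f"
proof
  assume "\<exists>g\<in>Hom U y x. Cmp U g f = Idm U x \<and> Cmp U f g = Idm U y"
  then obtain g where g: "g \<in> Hom U y x" "Cmp U g f = Idm U x" "Cmp U f g = Idm U y" by blast
  have "iso_fam x y (lab f) (lab g)"
    using lab_mor[OF obj f] lab_mor[OF obj(2,1) g(1)] lab_cmp[OF obj(1,2,1) f g(1)] lab_cmp[OF obj(2,1,2) g(1) f]
      g(2,3) lab_idm obj by (simp add: iso_fam_def)
  then show "invs f" using iso_fam_imp_inv[OF obj] invs_iff[OF obj f] by blast
next
  assume "invs f"
  then obtain G where "iso_fam x y (lab f) G"
    using inv_imp_iso_fam[OF obj lab_mor[OF obj f]] invs_iff[OF obj f] by blast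
  then have G: "mor y x G" "cmp x x G (lab f) = idm x" "cmp y y (lab f) G = idm y" by (auto simp: iso_fam_def)
  note g = hom_mk[OF obj(2,1) G(1)]
  show "\<exists>g\<in>Hom U y x. Cmp U g f = Idm U x \<and> Cmp U f g = Idm U y"
    using g U_cmp[OF obj(1,2,1) f, of "mk G"] U_cmp[OF obj(2,1,2) _ f, of "mk G"] G U_idm obj
    by (intro bexI[of _ "mk G"]) auto
qed

context
  fixes x y z f g
  assumes x: "x \<in> objs" and y: "y \<in> objs" and z: "z \<in> objs"
    and f: "f \<in> Hom U x y" and g: "g \<in> Hom U y z"
begin

lemma nneg_cmp: "nneg f \<Longrightarrow> nneg g \<Longrightarrow> nneg (Cmp U g f)"
  using nonneg_cmp[OF x y z lab_mor[OF x y f] lab_mor[OF y z g]]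
  unfolding nneg_iff[OF x y f] nneg_iff[OF y z g] nneg_iff[OF x z U_comp[OF x y z f g]] lab_cmp[OF x y z f g] .

lemma contr_cmp: "contr f \<Longrightarrow> contr g \<Longrightarrow> contr (Cmp U g f)"
  using contracting_cmp[OF x y z lab_mor[OF x y f] lab_mor[OF y z g]]
  unfolding contr_iff[OF x y f] contr_iff[OF y z g] contr_iff[OF x z U_comp[OF x y z f g]] lab_cmp[OF x y z f g] .

end

lemma elem_contr: "elem z f \<Longrightarrow> contr f"
  using inv_op_ident unfolding elem_def contr_def invertible_def by fast

lemma invs_contr: "invs f \<Longrightarrow> contr f"
  unfolding invs_def contr_def by blast

lemma invs_nneg: "invs f \<Longrightarrow> nneg f"
  unfolding invs_def nneg_def invertible_def using inv_op_grading by force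

lemma contr_nneg_invs: "contr f \<Longrightarrow> nneg f \<Longrightarrow> invs f"
  unfolding invs_def nneg_def contr_def by force

end

text \<open>The categories \<open>U\<close>, \<open>V\<close> and \<open>Tw\<close> are treated together as discrete opfibrations \<open>C\<close> over \<open>U\<close>. Here \<open>tg a f\<close>
  is the target of the lift of \<open>f\<close> with source \<open>a\<close>.\<close>

locale opfibration_over = enveloping P E nrm \<psi> D objs siz col lay U lab mk triv
  for P :: "('c, 'o, 'z) operad_scheme" and E nrm \<psi> D
    and objs :: "'a set" and siz col lay and U :: "('a, 'o list \<times> 'l) cat" and lab mk triv +
  fixes C :: "('d, 'o list \<times> 'l) cat" and pr :: "'d \<Rightarrow> 'a" and tg :: "'d \<Rightarrow> 'o list \<times> 'l \<Rightarrow> 'd"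
  assumes pr_obj: "a \<in> Obj C \<Longrightarrow> pr a \<in> objs"
    and hom_C: "a \<in> Obj C \<Longrightarrow> e \<in> Obj C \<Longrightarrow> f \<in> Hom C a e \<longleftrightarrow> f \<in> Hom U (pr a) (pr e) \<and> tg a f = e"
    and Idm_C: "a \<in> Obj C \<Longrightarrow> Idm C a = Idm U (pr a)"
    and Cmp_C: "Cmp C = Cmp U"
    and tg_obj: "a \<in> Obj C \<Longrightarrow> y \<in> objs \<Longrightarrow> f \<in> Hom U (pr a) y \<Longrightarrow> tg a f \<in> Obj C \<and> pr (tg a f) = y"
    and tg_idm: "a \<in> Obj C \<Longrightarrow> tg a (Idm U (pr a)) = a"
    and tg_cmp: "a \<in> Obj C \<Longrightarrow> y \<in> objs \<Longrightarrow> z \<in> objs \<Longrightarrow> f \<in> Hom U (pr a) y \<Longrightarrow> g \<in> Hom U y z \<Longrightarrow>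
      tg (tg a f) g = tg a (Cmp U g f)"
begin

section \<open>Lifting from \<open>U\<close> to an opfibration\<close>

lemma hom_CU: "a \<in> Obj C \<Longrightarrow> e \<in> Obj C \<Longrightarrow> f \<in> Hom C a e \<Longrightarrow> f \<in> Hom U (pr a) (pr e)"
  and hom_tg: "a \<in> Obj C \<Longrightarrow> e \<in> Obj C \<Longrightarrow> f \<in> Hom C a e \<Longrightarrow> tg a f = e"
  using hom_C by blast+

lemma lift_hom: "a \<in> Obj C \<Longrightarrow> y \<in> objs \<Longrightarrow> f \<in> Hom U (pr a) y \<Longrightarrow> f \<in> Hom C a (tg a f)"
  using hom_C tg_obj by metis

lemma C_idm_hom: "a \<in> Obj C \<Longrightarrow> Idm C a \<in> Hom C a a"
  using hom_C Idm_C U_idm_hom pr_obj tg_idm by metis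

lemma C_comp:
  assumes "a \<in> Obj C" "e \<in> Obj C" "c \<in> Obj C" "f \<in> Hom C a e" "g \<in> Hom C e c"
  shows "Cmp C g f \<in> Hom C a c"
proof -
  note f = hom_CU[OF assms(1,2,4)] hom_tg[OF assms(1,2,4)] and g = hom_CU[OF assms(2,3,5)] hom_tg[OF assms(2,3,5)]
  note o = pr_obj[OF assms(1)] pr_obj[OF assms(2)] pr_obj[OF assms(3)]
  have "Cmp U g f \<in> Hom U (pr a) (pr c)" using U_comp[OF o f(1) g(1)] .
  moreover have "tg a (Cmp U g f) = c" using tg_cmp[OF assms(1) o(2,3) f(1) g(1)] f(2) g(2) by simp
  ultimately show ?thesis using hom_C[OF assms(1,3)] by (simp add: Cmp_C)
qed

lemma category_C: "category C"
  unfolding category_def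
proof (intro conjI ballI)
  fix a e f assume a: "a \<in> Obj C" "e \<in> Obj C" "f \<in> Hom C a e"
  then show "Cmp C f (Idm C a) = f" "Cmp C (Idm C e) f = f"
    using U_unit[OF pr_obj[OF a(1)] pr_obj[OF a(2)] hom_CU[OF a]] by (simp_all add: Cmp_C Idm_C)
next
  fix a e c d f g h
  assume "a \<in> Obj C" "e \<in> Obj C" "c \<in> Obj C" "d \<in> Obj C" "f \<in> Hom C a e" "g \<in> Hom C e c" "h \<in> Hom C c d"
  then show "Cmp C h (Cmp C g f) = Cmp C (Cmp C h g) f"
    using U_assoc[of "pr a" "pr e" "pr c" "pr d" f g h] pr_obj hom_CU by (simp add: Cmp_C)
qed (use C_idm_hom C_comp in blast)+

lemma functor_C: "is_functor C U pr id"
proof -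
  show ?thesis
    unfolding is_functor_def using category_C category_U pr_obj hom_CU by (auto simp: U_obj Idm_C Cmp_C)
qed

lemma opfib_C: "discrete_opfibration C U pr id"
  unfolding discrete_opfibration_def
proof (intro conjI ballI functor_C)
  fix a y g assume a: "a \<in> Obj C" "y \<in> Obj U" "g \<in> Hom U (pr a) y"
  then have y: "y \<in> objs" by (simp add: U_obj)
  show "\<exists>!(e, f). e \<in> Obj C \<and> f \<in> Hom C a e \<and> pr e = y \<and> id f = g"
    using tg_obj[OF a(1) y a(3)] lift_hom[OF a(1) y a(3)] hom_tg[OF a(1)]
    by (intro ex1I[of _ "(tg a g, g)"]) auto
qed

text \<open>An inverse in \<open>U\<close> lifts: started at \<open>e\<close>, its lift ends at
  \<open>a\<close>, because its composite with \<open>f\<close> is an identity and \<open>tg\<close>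
  respects composites.\<close>

lemma isos_C:
  assumes a: "a \<in> Obj C" and e: "e \<in> Obj C"
  shows "Isos C a e = {f \<in> Hom C a e. invs f}"
proof -
  have "(\<exists>g\<in>Hom C e a. Cmp C g f = Idm C a \<and> Cmp C f g = Idm C e) \<longleftrightarrow> invs f" if f: "f \<in> Hom C a e" for f
  proof -
    note fU = hom_CU[OF a e f]
    have "g \<in> Hom C e a" if g: "g \<in> Hom U (pr e) (pr a)" "Cmp U g f = Idm U (pr a)" for g
      using tg_cmp[OF a pr_obj[OF e] pr_obj[OF a] fU g(1)] g hom_tg[OF a e f] tg_idm[OF a] hom_C[OF e a] by simp
    then have "(\<exists>g\<in>Hom C e a. Cmp C g f = Idm C a \<and> Cmp C f g = Idm C e) \<longleftrightarrow>
        (\<exists>g\<in>Hom U (pr e) (pr a). Cmp U g f = Idm U (pr a) \<and> Cmp U f g = Idm U (pr e))"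
      using hom_CU[OF e a] a e by (auto simp: Cmp_C Idm_C)
    then show ?thesis using U_iso[OF pr_obj[OF a] pr_obj[OF e] fU] by simp
  qed
  then show ?thesis unfolding Isos_def by blast
qed

lemma R_minus_one_C: "R_minus_one P \<psi> triv C a e = {f \<in> Hom C a e. elem (pr e) f}"
  unfolding R_minus_one_def elem_def by auto

lemma R_plus_C: "R_plus \<psi> C a e = {f \<in> Hom C a e. nneg f}"
  unfolding R_plus_def nneg_def by auto

text \<open>Lift \<open>l\<close> with source \<open>a\<close>, then \<open>r\<close> from where
  that lift ends; since \<open>tg\<close> respects composites, the second lift ends at
  \<open>e\<close>.\<close>

lemma fact_C:
  assumes a: "a \<in> Obj C" and e: "e \<in> Obj C" and f: "f \<in> Hom C a e"
  shows "\<exists>c\<in>Obj C. \<exists>l\<in>Hom C a c. \<exists>r\<in>Hom C c e. elem (pr c) l \<and> nneg r \<and> set (fst r) \<subseteq> set (fst f) \<and> Cmp C r l = f"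
proof -
  obtain z l r where z: "z \<in> objs" and l: "l \<in> Hom U (pr a) z" "elem z l" and r: "r \<in> Hom U z (pr e)" "nneg r"
    and s: "set (fst r) \<subseteq> set (fst f)" and c: "Cmp U r l = f"
    using U_fact[OF pr_obj[OF a] pr_obj[OF e] hom_CU[OF a e f]] by blast
  note t = tg_obj[OF a z l(1)]
  have "tg (tg a l) r = e" using tg_cmp[OF a z pr_obj[OF e] l(1) r(1)] c hom_tg[OF a e f] by simp
  then have "r \<in> Hom C (tg a l) e" using t r(1) hom_C[of "tg a l" e] e by simp
  then show ?thesis using t lift_hom[OF a z l(1)] l(2) r(2) s c by (auto simp: Cmp_C)
qed

text \<open>For the inclusion from right to left, factor \<open>f\<close>: the vertices of the right
  factor are among those of \<open>f\<close>, so it is both \<open>contr\<close> and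
  \<open>nneg\<close>, hence an isomorphism.\<close>

lemma R_minus_C:
  assumes a: "a \<in> Obj C" and e: "e \<in> Obj C"
  shows "R_minus P \<psi> triv C a e = {f \<in> Hom C a e. contr f}"
proof (intro set_eqI iffI)
  fix f assume "f \<in> R_minus P \<psi> triv C a e"
  then obtain c \<theta> l where c: "c \<in> Obj C" "l \<in> Hom C a c" "elem (pr c) l" "\<theta> \<in> Hom C c e" "invs \<theta>" "f = Cmp C \<theta> l"
    unfolding R_minus_def R_minus_one_C using isos_C e by blast
  then show "f \<in> {f \<in> Hom C a e. contr f}"
    using C_comp[OF a c(1) e c(2,4)] contr_cmp[of "pr a" "pr c" "pr e" l \<theta>] pr_obj a e hom_CU elem_contr invs_contr
    by (auto simp: Cmp_C)
next
  fix f assume "f \<in> {f \<in> Hom C a e. contr f}"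
  then have f: "f \<in> Hom C a e" "contr f" by auto
  obtain c l r where c: "c \<in> Obj C" "l \<in> Hom C a c" "r \<in> Hom C c e" "elem (pr c) l" "nneg r"
      "set (fst r) \<subseteq> set (fst f)" "Cmp C r l = f"
    using fact_C[OF a e f(1)] by blast
  have "contr r" using f(2) c(6) unfolding contr_def by blast
  then have "r \<in> Isos C c e" using isos_C[OF c(1) e] contr_nneg_invs c by auto
  then show "f \<in> R_minus P \<psi> triv C a e"
    unfolding R_minus_def R_minus_one_C using c by blast
qed

lemma contr_decomp:
  assumes a: "a \<in> Obj C" and e: "e \<in> Obj C" and f: "f \<in> Hom C a e" "contr f"
  obtains c l \<theta> \<theta>' where "c \<in> Obj C" "l \<in> Hom C a c" "elem (pr c) l" "\<theta> \<in> Hom C c e" "invs \<theta>" "f = Cmp C \<theta> l"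
    "\<theta>' \<in> Hom C e c" "invs \<theta>'" "Cmp C \<theta>' \<theta> = Idm C c" "Cmp C \<theta> \<theta>' = Idm C e"
proof -
  have "f \<in> R_minus P \<psi> triv C a e" using R_minus_C[OF a e] f by simp
  then obtain c \<theta> l where c: "c \<in> Obj C" "l \<in> Hom C a c" "elem (pr c) l" "\<theta> \<in> Isos C c e" "f = Cmp C \<theta> l"
    unfolding R_minus_def R_minus_one_C by blast
  then obtain \<theta>' where t: "\<theta>' \<in> Hom C e c" "Cmp C \<theta>' \<theta> = Idm C c" "Cmp C \<theta> \<theta>' = Idm C e" and th: "\<theta> \<in> Hom C c e"
    unfolding Isos_def by blast
  then have "\<theta>' \<in> Isos C e c" unfolding Isos_def by blast
  then show ?thesis using that[OF c(1-3) th _ c(5) t(1) _ t(2,3)] isos_C c e by blast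
qed

lemma C_assoc:
  "a \<in> Obj C \<Longrightarrow> e \<in> Obj C \<Longrightarrow> c \<in> Obj C \<Longrightarrow> d \<in> Obj C \<Longrightarrow> f \<in> Hom C a e \<Longrightarrow> g \<in> Hom C e c \<Longrightarrow> h \<in> Hom C c d \<Longrightarrow>
   Cmp C h (Cmp C g f) = Cmp C (Cmp C h g) f"
  using category_C unfolding category_def by blast

lemma C_unit:
  "a \<in> Obj C \<Longrightarrow> e \<in> Obj C \<Longrightarrow> f \<in> Hom C a e \<Longrightarrow> Cmp C f (Idm C a) = f \<and> Cmp C (Idm C e) f = f"
  using category_C unfolding category_def by blast

text \<open>Elementary morphisms can be cancelled, and so can isomorphisms. This yields the
  uniqueness of \<open>\<theta>\<close> in factorizations as well as the last Reedy axiom.\<close>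

lemma contr_epi:
  assumes a: "a \<in> Obj C" and e: "e \<in> Obj C" and d: "d \<in> Obj C" and f: "f \<in> Hom C a e" "contr f"
    and g: "g \<in> Hom C e d" "g' \<in> Hom C e d" and eq: "Cmp C g f = Cmp C g' f"
  shows "g = g'"
proof -
  from a e f obtain c l \<theta> \<theta>' where c: "c \<in> Obj C" and l: "l \<in> Hom C a c" "elem (pr c) l" and th: "\<theta> \<in> Hom C c e" "f = Cmp C \<theta> l"
    and th': "\<theta>' \<in> Hom C e c" "Cmp C \<theta> \<theta>' = Idm C e"
    by (rule contr_decomp)
  have "Cmp C (Cmp C g \<theta>) l = Cmp C (Cmp C g' \<theta>) l"
    using eq th C_assoc[OF a c e d l(1) th(1)] g by simp
  moreover note C_comp[OF c e d th(1) g(1)] C_comp[OF c e d th(1) g(2)]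
  ultimately have "Cmp C g \<theta> = Cmp C g' \<theta>"
    using U_epi[OF pr_obj[OF a] pr_obj[OF c] pr_obj[OF d] hom_CU[OF a c l(1)] l(2)] hom_CU[OF c d] by (simp add: Cmp_C)
  then have "Cmp C g (Cmp C \<theta> \<theta>') = Cmp C g' (Cmp C \<theta> \<theta>')"
    using C_assoc[OF e c e d th'(1) th(1)] g by simp
  then show ?thesis using th'(2) C_unit[OF e d] g by simp
qed

text \<open>Splitting each left factor into an elementary morphism and an isomorphism reduces the
  claim to \<open>U_fact_unique\<close>, where uniqueness holds on the nose; the comparison is
  \<open>v\<close> after the inverse of \<open>u\<close>. \<open>L\<close> and \<open>R\<close> need
  to agree with the vertex classes only on objects of \<open>C\<close>, since \<open>V\<close>
  inherits the families of \<open>U\<close>.\<close>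

lemma ofs_C:
  assumes L: "\<And>a e. a \<in> Obj C \<Longrightarrow> e \<in> Obj C \<Longrightarrow> L a e = {f \<in> Hom C a e. contr f}"
    and R: "\<And>a e. a \<in> Obj C \<Longrightarrow> e \<in> Obj C \<Longrightarrow> R a e = {f \<in> Hom C a e. nneg f}"
  shows "orthogonal_factorization_system C L R"
  unfolding orthogonal_factorization_system_def
proof (intro conjI ballI)
  have cc: "contr (Cmp C g f)" if "a \<in> Obj C" "e \<in> Obj C" "c \<in> Obj C" "f \<in> Hom C a e" "g \<in> Hom C e c" "contr f" "contr g"
    for a e c f g using contr_cmp[of "pr a" "pr e" "pr c" f g] pr_obj hom_CU that by (simp add: Cmp_C)
  have nn: "nneg (Cmp C g f)" if "a \<in> Obj C" "e \<in> Obj C" "c \<in> Obj C" "f \<in> Hom C a e" "g \<in> Hom C e c" "nneg f" "nneg g"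
    for a e c f g using nneg_cmp[of "pr a" "pr e" "pr c" f g] pr_obj hom_CU that by (simp add: Cmp_C)
  show "subcategory_with_isos C L"
    unfolding subcategory_with_isos_def using L C_comp cc isos_C invs_contr by auto
  show "subcategory_with_isos C R"
    unfolding subcategory_with_isos_def using R C_comp nn isos_C invs_nneg by auto
  fix a e f assume a: "a \<in> Obj C" and e: "e \<in> Obj C" and f: "f \<in> Hom C a e"
  show "\<exists>c\<in>Obj C. \<exists>l\<in>L a c. \<exists>r\<in>R c e. Cmp C r l = f"
    using fact_C[OF a e f] L[OF a] R[OF _ e] elem_contr by blast
  fix c c' l r l' r'
  assume c: "c \<in> Obj C" and c': "c' \<in> Obj C" and "l \<in> L a c" "r \<in> R c e" "l' \<in> L a c'" "r' \<in> R c' e"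
  then have l: "l \<in> Hom C a c" "contr l" and r: "r \<in> Hom C c e" "nneg r"
    and l': "l' \<in> Hom C a c'" "contr l'" and r': "r' \<in> Hom C c' e" "nneg r'"
    using L R a e by auto
  show "Cmp C r l = f \<and> Cmp C r' l' = f \<longrightarrow> (\<exists>!\<theta>. \<theta> \<in> Isos C c c' \<and> Cmp C \<theta> l = l' \<and> Cmp C r' \<theta> = r)"
  proof
    assume eq: "Cmp C r l = f \<and> Cmp C r' l' = f"
    from a c l obtain d m u u' where d: "d \<in> Obj C" and m: "m \<in> Hom C a d" "elem (pr d) m"
      and u: "u \<in> Hom C d c" "invs u" "l = Cmp C u m" and u': "u' \<in> Hom C c d" "invs u'" "Cmp C u' u = Idm C d" "Cmp C u u' = Idm C c"
      by (rule contr_decomp)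
    from a c' l' obtain d' m' v v' where d': "d' \<in> Obj C" and m': "m' \<in> Hom C a d'" "elem (pr d') m'"
      and v: "v \<in> Hom C d' c'" "invs v" "l' = Cmp C v m'" and v': "v' \<in> Hom C c' d'" "invs v'" "Cmp C v' v = Idm C d'" "Cmp C v v' = Idm C c'"
      by (rule contr_decomp)
    have ru: "Cmp C r u \<in> Hom C d e" "nneg (Cmp C r u)" and rv: "Cmp C r' v \<in> Hom C d' e" "nneg (Cmp C r' v)"
      using C_comp[OF d c e u(1) r(1)] C_comp[OF d' c' e v(1) r'(1)] nn[OF d c e u(1) r(1) invs_nneg[OF u(2)] r(2)]
        nn[OF d' c' e v(1) r'(1) invs_nneg[OF v(2)] r'(2)] by auto
    have e1: "Cmp C (Cmp C r u) m = Cmp C (Cmp C r' v) m'"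
      using eq u(3) v(3) C_assoc[OF a d c e m(1) u(1) r(1)] C_assoc[OF a d' c' e m'(1) v(1) r'(1)] by simp
    note fu = U_fact_unique[OF pr_obj[OF a] pr_obj[OF e] pr_obj[OF d] pr_obj[OF d'] hom_CU[OF a d m(1)] m(2)
        hom_CU[OF d e ru(1), unfolded Cmp_C] ru(2)[unfolded Cmp_C] hom_CU[OF a d' m'(1)] m'(2)
        hom_CU[OF d' e rv(1), unfolded Cmp_C] rv(2)[unfolded Cmp_C] e1[unfolded Cmp_C]]
    have mm: "m = m'" and rr: "Cmp C r u = Cmp C r' v"
      using fu e1 by (simp_all add: Cmp_C)
    have dd: "d = d'" using hom_tg[OF a d m(1)] hom_tg[OF a d' m'(1)] mm by simp
    define \<theta> where "\<theta> = Cmp C v u'"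
    have v: "v \<in> Hom C d c'" "invs v" "l' = Cmp C v m" and v': "v' \<in> Hom C c' d" "invs v'" "Cmp C v v' = Idm C c'" "Cmp C v' v = Idm C d"
      using v v' dd mm by auto
    have th: "\<theta> \<in> Hom C c c'" unfolding \<theta>_def using C_comp[OF c d c' u'(1) v(1)] .
    have uv: "Cmp C u v' \<in> Hom C c' c" using C_comp[OF c' d c v'(1) u(1)] .
    have "Cmp C \<theta> (Cmp C u v') = Cmp C v (Cmp C u' (Cmp C u v'))"
      unfolding \<theta>_def using C_assoc[OF c' c d c' uv u'(1) v(1)] by simp
    also have "Cmp C u' (Cmp C u v') = v'"
      using C_assoc[OF c' d c d v'(1) u(1) u'(1)] u'(3) C_unit[OF c' d v'(1)] by simp
    finally have 1: "Cmp C \<theta> (Cmp C u v') = Idm C c'" using v'(3) by simp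
    have "Cmp C (Cmp C u v') \<theta> = Cmp C u (Cmp C v' \<theta>)"
      using C_assoc[OF c c' d c th v'(1) u(1)] by simp
    also have "Cmp C v' \<theta> = u'"
      unfolding \<theta>_def using C_assoc[OF c d c' d u'(1) v(1) v'(1)] v'(4) C_unit[OF c d u'(1)] by simp
    finally have 2: "Cmp C (Cmp C u v') \<theta> = Idm C c" using u'(4) by simp
    have iso: "\<theta> \<in> Isos C c c'" using th uv 1 2 unfolding Isos_def by blast
    have tu: "Cmp C \<theta> u = v"
      unfolding \<theta>_def using C_assoc[OF d c d c' u(1) u'(1) v(1)] u'(3) C_unit[OF d c' v(1)] by simp
    have tl: "Cmp C \<theta> l = l'"
      using C_assoc[OF a d c c' m(1) u(1) th] tu u(3) v(3) by simp
    have "Cmp C r' \<theta> = Cmp C (Cmp C r' v) u'"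
      unfolding \<theta>_def using C_assoc[OF c d c' e u'(1) v(1) r'(1)] .
    also have "\<dots> = r" using rr C_assoc[OF c d c e u'(1) u(1) r(1)] u'(4) C_unit[OF c e r(1)] by simp
    finally have tr: "Cmp C r' \<theta> = r" .
    have "\<theta>' = \<theta>" if "\<theta>' \<in> Isos C c c'" "Cmp C \<theta>' l = l'" for \<theta>'
      using contr_epi[OF a c c' l _ th] that tl unfolding Isos_def by simp
    then show "\<exists>!\<theta>. \<theta> \<in> Isos C c c' \<and> Cmp C \<theta> l = l' \<and> Cmp C r' \<theta> = r"
      using iso tl tr by blast
  qed
qed (rule category_C)

lemma reedy_C:
  assumes L: "\<And>a e. a \<in> Obj C \<Longrightarrow> e \<in> Obj C \<Longrightarrow> L a e = {f \<in> Hom C a e. contr f}"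
    and R: "\<And>a e. a \<in> Obj C \<Longrightarrow> e \<in> Obj C \<Longrightarrow> R a e = {f \<in> Hom C a e. nneg f}"
    and deg_ge: "\<And>a. a \<in> Obj C \<Longrightarrow> -1 \<le> deg a"
    and deg: "\<And>a e f. a \<in> Obj C \<Longrightarrow> e \<in> Obj C \<Longrightarrow> f \<in> Hom C a e \<Longrightarrow> deg e = deg a + (\<Sum>q\<leftarrow>fst f. \<psi> q)"
    and zero: "\<And>q. q \<in> Ops P \<Longrightarrow> \<psi> q = 0 \<Longrightarrow> invertible q"
  shows "generalized_reedy C L R deg"
proof -
  have s0: "(\<Sum>q\<leftarrow>fst f. \<psi> q) = 0" if "invs f" for f
  proof -
    have "map \<psi> (fst f) = map (\<lambda>q. 0) (fst f)"
      using that inv_op_grading unfolding invs_def invertible_def by (auto intro!: map_cong)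
    then show ?thesis by (simp add: map_replicate_const sum_list_replicate)
  qed
  have sneg: "(\<Sum>q\<leftarrow>fst f. \<psi> q) < 0" if "contr f" "\<not> invs f" for f
  proof -
    have "(\<forall>q\<in>set qs. invertible q \<or> \<psi> q = -1) \<Longrightarrow>
      (\<Sum>q\<leftarrow>qs. \<psi> q) \<le> 0 \<and> (\<not> (\<forall>q\<in>set qs. invertible q) \<longrightarrow> (\<Sum>q\<leftarrow>qs. \<psi> q) < 0)" for qs
      by (induction qs) (auto simp: invertible_def dest: inv_op_grading)
    then show ?thesis using that unfolding contr_def invs_def by blast
  qed
  \<comment> \<open>The hypothesis on operations of grading 0 enters here: a sum of nonnegative
    gradings vanishes only if all of them do, and then all vertices are invertible.\<close>
  have spos: "(\<Sum>q\<leftarrow>fst f. \<psi> q) > 0" if "nneg f" "\<not> invs f" "set (fst f) \<subseteq> Ops P" for f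
  proof -
    have "(\<forall>q\<in>set qs. 0 \<le> \<psi> q \<and> q \<in> Ops P) \<Longrightarrow>
      (\<Sum>q\<leftarrow>qs. \<psi> q) \<ge> 0 \<and> (\<not> (\<forall>q\<in>set qs. invertible q) \<longrightarrow> (\<Sum>q\<leftarrow>qs. \<psi> q) > 0)" for qs
      using zero by (induction qs) (auto simp: order_le_less)
    then show ?thesis using that unfolding nneg_def invs_def by blast
  qed
  have ops: "set (fst f) \<subseteq> Ops P" if "a \<in> Obj C" "e \<in> Obj C" "f \<in> Hom C a e" for a e f
  proof -
    note l = lab_mor[OF pr_obj[OF that(1)] pr_obj[OF that(2)] hom_CU[OF that]]
    show ?thesis
      unfolding set_fst[OF pr_obj[OF that(1)] pr_obj[OF that(2)] hom_CU[OF that]]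
      using mor_Ops[OF l] mor_len[OF l] by (simp add: image_subset_iff all_set_conv_all_nth less_Suc_eq_le)
  qed
  have "\<theta> = Idm C e" if a: "a \<in> Obj C" and e: "e \<in> Obj C" and f: "f \<in> L a e" and th: "\<theta> \<in> Isos C e e" "Cmp C \<theta> f = f"
    for a e f \<theta>
    using contr_epi[OF a e e, of f \<theta> "Idm C e"] L[OF a e] f th C_unit[OF a e] C_idm_hom[OF e] isos_C[OF e e] by auto
  then show ?thesis
    unfolding generalized_reedy_def
    using deg_ge ofs_C[of L R, OF L R] deg sneg spos s0 ops isos_C L R by auto
qed

end

section \<open>Full subcategories closed under targets\<close>

context enveloping
begin

definition cod :: "'a \<Rightarrow> 'o list \<times> 'l \<Rightarrow> 'a" where
  "cod x f = (THE y. y \<in> objs \<and> f \<in> Hom U x y)"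

lemma cod_eq:
  assumes x: "x \<in> objs" and y: "y \<in> objs" and f: "f \<in> Hom U x y"
  shows "cod x f = y"
  unfolding cod_def using U_target_unique[OF x _ y _ f] y f by (intro the_equality) blast+

lemma full_simps: "Obj (full_subcategory C A) = A" "Hom (full_subcategory C A) = Hom C"
    "Idm (full_subcategory C A) = Idm C" "Cmp (full_subcategory C A) = Cmp C"
  by (simp_all add: full_subcategory_def)

text \<open>If targets stay in \<open>A\<close>, a morphism of \<open>U\<close> with source in
  \<open>A\<close> is its own unique lift. With \<open>A\<close> all objects this covers
  \<open>U\<close> itself, with the profiles of operations it covers \<open>V\<close>.\<close>

lemma full_opfibration:
  assumes A: "A \<subseteq> objs" and cosieve: "\<And>x y f. x \<in> A \<Longrightarrow> y \<in> objs \<Longrightarrow> f \<in> Hom U x y \<Longrightarrow> y \<in> A"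
  shows "opfibration_over P E nrm \<psi> D objs siz col lay U lab mk triv (full_subcategory U A) id cod"
proof (unfold_locales, unfold full_simps id_apply)
  fix x y z f g assume x: "x \<in> A" and y: "y \<in> objs" and f: "f \<in> Hom U x y"
  then have xo: "x \<in> objs" using A by blast
  show "cod x f \<in> A \<and> cod x f = y" using cod_eq[OF xo y f] cosieve[OF x y f] by simp
  assume z: "z \<in> objs" and g: "g \<in> Hom U y z"
  show "cod (cod x f) g = cod x (Cmp U g f)"
    using cod_eq[OF xo y f] cod_eq[OF y z g] cod_eq[OF xo z U_comp[OF xo y z f g]] by simp
next
  fix x y f assume "x \<in> A" "y \<in> A"
  then show "f \<in> Hom U x y \<longleftrightarrow> f \<in> Hom U x y \<and> cod x f = y" using cod_eq[of x y f] A by auto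
next
  fix x assume "x \<in> A"
  then show "cod x (Idm U x) = x" using cod_eq[of x x "Idm U x"] U_idm_hom A by blast
qed (use A in \<open>simp_all add: subset_iff\<close>)

end

section \<open>Twisted arrow categories and the main theorem for encoded tuples\<close>

text \<open>Beyond the opfibration, the main result needs the degree formula
  \<open>grading_tgt\<close>, the constancy of the grading on fibres, and the legs of the object
  \<open>pr p\<close>.\<close>

locale twisted = opfibration_over P E nrm \<psi> D objs siz col lay U lab mk triv Tw pr tgt
  for P :: "('c, 'o, 'z) operad_scheme" and E nrm \<psi> D
    and objs :: "'a set" and siz col lay and U :: "('a, 'o list \<times> 'l) cat" and lab mk triv
    and Tw :: "('o, 'o list \<times> 'l) cat" and pr tgt +
  assumes Tw_obj: "Obj Tw = Ops P"
    and pr_siz: "p \<in> Ops P \<Longrightarrow> siz (pr p) = arity P p"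
    and pr_col: "p \<in> Ops P \<Longrightarrow> col (pr p) 0 = out P p"
      "p \<in> Ops P \<Longrightarrow> i < arity P p \<Longrightarrow> col (pr p) (Suc i) = ins P p ! i"
    and grading_tgt: "p \<in> Ops P \<Longrightarrow> y \<in> objs \<Longrightarrow> f \<in> Hom U (pr p) y \<Longrightarrow>
      \<psi> (tgt p f) = \<psi> p + (\<Sum>q\<leftarrow>fst f. \<psi> q)"
    and grading_pr: "p \<in> Ops P \<Longrightarrow> p' \<in> Ops P \<Longrightarrow> pr p = pr p' \<Longrightarrow> \<psi> p = \<psi> p'"
begin

lemma fibre_degree:
  assumes p: "p \<in> Ops P"
  shows "fibre_degree P \<psi> pr (pr p) = \<psi> p"
  unfolding fibre_degree_def using grading_pr[OF _ p] p by (intro the_equality) metis+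

lemma grading0_invertible:
  assumes g: "grading0_groupoid P \<psi>" and q: "q \<in> Ops P" "\<psi> q = 0"
  shows "invertible q"
proof -
  have "length (ins P q) = 1" using g q unfolding grading0_groupoid_def by (simp add: arity_def)
  then obtain c where c: "ins P q = [c]" by (auto simp: length_Suc_conv)
  have "q \<in> Isos (grading0_cat P \<psi>) c (out P q)"
  proof -
    have "c \<in> Obj (grading0_cat P \<psi>)" "out P q \<in> Obj (grading0_cat P \<psi>)" "q \<in> Hom (grading0_cat P \<psi>) c (out P q)"
      using q c colours[OF q(1)] by (simp_all add: grading0_cat_def)
    then show ?thesis using g unfolding grading0_groupoid_def groupoid_def by blast
  qed
  then show ?thesis
    using q c unfolding Isos_def grading0_cat_def invertible_def inv_op_def by auto
qed

lemma invertible_grading0: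
  assumes inv: "\<And>q. q \<in> Ops P \<Longrightarrow> \<psi> q = 0 \<Longrightarrow> invertible q"
  shows "grading0_groupoid P \<psi>"
  unfolding grading0_groupoid_def groupoid_def
proof (intro conjI ballI impI)
  fix q assume "q \<in> Ops P" "\<psi> q = 0"
  then show "arity P q = 1" using inv[of q] by (auto simp: invertible_def inv_op_def arity_def)
next
  show "category (grading0_cat P \<psi>)"
    unfolding category_def grading0_cat_def cat.simps
  proof (intro conjI ballI)
    fix c assume "c \<in> Cols P"
    then show "ident P c \<in> {p \<in> Ops P. \<psi> p = 0 \<and> ins P p = [c] \<and> out P p = c}"
      using ident grading by (auto simp: planar_grading_def)
  next
    fix a b c f g
    assume "f \<in> {p \<in> Ops P. \<psi> p = 0 \<and> ins P p = [a] \<and> out P p = b}"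
      "g \<in> {p \<in> Ops P. \<psi> p = 0 \<and> ins P p = [b] \<and> out P p = c}"
    then show "plug P g [f] \<in> {p \<in> Ops P. \<psi> p = 0 \<and> ins P p = [a] \<and> out P p = c}"
      using plug[of g "[f]"] grading_plug[OF grading, of g "[f]"] by (auto simp: composable_def)
  next
    fix a b f assume f: "f \<in> {p \<in> Ops P. \<psi> p = 0 \<and> ins P p = [a] \<and> out P p = b}"
    then show "plug P f [ident P a] = f" "plug P (ident P b) [f] = f"
      using unit[of f] by auto
  next
    fix a b c d f g h
    assume "f \<in> {p \<in> Ops P. \<psi> p = 0 \<and> ins P p = [a] \<and> out P p = b}"
      "g \<in> {p \<in> Ops P. \<psi> p = 0 \<and> ins P p = [b] \<and> out P p = c}"
      "h \<in> {p \<in> Ops P. \<psi> p = 0 \<and> ins P p = [c] \<and> out P p = d}"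
    then show "plug P h [plug P g [f]] = plug P (plug P h [g]) [f]"
      using plug_plug1[of h g f] by auto
  qed
next
  fix a b assume "a \<in> Obj (grading0_cat P \<psi>)" "b \<in> Obj (grading0_cat P \<psi>)"
  show "Hom (grading0_cat P \<psi>) a b \<subseteq> Isos (grading0_cat P \<psi>) a b"
  proof
    fix q assume "q \<in> Hom (grading0_cat P \<psi>) a b"
    then have q: "q \<in> Ops P" "\<psi> q = 0" "ins P q = [a]" "out P q = b" by (auto simp: grading0_cat_def)
    then obtain r where r: "inv_op q r" using inv by (auto simp: invertible_def)
    then show "q \<in> Isos (grading0_cat P \<psi>) a b"
      using q inv_op_grading[OF inv_op_sym[OF r]] unfolding Isos_def
      by (auto simp: grading0_cat_def inv_op_def)
  qed
qed

text \<open>The operation \<open>q\<close> is glued to the input of an identity, and another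
  identity to its output. Both end objects are profiles of operations, so this is a morphism of
  \<open>V\<close>; it will test the invertibility of \<open>q\<close>.\<close>

lemma vertex_morphism:
  assumes q: "q \<in> Ops P"
  shows "\<exists>f\<in>Hom U (pr (ident P (out P q))) (pr q). fst f = [ident P (out P q), q]"
proof -
  define c where "c = out P q"
  have c: "c \<in> Cols P" using colours[OF q] by (simp add: c_def)
  note id = ident[OF c]
  let ?x = "pr (ident P c)" and ?y = "pr q"
  let ?L = "[(ident P c, [0]), (q, [1..<Suc (arity P q)])]"
  have o: "?x \<in> objs" "?y \<in> objs" using pr_obj id q Tw_obj by auto
  have sx: "siz ?x = 1" using pr_siz[of "ident P c"] id by (simp add: arity_def)
  have sy: "siz ?y = arity P q" using pr_siz[OF q] .
  have cx: "col ?x 0 = c" "col ?x 1 = c"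
    using pr_col(1)[of "ident P c"] pr_col(2)[of "ident P c" 0] id by (simp_all add: arity_def)
  have cy: "col ?y 0 = c" using pr_col(1)[OF q] by (simp add: c_def)
  have iq: "map (col ?y) [1..<Suc (arity P q)] = ins P q"
    using pr_col(2)[OF q] by (intro nth_equalityI) (auto simp: arity_def simp del: upt_Suc)
  have cc: "concat (map snd ?L) = [0..<Suc (siz ?y)]"
    by (simp add: sy upt_conv_Cons del: upt_Suc)
  have w0: "wt (vcol ?x ?y 0) (vout ?x ?y 0) (ident P c, [0])"
    using id cx cy by (auto simp: wt_def vcol_def vout_def)
  have "1 \<notin> D" using lower by auto
  then have w1: "wt (vcol ?x ?y 1) (vout ?x ?y 1) (q, [1..<Suc (arity P q)])"
    using q iq cx by (simp add: wt_def vcol_def vout_def c_def del: upt_Suc)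
  have m: "mor ?x ?y ?L"
    unfolding mor_def
  proof (intro conjI allI impI)
    fix i assume "i \<le> siz ?x"
    then have "i = 0 \<or> i = 1" using sx by auto
    then show "wt (vcol ?x ?y i) (vout ?x ?y i) (?L ! i)" "nrm (?L ! i) = ?L ! i"
      using w0 w1 nrm_sorted[OF w0] nrm_sorted[OF w1] by (auto simp del: upt_Suc)
  next
    show "lay (map snd ?L)" by (rule lay_triv[OF cc]) simp_all
    show "mset (concat (map snd ?L)) = mset [0..<Suc (siz ?y)]" by (simp only: cc)
  qed (simp_all add: sx)
  note h = hom_mk[OF o m]
  then have "fst (mk ?L) = map fst ?L" using hom_lab[OF o, of "mk ?L"] by metis
  then show ?thesis using h by (auto simp: c_def)
qed

theorem reedy_main:
  fixes V :: "('a, 'o list \<times> 'l) cat" and deg :: "'a \<Rightarrow> int" and Rm Rp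
  defines "V \<equiv> V_of U P pr" and "deg \<equiv> fibre_degree P \<psi> pr"
    and "Rm \<equiv> R_minus P \<psi> triv U" and "Rp \<equiv> R_plus \<psi> U"
  shows "discrete_opfibration Tw U pr id \<and>
    (\<forall>p\<in>Ops P. deg (pr p) = \<psi> p) \<and>
    orthogonal_factorization_system U Rm Rp \<and>
    orthogonal_factorization_system V Rm Rp \<and>
    (generalized_reedy V Rm Rp deg \<longleftrightarrow> grading0_groupoid P \<psi>) \<and>
    (grading0_groupoid P \<psi> \<longrightarrow>
       discrete_opfibration Tw V pr id \<and>
       generalized_reedy_map Tw (R_minus P \<psi> triv Tw) (R_plus \<psi> Tw) \<psi> V Rm Rp deg pr id)"
proof -
  let ?A = "pr ` Ops P"
  have pr_o: "pr p \<in> objs" if "p \<in> Ops P" for p using pr_obj that Tw_obj by simp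
  have A: "?A \<subseteq> objs" using pr_o by blast
  have fullU: "full_subcategory U objs = U" by (simp add: full_subcategory_def U_obj[symmetric])
  interpret UU: opfibration_over P E nrm \<psi> D objs siz col lay U lab mk triv U id cod
    using full_opfibration[of objs] unfolding fullU by blast
  have tgt_A: "y \<in> ?A" if "x \<in> ?A" "y \<in> objs" "f \<in> Hom U x y" for x y f
    using that tg_obj Tw_obj by blast
  have VA: "V = full_subcategory U ?A" unfolding V_def V_of_def ..
  interpret VV: opfibration_over P E nrm \<psi> D objs siz col lay U lab mk triv V id cod
    unfolding VA using full_opfibration[OF A tgt_A] .
  have V_simps: "Obj V = ?A" "Hom V = Hom U" "Cmp V = Cmp U" "Idm V = Idm U"
    by (simp_all add: VA full_simps)
  \<comment> \<open>\<open>Rm\<close> and \<open>Rp\<close> are formed in \<open>U\<close>. As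
    conditions on vertices they are also the classes that \<open>V\<close> would define by
    itself.\<close>
  have RmU: "Rm x y = {f \<in> Hom U x y. contr f}" "Rp x y = {f \<in> Hom U x y. nneg f}"
    if "x \<in> objs" "y \<in> objs" for x y
    using that UU.R_minus_C UU.R_plus_C by (simp_all add: U_obj Rm_def Rp_def)
  have RmV: "Rm x y = {f \<in> Hom V x y. contr f}" "Rp x y = {f \<in> Hom V x y. nneg f}"
    if "x \<in> Obj V" "y \<in> Obj V" for x y
  proof -
    have "x \<in> objs" "y \<in> objs" using that A by (auto simp: V_simps)
    from RmU[OF this] show "Rm x y = {f \<in> Hom V x y. contr f}" "Rp x y = {f \<in> Hom V x y. nneg f}"
      by (simp_all add: V_simps)
  qed
  have d: "\<forall>p\<in>Ops P. deg (pr p) = \<psi> p" using fibre_degree by (simp add: deg_def)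
  have degV: "deg y = deg x + (\<Sum>q\<leftarrow>fst f. \<psi> q)" if xy: "x \<in> Obj V" "y \<in> Obj V" "f \<in> Hom V x y" for x y f
  proof -
    \<comment> \<open>Degrees on \<open>V\<close> are known only through the fibres: the morphism is
      lifted to an operation over \<open>x\<close>, and gradings are compared there.\<close>
    obtain p where p: "p \<in> Ops P" "x = pr p" using xy(1) V_simps by auto
    have f: "y \<in> objs" "f \<in> Hom U (pr p) y" using xy A p V_simps by auto
    note t = tg_obj[of p y f, unfolded Tw_obj, OF p(1) f]
    show ?thesis using grading_tgt[OF p(1) f] t d p by metis
  qed
  have ge: "-1 \<le> deg x" if "x \<in> Obj V" for x
    using that d grading_ge by (auto simp: V_simps)
  have reedyV: "generalized_reedy V Rm Rp deg" if "grading0_groupoid P \<psi>"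
    using VV.reedy_C[of Rm Rp deg, OF RmV ge degV] grading0_invertible[OF that] by blast
  have degT: "\<psi> e = \<psi> a + (\<Sum>q\<leftarrow>fst f. \<psi> q)" if "a \<in> Obj Tw" "e \<in> Obj Tw" "f \<in> Hom Tw a e" for a e f
    using grading_tgt[of a "pr e" f] hom_CU[OF that] hom_tg[OF that] that pr_o by (simp add: Tw_obj)
  have reedyT: "generalized_reedy Tw (R_minus P \<psi> triv Tw) (R_plus \<psi> Tw) \<psi>" if "grading0_groupoid P \<psi>"
    using reedy_C[of "R_minus P \<psi> triv Tw" "R_plus \<psi> Tw" \<psi>, OF R_minus_C R_plus_C _ degT] grading_ge
      grading0_invertible[OF that] by (simp add: Tw_obj)
  have conv: "grading0_groupoid P \<psi>" if reedy: "generalized_reedy V Rm Rp deg"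
  proof (rule invertible_grading0)
    fix q assume q: "q \<in> Ops P" "\<psi> q = 0"
    let ?i = "ident P (out P q)"
    have i: "?i \<in> Ops P" "\<psi> ?i = 0" using colours[OF q(1)] ident grading by (auto simp: planar_grading_def)
    obtain f where f: "f \<in> Hom U (pr ?i) (pr q)" "fst f = [?i, q]" using vertex_morphism[OF q(1)] by blast
    have o: "pr ?i \<in> Obj V" "pr q \<in> Obj V" using i q by (simp_all add: V_simps)
    have "f \<in> Rp (pr ?i) (pr q)" using RmV(2)[OF o] f i q by (simp add: V_simps nneg_def)
    moreover have "deg (pr ?i) = deg (pr q)" using d i q by simp
    moreover have "\<forall>f\<in>Rp (pr ?i) (pr q) - Isos V (pr ?i) (pr q). deg (pr ?i) < deg (pr q)"
      using reedy o unfolding generalized_reedy_def by blast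
    ultimately have "f \<in> Isos V (pr ?i) (pr q)" by (metis DiffI order_less_irrefl)
    then show "invertible q" using VV.isos_C[OF o] f(2) by (simp add: invs_def)
  qed
  have funV: "is_functor Tw V pr id"
    using functor_C VV.category_C unfolding is_functor_def by (simp add: V_simps Tw_obj U_obj)
  have opfV: "discrete_opfibration Tw V pr id"
    unfolding discrete_opfibration_def
  proof (intro conjI ballI funV)
    fix a y g assume a: "a \<in> Obj Tw" "y \<in> Obj V" "g \<in> Hom V (pr a) y"
    then have "y \<in> Obj U" "g \<in> Hom U (pr a) y" using A by (auto simp: V_simps U_obj)
    then show "\<exists>!(e, f). e \<in> Obj Tw \<and> f \<in> Hom Tw a e \<and> pr e = y \<and> id f = g"
      using opfib_C a(1) unfolding discrete_opfibration_def by blast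
  qed
  have map: "id ` R_minus P \<psi> triv Tw a e \<subseteq> Rm (pr a) (pr e) \<and> id ` R_plus \<psi> Tw a e \<subseteq> Rp (pr a) (pr e)"
    if "a \<in> Obj Tw" "e \<in> Obj Tw" for a e
  proof -
    note o = pr_obj[OF that(1)] pr_obj[OF that(2)]
    show ?thesis
      unfolding R_minus_C[OF that] R_plus_C RmU[OF o] using hom_CU[OF that] by auto
  qed
  have "generalized_reedy_map Tw (R_minus P \<psi> triv Tw) (R_plus \<psi> Tw) \<psi> V Rm Rp deg pr id"
    if g: "grading0_groupoid P \<psi>"
    unfolding generalized_reedy_map_def using reedyT[OF g] reedyV[OF g] funV d map by (simp add: Tw_obj)
  moreover have "orthogonal_factorization_system U Rm Rp"
    using UU.ofs_C[of Rm Rp] RmU by (simp add: U_obj)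
  moreover have "orthogonal_factorization_system V Rm Rp"
    using VV.ofs_C[of Rm Rp, OF RmV] .
  ultimately show ?thesis using opfib_C d reedyV conv opfV by blast
qed

end

section \<open>Targets in the rooted cases\<close>

text \<open>The planar and the symmetric case differ only in \<open>E\<close> and the layouts.
  \<open>tgt_E\<close> ties the target to substitution: vertex 0 at the bottom, the source on its
  marked input, the upper vertices on the inputs of the source.\<close>

locale rooted = enveloping P E nrm \<psi> D objs siz col lay U lab mk triv
  for P :: "('c, 'o, 'z) operad_scheme" and E nrm \<psi> D
    and objs :: "'a set" and siz col lay and U :: "('a, 'o list \<times> 'l) cat" and lab mk triv +
  fixes Tw :: "('o, 'o list \<times> 'l) cat" and pr :: "'o \<Rightarrow> 'a" and tgt :: "'o \<Rightarrow> 'o list \<times> 'l \<Rightarrow> 'o"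
  assumes D0: "0 \<in> D"
    and Tw_obj: "Obj Tw = Ops P"
    and Tw_hom_iff: "p \<in> Ops P \<Longrightarrow> f \<in> Hom Tw p t \<longleftrightarrow> (\<exists>y\<in>objs. f \<in> Hom U (pr p) y) \<and> tgt p f = t"
    and Tw_idm: "p \<in> Ops P \<Longrightarrow> Idm Tw p = Idm U (pr p)"
    and Tw_cmp: "Cmp Tw = Cmp U"
    and pr_objs: "p \<in> Ops P \<Longrightarrow> pr p \<in> objs"
    and pr_siz: "p \<in> Ops P \<Longrightarrow> siz (pr p) = arity P p"
    and pr_col: "p \<in> Ops P \<Longrightarrow> col (pr p) 0 = out P p"
      "p \<in> Ops P \<Longrightarrow> i < arity P p \<Longrightarrow> col (pr p) (Suc i) = ins P p ! i"
    and grading_pr: "p \<in> Ops P \<Longrightarrow> p' \<in> Ops P \<Longrightarrow> pr p = pr p' \<Longrightarrow> \<psi> p = \<psi> p'"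
    and tgt_E: "p \<in> Ops P \<Longrightarrow> y \<in> objs \<Longrightarrow> f \<in> Hom U (pr p) y \<Longrightarrow>
      E (subst (lab f ! 0) (\<lambda>v. if v = 0 then subst (p, [1..<Suc (arity P p)]) ((!) (lab f)) else unit_op (col y) v))
        (tgt p f, [1..<Suc (siz y)])"
begin

section \<open>The source and the target as substitutions\<close>

definition src :: "'o \<Rightarrow> 'o \<times> nat list" where
  "src p = (p, [1..<Suc (arity P p)])"

definition tfam :: "'o \<Rightarrow> 'a \<Rightarrow> ('o \<times> nat list) list \<Rightarrow> 'o \<times> nat list" where
  "tfam p y F = subst (F ! 0) (\<lambda>v. if v = 0 then subst (src p) ((!) F) else unit_op (col y) v)"

lemma set_src: "set (snd (src p)) = {1..arity P p}"
  by (auto simp: src_def)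

lemma notD: "w \<noteq> 0 \<Longrightarrow> w \<notin> D"
  using lower by blast

lemma wt_src: "p \<in> Ops P \<Longrightarrow> wt (col (pr p)) (out P p) (src p)"
  unfolding wt_def src_def using pr_col(2)
  by (auto intro!: nth_equalityI simp: arity_def simp del: upt_Suc)

lemma src_arg:
  assumes p: "p \<in> Ops P" and F: "mor (pr p) y F" and w: "w \<in> set (snd (src p))"
  shows "wt (col y) (col (pr p) w) (F ! w)"
  using mor_wt_upper[OF F _ notD, of w] w pr_siz[OF p] unfolding set_src by auto

lemma wt_src_subst:
  "p \<in> Ops P \<Longrightarrow> mor (pr p) y F \<Longrightarrow> wt (col y) (out P p) (subst (src p) ((!) F))"
  by (rule wt_subst[OF wt_src src_arg])

lemma tfam_arg:
  assumes p: "p \<in> Ops P" and y: "y \<in> objs" and F: "mor (pr p) y F" and v: "v \<in> set (snd (F ! 0))"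
  shows "wt (col y) (((col y)(0 := col (pr p) 0)) v)
    (if v = 0 then subst (src p) ((!) F) else unit_op (col y) v)"
  using wt_src_subst[OF p F] pr_col(1)[OF p] obj_cols[OF y mor_label[OF F le0 v]] by (auto intro: wt_unit)

lemma wt_tfam:
  assumes p: "p \<in> Ops P" and y: "y \<in> objs" and F: "mor (pr p) y F"
  shows "wt (col y) (col y 0) (tfam p y F)"
  unfolding tfam_def by (rule wt_subst[OF mor_wt_lower[OF F D0] tfam_arg[OF p y F]])

text \<open>Increasing labels mark a normal form, so here \<open>E\<close> is equality; a target is
  thereby determined by its class.\<close>

lemma E_sorted_eq:
  assumes "wt \<kappa> c (a, xs)" "E (a, xs) (a', xs)" "distinct xs" "sorted xs"
  shows "a = a'"
  using nrm_E[OF assms(1) _ assms(2)] nrm_sorted[OF assms(1)] nrm_sorted[OF E_wt[OF assms(1,2)]] assms(3,4)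
  by simp

context
  fixes p y f
  assumes p: "p \<in> Ops P" and y: "y \<in> objs" and f: "f \<in> Hom U (pr p) y"
begin

lemma tgt_tfam: "E (tfam p y (lab f)) (tgt p f, [1..<Suc (siz y)])"
  using tgt_E[OF p y f] unfolding tfam_def src_def .

lemma lab_mor': "mor (pr p) y (lab f)"
  using lab_mor[OF pr_objs[OF p] y f] .

lemma wt_tgt: "wt (col y) (col y 0) (tgt p f, [1..<Suc (siz y)])"
  using E_wt[OF wt_tfam[OF p y lab_mor'] tgt_tfam] .

lemma tgt_Ops: "tgt p f \<in> Ops P"
  using wt_tgt by (simp add: wt_def)

lemma pr_tgt: "pr (tgt p f) = y"
proof (rule obj_unique[OF pr_objs[OF tgt_Ops] y])
  note w = wt_tgt[unfolded wt_def fst_conv snd_conv]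
  show s: "siz (pr (tgt p f)) = siz y"
    using pr_siz[OF tgt_Ops] wt_arity[OF wt_tgt] by (simp del: upt_Suc)
  fix i assume i: "i \<le> siz y"
  show "col (pr (tgt p f)) i = col y i"
  proof (cases i)
    case 0
    then show ?thesis using pr_col(1)[OF tgt_Ops] w by simp
  next
    case (Suc k)
    then have "k < siz y" using i by simp
    moreover have "ins P (tgt p f) ! k = map (col y) [1..<Suc (siz y)] ! k" using w by simp
    ultimately show ?thesis
      using Suc pr_col(2)[OF tgt_Ops, of k] s pr_siz[OF tgt_Ops] by (simp del: upt_Suc)
  qed
qed

lemma tgt_obj: "tgt p f \<in> Ops P \<and> pr (tgt p f) = y"
  using tgt_Ops pr_tgt by blast

lemma tgt_src: "src (tgt p f) = (tgt p f, [1..<Suc (siz y)])"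
  using pr_siz[OF tgt_Ops] pr_tgt by (simp add: src_def)

lemma grading_tgt: "\<psi> (tgt p f) = \<psi> p + (\<Sum>q\<leftarrow>fst f. \<psi> q)"
proof -
  note F = lab_mor'
  let ?F = "lab f"
  have "\<psi> (tgt p f) = \<psi> (fst (tfam p y ?F))"
    using E_grading[OF wt_tfam[OF p y F] tgt_tfam] by simp
  also have "\<dots> = \<psi> (fst (?F ! 0)) +
      (\<Sum>v\<leftarrow>snd (?F ! 0). \<psi> (fst (if v = 0 then subst (src p) ((!) ?F) else unit_op (col y) v)))"
    unfolding tfam_def by (rule grading_subst[OF grading mor_wt_lower[OF F D0] tfam_arg[OF p y F]])
  also have "(\<Sum>v\<leftarrow>snd (?F ! 0). \<psi> (fst (if v = 0 then subst (src p) ((!) ?F) else unit_op (col y) v))) =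
      (\<Sum>v\<leftarrow>snd (?F ! 0). if v = 0 then \<psi> (fst (subst (src p) ((!) ?F))) else 0)"
    using mor_label[OF F, of 0] grading_unit[OF y] by (intro arg_cong[where f = sum_list] map_cong) auto
  also have "\<dots> = \<psi> (fst (subst (src p) ((!) ?F)))"
  proof -
    obtain l r where l: "snd (?F ! 0) = l @ 0 # r" "0 \<notin> set l" "0 \<notin> set r" by (rule mor_split[OF F D0])
    have "(\<Sum>v\<leftarrow>xs. if v = 0 then c else (0::int)) = 0" if "0 \<notin> set xs" for xs :: "nat list" and c
      using that by (induction xs) auto
    then show ?thesis using l by simp
  qed
  also have "\<dots> = \<psi> p + (\<Sum>w\<leftarrow>[1..<Suc (arity P p)]. \<psi> (fst (?F ! w)))"
    using grading_subst[OF grading wt_src[OF p] src_arg[OF p F]] by (simp add: src_def)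
  also have "\<psi> (fst (?F ! 0)) + (\<psi> p + (\<Sum>w\<leftarrow>[1..<Suc (arity P p)]. \<psi> (fst (?F ! w)))) =
      \<psi> p + (\<Sum>w\<leftarrow>[0..<Suc (arity P p)]. \<psi> (fst (?F ! w)))"
    using upt_conv_Cons[of 0 "Suc (arity P p)"] by (simp del: upt_Suc)
  also have "map (\<lambda>w. \<psi> (fst (?F ! w))) [0..<Suc (arity P p)] = map \<psi> (fst f)"
  proof -
    have "fst f = map fst ?F" using hom_lab[OF pr_objs[OF p] y f] by simp
    then show ?thesis using mor_len[OF F] pr_siz[OF p]
      by (intro nth_equalityI) (auto simp del: upt_Suc)
  qed
  finally show ?thesis .
qed

end

lemma tgt_idm:
  assumes p: "p \<in> Ops P" shows "tgt p (Idm U (pr p)) = p"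
proof -
  note x = pr_objs[OF p] and h = U_idm_hom[OF pr_objs[OF p]]
  have n: "idm (pr p) ! w = unit_op (col (pr p)) w" if "w \<le> siz (pr p)" for w
    using idm_nth[OF that] .
  have s: "subst (src p) ((!) (idm (pr p))) = src p"
    using n pr_siz[OF p] by (intro subst_unit'[OF wt_src[OF p]]) (auto simp: set_src)
  have "tfam p (pr p) (idm (pr p)) = src p"
    using unit_subst[of "col (pr p)" "col (pr p)" 0 "\<lambda>v. if v = 0 then src p else unit_op (col (pr p)) v"]
      wt_src[OF p] pr_col(1)[OF p] n[of 0] unfolding tfam_def s by simp
  then have "E (src p) (tgt p (Idm U (pr p)), [1..<Suc (arity P p)])"
    using tgt_tfam[OF p x h] lab_idm[OF x] pr_siz[OF p] by simp
  then show ?thesis using E_sorted_eq[of _ _ p] wt_src[OF p] unfolding src_def by (metis distinct_upt sorted_upt)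
qed

text \<open>As for associativity, both sides are related to an iterated substitution, here
  \<open>B\<close>: \<open>G ! 0\<close> at the bottom, on its marked input \<open>F ! 0\<close>, on
  the marked input of that the source with the upper vertices of \<open>F\<close>, and vertices of
  \<open>G\<close> on what remains open.\<close>

lemma tgt_cmp:
  assumes p: "p \<in> Ops P" and y: "y \<in> objs" and z: "z \<in> objs" and f: "f \<in> Hom U (pr p) y" and g: "g \<in> Hom U y z"
  shows "tgt (tgt p f) g = tgt p (Cmp U g f)"
proof -
  note x = pr_objs[OF p]
  define t where "t = tgt p f"
  have t: "t \<in> Ops P" "pr t = y" using tgt_Ops[OF p y f] pr_tgt[OF p y f] by (simp_all add: t_def)
  have g': "g \<in> Hom U (pr t) z" using g t by simp
  define F G H where "F = lab f" and "G = lab g" and "H = cmp (pr p) z G F"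
  have F: "mor (pr p) y F" and G: "mor y z G" using lab_mor x y z f g by (simp_all add: F_def G_def)
  have GF: "mor (pr p) z H" unfolding H_def by (rule comp_mor[OF x y z F G])
  note wF = mor_wt_lower[OF F D0] and wG = mor_wt_lower[OF G D0]
  have Gw: "wt (col z) (col y w) (G ! w)" "0 \<notin> set (snd (G ! w))" if "w \<le> siz y" "w \<noteq> 0" for w
    using mor_wt_upper[OF G that(1) notD[OF that(2)]] mor_nz[OF G that(1) notD[OF that(2)]] D0 by auto
  define A where "A = subst (F ! 0) (\<lambda>v. if v = 0 then subst (subst (src p) ((!) F)) ((!) G) else G ! v)"
  define SF where "SF = subst (src p) ((!) F)"
  have wSF: "wt (col y) (out P p) SF" unfolding SF_def by (rule wt_src_subst[OF p F])
  have TF: "E (tfam p y F) (src t)"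
    using tgt_tfam[OF p y f] tgt_src[OF p y f] by (simp add: F_def t_def)
  note wTF = wt_tfam[OF p y F]
  have labTF: "w \<le> siz y" "w \<noteq> 0" if "w \<in> set (snd (tfam p y F))" for w
  proof -
    have "w \<in> {1..arity P t}" using that mset_eq_setD[OF E_mset[OF wTF TF]] by (simp add: set_src)
    then show "w \<le> siz y" "w \<noteq> 0" using pr_siz[OF t(1)] t(2) by auto
  qed
  have labSF: "w \<in> set (snd (tfam p y F))" if "w \<in> set (snd SF)" for w
    using that mor_0[OF F D0] by (auto simp: tfam_def SF_def)
  have wSFG: "wt (col z) (out P p) (subst SF ((!) G))"
    using Gw(1) labSF labTF by (intro wt_subst[OF wSF]) auto
  have argA: "wt (col z) (((col y)(0 := col (pr p) 0)) v) (if v = 0 then subst SF ((!) G) else G ! v)"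
    if "v \<in> set (snd (F ! 0))" for v
    using wSFG pr_col(1)[OF p] Gw(1)[OF mor_label[OF F le0 that]] by auto
  have A: "A = subst (F ! 0) (\<lambda>v. if v = 0 then subst SF ((!) G) else G ! v)" unfolding A_def SF_def ..
  have wA: "wt (col z) (col y 0) A" unfolding A by (rule wt_subst[OF wF argA])
  have TFG: "subst (tfam p y F) ((!) G) = A"
  proof -
    have "subst (tfam p y F) ((!) G) =
      subst (F ! 0) (\<lambda>v. subst (if v = 0 then SF else unit_op (col y) v) ((!) G))"
      unfolding tfam_def SF_def
    proof (rule subst_assoc[OF wF tfam_arg[OF p y F]])
      fix v w assume v: "v \<in> set (snd (F ! 0))" "w \<in> set (snd (if v = 0 then subst (src p) ((!) F) else unit_op (col y) v))"
      then have "w \<in> (\<Union>v\<in>set (snd (F ! 0)). set (snd (if v = 0 then subst (src p) ((!) F) else unit_op (col y) v)))"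
        by blast
      then have "w \<in> set (snd (tfam p y F))" unfolding tfam_def by simp
      then show "wt (col z) (col y w) (G ! w)" using labTF Gw(1) by blast
    qed
    also have "\<dots> = A"
      unfolding A
    proof (rule subst_cong)
      fix v assume "v \<in> set (snd (F ! 0))"
      then show "subst (if v = 0 then SF else unit_op (col y) v) ((!) G) = (if v = 0 then subst SF ((!) G) else G ! v)"
        using unit_subst[of "col z" "col y" v "(!) G"] Gw(1)[OF mor_label[OF F le0]] by auto
    qed
    finally show ?thesis .
  qed
  have EA: "E A (subst (src t) ((!) G))"
    unfolding TFG[symmetric] using labTF Gw(1) by (intro E_subst[OF wTF _ TF]) (auto intro: E_refl)
  define B where "B = subst (G ! 0) (\<lambda>v. if v = 0 then A else unit_op (col z) v)"
  have argB: "wt (col z) (((col z)(0 := col y 0)) v) (if v = 0 then A else unit_op (col z) v)"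
    if "v \<in> set (snd (G ! 0))" for v
    using wA obj_cols[OF z mor_label[OF G le0 that]] by (auto intro: wt_unit)
  have wB: "wt (col z) (col z 0) B" unfolding B_def by (rule wt_subst[OF wG argB])
  have 1: "E B (tfam t z G)"
    unfolding B_def tfam_def
  proof (rule E_subst[OF wG argB E_refl[OF wG]])
    fix v assume "v \<in> set (snd (G ! 0))"
    then show "E (if v = 0 then A else unit_op (col z) v) (if v = 0 then subst (src t) ((!) G) else unit_op (col z) v)"
      using EA E_refl[OF argB, of v] by (cases "v = 0") auto
  qed
  define R where "R v = (if v = 0 then subst (src p) ((!) H) else unit_op (col z) v)" for v
  define K where "K = vert (pr p) z G F 0"
  have wK: "wt ((col z)(0 := col (pr p) 0)) (col z 0) K" and EK: "E K (H ! 0)"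
    using wt_vert[OF F G x z, of 0] cmp_E[OF F G x z, of 0] D0 by (simp_all add: K_def H_def vcol_def vout_def)
  have wR: "wt (col z) (((col z)(0 := col (pr p) 0)) v) (R v)" if "v \<in> set (snd K)" for v
    using tfam_arg[OF p z GF] that mset_eq_setD[OF E_mset[OF wK EK]] unfolding R_def by blast
  have "E (subst K R) (subst (H ! 0) R)"
    using wR by (intro E_subst[OF wK wR EK]) (auto intro: E_refl)
  then have KT: "E (subst K R) (tfam p z H)" unfolding tfam_def R_def .
  define FG where "FG = subst (F ! 0) (star (pr p) G)"
  have K: "K = subst (G ! 0) (\<lambda>v. if v = 0 then FG else unit_op (col z) v)"
    unfolding K_def FG_def vert_def using D0 by simp
  have "set (snd K) = (\<Union>v\<in>set (snd (G ! 0)). if v = 0 then set (snd FG) else {v})"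
    unfolding K by (auto split: if_splits)
  then have sub: "set (snd FG) \<subseteq> set (snd K)" "\<And>v. v \<in> set (snd (G ! 0)) \<Longrightarrow> v \<noteq> 0 \<Longrightarrow> v \<in> set (snd K)"
    using mor_0[OF G D0] by auto
  have "subst K R = subst (G ! 0) (\<lambda>v. subst (if v = 0 then FG else unit_op (col z) v) R)"
    unfolding K FG_def
  proof (rule subst_assoc[OF wG wt_lower_arg[OF F G x z D0]])
    fix v u assume "v \<in> set (snd (G ! 0))"
      "u \<in> set (snd (if v = 0 then subst (F ! 0) (star (pr p) G) else unit_op (col z) v))"
    then have "u \<in> set (snd K)" using sub unfolding FG_def by (auto simp del: snd_subst split: if_splits)
    then show "wt (col z) (((col z)(0 := col (pr p) 0)) u) (R u)" by (rule wR)
  qed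
  also have "\<dots> = subst (G ! 0) (\<lambda>v. if v = 0 then subst FG R else unit_op (col z) v)"
  proof (rule subst_cong)
    fix v assume v: "v \<in> set (snd (G ! 0))"
    show "subst (if v = 0 then FG else unit_op (col z) v) R = (if v = 0 then subst FG R else unit_op (col z) v)"
      using unit_subst[of "col z" "col z" v R] wR[OF sub(2)[OF v]] by (auto simp: R_def)
  qed
  finally have KR: "subst K R = subst (G ! 0) (\<lambda>v. if v = 0 then subst FG R else unit_op (col z) v)" .
  have "subst FG R = subst (F ! 0) (\<lambda>w. subst (star (pr p) G w) R)"
    unfolding FG_def
  proof (rule subst_assoc[OF wF wt_star[OF F G x D0]])
    fix w u assume "w \<in> set (snd (F ! 0))" "u \<in> set (snd (star (pr p) G w))"
    then have "u \<in> set (snd K)" using sub(1) by (auto simp: FG_def)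
    then show "wt (col z) (((col z)(0 := col (pr p) 0)) u) (R u)" by (rule wR)
  qed
  also have "\<dots> = subst (F ! 0) (\<lambda>w. if w = 0 then subst (src p) ((!) H) else G ! w)"
  proof (rule subst_cong)
    fix w assume w: "w \<in> set (snd (F ! 0))"
    show "subst (star (pr p) G w) R = (if w = 0 then subst (src p) ((!) H) else G ! w)"
    proof (cases "w = 0")
      case True
      then show ?thesis
        using unit_subst[of "col z" "col (pr p)" 0 R] wt_src_subst[OF p GF] pr_col(1)[OF p] by (simp add: star_def R_def)
    next
      case False
      note wy = mor_label[OF F le0 w]
      have "subst (G ! w) R = G ! w"
        using Gw[OF wy False] by (intro subst_unit'[OF Gw(1)[OF wy False]]) (auto simp: R_def)
      then show ?thesis using False by (simp add: star_def)
    qed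
  qed
  finally have FGR: "subst FG R = subst (F ! 0) (\<lambda>w. if w = 0 then subst (src p) ((!) H) else G ! w)" .
  have ES: "E (subst SF ((!) G)) (subst (src p) ((!) H))"
  proof -
    have "subst SF ((!) G) = subst (src p) (\<lambda>i. subst (F ! i) ((!) G))"
      unfolding SF_def
    proof (rule subst_assoc[OF wt_src[OF p] src_arg[OF p F]])
      fix i w assume "i \<in> set (snd (src p))" "w \<in> set (snd (F ! i))"
      then have "w \<in> set (snd SF)" by (auto simp: SF_def)
      then show "wt (col z) (col y w) (G ! w)" using labSF labTF Gw(1) by blast
    qed
    also have "E \<dots> (subst (src p) ((!) H))"
    proof (rule E_subst[OF wt_src[OF p] _ E_refl[OF wt_src[OF p]]])
      fix i assume "i \<in> set (snd (src p))"
      then have i: "i \<le> siz (pr p)" "i \<notin> D" using pr_siz[OF p] notD[of i] by (auto simp: set_src)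
      show "wt (col z) (col (pr p) i) (subst (F ! i) ((!) G))" "E (subst (F ! i) ((!) G)) (H ! i)"
        using wt_vert[OF F G x z i(1)] cmp_E[OF F G x z i(1)] i(2)
        by (simp_all add: vert_def vcol_def vout_def H_def)
    qed
    finally show ?thesis .
  qed
  have EFG: "E A (subst FG R)"
    unfolding FGR A
  proof (rule E_subst[OF wF argA E_refl[OF wF]])
    fix v assume "v \<in> set (snd (F ! 0))"
    then show "E (if v = 0 then subst SF ((!) G) else G ! v) (if v = 0 then subst (src p) ((!) H) else G ! v)"
      using ES E_refl[OF argA, of v] by (cases "v = 0") auto
  qed
  have "E B (subst K R)"
    unfolding B_def KR
  proof (rule E_subst[OF wG argB E_refl[OF wG]])
    fix v assume "v \<in> set (snd (G ! 0))"
    then show "E (if v = 0 then A else unit_op (col z) v) (if v = 0 then subst FG R else unit_op (col z) v)"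
      using EFG E_refl[OF argB, of v] by (cases "v = 0") auto
  qed
  then have 2: "E B (tfam p z H)" using E_trans[OF wB _ KT] by blast
  note c = U_comp[OF x y z f g]
  have 3: "E B (tgt t g, [1..<Suc (siz z)])" using E_trans[OF wB 1] tgt_tfam[OF t(1) z g'] by (simp add: G_def)
  have 4: "E B (tgt p (Cmp U g f), [1..<Suc (siz z)])"
    using E_trans[OF wB 2] tgt_tfam[OF p z c] lab_cmp[OF x y z f g] by (simp add: H_def G_def F_def)
  have "tgt t g = tgt p (Cmp U g f)"
    using E_sorted_eq[OF E_wt[OF wB 3] E_trans[OF E_wt[OF wB 3] E_sym[OF wB 3] 4]] by (simp del: upt_Suc)
  then show ?thesis by (simp add: t_def)
qed

lemma Tw_hom:
  assumes "p \<in> Ops P" "t \<in> Ops P"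
  shows "f \<in> Hom Tw p t \<longleftrightarrow> f \<in> Hom U (pr p) (pr t) \<and> tgt p f = t"
proof
  assume "f \<in> Hom Tw p t"
  then obtain y where y: "y \<in> objs" "f \<in> Hom U (pr p) y" "tgt p f = t" using Tw_hom_iff[OF assms(1)] by blast
  then show "f \<in> Hom U (pr p) (pr t) \<and> tgt p f = t" using pr_tgt[OF assms(1) y(1,2)] by simp
next
  assume "f \<in> Hom U (pr p) (pr t) \<and> tgt p f = t"
  then show "f \<in> Hom Tw p t" using Tw_hom_iff[OF assms(1)] pr_objs[OF assms(2)] by blast
qed

sublocale twisted P E nrm \<psi> D objs siz col lay U lab mk triv Tw pr tgt
  by (unfold_locales; (unfold Tw_obj)?;
      fact refl pr_objs Tw_hom Tw_idm Tw_cmp tgt_Ops pr_tgt tgt_idm tgt_cmp pr_siz pr_col grading_tgt grading_pr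
        tgt_obj)

end

section \<open>Profiles as objects\<close>

definition psiz :: "'c list \<times> 'c \<Rightarrow> nat" where
  "psiz x = length (fst x)"

definition pcol :: "'c list \<times> 'c \<Rightarrow> nat \<Rightarrow> 'c" where
  "pcol x i = (snd x # fst x) ! i"

lemma pcol_0 [simp]: "pcol x 0 = snd x"
  by (simp add: pcol_def)

lemma pcol_Suc [simp]: "pcol x (Suc i) = fst x ! i"
  by (simp add: pcol_def)

lemma pcol_map: "map (pcol x) [1..<Suc (psiz x)] = fst x"
  by (intro nth_equalityI) (simp_all add: psiz_def del: upt_Suc)

lemma Profiles_iff: "x \<in> Profiles P \<longleftrightarrow> set (fst x) \<subseteq> Cols P \<and> snd x \<in> Cols P"
  by (cases x) (auto simp: Profiles_def)

lemma pcol_Cols: "x \<in> Profiles P \<Longrightarrow> i \<le> psiz x \<Longrightarrow> pcol x i \<in> Cols P"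
  by (cases i) (auto simp: Profiles_iff psiz_def subset_iff)

lemma profile_exists:
  assumes "\<And>i. i \<le> n \<Longrightarrow> \<gamma> i \<in> Cols P"
  shows "\<exists>x\<in>Profiles P. psiz x = n \<and> (\<forall>i\<le>n. pcol x i = \<gamma> i)"
proof (intro bexI[of _ "(map \<gamma> [1..<Suc n], \<gamma> 0)"] conjI allI impI)
  fix i assume "i \<le> n"
  then show "pcol (map \<gamma> [1..<Suc n], \<gamma> 0) i = \<gamma> i" by (cases i) (simp_all del: upt_Suc)
qed (use assms in \<open>auto simp: psiz_def Profiles_iff simp del: upt_Suc\<close>)

lemma profile_unique:
  assumes "psiz x = psiz y" "\<And>i. i \<le> psiz y \<Longrightarrow> pcol x i = pcol y i"
  shows "x = y"
proof (rule prod_eqI)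
  show "fst x = fst y"
  proof (rule nth_equalityI)
    show "length (fst x) = length (fst y)" using assms(1) by (simp add: psiz_def)
    fix i assume "i < length (fst x)"
    then show "fst x ! i = fst y ! i" using assms(1) assms(2)[of "Suc i"] by (simp add: psiz_def)
  qed
  show "snd x = snd y" using assms(2)[of 0] by simp
qed

context planar_operad
begin

lemma profile_Profiles: "p \<in> Ops P \<Longrightarrow> profile P p \<in> Profiles P"
  using colours by (auto simp: profile_def Profiles_iff)

lemma profile_cols: "psiz (profile P p) = arity P p" "pcol (profile P p) 0 = out P p"
    "pcol (profile P p) (Suc i) = ins P p ! i"
  by (simp_all add: psiz_def profile_def arity_def)

text \<open>Turns a position into a label, so that partial composites at the marked input can be
  compared with substitutions.\<close>

lemma pcomp_wt:
  assumes X: "wt \<kappa> c X" and s: "snd X = l @ v # r" "v \<notin> set l" "v \<notin> set r"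
  shows "pcomp P (fst X) (Suc (length l)) q = plug P (fst X) (map (\<lambda>u. if u = v then q else ident P (\<kappa> u)) (snd X))"
proof -
  have "(map (ident P) (ins P (fst X)))[length l := q] = map (\<lambda>u. if u = v then q else ident P (\<kappa> u)) (snd X)"
  proof -
    have i: "ins P (fst X) = map \<kappa> (l @ v # r)" using X s(1) by (simp add: wt_def)
    have "map (\<lambda>u. if u = v then q else ident P (\<kappa> u)) xs = map (\<lambda>u. ident P (\<kappa> u)) xs" if "v \<notin> set xs" for xs
      using that by auto
    then show ?thesis unfolding i s(1) using s(2,3) by (simp add: list_update_append comp_def)
  qed
  then show ?thesis by (simp add: pcomp_def)
qed

end

lemma map2_concat_eq:
  assumes "map length xss = map length yss" "concat xss = concat yss"
  shows "xss = yss"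
  using assms by (intro concat_injective) (auto simp: list_eq_iff_nth_eq in_set_zip)

section \<open>The planar case\<close>

text \<open>The mark 0 splits the lower vertex into \<open>l\<close> and \<open>r\<close>. Going
  around the plane tree from left to right one meets \<open>l\<close>, then the leaves of the upper
  vertices, then \<open>r\<close>, and these must be numbered consecutively.\<close>

definition pl_lay :: "nat list list \<Rightarrow> bool" where
  "pl_lay ls \<longleftrightarrow> (\<exists>l r. hd ls = l @ 0 # r \<and> l @ concat (tl ls) @ r = [1..<length (concat ls)])"

definition pl_lab :: "('c, 'o, 'z) operad_scheme \<Rightarrow> 'o pl_mor \<Rightarrow> ('o \<times> nat list) list" where
  "pl_lab P f = map (\<lambda>j. (fst f ! j,
     map (\<lambda>k. if j = 0 \<and> k = snd f then 0 else pl_num P f j k) [1..<Suc (arity P (fst f ! j))])) [0..<length (fst f)]"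

definition pl_mk :: "('o \<times> nat list) list \<Rightarrow> 'o pl_mor" where
  "pl_mk L = (map fst L, Suc (length (takeWhile (\<lambda>w. w \<noteq> 0) (snd (L ! 0)))))"

lemma pl_lay_length:
  assumes "hd ls = l @ 0 # r" "ls \<noteq> []"
  shows "length (concat ls) = Suc (length l + length (concat (tl ls)) + length r)"
  using assms by (cases ls) auto

text \<open>Once the number of labels of each vertex and the place of the mark are fixed, a planar
  layout has no freedom left. A family is recovered from its tuple in this way.\<close>

lemma pl_lay_unique:
  assumes ls: "hd ls = l @ 0 # r" "l @ concat (tl ls) @ r = [1..<M]"
    and ls': "hd ls' = l' @ 0 # r'" "l' @ concat (tl ls') @ r' = [1..<M]"
    and len: "map length ls = map length ls'" "length l = length l'" and ne: "ls \<noteq> []"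
  shows "ls = ls'"
proof -
  have ne': "ls' \<noteq> []" using len(1) ne by auto
  have tl: "map length (tl ls) = map length (tl ls')" using len(1) by (simp add: map_tl)
  then have "length (concat (tl ls)) = length (concat (tl ls'))" by (simp add: length_concat)
  moreover have "l @ concat (tl ls) @ r = l' @ concat (tl ls') @ r'" using ls(2) ls'(2) by simp
  ultimately have "l = l'" "concat (tl ls) = concat (tl ls')" "r = r'"
    using len(2) by (simp_all add: append_eq_append_conv)
  then have "tl ls = tl ls'" "hd ls = hd ls'" using map2_concat_eq[OF tl] ls(1) ls'(1) by simp_all
  then show ?thesis using ne ne' by (simp add: list.expand)
qed

lemma upt_append3: "i \<le> j \<Longrightarrow> j \<le> k \<Longrightarrow> [i..<k] = [i..<j] @ [j..<k]"
  using upt_add_eq_append[of i j "k - j"] by simp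

lemma concat_consecutive:
  "concat (map (\<lambda>j. [c + (\<Sum>a\<in>{1..<j}. m a)..<c + (\<Sum>a\<in>{1..<Suc j}. m a)]) [1..<Suc n]) =
   [c..<c + (\<Sum>a\<in>{1..<Suc n}. m a)]" for c :: nat
proof (induction n)
  case (Suc n)
  have "(\<Sum>a\<in>{1..<Suc (Suc n)}. m a) = (\<Sum>a\<in>{1..<Suc n}. m a) + m (Suc n)"
    "[1..<Suc (Suc n)] = [1..<Suc n] @ [Suc n]" by simp_all
  then show ?case
    using Suc upt_add_eq_append[of c "c + (\<Sum>a\<in>{1..<Suc n}. m a)" "m (Suc n)"]
    by (simp add: add.assoc del: upt_Suc sum.op_ivl_Suc)
qed simp

lemma pl_lab_lay:
  assumes i: "1 \<le> i" "i \<le> arity P (qs ! 0)" and qs: "qs \<noteq> []"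
  defines "ls \<equiv> map snd (pl_lab P (qs, i))"
  obtains r where "hd ls = [1..<i] @ 0 # r" "[1..<i] @ concat (tl ls) @ r = [1..<length (concat ls)]"
proof -
  define m where "m j = arity P (qs ! j)" for j
  define N where "N = (\<Sum>a\<in>{1..<length qs}. m a)"
  define r where "r = [i + N..<m 0 + N]"
  obtain n where n: "length qs = Suc n" using qs by (cases qs) auto
  have ls: "ls = map (\<lambda>j. map (\<lambda>k. if j = 0 \<and> k = i then 0 else pl_num P (qs, i) j k) [1..<Suc (m j)]) [0..<Suc n]"
    unfolding ls_def pl_lab_def m_def n by (simp add: comp_def n del: upt_Suc)
  have up: "[0..<Suc n] = 0 # [1..<Suc n]" using upt_conv_Cons[of 0 "Suc n"] by (simp del: upt_Suc)
  have "[1..<Suc (m 0)] = [1..<i] @ i # [Suc i..<Suc (m 0)]"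
    using i upt_append3[of 1 i "Suc (m 0)"] upt_conv_Cons[of i "Suc (m 0)"] unfolding m_def
    by (simp del: upt_Suc)
  moreover have "map (\<lambda>k. if k = i then 0 else pl_num P (qs, i) 0 k) [Suc i..<Suc (m 0)] = r"
    using i unfolding r_def by (intro nth_equalityI) (auto simp: N_def m_def simp del: upt_Suc)
  moreover have "map (\<lambda>k. if k = i then 0 else pl_num P (qs, i) 0 k) [1..<i] = [1..<i]"
    by (rule map_idI) auto
  ultimately have hd: "hd ls = [1..<i] @ 0 # r"
    unfolding ls up by simp
  have "map (\<lambda>k. if j = 0 \<and> k = i then 0 else pl_num P (qs, i) j k) [1..<Suc (m j)] =
      [i + (\<Sum>a\<in>{1..<j}. m a)..<i + (\<Sum>a\<in>{1..<Suc j}. m a)]" if "j \<in> set [1..<Suc n]" for j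
    using that i by (intro nth_equalityI) (auto simp: m_def simp del: upt_Suc)
  then have "tl ls = map (\<lambda>j. [i + (\<Sum>a\<in>{1..<j}. m a)..<i + (\<Sum>a\<in>{1..<Suc j}. m a)]) [1..<Suc n]"
    unfolding ls up list.map list.sel by (intro map_cong refl)
  then have tl: "concat (tl ls) = [i..<i + N]"
    using concat_consecutive[of i m n] by (simp only: N_def n)
  have len: "length (concat ls) = m 0 + N"
    using pl_lay_length[OF hd] i unfolding tl r_def by (simp add: ls m_def del: upt_Suc)
  have "[1..<i] @ concat (tl ls) @ r = [1..<length (concat ls)]"
    unfolding tl len r_def using i upt_append3[of 1 i "i + N"]
      upt_append3[of 1 "i + N" "m 0 + N"] by (simp add: m_def)
  then show ?thesis using that hd by blast
qed

locale graded_planar = planar_operad P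
  for P :: "('c, 'o, 'z) operad_scheme" +
  fixes \<psi> :: "'o \<Rightarrow> int"
  assumes gr: "planar_grading P \<psi>" and ni: "nice P \<psi>" and dep: "grading_depends_on_colours P \<psi>"
begin

text \<open>Without group actions there is nothing to normalize, so \<open>E\<close> is equality and
  the normal form is \<open>id\<close>; the labels are pinned down by \<open>pl_lay\<close>
  instead.\<close>

sublocale fam: labelled_families P "(=)" id \<psi> "{0}" "Profiles P" psiz pcol pl_lay
proof unfold_locales
  fix X Y :: "'o \<times> nat list" and F F' :: "nat \<Rightarrow> 'o \<times> nat list"
  assume "X = Y" "\<And>x. x \<in> set (snd X) \<Longrightarrow> F x = F' x"
  then show "subst X F = subst Y F'" using subst_cong by metis
next
  fix n and \<gamma> :: "nat \<Rightarrow> 'c" assume "\<And>i. i \<le> n \<Longrightarrow> \<gamma> i \<in> Cols P"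
  then show "\<exists>x\<in>Profiles P. psiz x = n \<and> (\<forall>i\<le>n. pcol x i = \<gamma> i)" by (rule profile_exists)
next
  fix x y :: "'c list \<times> 'c" assume "psiz x = psiz y" "\<And>i. i \<le> psiz y \<Longrightarrow> pcol x i = pcol y i"
  then show "x = y" by (rule profile_unique)
next
  fix p assume "p \<in> Ops P"
  then show "-1 \<le> \<psi> p" "\<psi> p = -1 \<Longrightarrow> arity P p = 0" using ni unfolding nice_def by blast+
qed (simp_all add: pcol_Cols gr)

lemma lay_mor:
  assumes L: "fam.mor x y L"
  obtains l r where "snd (L ! 0) = l @ 0 # r" "0 \<notin> set l" "0 \<notin> set r"
    "l @ concat (map snd (tl L)) @ r = [1..<Suc (psiz y)]"
proof -
  have ne: "L \<noteq> []" using fam.mor_len[OF L] by auto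
  obtain l r where l: "hd (map snd L) = l @ 0 # r"
      "l @ concat (tl (map snd L)) @ r = [1..<length (concat (map snd L))]"
    using fam.mor_lay[OF L] unfolding pl_lay_def by blast
  have "length (concat (map snd L)) = Suc (psiz y)"
    using mset_eq_length[OF fam.mor_mset[OF L]] by simp
  moreover have "snd (L ! 0) = l @ 0 # r" using l ne by (simp add: hd_map hd_conv_nth)
  ultimately show ?thesis using that l fam.mor_distinct[OF L, of 0] by (simp add: map_tl)
qed

sublocale cat: family_category P "(=)" id \<psi> "{0}" "Profiles P" psiz pcol pl_lay
proof unfold_locales
  fix x y z F G assume F: "fam.mor x y F" and G: "fam.mor y z G"
  obtain l r where f: "snd (F ! 0) = l @ 0 # r" "l @ concat (map snd (tl F)) @ r = [1..<Suc (psiz y)]"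
    by (rule lay_mor[OF F])
  obtain l' r' where g: "snd (G ! 0) = l' @ 0 # r'" "l' @ concat (map snd (tl G)) @ r' = [1..<Suc (psiz z)]"
    by (rule lay_mor[OF G])
  let ?V = "\<lambda>i. snd (fam.vert x z G F i)"
  define H where "H ws = concat (map (\<lambda>w. snd (G ! w)) ws)" for ws
  have H: "H (as @ bs) = H as @ H bs" for as bs by (simp add: H_def)
  have up: "[0..<Suc (psiz x)] = 0 # [1..<Suc (psiz x)]" using upt_conv_Cons[of 0 "Suc (psiz x)"] by (simp del: upt_Suc)
  have c: "map snd (fam.cmp x z G F) = map ?V (0 # [1..<Suc (psiz x)])"
    unfolding fam.cmp_def up by (simp add: comp_def del: upt_Suc)
  have v0: "?V 0 = (l' @ H l) @ 0 # H r @ r'"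
    using fam.vert_0_labels[OF F G _ f(1) g(1)] by (simp add: H_def)
  have v: "concat (map ?V [1..<Suc (psiz x)]) = H (concat (map snd (tl F)))"
    using fam.upper_labels[OF F] by (simp add: H_def)
  have "length (concat (map ?V [0..<Suc (psiz x)])) = Suc (psiz z)"
    using mset_eq_length[OF fam.vert_mset[OF F G]] by simp
  then have len: "length (concat (map snd (fam.cmp x z G F))) = Suc (psiz z)"
    unfolding c up .
  have "H [1..<Suc (psiz y)] = concat (map snd (tl G))"
  proof -
    have "tl G = map ((!) G) [1..<Suc (psiz y)]"
      using fam.mor_len[OF G] by (intro nth_equalityI) (auto simp: nth_tl simp del: upt_Suc)
    then show ?thesis by (simp add: H_def comp_def del: upt_Suc)
  qed
  \<comment> \<open>\<open>H\<close> replaces labels of \<open>F\<close> by those of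
    \<open>G\<close>. Applied to the layout of \<open>F\<close>, which reads 1, 2, ..., it produces
    the leaves of the upper vertices of \<open>G\<close> in order, the middle stretch of the layout
    of \<open>G\<close>.\<close>
  then have "(l' @ H l) @ H (concat (map snd (tl F))) @ (H r @ r') = [1..<Suc (psiz z)]"
    using g(2) f(2) by (metis H append.assoc)
  then show "pl_lay (map snd (fam.cmp x z G F))"
    unfolding pl_lay_def len unfolding c using v0 v by (intro exI[of _ "l' @ H l"] exI[of _ "H r @ r'"]) (simp del: upt_Suc)
next
  fix ls :: "nat list list" and m assume c: "concat ls = [0..<Suc m]" "ls \<noteq> []" "0 \<in> {0::nat} \<Longrightarrow> hd ls = [0]"
  then have "concat ls = 0 # concat (tl ls)" by (cases ls) auto
  then have "concat (tl ls) = [1..<Suc m]" using c(1) upt_conv_Cons[of 0 "Suc m"] by (simp del: upt_Suc)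
  then show "pl_lay ls"
    unfolding pl_lay_def c(1) using c(3) by (intro exI[of _ "[]"]) (simp del: upt_Suc)
next
  fix ls ls' :: "nat list list"
  assume c: "pl_lay ls" "ls \<noteq> []" "ls' \<noteq> []" "0 \<in> {0::nat} \<Longrightarrow> hd ls = hd ls'" "concat ls = concat ls'"
  then have "concat (tl ls) = concat (tl ls')" by (cases ls; cases ls') auto
  then show "pl_lay ls'" using c unfolding pl_lay_def by simp
next
  fix \<pi> \<rho> :: "nat \<Rightarrow> nat" and n
  assume l: "pl_lay (map (\<lambda>i. [\<pi> i]) [0..<Suc n])" and z: "0 \<in> {0::nat} \<Longrightarrow> \<pi> 0 = 0"
    and inv: "\<And>i. i \<le> n \<Longrightarrow> \<rho> (\<pi> i) = i"
  have up: "[0..<Suc n] = 0 # [1..<Suc n]" using upt_conv_Cons[of 0 "Suc n"] by (simp del: upt_Suc)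
  have len: "length (concat (map (\<lambda>i. [\<pi> i]) [0..<Suc n])) = Suc n" by (simp add: length_concat comp_def del: upt_Suc)
  obtain l' r' where lr: "[0] = l' @ 0 # r'" "l' @ map \<pi> [1..<Suc n] @ r' = [1..<Suc n]"
    using l[unfolded pl_lay_def len] z unfolding up by (auto simp del: upt_Suc)
  \<comment> \<open>Vertex 0 has no label besides the mark, so the other legs must already be in
    order: the only planar permutation of legs is the identity.\<close>
  then have "l' = []" "r' = []" by (auto simp: Cons_eq_append_conv)
  then have m: "map \<pi> [1..<Suc n] = [1..<Suc n]" using lr by simp
  have pi: "\<pi> i = i" if "i \<le> n" for i
  proof (cases i)
    case (Suc k)
    then show ?thesis using arg_cong[OF m, of "\<lambda>xs. xs ! k"] that by (simp del: upt_Suc)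
  qed (use z in simp)
  have "\<rho> i = \<pi> i" if "i \<le> n" for i using pi[OF that] inv[OF that] by simp
  then have "map (\<lambda>i. [\<rho> i]) [0..<Suc n] = map (\<lambda>i. [\<pi> i]) [0..<Suc n]"
    by (intro map_cong refl) (simp add: less_Suc_eq_le del: upt_Suc)
  then show "pl_lay (map (\<lambda>i. [\<rho> i]) [0..<Suc n])" using l by (simp only:)
qed

section \<open>Planar tuples as families\<close>

lemma pl_hom: "f \<in> Hom (pl_U P) x y \<longleftrightarrow> pl_tuple P x f \<and> pl_target_profile P f = y"
  by (simp add: pl_U_def)

lemma length_pl_lab [simp]: "length (pl_lab P f) = length (fst f)"
  by (simp add: pl_lab_def)

lemma fst_pl_lab: "map fst (pl_lab P f) = fst f"
  by (intro nth_equalityI) (simp_all add: pl_lab_def)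

lemma pl_lab_nth: "j < length (fst f) \<Longrightarrow> fst (pl_lab P f ! j) = fst f ! j \<and>
    length (snd (pl_lab P f ! j)) = arity P (fst f ! j)"
  by (simp add: pl_lab_def del: upt_Suc)

lemma pl_mk_eq: "snd (L ! 0) = l @ 0 # r \<Longrightarrow> 0 \<notin> set l \<Longrightarrow> pl_mk L = (map fst L, Suc (length l))"
proof -
  assume "snd (L ! 0) = l @ 0 # r" "0 \<notin> set l"
  moreover have "takeWhile (\<lambda>w. w \<noteq> 0) (l @ 0 # r) = l" using calculation(2) by (induction l) auto
  ultimately show ?thesis by (simp add: pl_mk_def)
qed

lemma pl_hom_lab:
  assumes f: "f \<in> Hom (pl_U P) x y"
  shows "fam.mor x y (pl_lab P f)" "pl_mk (pl_lab P f) = f"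
proof -
  obtain qs i where f': "f = (qs, i)" by (cases f)
  obtain cs c0 where x: "x = (cs, c0)" by (cases x)
  note t = f[unfolded pl_hom f' x, simplified]
  have qs: "qs \<noteq> []" "length qs = Suc (length cs)" using t by auto
  define ls where "ls = map snd (pl_lab P (qs, i))"
  have i: "1 \<le> i" "i \<le> arity P (qs ! 0)" using t by auto
  obtain r where l: "hd ls = [1..<i] @ 0 # r" "[1..<i] @ concat (tl ls) @ r = [1..<length (concat ls)]"
    unfolding ls_def by (rule pl_lab_lay[OF i qs(1)])
  have len: "map length ls = map (arity P) qs"
    unfolding ls_def using pl_lab_nth[of _ "(qs, i)"] by (intro nth_equalityI) auto
  have lls: "length ls = length qs" by (simp add: ls_def)
  then have ne: "ls \<noteq> []" "length ls = length qs" using qs by auto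
  have ls0: "snd (pl_lab P (qs, i) ! 0) = [1..<i] @ 0 # r"
    using l(1) ne qs unfolding ls_def by (simp add: hd_map hd_conv_nth)
  have y: "fst y = take (i - 1) (ins P (qs ! 0)) @ concat (map (ins P) (tl qs)) @ drop i (ins P (qs ! 0))"
    "snd y = out P (qs ! 0)" using t by auto
  have arsum: "length (concat (tl ls)) = length (concat (map (ins P) (tl qs)))"
    using len by (simp add: length_concat map_tl comp_def arity_def[abs_def])
  have ar0: "length (hd ls) = arity P (qs ! 0)"
    using len ne qs by (metis hd_conv_nth hd_map)
  have psiz: "Suc (psiz y) = length (concat ls)"
  proof -
    have "1 \<le> i" "i \<le> arity P (qs ! 0)" using t by auto
    then show ?thesis
      using pl_lay_length[OF l(1) ne(1)] ar0 arsum unfolding psiz_def y l(1) by (simp add: arity_def)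
  qed
  have m: "map (pcol y) [1..<i] @ map (pcol y) (concat (tl ls)) @ map (pcol y) r = fst y"
    using arg_cong[OF l(2), of "map (pcol y)"] pcol_map[of y] psiz by simp
  \<comment> \<open>The colours of the target split into three stretches of known lengths: left of
    the mark, upper vertices, right of the mark.\<close>
  then have m1: "map (pcol y) [1..<i] = take (i - 1) (ins P (qs ! 0))"
    "map (pcol y) (concat (tl ls)) = concat (map (ins P) (tl qs))"
    "map (pcol y) r = drop i (ins P (qs ! 0))"
    unfolding y using arsum t by (auto simp: append_eq_append_conv arity_def simp del: upt_Suc)
  have "map (map (pcol y)) (tl ls) = map (ins P) (tl qs)"
  proof (rule map2_concat_eq)
    have "map length (tl ls) = map (arity P) (tl qs)" using len by (simp only: map_tl)
    then show "map length (map (map (pcol y)) (tl ls)) = map length (map (ins P) (tl qs))"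
      by (simp add: comp_def arity_def[abs_def])
    show "concat (map (map (pcol y)) (tl ls)) = concat (map (ins P) (tl qs))"
      using m1(2) by (simp only: map_concat)
  qed
  then have m2: "map (pcol y) (tl ls ! k) = ins P (tl qs ! k)" if "k < length cs" for k
    using that qs ne by (metis length_tl nth_map diff_Suc_1)
  have wt: "wt (fam.vcol x y j) (fam.vout x y j) (pl_lab P (qs, i) ! j)" if "j \<le> psiz x" for j
  proof (cases j)
    case 0
    have "0 \<notin> set r"
      using l(2) by (metis Un_iff atLeastLessThan_iff not_one_le_zero set_append set_upt)
    then have "map ((pcol y)(0 := pcol x 0)) ([1..<i] @ 0 # r) =
        take (i - 1) (ins P (qs ! 0)) @ c0 # drop i (ins P (qs ! 0))"
      using m1(1,3) x by (simp del: upt_Suc)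
    also have "\<dots> = ins P (qs ! 0)"
    proof -
      obtain k where "i = Suc k" using t by (cases i) auto
      then show ?thesis using t id_take_nth_drop[of k "ins P (qs ! 0)"] by (auto simp: arity_def)
    qed
    finally show ?thesis
      using 0 t qs y(2) ls0 pl_lab_nth[of 0 "(qs, i)"] nth_mem[of 0 qs]
      by (auto simp: wt_def fam.vcol_def fam.vout_def)
  next
    case (Suc k)
    then have k: "k < length cs" using that by (simp add: x psiz_def)
    then have "snd (pl_lab P (qs, i) ! j) = tl ls ! k"
      using qs Suc unfolding ls_def by (simp add: nth_tl)
    then show ?thesis
      using Suc t k m2[OF k] qs pl_lab_nth[of j "(qs, i)"] nth_mem[of j qs] x
      by (auto simp: wt_def fam.vcol_def fam.vout_def nth_tl)
  qed
  show "fam.mor x y (pl_lab P f)"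
    unfolding fam.mor_def f'
  proof (intro conjI allI impI)
    show "mset (concat (map snd (pl_lab P (qs, i)))) = mset [0..<Suc (psiz y)]"
    proof -
      have "concat ls = hd ls @ concat (tl ls)" using ne by (cases ls) auto
      then have m: "mset (concat ls) = mset (0 # [1..<length (concat ls)])"
        unfolding l(2)[symmetric] l(1) by simp
      have u: "[0..<length (concat ls)] = 0 # [1..<length (concat ls)]"
        unfolding psiz[symmetric] One_nat_def by (rule upt_conv_Cons) simp
      show ?thesis unfolding ls_def[symmetric] psiz u by (rule m)
    qed
    show "pl_lay (map snd (pl_lab P (qs, i)))"
      unfolding pl_lay_def using l unfolding ls_def by blast
    show "length (pl_lab P (qs, i)) = Suc (psiz x)" using qs x by (simp add: psiz_def)
    show "0 \<in> set (snd (pl_lab P (qs, i) ! 0))" unfolding ls0 by simp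
    fix j assume "j \<le> psiz x"
    then show "wt (fam.vcol x y j) (fam.vout x y j) (pl_lab P (qs, i) ! j)" by (rule wt)
  qed simp
  show "pl_mk (pl_lab P f) = f"
    using pl_mk_eq[OF ls0] t fst_pl_lab[of "(qs, i)"] unfolding f' by simp
qed

lemma pl_hom_mk:
  assumes L: "fam.mor x y L"
  shows "pl_mk L \<in> Hom (pl_U P) x y" "pl_lab P (pl_mk L) = L"
proof -
  obtain l r where l: "snd (L ! 0) = l @ 0 # r" "0 \<notin> set l" "0 \<notin> set r"
    "l @ concat (map snd (tl L)) @ r = [1..<Suc (psiz y)]"
    by (rule lay_mor[OF L])
  define qs where "qs = map fst L"
  have mk: "pl_mk L = (qs, Suc (length l))" using pl_mk_eq[OF l(1,2)] by (simp add: qs_def)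
  have len: "length L = Suc (psiz x)" by (rule fam.mor_len[OF L])
  then have q0: "qs ! 0 = fst (L ! 0)" and ne: "L \<noteq> []" by (auto simp: qs_def)
  have w0: "wt ((pcol y)(0 := pcol x 0)) (pcol y 0) (L ! 0)" using fam.mor_wt_lower[OF L] by simp
  then have i0: "ins P (qs ! 0) = map (pcol y) l @ snd x # map (pcol y) r"
    using l(1-3) by (auto simp: wt_def q0)
  have wj: "wt (pcol y) (pcol x (Suc k)) (L ! Suc k)" if "k < psiz x" for k
    using fam.mor_wt_upper[OF L, of "Suc k"] that by simp
  have "map (ins P) (tl qs) = map (map (pcol y)) (map snd (tl L))"
    using wj len unfolding qs_def by (intro nth_equalityI) (auto simp: nth_tl wt_def)
  then have "concat (map (ins P) (tl qs)) = map (pcol y) (concat (map snd (tl L)))"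
    by (simp add: map_concat)
  then have "pl_target_profile P (qs, Suc (length l)) = (map (pcol y) [1..<Suc (psiz y)], snd y)"
    using i0 w0 l(4)[symmetric] by (simp add: wt_def q0)
  then have tp: "pl_target_profile P (qs, Suc (length l)) = y" unfolding pcol_map by simp
  have "set qs \<subseteq> Ops P" using cat.mor_Ops[OF L] len by (simp add: qs_def image_subset_iff all_set_conv_all_nth less_Suc_eq_le)
  moreover have "out P (qs ! Suc k) = fst x ! k" if "k < psiz x" for k
    using wj[OF that] that len by (simp add: wt_def qs_def)
  then have "\<forall>j\<in>{1..psiz x}. out P (qs ! j) = fst x ! (j - 1)"
    by (metis One_nat_def Suc_le_lessD Suc_pred atLeastAtMost_iff less_eq_Suc_le)
  ultimately have "pl_tuple P x (qs, Suc (length l))"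
    using i0 len by (cases x) (auto simp: qs_def psiz_def arity_def nth_append)
  then show hom: "pl_mk L \<in> Hom (pl_U P) x y" using tp by (simp add: pl_hom mk)
  have L': "fam.mor x y (pl_lab P (pl_mk L))" using pl_hom_lab(1)[OF hom] .
  obtain l' r' where l': "snd (pl_lab P (pl_mk L) ! 0) = l' @ 0 # r'" "0 \<notin> set l'"
    "l' @ concat (map snd (tl (pl_lab P (pl_mk L)))) @ r' = [1..<Suc (psiz y)]"
    by (rule lay_mor[OF L'])
  have "length l' = length l"
    using pl_mk_eq[OF l'(1,2)] pl_hom_lab(2)[OF hom] mk by simp
  moreover have len': "length (pl_lab P (pl_mk L)) = length L" by (simp add: mk qs_def)
  moreover have fs: "fst (pl_lab P (pl_mk L) ! j) = fst (L ! j) \<and>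
      length (snd (pl_lab P (pl_mk L) ! j)) = length (snd (L ! j))" if "j < length L" for j
  proof -
    have "j \<le> psiz x" using that len by simp
    then show ?thesis
      using pl_lab_nth[of j "pl_mk L"] wt_arity[OF fam.mor_wt[OF L]] that by (simp add: mk qs_def)
  qed
  ultimately have ml: "map length (map snd (pl_lab P (pl_mk L))) = map length (map snd L)"
    and ll: "length l' = length l"
    by (auto intro: nth_equalityI)
  have ne': "pl_lab P (pl_mk L) \<noteq> []" using len' ne by (metis length_0_conv)
  have "map snd (pl_lab P (pl_mk L)) = map snd L"
  proof (rule pl_lay_unique[OF _ _ _ _ ml ll])
    show "hd (map snd (pl_lab P (pl_mk L))) = l' @ 0 # r'" "hd (map snd L) = l @ 0 # r"
      using l(1) l'(1) ne ne' by (metis hd_conv_nth hd_map)+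
    show "l' @ concat (tl (map snd (pl_lab P (pl_mk L)))) @ r' = [1..<Suc (psiz y)]"
      "l @ concat (tl (map snd L)) @ r = [1..<Suc (psiz y)]"
      using l(4) l'(3) by (simp_all only: map_tl)
    show "map snd (pl_lab P (pl_mk L)) \<noteq> []" using ne' by simp
  qed
  moreover have "map fst (pl_lab P (pl_mk L)) = map fst L" by (simp add: fst_pl_lab mk qs_def)
  ultimately show "pl_lab P (pl_mk L) = L" by (metis zip_map_fst_snd)
qed

lemma pl_lab_0:
  assumes f: "(qs, i) \<in> Hom (pl_U P) x y"
  obtains r where "snd (pl_lab P (qs, i) ! 0) = [1..<i] @ 0 # r"
    "[1..<i] @ concat (map snd (tl (pl_lab P (qs, i)))) @ r = [1..<Suc (psiz y)]"
proof -
  obtain cs c0 where x: "x = (cs, c0)" by (cases x)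
  have t: "pl_tuple P (cs, c0) (qs, i)" using f by (simp add: pl_hom x)
  have i: "1 \<le> i" "i \<le> arity P (qs ! 0)" and qs: "qs \<noteq> []" using t by auto
  obtain r where r: "hd (map snd (pl_lab P (qs, i))) = [1..<i] @ 0 # r"
    "[1..<i] @ concat (tl (map snd (pl_lab P (qs, i)))) @ r = [1..<length (concat (map snd (pl_lab P (qs, i))))]"
    by (rule pl_lab_lay[OF i qs])
  have ne: "pl_lab P (qs, i) \<noteq> []" using qs length_pl_lab[of "(qs, i)"] by (metis fst_conv length_0_conv)
  have "length (concat (map snd (pl_lab P (qs, i)))) = Suc (psiz y)"
    using mset_eq_length[OF fam.mor_mset[OF pl_hom_lab(1)[OF f]]] by simp
  moreover have "snd (pl_lab P (qs, i) ! 0) = [1..<i] @ 0 # r"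
    using r(1) ne by (metis hd_conv_nth hd_map)
  ultimately show ?thesis using that r(2) by (simp only: map_tl)
qed

lemma pl_comp_mk:
  assumes x: "x \<in> Profiles P" and z: "z \<in> Profiles P"
    and f: "f \<in> Hom (pl_U P) x y" and g: "g \<in> Hom (pl_U P) y z"
  shows "pl_comp P g f = pl_mk (fam.cmp x z (pl_lab P g) (pl_lab P f))"
proof -
  obtain qs i where f': "f = (qs, i)" by (cases f)
  obtain rs i' where g': "g = (rs, i')" by (cases g)
  define F G where "F = pl_lab P f" and "G = pl_lab P g"
  have F: "fam.mor x y F" and G: "fam.mor y z G" using pl_hom_lab(1) f g by (simp_all add: F_def G_def)
  have tf: "length qs = Suc (psiz x)" "ins P (qs ! 0) ! (i - 1) = snd x" "1 \<le> i" "i \<le> arity P (qs ! 0)"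
    using f by (cases x; simp add: pl_hom f' psiz_def)+
  have tg: "length rs = Suc (psiz y)" "1 \<le> i'" using g by (cases y; simp add: pl_hom g' psiz_def)+
  have Ff: "fst (F ! j) = qs ! j" and Fs: "snd (F ! j) = map (\<lambda>k. if j = 0 \<and> k = i then 0 else pl_num P (qs, i) j k) [1..<Suc (arity P (qs ! j))]"
    if "j < length qs" for j using that by (simp_all add: F_def pl_lab_def f' del: upt_Suc pl_num.simps)
  have Gf: "fst (G ! w) = rs ! w" and Gl: "length (snd (G ! w)) = arity P (rs ! w)" if "w < length rs" for w
    using pl_lab_nth[of w g] that by (simp_all add: G_def g')
  have lab: "w < length rs" if "j < length qs" "w \<in> set (snd (F ! j))" for j w
    using fam.mor_label[OF F, of j w] that tf(1) tg(1) by simp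
  obtain r where r: "snd (F ! 0) = [1..<i] @ 0 # r" using pl_lab_0[of qs i x y] f unfolding F_def f' by metis
  obtain r' where r': "snd (G ! 0) = [1..<i'] @ 0 # r'" using pl_lab_0[of rs i' y z] g unfolding G_def g' by metis
  have d: "0 \<notin> set [1..<i']" "0 \<notin> set r'" using fam.mor_distinct[OF G, of 0] r' by auto
  let ?V = "fam.vert x z G F"
  have upper: "fst (?V j) = plug P (qs ! j) (map (\<lambda>k. rs ! pl_num P (qs, i) j k) [1..<Suc (arity P (qs ! j))])"
    if "j \<in> {1..<length qs}" for j
  proof -
    have j: "j < length qs" "j \<noteq> 0" using that by auto
    have "fst (?V j) = plug P (qs ! j) (map (\<lambda>w. fst (G ! w)) (snd (F ! j)))"
      using j Ff[OF j(1)] by (simp add: fam.vert_def subst_def)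
    also have "map (\<lambda>w. fst (G ! w)) (snd (F ! j)) = map (\<lambda>w. rs ! w) (snd (F ! j))"
      using lab[OF j(1)] Gf by (intro map_cong) auto
    also have "\<dots> = map (\<lambda>k. rs ! pl_num P (qs, i) j k) [1..<Suc (arity P (qs ! j))]"
      using Fs[OF j(1)] j(2) by (simp add: comp_def del: upt_Suc pl_num.simps)
    finally show ?thesis .
  qed
  define Q where "Q = plug P (qs ! 0) (map (\<lambda>k. if k = i then ident P (ins P (qs ! 0) ! (i - 1)) else rs ! pl_num P (qs, i) 0 k)
    [1..<Suc (arity P (qs ! 0))])"
  have q0: "0 < length qs" using tf by simp
  have SF: "fst (subst (F ! 0) (fam.star x G)) = Q"
  proof -
    have "fst (fam.star x G (if k = i then 0 else pl_num P (qs, i) 0 k)) =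
        (if k = i then ident P (ins P (qs ! 0) ! (i - 1)) else rs ! pl_num P (qs, i) 0 k)"
      if k: "k \<in> set [1..<Suc (arity P (qs ! 0))]" for k
    proof (cases "k = i")
      case True
      then show ?thesis using tf(2) by (simp add: fam.star_def)
    next
      case False
      have "pl_num P (qs, i) 0 k \<in> set (snd (F ! 0))" unfolding Fs[OF q0] using k False by force
      then have "pl_num P (qs, i) 0 k < length rs" using lab[OF q0] by blast
      moreover have "pl_num P (qs, i) 0 k \<noteq> 0" using k False tf(3) by auto
      ultimately show ?thesis using False Gf by (simp add: fam.star_def del: pl_num.simps)
    qed
    then have "map (\<lambda>k. fst (fam.star x G (if k = i then 0 else pl_num P (qs, i) 0 k))) [1..<Suc (arity P (qs ! 0))] =
        map (\<lambda>k. if k = i then ident P (ins P (qs ! 0) ! (i - 1)) else rs ! pl_num P (qs, i) 0 k) [1..<Suc (arity P (qs ! 0))]"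
      by (rule map_cong[OF refl])
    then show ?thesis
      unfolding subst_def Q_def fst_conv Ff[OF q0] Fs[OF q0] map_map comp_def by (simp only: simp_thms)
  qed
  have lower: "fst (?V 0) = pcomp P (rs ! 0) i' Q"
  proof -
    have r0: "0 < length rs" using tg by simp
    have w: "wt ((pcol z)(0 := pcol y 0)) (pcol z 0) (G ! 0)" using fam.mor_wt_lower[OF G] by simp
    have "pcomp P (rs ! 0) i' Q = plug P (fst (G ! 0)) (map (\<lambda>u. if u = 0 then Q else ident P (((pcol z)(0 := pcol y 0)) u)) (snd (G ! 0)))"
      using pcomp_wt[OF w r' d, of Q] tg(2) Gf[OF r0] by simp
    also have "\<dots> = plug P (fst (G ! 0)) (map (\<lambda>v. fst (if v = 0 then subst (F ! 0) (fam.star x G) else unit_op (pcol z) v)) (snd (G ! 0)))"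
      using SF by (intro arg_cong[where f = "plug P (fst (G ! 0))"] map_cong) auto
    also have "\<dots> = fst (?V 0)" by (simp add: fam.vert_def subst_def[of "G ! 0"])
    finally show ?thesis ..
  qed
  have up: "[0..<Suc (psiz x)] = 0 # [1..<length qs]" unfolding tf(1) by (simp add: upt_conv_Cons del: upt_Suc)
  have c: "fam.cmp x z G F = map ?V (0 # [1..<length qs])" by (simp add: fam.cmp_def up del: upt_Suc)
  have v0: "snd (?V 0) = ([1..<i'] @ concat (map (\<lambda>w. snd (G ! w)) [1..<i])) @ 0 # concat (map (\<lambda>w. snd (G ! w)) r) @ r'"
    using fam.vert_0_labels[OF F G _ r r'] by simp
  have nz: "0 \<notin> set ([1..<i'] @ concat (map (\<lambda>w. snd (G ! w)) [1..<i]))"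
    using fam.vert_distinct[OF F G, of 0] unfolding v0 by auto
  have "fam.cmp x z G F ! 0 = ?V 0" unfolding c by simp
  then have mk: "pl_mk (fam.cmp x z G F) = (map fst (map ?V (0 # [1..<length qs])), Suc (length ([1..<i'] @ concat (map (\<lambda>w. snd (G ! w)) [1..<i]))))"
    using pl_mk_eq[OF _ nz, of "fam.cmp x z G F"] v0 unfolding c by metis
  have "w \<in> set [1..<i] \<Longrightarrow> w < length rs" for w using lab[OF q0] r by simp
  then have "map (\<lambda>w. length (snd (G ! w))) [1..<i] = map (\<lambda>w. arity P (rs ! w)) [1..<i]"
    using Gl by (intro map_cong) auto
  then have "length (concat (map (\<lambda>w. snd (G ! w)) [1..<i])) = (\<Sum>k\<in>{1..<i}. arity P (rs ! k))"
    by (simp add: length_concat comp_def interv_sum_list_conv_sum_set_nat)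
  \<comment> \<open>The mark of the composite starts from that of \<open>g\<close> and is pushed to
    the right by everything plugged in left of the mark of \<open>f\<close>.\<close>
  then have "Suc (length ([1..<i'] @ concat (map (\<lambda>w. snd (G ! w)) [1..<i]))) = i' + (\<Sum>k\<in>{1..<i}. arity P (rs ! k))"
    using tg(2) by simp
  moreover have "map fst (map ?V (0 # [1..<length qs])) = pcomp P (rs ! 0) i' Q #
      map (\<lambda>j. plug P (qs ! j) (map (\<lambda>k. rs ! pl_num P (qs, i) j k) [1..<Suc (arity P (qs ! j))])) [1..<length qs]"
    using lower upper by (simp del: upt_Suc)
  ultimately show ?thesis
    unfolding F_def[symmetric] G_def[symmetric] mk unfolding f' g' pl_comp.simps Let_def Q_def by simp
qed

lemma pl_id_mk: "x \<in> Profiles P \<Longrightarrow> pl_id P x = pl_mk (fam.idm x)"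
proof -
  obtain cs c0 where x: "x = (cs, c0)" by (cases x)
  have "map (\<lambda>i. ident P (pcol x i)) [0..<Suc (psiz x)] = map (ident P) (c0 # cs)"
    by (intro nth_equalityI) (auto simp: x psiz_def pcol_def nth_Cons' simp del: upt_Suc)
  moreover have "fam.idm x ! 0 = unit_op (pcol x) 0" by (simp add: fam.idm_def del: upt_Suc)
  ultimately show ?thesis
    using pl_mk_eq[of "fam.idm x" "[]" "[]"] by (simp add: pl_id_def x fam.idm_def comp_def del: upt_Suc)
qed

sublocale env: enveloping P "(=)" id \<psi> "{0}" "Profiles P" psiz pcol pl_lay "pl_U P" "pl_lab P" pl_mk "pl_trivial P"
proof unfold_locales
  show "Obj (pl_U P) = Profiles P" by (simp add: pl_U_def)
  fix x y f assume x: "x \<in> Profiles P" and y: "y \<in> Profiles P"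
  { assume "f \<in> Hom (pl_U P) x y"
    then show "fam.mor x y (pl_lab P f) \<and> pl_mk (pl_lab P f) = f \<and> map fst (pl_lab P f) = fst f"
      using pl_hom_lab fst_pl_lab by blast }
  { fix L assume "fam.mor x y L"
    then show "pl_mk L \<in> Hom (pl_U P) x y \<and> pl_lab P (pl_mk L) = L" using pl_hom_mk by blast }
  { fix z g assume "z \<in> Profiles P" "f \<in> Hom (pl_U P) x y" "g \<in> Hom (pl_U P) y z"
    then show "Cmp (pl_U P) g f = pl_mk (fam.cmp x z (pl_lab P g) (pl_lab P f))"
      using pl_comp_mk[OF x] by (simp add: pl_U_def) }
  show "Idm (pl_U P) x = pl_mk (fam.idm x)" using pl_id_mk[OF x] by (simp add: pl_U_def)
  \<comment> \<open>\<open>pl_trivial\<close> always holds, so the labels have to be in natural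
    order automatically. Indeed the lower vertex has an input, hence is not of grading -1, hence is
    an identity, and nothing lies beside its mark.\<close>
  { assume f: "f \<in> Hom (pl_U P) x y" and v: "\<And>q. q \<in> set (fst f) \<Longrightarrow> q \<in> ident P ` Cols P \<or> \<psi> q = -1"
    obtain qs i where f': "f = (qs, i)" by (cases f)
    obtain cs c0 where x: "x = (cs, c0)" by (cases x)
    have t: "length qs = Suc (length cs)" "set qs \<subseteq> Ops P" "1 \<le> i" "i \<le> arity P (qs ! 0)"
      using f by (auto simp: pl_hom f' x)
    then have q: "qs ! 0 \<in> set qs" by simp
    then have "qs ! 0 \<in> Ops P" using t(2) by blast
    then have "\<psi> (qs ! 0) \<noteq> -1" using t fam.grading_minus1[of "qs ! 0"] by auto
    then have a: "arity P (qs ! 0) = 1" using v[of "qs ! 0"] q ident f' by (auto simp: arity_def)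
    obtain r where r: "snd (pl_lab P (qs, i) ! 0) = [1..<i] @ 0 # r"
      "[1..<i] @ concat (map snd (tl (pl_lab P (qs, i)))) @ r = [1..<Suc (psiz y)]"
      using pl_lab_0 f unfolding f' by blast
    have "length (snd (pl_lab P (qs, i) ! 0)) = 1" using pl_lab_nth[of 0 "(qs, i)"] t a by simp
    then have "i - 1 + Suc (length r) = 1" unfolding r(1) by simp
    then have "length r = 0" and i1: "i = 1" using t(3) by linarith+
    then have 0: "r = []" "i = 1" by simp_all
    have ne: "pl_lab P (qs, i) = pl_lab P (qs, i) ! 0 # tl (pl_lab P (qs, i))"
      using t length_pl_lab[of "(qs, i)"] by (cases "pl_lab P (qs, i)") auto
    have "concat (map snd (pl_lab P (qs, i))) = 0 # [1..<Suc (psiz y)]"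
      by (subst ne) (use r 0 in \<open>simp del: upt_Suc\<close>)
    also have "\<dots> = [0..<Suc (psiz y)]" by (simp add: upt_conv_Cons del: upt_Suc)
    finally show "pl_trivial P f \<longleftrightarrow> concat (map snd (pl_lab P f)) = [0..<Suc (psiz y)]"
      unfolding f' pl_trivial_def by simp }
qed

lemma pl_target_lab:
  assumes p: "p \<in> Ops P" and y: "y \<in> Profiles P" and f: "f \<in> Hom (pl_U P) (profile P p) y"
  shows "subst (pl_lab P f ! 0) (\<lambda>v. if v = 0 then subst (p, [1..<Suc (arity P p)]) ((!) (pl_lab P f)) else unit_op (pcol y) v) =
    (pl_target P p f, [1..<Suc (psiz y)])" (is "subst (?F ! 0) ?R = _")
proof -
  obtain qs i where f': "f = (qs, i)" by (cases f)
  have F: "fam.mor (profile P p) y ?F" by (rule pl_hom_lab(1)[OF f])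
  have t: "length qs = Suc (arity P p)" "1 \<le> i" using f by (auto simp: pl_hom f' profile_def arity_def)
  obtain r where r: "snd (?F ! 0) = [1..<i] @ 0 # r"
      "[1..<i] @ concat (map snd (tl ?F)) @ r = [1..<Suc (psiz y)]"
    using pl_lab_0 f unfolding f' by blast
  have d: "0 \<notin> set [1..<i]" "0 \<notin> set r" using fam.mor_distinct[OF F, of 0] r by auto
  have len: "length ?F = Suc (arity P p)" using t by (simp add: f')
  have tlF: "tl ?F = map ((!) ?F) [1..<Suc (arity P p)]"
    using len by (intro nth_equalityI) (simp_all add: nth_tl del: upt_Suc)
  have "map fst (tl ?F) = tl qs" using fst_pl_lab[of f] by (simp add: f' map_tl)
  then have S: "subst (p, [1..<Suc (arity P p)]) ((!) ?F) = (plug P p (tl qs), concat (map snd (tl ?F)))"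
    unfolding tlF by (simp add: subst_def comp_def del: upt_Suc)
  have w: "wt ((pcol y)(0 := pcol (profile P p) 0)) (pcol y 0) (?F ! 0)" using fam.mor_wt_lower[OF F] by simp
  have "fst (?F ! 0) = qs ! 0" using pl_lab_nth[of 0 f] t by (simp add: f')
  then have "pl_target P p f = plug P (fst (?F ! 0)) (map (\<lambda>u. if u = 0 then plug P p (tl qs)
      else ident P (((pcol y)(0 := pcol (profile P p) 0)) u)) (snd (?F ! 0)))"
    using pcomp_wt[OF w r(1) d, of "plug P p (tl qs)"] t(2) by (simp add: f')
  also have "\<dots> = fst (subst (?F ! 0) ?R)"
    unfolding subst_def[of "?F ! 0"] fst_conv S by (intro arg_cong[where f = "plug P (fst (?F ! 0))"] map_cong) auto
  finally have 1: "fst (subst (?F ! 0) ?R) = pl_target P p f" ..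
  have "concat (map (\<lambda>v. snd (?R v)) xs) = xs" if "0 \<notin> set xs" for xs
  proof (rule concat_map_eq_singletons)
    fix v assume "v \<in> set xs"
    then have "v \<noteq> 0" using that by metis
    then show "snd (?R v) = [v]" by simp
  qed
  then have "snd (subst (?F ! 0) ?R) = [1..<i] @ concat (map snd (tl ?F)) @ r"
    using d unfolding snd_subst r(1) S by simp
  then show ?thesis using 1 r(2) by (simp add: prod_eq_iff)
qed

sublocale tw: rooted P "(=)" id \<psi> "{0}" "Profiles P" psiz pcol pl_lay "pl_U P" "pl_lab P" pl_mk "pl_trivial P"
  "pl_Tw P" "profile P" "pl_target P"
proof unfold_locales
  fix p t f assume p: "p \<in> Ops P"
  \<comment> \<open>A morphism of the twisted arrow category mentions no target profile, so it must
    be checked that the computed one consists of colours.\<close>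
  have "pl_target_profile P f \<in> Profiles P" if h: "pl_tuple P (profile P p) f"
  proof -
    obtain qs i where f': "f = (qs, i)" by (cases f)
    have s: "set qs \<subseteq> Ops P" "qs \<noteq> []" using h by (auto simp: f' profile_def)
    then have c: "set (ins P q) \<subseteq> Cols P" "out P q \<in> Cols P" if "q \<in> set qs" for q
      using colours[of q] that s(1) by auto
    have q0: "qs ! 0 \<in> set qs" using s(2) by simp
    have "set (concat (map (ins P) (tl qs))) \<subseteq> Cols P" using c(1) s(2) by (cases qs) auto
    then show ?thesis
      using set_take_subset[of "i - 1" "ins P (qs ! 0)"] set_drop_subset[of i "ins P (qs ! 0)"] c[OF q0]
      unfolding Profiles_iff f' pl_target_profile.simps fst_conv snd_conv set_append by blast
  qed
  moreover have "f \<in> Hom (pl_Tw P) p t \<longleftrightarrow> pl_tuple P (profile P p) f \<and> pl_target P p f = t"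
    by (simp add: pl_Tw_def)
  ultimately show "f \<in> Hom (pl_Tw P) p t \<longleftrightarrow> (\<exists>y\<in>Profiles P. f \<in> Hom (pl_U P) (profile P p) y) \<and> pl_target P p f = t"
    by (metis pl_hom)
next
  fix p p' assume "p \<in> Ops P" "p' \<in> Ops P" "profile P p = profile P p'"
  then show "\<psi> p = \<psi> p'" using dep unfolding grading_depends_on_colours_def profile_def by (metis prod.inject)
next
  fix p y f assume "p \<in> Ops P" "y \<in> Profiles P" "f \<in> Hom (pl_U P) (profile P p) y"
  then show "subst (pl_lab P f ! 0) (\<lambda>v. if v = 0 then subst (p, [1..<Suc (arity P p)]) ((!) (pl_lab P f))
      else unit_op (pcol y) v) = (pl_target P p f, [1..<Suc (psiz y)])"
    by (rule pl_target_lab)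
next
  show "pcol (profile P p) 0 = out P p" "pcol (profile P p) (Suc i) = ins P p ! i" for p i
    by (rule profile_cols)+
next
  show "Obj (pl_Tw P) = Ops P" "Cmp (pl_Tw P) = Cmp (pl_U P)" "Idm (pl_Tw P) p = Idm (pl_U P) (profile P p)" for p
    by (simp_all add: pl_Tw_def pl_U_def)
  show "p \<in> Ops P \<Longrightarrow> profile P p \<in> Profiles P" "psiz (profile P p) = arity P p" for p
    by (rule profile_Profiles, assumption, rule profile_cols)
qed simp

end

section \<open>The symmetric case\<close>

text \<open>The mark 0 precedes all leaf numbers, so sorting the lower vertex keeps its first input
  in place. This matches the permutation in \<open>sym_lower_vertex\<close>.\<close>

lemma ranks_0: "0 \<notin> set xs \<Longrightarrow> ranks (0 # xs) = 1 # map Suc (ranks xs)"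
proof -
  assume z: "0 \<notin> set xs"
  have "card {y \<in> set (0 # xs). y \<le> x} = Suc (card {y \<in> set xs. y \<le> x})" for x
  proof -
    have "{y \<in> set (0 # xs). y \<le> x} = insert 0 {y \<in> set xs. y \<le> x}" by auto
    then show ?thesis using z by simp
  qed
  moreover have "{y \<in> set xs. y \<le> 0} = {}" using z by auto
  ultimately show ?thesis by (simp add: ranks_def)
qed

lemma sort_0: "sort (0 # xs) = 0 # sort (xs :: nat list)"
  by (cases "sort xs") (simp_all add: insort_is_Cons)

lemma numbering_sorted:
  assumes "numbering xs A lam" "\<And>k. a \<le> k \<Longrightarrow> k < e \<Longrightarrow> (i, k) \<in> set xs"
  shows "sorted_wrt (<) (map (\<lambda>k. lam (i, k)) [a..<e])"
  unfolding sorted_wrt_map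
  by (rule sorted_wrt_mono_rel[OF _ sorted_wrt_upt]) (use assms in \<open>auto simp: numbering_def\<close>)

lemma numbering_mset:
  assumes "numbering xs A lam" "card A = length xs"
  shows "mset (map lam xs) = mset_set A" "distinct xs"
proof -
  have b: "bij_betw lam (set xs) A" using assms(1) by (simp add: numbering_def)
  then have "card (set xs) = length xs" using bij_betw_same_card[OF b] assms(2) by simp
  then show d: "distinct xs" by (rule card_distinct)
  have "mset (map lam xs) = image_mset lam (mset_set (set xs))" using d by (simp add: mset_set_set)
  also have "\<dots> = mset_set A" using b by (simp add: bij_betw_def image_mset_mset_set)
  finally show "mset (map lam xs) = mset_set A" .
qed

lemma numberingI:
  assumes "mset (map lam xs) = mset_set A" "finite A" "lam \<in> extensional (set xs)"
    and "\<And>i k k'. (i, k) \<in> set xs \<Longrightarrow> (i, k') \<in> set xs \<Longrightarrow> k < k' \<Longrightarrow> lam (i, k) < lam (i, k')"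
  shows "numbering xs A lam"
proof -
  have A: "set (map lam xs) = A" using mset_eq_setD[of "map lam xs" "sorted_list_of_set A"] assms(1,2)
    by (metis finite_set_mset_mset_set set_mset_mset)
  moreover have "distinct (map lam xs)"
    unfolding distinct_count_atmost_1 A assms(1) using assms(2) by simp
  ultimately show ?thesis
    using assms(3,4) unfolding numbering_def by (auto simp: bij_betw_def distinct_map)
qed

definition sym_lab :: "('c, 'o, 'z) operad_scheme \<Rightarrow> 'o num_mor \<Rightarrow> ('o \<times> nat list) list" where
  "sym_lab P f = map (\<lambda>i. (fst f ! i,
     if i = 0 then 0 # map (\<lambda>k. snd f (0, k)) [2..<Suc (arity P (fst f ! 0))]
     else map (\<lambda>k. snd f (i, k)) [1..<Suc (arity P (fst f ! i))])) [0..<length (fst f)]"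

definition sym_mk :: "('c, 'o, 'z) operad_scheme \<Rightarrow> ('o \<times> nat list) list \<Rightarrow> 'o num_mor" where
  "sym_mk P L = (map fst L, restrict (\<lambda>(i, k). snd (L ! i) ! (k - 1)) (set (sym_leaves P (map fst L))))"

lemma sym_leaves_iff:
  "(i, k) \<in> set (sym_leaves P qs) \<longleftrightarrow>
     (if i = 0 then 2 \<le> k \<and> k \<le> arity P (qs ! 0) else i < length qs \<and> 1 \<le> k \<and> k \<le> arity P (qs ! i))"
  unfolding sym_leaves_def by (auto simp: image_iff simp del: upt_Suc)

lemma length_sym_lab [simp]: "length (sym_lab P f) = length (fst f)"
  by (simp add: sym_lab_def)

lemma fst_sym_lab: "map fst (sym_lab P f) = fst f"
  by (intro nth_equalityI) (simp_all add: sym_lab_def)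

lemma sym_lab_0: "fst f \<noteq> [] \<Longrightarrow> sym_lab P f ! 0 = (fst f ! 0, 0 # map (\<lambda>k. snd f (0, k)) [2..<Suc (arity P (fst f ! 0))])"
  by (simp add: sym_lab_def del: upt_Suc)

lemma sym_lab_upper: "i < length (fst f) \<Longrightarrow> i \<noteq> 0 \<Longrightarrow>
    sym_lab P f ! i = (fst f ! i, map (\<lambda>k. snd f (i, k)) [1..<Suc (arity P (fst f ! i))])"
  by (simp add: sym_lab_def del: upt_Suc)

text \<open>The leaves of the lower vertex come last in the planar order, while vertex 0 comes first
  in the family.\<close>

lemma map_sym_leaves:
  assumes "fst f \<noteq> []"
  shows "map (snd f) (sym_leaves P (fst f)) = concat (map snd (tl (sym_lab P f))) @ tl (snd (sym_lab P f ! 0))"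
proof -
  have "tl (sym_lab P f) = map ((!) (sym_lab P f)) [1..<length (fst f)]"
    by (intro nth_equalityI) (auto simp: nth_tl)
  then have "map snd (tl (sym_lab P f)) = map (\<lambda>i. map (\<lambda>k. snd f (i, k)) [1..<Suc (arity P (fst f ! i))]) [1..<length (fst f)]"
    by (auto simp: sym_lab_upper simp del: upt_Suc)
  then show ?thesis
    using assms by (simp add: sym_leaves_def map_concat comp_def sym_lab_0 del: upt_Suc)
qed

lemma upt2_nth: "Suc (Suc j) \<le> n \<Longrightarrow> [2..<Suc n] ! j = Suc (Suc j)"
  by (subst nth_upt) auto

lemma upt1_nth: "1 \<le> k \<Longrightarrow> k \<le> n \<Longrightarrow> [1..<Suc n] ! (k - 1) = k"
  by (subst nth_upt) auto

lemma restrict_eqI: "(\<And>x. x \<in> A \<Longrightarrow> f x = g x) \<Longrightarrow> restrict f A = restrict g A"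
  by (rule ext) (simp add: restrict_def)

context symmetric_operad
begin

lemma relab_grading:
  assumes "wt \<kappa> c X" "relab X Y" "\<And>p \<sigma>. p \<in> Ops P \<Longrightarrow> \<sigma> permutes {1..arity P p} \<Longrightarrow> \<psi> (act P \<sigma> p) = \<psi> p"
  shows "\<psi> (fst Y) = \<psi> (fst X)"
  using assms unfolding relab_def wt_def by metis

text \<open>Acting by the list of labels itself moves the input with label \<open>v\<close> to
  position \<open>v\<close>; \<open>sym_target\<close> numbers its inputs in this way.\<close>

lemma relab_place:
  assumes X: "wt \<kappa> c X" and s: "set (snd X) = {1..n}" "length (snd X) = n"
  shows "relab X (act P (place (snd X)) (fst X), [1..<Suc n])"
  unfolding relab_def
proof (intro exI[of _ "place (snd X)"] conjI ballI)
  have a: "arity P (fst X) = n" using wt_arity[OF X] s by simp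
  show "place (snd X) permutes {1..arity P (fst X)}" using place_permutes[of "snd X" n] s a by simp
  fix i assume i: "i \<in> {1..arity P (fst X)}"
  then have "snd X ! (i - 1) \<in> set (snd X)" using a s(2) by (intro nth_mem) auto
  then have "snd X ! (i - 1) \<in> {1..n}" using s(1) by simp
  then show "snd (act P (place (snd X)) (fst X), [1..<Suc n]) ! (place (snd X) i - 1) = snd X ! (i - 1)"
    using i a s(2) by (auto simp: place_def nth_upt simp del: upt_Suc)
qed (use s in simp_all)

lemma nrm_fixed_sorted: "nrm X = X \<Longrightarrow> sorted (snd X)"
  unfolding nrm_def by (metis snd_conv sorted_sort)

end

locale graded_symmetric = symmetric_operad P
  for P :: "('c, 'o, 'z) sym_operad_scheme" +
  fixes \<psi> :: "'o \<Rightarrow> int"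
  assumes gr: "symmetric_grading P \<psi>" and ni: "nice P \<psi>" and dep: "grading_depends_on_colours P \<psi>"
begin

sublocale fam: labelled_families P relab nrm \<psi> "{0}" "Profiles P" psiz pcol "\<lambda>_. True"
proof unfold_locales
  fix \<kappa> \<kappa>' :: "nat \<Rightarrow> 'c" and c X Y F F'
  assume X: "wt \<kappa> c X"
  then have o: "fst X \<in> Ops P" by (simp add: wt_def)
  show "relab X X" using relab_refl o .
  { assume r: "relab X Y"
    show "relab Y X" using relab_sym[OF X r] .
    show "wt \<kappa> c Y" "mset (snd Y) = mset (snd X)" using relab_wt[OF X r] .
    show "\<psi> (fst Y) = \<psi> (fst X)" using relab_grading[OF X r] gr unfolding symmetric_grading_def by blast
    show "relab Y Z \<Longrightarrow> relab X Z" for Z using relab_trans[OF o r] .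
    show "distinct (snd X) \<Longrightarrow> nrm X = nrm Y" using relab_nrm_eq[OF X _ r] .
    assume "\<And>x. x \<in> set (snd X) \<Longrightarrow> wt \<kappa>' (\<kappa> x) (F x)" "\<And>x. x \<in> set (snd X) \<Longrightarrow> relab (F x) (F' x)"
    then show "relab (subst X F) (subst Y F')" using relab_subst[OF X _ r] by blast }
  show "distinct (snd X) \<Longrightarrow> relab X (nrm X)" using relab_nrm[OF X] .
  show "distinct (snd X) \<Longrightarrow> sorted (snd X) \<Longrightarrow> nrm X = X" using nrm_sorted[OF X] .
next
  show "planar_grading P \<psi>" using gr by (simp add: symmetric_grading_def)
next
  fix p assume "p \<in> Ops P"
  then show "-1 \<le> \<psi> p" "\<psi> p = -1 \<Longrightarrow> arity P p = 0" using ni unfolding nice_def by blast+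
next
  fix n and \<gamma> :: "nat \<Rightarrow> 'c" assume "\<And>i. i \<le> n \<Longrightarrow> \<gamma> i \<in> Cols P"
  then show "\<exists>x\<in>Profiles P. psiz x = n \<and> (\<forall>i\<le>n. pcol x i = \<gamma> i)" by (rule profile_exists)
next
  fix x y :: "'c list \<times> 'c" assume "psiz x = psiz y" "\<And>i. i \<le> psiz y \<Longrightarrow> pcol x i = pcol y i"
  then show "x = y" by (rule profile_unique)
next
  fix x :: "'c list \<times> 'c" and i assume "x \<in> Profiles P" "i \<le> psiz x"
  then show "pcol x i \<in> Cols P" by (rule pcol_Cols)
qed simp

sublocale cat: family_category P relab nrm \<psi> "{0}" "Profiles P" psiz pcol "\<lambda>_. True"
  by unfold_locales simp_all

section \<open>Symmetric tuples as families\<close>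

lemma sym_hom: "f \<in> Hom (sym_U P) x y \<longleftrightarrow> sym_tuple P x f \<and> sym_has_target_profile P f y"
  by (simp add: sym_U_def)

lemma sym_hom_lab:
  assumes f: "f \<in> Hom (sym_U P) x y"
  shows "fam.mor x y (sym_lab P f)" "sym_mk P (sym_lab P f) = f" "length (sym_leaves P (fst f)) = psiz y"
proof -
  obtain qs lam where f': "f = (qs, lam)" by (cases f)
  obtain cs c0 where x: "x = (cs, c0)" by (cases x)
  obtain ds d0 where y: "y = (ds, d0)" by (cases y)
  have len: "length qs = Suc (psiz x)" and ops: "set qs \<subseteq> Ops P" and a0: "1 \<le> arity P (qs ! 0)"
    and c0: "ins P (qs ! 0) ! 0 = c0" and out: "\<And>i. i \<in> {1..length cs} \<Longrightarrow> out P (qs ! i) = cs ! (i - 1)"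
    and num: "numbering (sym_leaves P qs) {1..length (sym_leaves P qs)} lam"
    and d0: "d0 = out P (qs ! 0)" and lds: "length ds = length (sym_leaves P qs)"
    and dsn: "\<And>i k. (i, k) \<in> set (sym_leaves P qs) \<Longrightarrow> ds ! (lam (i, k) - 1) = ins P (qs ! i) ! (k - 1)"
    using f by (auto simp: sym_hom f' x y psiz_def)
  have ne: "qs \<noteq> []" using len by auto
  have lam1: "1 \<le> lam (i, k)" if "(i, k) \<in> set (sym_leaves P qs)" for i k
    using num that by (auto simp: numbering_def bij_betw_def)
  have col: "pcol y (lam (i, k)) = ins P (qs ! i) ! (k - 1)" if "(i, k) \<in> set (sym_leaves P qs)" for i k
    using dsn[OF that] lam1[OF that] by (cases "lam (i, k)") (simp_all add: y)
  let ?L = "sym_lab P f"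
  have L0: "?L ! 0 = (qs ! 0, 0 # map (\<lambda>k. lam (0, k)) [2..<Suc (arity P (qs ! 0))])"
    using sym_lab_0[of f P] ne by (simp add: f')
  have Li: "?L ! i = (qs ! i, map (\<lambda>k. lam (i, k)) [1..<Suc (arity P (qs ! i))])" if "i < length qs" "i \<noteq> 0" for i
    using sym_lab_upper[of i f P] that by (simp add: f')
  show ly: "length (sym_leaves P (fst f)) = psiz y" using lds by (simp add: f' y psiz_def)
  have "concat (map snd ?L) = snd (?L ! 0) @ concat (map snd (tl ?L))"
  proof -
    have "?L \<noteq> []" using ne length_sym_lab[of P f] unfolding f' by (metis fst_conv length_0_conv)
    then show ?thesis by (cases ?L) simp_all
  qed
  also have "\<dots> = 0 # tl (snd (?L ! 0)) @ concat (map snd (tl ?L))" by (simp add: L0)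
  finally have "mset (concat (map snd ?L)) = mset (0 # map lam (sym_leaves P qs))"
    using map_sym_leaves[of f P] ne by (simp add: f')
  also have "\<dots> = mset [0..<Suc (psiz y)]"
    using numbering_mset(1)[OF num] ly by (simp add: upt_conv_Cons f' atLeastLessThanSuc_atLeastAtMost del: upt_Suc mset_map)
  finally have ms: "mset (concat (map snd ?L)) = mset [0..<Suc (psiz y)]" .
  \<comment> \<open>The numbering increases along the vertex, and leaf numbers start at 1, so the
    mark 0 in front keeps the list increasing and the vertex is a normal form.\<close>
  have s0: "sorted (snd (?L ! 0))" "distinct (snd (?L ! 0))"
  proof -
    have "sorted_wrt (<) (map (\<lambda>k. lam (0, k)) [2..<Suc (arity P (qs ! 0))])"
      by (rule numbering_sorted[OF num]) (simp add: sym_leaves_iff)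
    moreover have "0 < v" if v: "v \<in> set (map (\<lambda>k. lam (0, k)) [2..<Suc (arity P (qs ! 0))])" for v
    proof -
      obtain k where "k \<in> set [2..<Suc (arity P (qs ! 0))]" "v = lam (0, k)" using v
        by (auto simp del: upt_Suc)
      then show ?thesis using lam1[of 0 k] by (simp add: sym_leaves_iff del: upt_Suc)
    qed
    ultimately have "sorted_wrt (<) (snd (?L ! 0))" unfolding L0 snd_conv sorted_wrt.simps by blast
    then show "sorted (snd (?L ! 0))" "distinct (snd (?L ! 0))" by (simp_all add: strict_sorted_iff)
  qed
  have si: "sorted (snd (?L ! i)) \<and> distinct (snd (?L ! i))" if "i < length qs" for i
  proof (cases "i = 0")
    case False
    have "sorted_wrt (<) (snd (?L ! i))" unfolding Li[OF that False] snd_conv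
      by (rule numbering_sorted[OF num]) (use that False in \<open>simp add: sym_leaves_iff\<close>)
    then show ?thesis by (simp add: strict_sorted_iff)
  qed (use s0 in simp)
  have wt: "wt (fam.vcol x y i) (fam.vout x y i) (?L ! i)" if i: "i \<le> psiz x" for i
  proof -
    have il: "i < length qs" using i len by simp
    then have o: "qs ! i \<in> Ops P" using ops by auto
    show ?thesis
    proof (cases "i = 0")
      case False
      have "map (pcol y) (snd (?L ! i)) = ins P (qs ! i)"
      proof (rule nth_equalityI)
        fix k assume "k < length (map (pcol y) (snd (?L ! i)))"
        then have k: "k < arity P (qs ! i)" by (simp add: Li[OF il False] del: upt_Suc)
        then show "map (pcol y) (snd (?L ! i)) ! k = ins P (qs ! i) ! k"
          using col[of i "Suc k"] il False by (simp add: Li[OF il False] sym_leaves_iff del: upt_Suc)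
      qed (simp add: Li[OF il False] arity_def del: upt_Suc)
      moreover have "out P (qs ! i) = pcol x i"
        using out[of i] i False by (cases i) (simp_all add: x psiz_def)
      ultimately show ?thesis using False o Li[OF il False] by (simp add: wt_def fam.vcol_def fam.vout_def del: upt_Suc)
    next
      case True
      have "map ((pcol y)(0 := pcol x 0)) (snd (?L ! 0)) = ins P (qs ! 0)"
      proof (rule nth_equalityI)
        fix k assume "k < length (map ((pcol y)(0 := pcol x 0)) (snd (?L ! 0)))"
        then have k: "k < arity P (qs ! 0)" using a0 by (simp add: L0 del: upt_Suc)
        show "map ((pcol y)(0 := pcol x 0)) (snd (?L ! 0)) ! k = ins P (qs ! 0) ! k"
        proof (cases k)
          case 0
          then show ?thesis using c0 by (simp add: L0 x del: upt_Suc)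
        next
          case (Suc j)
          then have m: "(0, Suc (Suc j)) \<in> set (sym_leaves P qs)" using k by (simp add: sym_leaves_iff)
          have j: "j < length [2..<Suc (arity P (qs ! 0))]" "Suc (Suc j) \<le> arity P (qs ! 0)"
            using k Suc by (simp_all del: upt_Suc)
          then have "snd (?L ! 0) ! k = lam (0, Suc (Suc j))" using Suc upt2_nth[OF j(2)] by (simp add: L0 del: upt_Suc)
          then show ?thesis using col[OF m] lam1[OF m] Suc k a0 by (simp add: L0 del: upt_Suc)
        qed
      qed (use a0 in \<open>simp add: L0 arity_def del: upt_Suc\<close>)
      then show ?thesis using True o d0 by (simp add: wt_def fam.vcol_def fam.vout_def y L0 del: upt_Suc)
    qed
  qed
  show "fam.mor x y ?L"
    unfolding fam.mor_def
  proof (intro conjI allI impI)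
    show "length ?L = Suc (psiz x)" using len by (simp add: f')
    show "0 \<in> set (snd (?L ! 0))" by (simp add: L0)
    fix i assume i: "i \<le> psiz x"
    show "wt (fam.vcol x y i) (fam.vout x y i) (?L ! i)" by (rule wt[OF i])
    show "nrm (?L ! i) = ?L ! i" using nrm_sorted[OF wt[OF i]] si[of i] i len by simp
  qed (simp_all only: ms)
  have "restrict (\<lambda>(i, k). snd (?L ! i) ! (k - 1)) (set (sym_leaves P qs)) = restrict lam (set (sym_leaves P qs))"
  proof (rule restrict_eqI, clarify)
    fix i k assume m: "(i, k) \<in> set (sym_leaves P qs)"
    show "snd (?L ! i) ! (k - 1) = lam (i, k)"
    proof (cases "i = 0")
      case True
      then have "2 \<le> k" "k \<le> arity P (qs ! 0)" using m by (simp_all add: sym_leaves_iff)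
      then obtain j where "k = Suc (Suc j)" by (metis Suc_le_D numeral_2_eq_2 Suc_le_mono)
      then show ?thesis using True \<open>k \<le> arity P (qs ! 0)\<close> upt2_nth[of j "arity P (qs ! 0)"]
        by (simp add: L0 del: upt_Suc)
    next
      case False
      then have "1 \<le> k" "k \<le> arity P (qs ! i)" "i < length qs" using m by (simp_all add: sym_leaves_iff)
      then show ?thesis using Li[of i] False upt1_nth[of k "arity P (qs ! i)"] by (simp del: upt_Suc)
    qed
  qed
  also have "\<dots> = lam" using num by (intro extensional_restrict) (simp add: numbering_def)
  finally show "sym_mk P ?L = f" unfolding sym_mk_def fst_sym_lab by (simp add: f')
qed

lemma sym_hom_mk:
  assumes L: "fam.mor x y L"
  shows "sym_mk P L \<in> Hom (sym_U P) x y" "sym_lab P (sym_mk P L) = L"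
proof -
  define qs lam where "qs = map fst L" and "lam = snd (sym_mk P L)"
  have mk: "sym_mk P L = (qs, lam)" by (simp add: lam_def qs_def sym_mk_def)
  have len: "length L = Suc (psiz x)" by (rule fam.mor_len[OF L])
  then have lq: "length qs = Suc (psiz x)" "qs \<noteq> []" by (auto simp: qs_def)
  have ar: "arity P (qs ! i) = length (snd (L ! i))" if "i < length qs" for i
    using wt_arity[OF fam.mor_wt[OF L, of i]] that len by (simp add: qs_def)
  have srt: "sorted_wrt (<) (snd (L ! i))" if "i < length qs" for i
    using nrm_fixed_sorted[OF fam.mor_nrm[OF L, of i]] fam.mor_distinct[OF L, of i] that len
    by (simp add: strict_sorted_iff qs_def)
  have 0: "0 \<in> set (snd (L ! 0))" using fam.mor_0[OF L] by simp
  \<comment> \<open>Labels of a normal form increase, so the mark 0 comes first; tuples demand the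
    gluing at the first input.\<close>
  then obtain r where r: "snd (L ! 0) = 0 # r"
    using srt[of 0] lq by (cases "snd (L ! 0)") auto
  have lam: "lam (i, k) = snd (L ! i) ! (k - 1)" if "(i, k) \<in> set (sym_leaves P qs)" for i k
    using that by (simp add: lam_def sym_mk_def qs_def)
  have lab_mk: "sym_lab P (qs, lam) = L"
  proof (rule nth_equalityI)
    fix i assume "i < length (sym_lab P (qs, lam))"
    then have i: "i < length qs" by simp
    show "sym_lab P (qs, lam) ! i = L ! i"
    proof (cases "i = 0")
      case True
      have "map (\<lambda>k. lam (0, k)) [2..<Suc (arity P (qs ! 0))] = r"
      proof (rule nth_equalityI)
        show "length (map (\<lambda>k. lam (0, k)) [2..<Suc (arity P (qs ! 0))]) = length r"
          using ar[of 0] lq r by (simp del: upt_Suc)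
        fix j assume "j < length (map (\<lambda>k. lam (0, k)) [2..<Suc (arity P (qs ! 0))])"
        then have j: "Suc (Suc j) \<le> arity P (qs ! 0)" by (simp del: upt_Suc)
        then have "lam (0, Suc (Suc j)) = r ! j" using lam[of 0 "Suc (Suc j)"] r by (simp add: sym_leaves_iff)
        then show "map (\<lambda>k. lam (0, k)) [2..<Suc (arity P (qs ! 0))] ! j = r ! j"
          using j upt2_nth[OF j] by (simp del: upt_Suc)
      qed
      then show ?thesis using True sym_lab_0[of "(qs, lam)" P] lq r by (simp add: prod_eq_iff qs_def del: upt_Suc)
    next
      case False
      have "map (\<lambda>k. lam (i, k)) [1..<Suc (arity P (qs ! i))] = snd (L ! i)"
      proof (rule nth_equalityI)
        show "length (map (\<lambda>k. lam (i, k)) [1..<Suc (arity P (qs ! i))]) = length (snd (L ! i))"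
          using ar[OF i] by (simp del: upt_Suc)
        fix j assume "j < length (map (\<lambda>k. lam (i, k)) [1..<Suc (arity P (qs ! i))])"
        then have j: "Suc j \<le> arity P (qs ! i)" by (simp del: upt_Suc)
        then have "lam (i, Suc j) = snd (L ! i) ! j" using lam[of i "Suc j"] i False by (simp add: sym_leaves_iff)
        then show "map (\<lambda>k. lam (i, k)) [1..<Suc (arity P (qs ! i))] ! j = snd (L ! i) ! j"
          using j by (simp add: nth_upt del: upt_Suc)
      qed
      then show ?thesis using False i sym_lab_upper[of i "(qs, lam)" P] by (simp add: prod_eq_iff qs_def del: upt_Suc)
    qed
  qed (simp add: qs_def)
  then show "sym_lab P (sym_mk P L) = L" by (simp add: mk)
  have ml: "map lam (sym_leaves P qs) = concat (map snd (tl L)) @ r"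
    using map_sym_leaves[of "(qs, lam)" P] lq r lab_mk by simp
  have "concat (map snd L) = (0 # r) @ concat (map snd (tl L))" using r len by (cases L) auto
  then have "add_mset 0 (mset (map lam (sym_leaves P qs))) = mset [0..<Suc (psiz y)]"
    using fam.mor_mset[OF L] ml by (simp add: ac_simps del: upt_Suc)
  then have ms: "mset (map lam (sym_leaves P qs)) = mset_set {1..psiz y}"
    by (simp add: upt_conv_Cons atLeastLessThanSuc_atLeastAtMost del: upt_Suc mset_map)
  have ly: "length (sym_leaves P qs) = psiz y" using arg_cong[OF ms, of size] by simp
  have lam1: "1 \<le> lam (i, k)" if "(i, k) \<in> set (sym_leaves P qs)" for i k
  proof -
    have "lam (i, k) \<in> set_mset (mset (map lam (sym_leaves P qs)))" using that by force
    then show ?thesis unfolding ms by simp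
  qed
  have num: "numbering (sym_leaves P qs) {1..length (sym_leaves P qs)} lam"
    unfolding ly
  proof (rule numberingI[OF ms])
    show "lam \<in> extensional (set (sym_leaves P qs))" by (simp add: lam_def sym_mk_def qs_def)
    fix i k k' assume m: "(i, k) \<in> set (sym_leaves P qs)" "(i, k') \<in> set (sym_leaves P qs)" "k < k'"
    have i: "i < length qs" "1 \<le> k" "k' \<le> arity P (qs ! i)" using m lq by (auto simp: sym_leaves_iff split: if_splits)
    then show "lam (i, k) < lam (i, k')"
      using sorted_wrt_nth_less[OF srt[OF i(1)], of "k - 1" "k' - 1"] m(3) ar[OF i(1)] lam m(1,2) by simp
  qed simp
  have ops: "set qs \<subseteq> Ops P" using cat.mor_Ops[OF L] len by (simp add: qs_def image_subset_iff all_set_conv_all_nth less_Suc_eq_le)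
  have w0: "wt ((pcol y)(0 := pcol x 0)) (pcol y 0) (L ! 0)" using fam.mor_wt_lower[OF L] by simp
  have q0: "qs ! 0 = fst (L ! 0)" using len by (simp add: qs_def)
  have i0: "ins P (qs ! 0) = map ((pcol y)(0 := pcol x 0)) (0 # r)" using w0 r by (simp add: wt_def q0)
  have tup: "sym_tuple P x (qs, lam)"
  proof -
    obtain cs c0 where x: "x = (cs, c0)" by (cases x)
    have "out P (qs ! i) = cs ! (i - 1)" if "i \<in> {1..length cs}" for i
      using fam.mor_wt_upper[OF L, of i] that len by (cases i) (auto simp: wt_def qs_def x psiz_def)
    then show ?thesis using lq ops num i0 by (simp add: x psiz_def arity_def)
  qed
  have "sym_has_target_profile P (qs, lam) y"
  proof -
    obtain ds d0 where y: "y = (ds, d0)" by (cases y)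
    have "ds ! (lam (i, k) - 1) = ins P (qs ! i) ! (k - 1)" if m: "(i, k) \<in> set (sym_leaves P qs)" for i k
    proof -
      have i: "i < length qs" "i \<le> psiz x" "1 \<le> k" "k \<le> arity P (qs ! i)" using m lq by (auto simp: sym_leaves_iff split: if_splits)
      have "ds ! (lam (i, k) - 1) = pcol y (lam (i, k))"
        using lam1[OF m] by (cases "lam (i, k)") (simp_all add: y)
      also have "\<dots> = fam.vcol x y i (snd (L ! i) ! (k - 1))"
      proof -
        have "snd (L ! i) ! (k - 1) \<noteq> 0" using lam[OF m] lam1[OF m] by linarith
        then show ?thesis using lam[OF m] by (cases "i = 0") (simp_all add: fam.vcol_def)
      qed
      also have "\<dots> = map (fam.vcol x y i) (snd (L ! i)) ! (k - 1)" using i ar[OF i(1)] by simp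
      also have "\<dots> = ins P (qs ! i) ! (k - 1)" using fam.mor_wt[OF L i(2)] i(1) by (simp add: wt_def qs_def)
      finally show ?thesis .
    qed
    moreover have "d0 = out P (qs ! 0)" using w0 by (simp add: wt_def q0 y)
    ultimately show ?thesis using ly by (auto simp: y psiz_def)
  qed
  then show "sym_mk P L \<in> Hom (sym_U P) x y" using tup by (simp add: sym_hom mk)
qed

lemma sym_comp_mk:
  assumes x: "x \<in> Profiles P" and z: "z \<in> Profiles P"
    and f: "f \<in> Hom (sym_U P) x y" and g: "g \<in> Hom (sym_U P) y z"
  shows "sym_comp P g f = sym_mk P (fam.cmp x z (sym_lab P g) (sym_lab P f))"
proof -
  obtain qs lam where f': "f = (qs, lam)" by (cases f)
  obtain rs mu where g': "g = (rs, mu)" by (cases g)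
  define F G where "F = sym_lab P f" and "G = sym_lab P g"
  have F: "fam.mor x y F" and G: "fam.mor y z G" using sym_hom_lab(1) f g by (simp_all add: F_def G_def)
  have lq: "length qs = Suc (psiz x)" "0 < length qs" using fam.mor_len[OF F] by (simp_all add: F_def f')
  have lr: "length rs = Suc (psiz y)" "0 < length rs" using fam.mor_len[OF G] by (simp_all add: G_def g')
  have ne: "qs \<noteq> []" "rs \<noteq> []" using lq lr by auto
  have F0: "F ! 0 = (qs ! 0, 0 # map (\<lambda>k. lam (0, k)) [2..<Suc (arity P (qs ! 0))])"
    using sym_lab_0[of f P] ne by (simp add: F_def f' del: upt_Suc)
  have G0: "G ! 0 = (rs ! 0, 0 # map (\<lambda>l. mu (0, l)) [2..<Suc (arity P (rs ! 0))])"
    using sym_lab_0[of g P] ne by (simp add: G_def g' del: upt_Suc)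
  have Fi: "F ! i = (qs ! i, map (\<lambda>k. lam (i, k)) [1..<Suc (arity P (qs ! i))])" if "i < length qs" "i \<noteq> 0" for i
    using sym_lab_upper[of i f P] that by (simp add: F_def f' del: upt_Suc)
  have Gw: "G ! w = (rs ! w, map (\<lambda>l. mu (w, l)) [1..<Suc (arity P (rs ! w))])" if "w < length rs" "w \<noteq> 0" for w
    using sym_lab_upper[of w g P] that by (simp add: G_def g' del: upt_Suc)
  have lab: "w < length rs" if "i < length qs" "w \<in> set (snd (F ! i))" for i w
    using fam.mor_label[OF F, of i w] that lq lr by simp
  have nz: "w \<noteq> 0" if "i < length qs" "i \<noteq> 0" "w \<in> set (snd (F ! i))" for i w
    using fam.mor_nz[OF F, of i w] that lq by simp
  have nz0: "w \<noteq> 0" if "w \<in> set (map (\<lambda>k. lam (0, k)) [2..<Suc (arity P (qs ! 0))])" for w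
    using fam.mor_distinct[OF F, of 0] that unfolding F0 by (metis distinct.simps(2) le0 snd_conv)
  have nzG: "w \<noteq> 0" if "w \<in> set (map (\<lambda>l. mu (0, l)) [2..<Suc (arity P (rs ! 0))])" for w
    using fam.mor_distinct[OF G, of 0] that unfolding G0 by (metis distinct.simps(2) le0 snd_conv)
  let ?V = "fam.vert x z G F"
  have leaf: "leaf_nums P g f i ks = concat (map (\<lambda>w. snd (G ! w)) (map (\<lambda>k. lam (i, k)) ks))"
    if "\<And>w. w \<in> set (map (\<lambda>k. lam (i, k)) ks) \<Longrightarrow> w < length rs \<and> w \<noteq> 0" for i ks
  proof -
    have "map (\<lambda>k. map (\<lambda>l. mu (lam (i, k), l)) [1..<Suc (arity P (rs ! lam (i, k)))]) ks = map (\<lambda>k. snd (G ! lam (i, k))) ks"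
      using that Gw by (intro map_cong refl) simp
    then show ?thesis unfolding leaf_nums_def f' g' fst_conv snd_conv map_map comp_def by (simp only:)
  qed
  have upper: "upper_vertex P g f i = fst (nrm (?V i))"
    "leaf_nums P g f i [1..<Suc (arity P (qs ! i))] = snd (?V i)"
    if i: "i \<in> {1..<length qs}" for i
  proof -
    have i': "i < length qs" "i \<noteq> 0" using i by auto
    let ?ks = "[1..<Suc (arity P (qs ! i))]"
    have w: "w < length rs \<and> w \<noteq> 0" if "w \<in> set (map (\<lambda>k. lam (i, k)) ?ks)" for w
      using that lab[OF i'(1), of w] nz[OF i', of w] unfolding Fi[OF i'] snd_conv by blast
    have V: "?V i = (plug P (qs ! i) (map (\<lambda>w. fst (G ! w)) (map (\<lambda>k. lam (i, k)) ?ks)),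
        concat (map (\<lambda>w. snd (G ! w)) (map (\<lambda>k. lam (i, k)) ?ks)))"
      using i' by (simp add: fam.vert_def subst_def Fi[OF i'] del: upt_Suc)
    show l: "leaf_nums P g f i ?ks = snd (?V i)" unfolding V snd_conv by (rule leaf[OF w])
    have "map (\<lambda>w. fst (G ! w)) (map (\<lambda>k. lam (i, k)) ?ks) = map (\<lambda>k. rs ! lam (i, k)) ?ks"
      unfolding map_map using w Gw by (intro map_cong refl) simp
    then have "fst (?V i) = plug P (qs ! i) (map (\<lambda>k. rs ! lam (i, k)) ?ks)" unfolding V fst_conv by (simp only:)
    then show "upper_vertex P g f i = fst (nrm (?V i))"
      unfolding nrm_def fst_conv l[symmetric] upper_vertex_def Let_def f' g' snd_conv by (simp only:)
  qed
  define nums where "nums = sym_lower_nums P g f"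
  have r: "w < length rs \<and> w \<noteq> 0" if "w \<in> set (map (\<lambda>k. lam (0, k)) [2..<Suc (arity P (qs ! 0))])" for w
    using lab[OF lq(2), of w] nz0[OF that] that unfolding F0 by simp
  have lf: "leaf_nums P g f 0 [2..<Suc (arity P (qs ! 0))] =
      concat (map (\<lambda>w. snd (G ! w)) (map (\<lambda>k. lam (0, k)) [2..<Suc (arity P (qs ! 0))]))"
    by (rule leaf[OF r])
  have "nums = concat (map (\<lambda>w. snd (G ! w)) (map (\<lambda>k. lam (0, k)) [2..<Suc (arity P (qs ! 0))])) @
      map (\<lambda>l. mu (0, l)) [2..<Suc (arity P (rs ! 0))]"
    unfolding nums_def sym_lower_nums_def lf[symmetric] by (simp add: f' g' del: upt_Suc)
  moreover have "snd (F ! 0) = [] @ 0 # map (\<lambda>k. lam (0, k)) [2..<Suc (arity P (qs ! 0))]"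
    "snd (G ! 0) = [] @ 0 # map (\<lambda>l. mu (0, l)) [2..<Suc (arity P (rs ! 0))]"
    by (simp_all add: F0 G0 del: upt_Suc)
  ultimately have V0: "snd (?V 0) = 0 # nums"
    using fam.vert_0_labels[OF F G _, of "[]" _ "[]"] by (simp del: upt_Suc map_map)
  have dn: "0 \<notin> set nums" using fam.vert_distinct[OF F G, of 0] unfolding V0 by simp
  have w0: "wt ((pcol z)(0 := pcol y 0)) (pcol z 0) (G ! 0)" using fam.mor_wt_lower[OF G] by simp
  have wF: "wt ((pcol y)(0 := pcol x 0)) (pcol y 0) (F ! 0)" using fam.mor_wt_lower[OF F] by simp
  have i0: "ins P (qs ! 0) ! 0 = pcol x 0" using wF by (simp add: wt_def F0 del: upt_Suc) (metis nth_Cons_0)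
  define Q where "Q = plug P (qs ! 0) (ident P (ins P (qs ! 0) ! 0) # map (\<lambda>k. rs ! lam (0, k)) [2..<Suc (arity P (qs ! 0))])"
  have SF: "fst (subst (F ! 0) (fam.star x G)) = Q"
  proof -
    have "map (\<lambda>w. fst (fam.star x G w)) (map (\<lambda>k. lam (0, k)) [2..<Suc (arity P (qs ! 0))]) =
        map (\<lambda>k. rs ! lam (0, k)) [2..<Suc (arity P (qs ! 0))]"
      unfolding map_map
    proof (intro map_cong refl)
      fix k assume "k \<in> set [2..<Suc (arity P (qs ! 0))]"
      then have "lam (0, k) \<in> set (map (\<lambda>k. lam (0, k)) [2..<Suc (arity P (qs ! 0))])" unfolding set_map by blast
      from r[OF this] show "((\<lambda>w. fst (fam.star x G w)) \<circ> (\<lambda>k. lam (0, k))) k = rs ! lam (0, k)"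
        using Gw by (simp add: fam.star_def del: upt_Suc)
    qed
    moreover have "fst (fam.star x G 0) = ident P (ins P (qs ! 0) ! 0)" by (simp add: fam.star_def i0)
    ultimately show ?thesis unfolding subst_def Q_def F0 fst_conv snd_conv list.map by (simp only:)
  qed
  have nG: "0 \<notin> set (map (\<lambda>l. mu (0, l)) [2..<Suc (arity P (rs ! 0))])" using nzG by blast
  have "pcomp P (rs ! 0) 1 Q = plug P (fst (G ! 0)) (map (\<lambda>u. if u = 0 then Q else ident P (((pcol z)(0 := pcol y 0)) u)) (snd (G ! 0)))"
    using pcomp_wt[OF w0, of "[]" 0 "map (\<lambda>l. mu (0, l)) [2..<Suc (arity P (rs ! 0))]" Q] nG
    unfolding G0 fst_conv snd_conv by (simp del: upt_Suc map_map set_map list.map)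
  also have "\<dots> = plug P (fst (G ! 0)) (map (\<lambda>v. fst (if v = 0 then subst (F ! 0) (fam.star x G) else unit_op (pcol z) v)) (snd (G ! 0)))"
    using SF by (intro arg_cong[where f = "plug P (fst (G ! 0))"] map_cong) auto
  also have "\<dots> = fst (?V 0)" by (simp add: fam.vert_def subst_def[of "G ! 0"])
  finally have low: "pcomp P (rs ! 0) 1 Q = fst (?V 0)" .
  \<comment> \<open>The labels are the mark followed by \<open>nums\<close>, so
    \<open>ranks_0\<close> rewrites the normalizing permutation into the one that fixes the first
    input.\<close>
  have lower: "sym_lower_vertex P g f = fst (nrm (?V 0))"
    unfolding nrm_def fst_conv V0 snd_conv ranks_0[OF dn] sym_lower_vertex_def nums_def[symmetric] low[symmetric] Q_def
    unfolding f' g' fst_conv snd_conv ..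
  have up: "[0..<Suc (psiz x)] = 0 # [1..<length qs]" unfolding lq(1) by (simp add: upt_conv_Cons del: upt_Suc)
  have "map fst (fam.cmp x z G F) = map (\<lambda>i. fst (nrm (?V i))) (0 # [1..<length qs])"
    unfolding fam.cmp_def up map_map comp_def ..
  also have "\<dots> = sym_lower_vertex P g f # map (upper_vertex P g f) [1..<length (fst f)]"
    using lower upper(1) by (simp add: f')
  finally have vs: "map fst (fam.cmp x z G F) = sym_lower_vertex P g f # map (upper_vertex P g f) [1..<length (fst f)]" .
  let ?vs = "sym_lower_vertex P g f # map (upper_vertex P g f) [1..<length (fst f)]"
  have lv: "length ?vs = length qs" using lq by (simp add: f')
  have "restrict (\<lambda>(i, k). if i = 0 then sort (sym_lower_nums P g f) ! (k - 2)
       else sort (leaf_nums P g f i [1..<Suc (arity P (fst f ! i))]) ! (k - 1)) (set (sym_leaves P ?vs)) =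
     restrict (\<lambda>(i, k). snd (fam.cmp x z G F ! i) ! (k - 1)) (set (sym_leaves P ?vs))"
  proof (rule restrict_eqI, clarify)
    fix i k assume m: "(i, k) \<in> set (sym_leaves P ?vs)"
    show "(if i = 0 then sort (sym_lower_nums P g f) ! (k - 2)
       else sort (leaf_nums P g f i [1..<Suc (arity P (fst f ! i))]) ! (k - 1)) = snd (fam.cmp x z G F ! i) ! (k - 1)"
    proof (cases "i = 0")
      case True
      then have "2 \<le> k" using m by (simp add: sym_leaves_iff)
      then obtain j where j: "k = Suc (Suc j)" by (metis Suc_le_D numeral_2_eq_2 Suc_le_mono)
      \<comment> \<open>The mark accounts for the shift: leaf \<open>(0, k)\<close> is entry
        \<open>k - 1\<close> of the labels but entry \<open>k - 2\<close> of the leaf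
        numbers.\<close>
      have "snd (fam.cmp x z G F ! 0) = 0 # sort nums"
        using fam.cmp_nth[of 0 x z G F] unfolding nrm_def V0 snd_conv sort_0 by simp
      then show ?thesis using True j by (simp add: nums_def)
    next
      case False
      then have i: "i \<in> {1..<length qs}" "i \<le> psiz x" using m lv lq by (auto simp: sym_leaves_iff)
      then have "snd (fam.cmp x z G F ! i) = sort (snd (?V i))"
        using fam.cmp_nth[of i x z G F] by (simp add: nrm_def)
      then show ?thesis using False upper(2)[OF i(1)] by (simp add: f')
    qed
  qed
  then show ?thesis
    unfolding F_def[symmetric] G_def[symmetric] sym_mk_def vs sym_comp_def Let_def by simp
qed

lemma sym_id_mk:
  assumes x: "x \<in> Profiles P" shows "sym_id P x = sym_mk P (fam.idm x)"
proof -
  obtain cs c0 where x': "x = (cs, c0)" by (cases x)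
  define vs where "vs = map (ident P) (c0 # cs)"
  have lv: "length vs = Suc (length cs)" by (simp add: vs_def)
  have m: "map fst (fam.idm x) = vs"
    unfolding fam.idm_def vs_def by (intro nth_equalityI) (auto simp: x' psiz_def pcol_def nth_Cons' simp del: upt_Suc)
  have a: "arity P (vs ! i) = 1" if "i < length vs" for i
  proof -
    have "(c0 # cs) ! i \<in> Cols P" using x that pcol_Cols[of x P i] by (simp add: x' pcol_def psiz_def lv)
    moreover have "vs ! i = ident P ((c0 # cs) ! i)" using that unfolding vs_def by (intro nth_map) simp
    ultimately show ?thesis using ident by (simp add: arity_def)
  qed
  have l: "set (sym_leaves P vs) = {1..length cs} \<times> {1}"
  proof (intro set_eqI, clarify)
    fix i k
    show "(i, k) \<in> set (sym_leaves P vs) \<longleftrightarrow> (i, k) \<in> {1..length cs} \<times> {1}"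
    proof (cases "i < length vs")
      case True
      then show ?thesis using a[OF True] lv unfolding sym_leaves_iff by (cases "i = 0") auto
    next
      case False
      then show ?thesis using lv unfolding sym_leaves_iff by (cases "i = 0") auto
    qed
  qed
  have "restrict fst ({1..length cs} \<times> {1}) = restrict (\<lambda>(i, k). snd (fam.idm x ! i) ! (k - 1)) ({1..length cs} \<times> {1::nat})"
  proof (rule restrict_eqI, clarify)
    fix i k assume "i \<in> {1..length cs}"
    then have "fam.idm x ! i = unit_op (pcol x) i" by (intro cat.idm_nth) (simp add: x' psiz_def)
    then show "fst (i, 1) = snd (fam.idm x ! i) ! (1 - 1)" by simp
  qed
  moreover have "sym_id P x = (vs, restrict fst ({1..length cs} \<times> {1}))"
    by (simp add: sym_id_def x' vs_def)
  ultimately show ?thesis unfolding sym_mk_def m l by simp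
qed

sublocale env: enveloping P relab nrm \<psi> "{0}" "Profiles P" psiz pcol "\<lambda>_. True" "sym_U P" "sym_lab P" "sym_mk P" "sym_trivial P"
proof unfold_locales
  show "Obj (sym_U P) = Profiles P" by (simp add: sym_U_def)
  fix x y f assume x: "x \<in> Profiles P" and y: "y \<in> Profiles P"
  { assume "f \<in> Hom (sym_U P) x y"
    then show "fam.mor x y (sym_lab P f) \<and> sym_mk P (sym_lab P f) = f \<and> map fst (sym_lab P f) = fst f"
      using sym_hom_lab fst_sym_lab by blast }
  { fix L assume "fam.mor x y L"
    then show "sym_mk P L \<in> Hom (sym_U P) x y \<and> sym_lab P (sym_mk P L) = L" using sym_hom_mk by blast }
  { fix z g assume "z \<in> Profiles P" "f \<in> Hom (sym_U P) x y" "g \<in> Hom (sym_U P) y z"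
    then show "Cmp (sym_U P) g f = sym_mk P (fam.cmp x z (sym_lab P g) (sym_lab P f))"
      using sym_comp_mk[OF x] by (simp add: sym_U_def) }
  show "Idm (sym_U P) x = sym_mk P (fam.idm x)" using sym_id_mk[OF x] by (simp add: sym_U_def)
  { assume f: "f \<in> Hom (sym_U P) x y" and v: "\<And>q. q \<in> set (fst f) \<Longrightarrow> q \<in> ident P ` Cols P \<or> \<psi> q = -1"
    let ?L = "sym_lab P f"
    note L = sym_hom_lab(1)[OF f]
    have len: "length (fst f) = Suc (psiz x)" using fam.mor_len[OF L] by simp
    then have ne: "fst f \<noteq> []" by auto
    have q: "fst f ! 0 \<in> set (fst f)" using len by simp
    have L0: "fst (?L ! 0) = fst f ! 0" "snd (?L ! 0) = 0 # map (\<lambda>k. snd f (0, k)) [2..<Suc (arity P (fst f ! 0))]"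
      using sym_lab_0[OF ne, of P] by simp_all
    have o: "fst f ! 0 \<in> Ops P" using cat.mor_Ops[OF L le0] L0(1) by simp
    have w: "arity P (fst f ! 0) = length (snd (?L ! 0))"
      using wt_arity[OF fam.mor_wt[OF L le0]] L0(1) by simp
    then have "arity P (fst f ! 0) \<noteq> 0" unfolding L0(2) by simp
    then have "\<psi> (fst f ! 0) \<noteq> -1" using fam.grading_minus1[OF o] by auto
    then have "fst f ! 0 \<in> ident P ` Cols P" using v[OF q] by blast
    then have "arity P (fst f ! 0) = 1" using ident by (auto simp: arity_def)
    then have L0: "snd (?L ! 0) = [0]" using L0(2) by simp
    have "?L \<noteq> []" using ne length_sym_lab[of P f] by (metis length_0_conv)
    then have c: "concat (map snd ?L) = 0 # map (snd f) (sym_leaves P (fst f))"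
      using map_sym_leaves[OF ne, of P] L0 by (cases ?L) simp_all
    show "sym_trivial P f \<longleftrightarrow> concat (map snd ?L) = [0..<Suc (psiz y)]"
      unfolding sym_trivial_def c sym_hom_lab(3)[OF f] by (simp add: upt_conv_Cons del: upt_Suc) }
qed

sublocale tw: rooted P relab nrm \<psi> "{0}" "Profiles P" psiz pcol "\<lambda>_. True" "sym_U P" "sym_lab P" "sym_mk P" "sym_trivial P"
  "sym_Tw P" "profile P" "sym_target P"
proof unfold_locales
  fix p t f assume p: "p \<in> Ops P"
  have "\<exists>y\<in>Profiles P. sym_has_target_profile P f y" if h: "sym_tuple P (profile P p) f"
  proof -
    obtain qs lam where f': "f = (qs, lam)" by (cases f)
    have ops: "set qs \<subseteq> Ops P" and ne: "qs \<noteq> []" and b: "bij_betw lam (set (sym_leaves P qs)) {1..length (sym_leaves P qs)}"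
      using h by (auto simp: f' profile_def numbering_def)
    define \<mu> where "\<mu> = inv_into (set (sym_leaves P qs)) lam"
    have mu: "\<mu> (lam a) = a" if "a \<in> set (sym_leaves P qs)" for a
      using b that by (simp add: \<mu>_def bij_betw_inv_into_left)
    have mu': "\<mu> n \<in> set (sym_leaves P qs)" if "n \<in> {1..length (sym_leaves P qs)}" for n
      using b that unfolding \<mu>_def by (metis bij_betw_def inv_into_into)
    \<comment> \<open>The colour of leg \<open>n\<close> of the target is read off the leaf with
      number \<open>n\<close>.\<close>
    define ds where "ds = map (\<lambda>n. ins P (qs ! fst (\<mu> n)) ! (snd (\<mu> n) - 1)) [1..<Suc (length (sym_leaves P qs))]"
    have cols: "ins P (qs ! i) ! (k - 1) \<in> Cols P" if "(i, k) \<in> set (sym_leaves P qs)" for i k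
    proof -
      have i: "i < length qs" "k - 1 < length (ins P (qs ! i))"
        using that ne by (auto simp: sym_leaves_iff arity_def split: if_splits)
      then have "qs ! i \<in> Ops P" using ops by auto
      then show ?thesis using colours[of "qs ! i"] i(2) nth_mem by blast
    qed
    have "set ds \<subseteq> Cols P"
    proof
      fix c assume "c \<in> set ds"
      then obtain n where n: "n \<in> {1..length (sym_leaves P qs)}" "c = ins P (qs ! fst (\<mu> n)) ! (snd (\<mu> n) - 1)"
        unfolding ds_def by (auto simp: atLeastLessThanSuc_atLeastAtMost simp del: upt_Suc)
      then show "c \<in> Cols P" using cols[of "fst (\<mu> n)" "snd (\<mu> n)"] mu'[OF n(1)] by simp
    qed
    moreover have "qs ! 0 \<in> Ops P" using ops ne by (metis nth_mem subsetD length_greater_0_conv)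
    then have "out P (qs ! 0) \<in> Cols P" using colours by blast
    moreover have "ds ! (lam (i, k) - 1) = ins P (qs ! i) ! (k - 1)" if m: "(i, k) \<in> set (sym_leaves P qs)" for i k
    proof -
      have "lam (i, k) \<in> {1..length (sym_leaves P qs)}" using b m by (auto simp: bij_betw_def)
      then obtain j where j: "lam (i, k) = Suc j" "j < length (sym_leaves P qs)" by (cases "lam (i, k)") auto
      then have "[1..<Suc (length (sym_leaves P qs))] ! j = Suc j" by (subst nth_upt) auto
      then show ?thesis unfolding ds_def using mu[OF m] j by (simp del: upt_Suc)
    qed
    ultimately show ?thesis
      by (intro bexI[of _ "(ds, out P (qs ! 0))"]) (auto simp: f' Profiles_iff ds_def simp del: upt_Suc)
  qed
  moreover have "f \<in> Hom (sym_Tw P) p t \<longleftrightarrow> sym_tuple P (profile P p) f \<and> sym_target P p f = t"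
    by (simp add: sym_Tw_def)
  ultimately show "f \<in> Hom (sym_Tw P) p t \<longleftrightarrow> (\<exists>y\<in>Profiles P. f \<in> Hom (sym_U P) (profile P p) y) \<and> sym_target P p f = t"
    by (metis sym_hom)
next
  fix p p' assume "p \<in> Ops P" "p' \<in> Ops P" "profile P p = profile P p'"
  then show "\<psi> p = \<psi> p'" using dep unfolding grading_depends_on_colours_def profile_def by (metis prod.inject)
next
  fix p y f assume p: "p \<in> Ops P" and y: "y \<in> Profiles P" and f: "f \<in> Hom (sym_U P) (profile P p) y"
  let ?F = "sym_lab P f"
  let ?R = "\<lambda>v. if v = 0 then subst (p, [1..<Suc (arity P p)]) ((!) ?F) else unit_op (pcol y) v"
  obtain qs lam where f': "f = (qs, lam)" by (cases f)
  note F = sym_hom_lab(1)[OF f]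
  have lq: "length qs = Suc (arity P p)" using fam.mor_len[OF F] by (simp add: f' profile_cols)
  then have ne: "fst f \<noteq> []" by (auto simp: f')
  define r where "r = map (\<lambda>k. lam (0, k)) [2..<Suc (arity P (qs ! 0))]"
  have F0: "?F ! 0 = (qs ! 0, 0 # r)" using sym_lab_0[OF ne, of P] by (simp add: f' r_def)
  have d: "0 \<notin> set r" using fam.mor_distinct[OF F, of 0] by (simp add: F0)
  have tlF: "tl ?F = map ((!) ?F) [1..<Suc (arity P p)]"
    using lq by (intro nth_equalityI) (simp_all add: nth_tl f' del: upt_Suc)
  have "map fst (tl ?F) = tl qs" using fst_sym_lab[of P f] by (simp add: f' map_tl)
  then have S: "subst (p, [1..<Suc (arity P p)]) ((!) ?F) = (plug P p (tl qs), concat (map snd (tl ?F)))"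
    unfolding tlF by (simp add: subst_def comp_def del: upt_Suc)
  have w: "wt ((pcol y)(0 := pcol (profile P p) 0)) (pcol y 0) (?F ! 0)" using fam.mor_wt_lower[OF F] by simp
  have "pcomp P (qs ! 0) 1 (plug P p (tl qs)) = plug P (fst (?F ! 0)) (map (\<lambda>u. if u = 0 then plug P p (tl qs)
      else ident P (((pcol y)(0 := pcol (profile P p) 0)) u)) (snd (?F ! 0)))"
    using pcomp_wt[OF w, of "[]" 0 r "plug P p (tl qs)"] d by (simp add: F0)
  also have "\<dots> = fst (subst (?F ! 0) ?R)"
    unfolding subst_def[of "?F ! 0"] fst_conv S by (intro arg_cong[where f = "plug P (fst (?F ! 0))"] map_cong) auto
  finally have 1: "fst (subst (?F ! 0) ?R) = pcomp P (qs ! 0) 1 (plug P p (tl qs))" ..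
  have "concat (map (\<lambda>v. snd (?R v)) xs) = xs" if "0 \<notin> set xs" for xs
  proof (rule concat_map_eq_singletons)
    fix v assume "v \<in> set xs"
    then have "v \<noteq> 0" using that by metis
    then show "snd (?R v) = [v]" by simp
  qed
  then have "snd (subst (?F ! 0) ?R) = concat (map snd (tl ?F)) @ r"
    using d unfolding snd_subst F0 S by simp
  then have 2: "snd (subst (?F ! 0) ?R) = map lam (sym_leaves P qs)"
    using map_sym_leaves[OF ne, of P] by (simp add: f' F0[unfolded f'])
  have num: "numbering (sym_leaves P qs) {1..length (sym_leaves P qs)} lam"
    using f by (cases "profile P p") (simp add: sym_hom f')
  have ly: "length (sym_leaves P qs) = psiz y" using sym_hom_lab(3)[OF f] by (simp add: f')
  have "set (map lam (sym_leaves P qs)) = {1..psiz y}"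
    using num unfolding ly numbering_def bij_betw_def by simp
  moreover have "wt (pcol y) (pcol y 0) (subst (?F ! 0) ?R)"
  proof (rule wt_subst[OF w])
    fix v assume v: "v \<in> set (snd (?F ! 0))"
    have src: "wt (pcol (profile P p)) (out P p) (p, [1..<Suc (arity P p)])"
      using p pcol_map[of "profile P p", unfolded profile_cols(1)] by (simp add: wt_def profile_def del: upt_Suc)
    have "wt (pcol y) (out P p) (subst (p, [1..<Suc (arity P p)]) ((!) ?F))"
      using fam.mor_wt_upper[OF F] by (intro wt_subst[OF src]) (auto simp: profile_cols simp del: upt_Suc)
    then show "wt (pcol y) (((pcol y)(0 := pcol (profile P p) 0)) v) (?R v)"
      using pcol_Cols[OF y fam.mor_label[OF F le0 v]] profile_cols(2)[of p] by (auto intro: wt_unit)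
  qed
  ultimately show "relab (subst (?F ! 0) ?R) (sym_target P p f, [1..<Suc (psiz y)])"
    using relab_place[of "pcol y" "pcol y 0" "subst (?F ! 0) ?R" "psiz y"] ly unfolding 1 2 by (simp add: f')
next
  show "pcol (profile P p) 0 = out P p" "pcol (profile P p) (Suc i) = ins P p ! i" for p i
    by (rule profile_cols)+
next
  show "Obj (sym_Tw P) = Ops P" "Cmp (sym_Tw P) = Cmp (sym_U P)" "Idm (sym_Tw P) p = Idm (sym_U P) (profile P p)" for p
    by (simp_all add: sym_Tw_def sym_U_def)
  show "p \<in> Ops P \<Longrightarrow> profile P p \<in> Profiles P" "psiz (profile P p) = arity P p" for p
    by (rule profile_Profiles, assumption, rule profile_cols)
qed simp

end

section \<open>The cyclic enveloping category\<close>

definition cyc_lab :: "('c, 'o, 'z) operad_scheme \<Rightarrow> 'o num_mor \<Rightarrow> ('o \<times> nat list) list" where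
  "cyc_lab P f = map (\<lambda>j. (fst f ! j, map (\<lambda>k. snd f (j, k)) [1..<Suc (arity P (fst f ! j))])) [0..<length (fst f)]"

definition cyc_mk :: "('c, 'o, 'z) operad_scheme \<Rightarrow> ('o \<times> nat list) list \<Rightarrow> 'o num_mor" where
  "cyc_mk P L = (map fst L, restrict (\<lambda>(j, k). snd (L ! j) ! (k - 1)) (set (cyc_leaves P (map fst L))))"

lemma cyc_leaves_iff:
  "(j, k) \<in> set (cyc_leaves P qs) \<longleftrightarrow> j < length qs \<and> 1 \<le> k \<and> k \<le> arity P (qs ! j)"
  unfolding cyc_leaves_def by (auto simp: image_iff simp del: upt_Suc)

lemma length_cyc_lab [simp]: "length (cyc_lab P f) = length (fst f)"
  by (simp add: cyc_lab_def)

lemma fst_cyc_lab: "map fst (cyc_lab P f) = fst f"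
  by (intro nth_equalityI) (simp_all add: cyc_lab_def)

lemma cyc_lab_nth: "j < length (fst f) \<Longrightarrow>
    cyc_lab P f ! j = (fst f ! j, map (\<lambda>k. snd f (j, k)) [1..<Suc (arity P (fst f ! j))])"
  by (simp add: cyc_lab_def del: upt_Suc)

lemma map_cyc_leaves: "map (snd f) (cyc_leaves P (fst f)) = concat (map snd (cyc_lab P f))"
  by (simp add: cyc_leaves_def cyc_lab_def map_concat comp_def del: upt_Suc)

lemma length_cyc_leaves: "length (cyc_leaves P qs) = (\<Sum>q\<leftarrow>qs. arity P q)"
proof -
  have "map (\<lambda>j. arity P (qs ! j)) [0..<length qs] = map (arity P) qs"
    by (rule nth_equalityI) simp_all
  then show ?thesis by (simp add: cyc_leaves_def length_concat comp_def del: upt_Suc)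
qed

context cyclic_operad
begin

lemma wt_single: "wt \<kappa> c X \<longleftrightarrow> fst X \<in> Ops P \<and> arity P (fst X) = length (snd X)"
  unfolding wt_def arity_def by (auto intro: nth_equalityI dest: arg_cong[where f = length])

lemma single [simp]: "c \<in> Cols P"
  using single_coloured by simp

end

locale graded_cyclic = cyclic_operad P
  for P :: "(unit, 'o, 'z) sym_operad_scheme" +
  fixes \<psi> :: "'o \<Rightarrow> int"
  assumes gr: "cyclic_grading P \<psi>" and ni: "nice P \<psi>" and dep: "grading_depends_on_colours P \<psi>"
begin

lemma grading_act: "p \<in> Ops P \<Longrightarrow> \<sigma> permutes {0..arity P p} \<Longrightarrow> \<psi> (act P \<sigma> p) = \<psi> p"
  using gr unfolding cyclic_grading_def by blast

sublocale fam: labelled_families P relab nrm \<psi> "{}" "UNIV :: nat set" "\<lambda>n. n" "\<lambda>_ _. ()" "\<lambda>_. True"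
proof unfold_locales
  fix \<kappa> \<kappa>' :: "nat \<Rightarrow> unit" and c X Y F F'
  assume X: "wt \<kappa> c X"
  then have o: "fst X \<in> Ops P" by (simp add: wt_def)
  show "relab X X" using relab_refl o .
  { assume r: "relab X Y"
    show "relab Y X" using relab_sym[OF X r] .
    show "wt \<kappa> c Y" "mset (snd Y) = mset (snd X)" using relab_wt[OF X r] .
    show "\<psi> (fst Y) = \<psi> (fst X)"
    proof (rule relab_grading[OF X r])
      fix p \<sigma> assume "p \<in> Ops P" "\<sigma> permutes {1..arity P p}"
      \<comment> \<open>Permutations of the inputs are those permutations of the legs that fix leg
        0.\<close>
      then show "\<psi> (act P \<sigma> p) = \<psi> p" by (intro grading_act) (auto intro: permutes_subset)
    qed
    show "relab Y Z \<Longrightarrow> relab X Z" for Z using relab_trans[OF o r] .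
    show "distinct (snd X) \<Longrightarrow> nrm X = nrm Y" using relab_nrm_eq[OF X _ r] .
    assume "\<And>x. x \<in> set (snd X) \<Longrightarrow> wt \<kappa>' (\<kappa> x) (F x)" "\<And>x. x \<in> set (snd X) \<Longrightarrow> relab (F x) (F' x)"
    then show "relab (subst X F) (subst Y F')" using relab_subst[OF X _ r] by blast }
  show "distinct (snd X) \<Longrightarrow> relab X (nrm X)" using relab_nrm[OF X] .
  show "distinct (snd X) \<Longrightarrow> sorted (snd X) \<Longrightarrow> nrm X = X" using nrm_sorted[OF X] .
next
  show "planar_grading P \<psi>" using gr by (simp add: cyclic_grading_def)
next
  fix p assume "p \<in> Ops P"
  then show "-1 \<le> \<psi> p" "\<psi> p = -1 \<Longrightarrow> arity P p = 0" using ni unfolding nice_def by blast+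
qed simp_all

sublocale cat: family_category P relab nrm \<psi> "{}" "UNIV :: nat set" "\<lambda>n. n" "\<lambda>_ _. ()" "\<lambda>_. True"
  by unfold_locales simp_all

section \<open>Cyclic tuples as families\<close>

lemma cyc_hom: "f \<in> Hom (cyc_U P) n N \<longleftrightarrow> cyc_tuple P n f \<and> length (cyc_leaves P (fst f)) = Suc N"
  by (simp add: cyc_U_def)

lemma mor_iff: "fam.mor n N L \<longleftrightarrow> length L = Suc n \<and>
    (\<forall>i\<le>n. fst (L ! i) \<in> Ops P \<and> arity P (fst (L ! i)) = length (snd (L ! i)) \<and> nrm (L ! i) = L ! i) \<and>
    mset (concat (map snd L)) = mset [0..<Suc N]"
  unfolding fam.mor_def wt_single by (simp del: upt_Suc)

lemma cyc_hom_lab: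
  assumes f: "f \<in> Hom (cyc_U P) n N"
  shows "fam.mor n N (cyc_lab P f)" "cyc_mk P (cyc_lab P f) = f" "length (cyc_leaves P (fst f)) = Suc N"
proof -
  obtain qs lam where f': "f = (qs, lam)" by (cases f)
  have len: "length qs = Suc n" and ops: "set qs \<subseteq> Ops P"
    and num: "numbering (cyc_leaves P qs) {0..<length (cyc_leaves P qs)} lam"
    using f by (auto simp: cyc_hom f')
  show ly: "length (cyc_leaves P (fst f)) = Suc N" using f by (simp add: cyc_hom)
  let ?L = "cyc_lab P f"
  have L: "?L ! j = (qs ! j, map (\<lambda>k. lam (j, k)) [1..<Suc (arity P (qs ! j))])" if "j < length qs" for j
    using cyc_lab_nth[of j f P] that by (simp add: f' del: upt_Suc)
  have ms: "mset (concat (map snd ?L)) = mset [0..<Suc N]"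
    using numbering_mset(1)[OF num] ly map_cyc_leaves[of f P] by (simp add: f' del: upt_Suc mset_map)
  show "fam.mor n N ?L"
    unfolding mor_iff
  proof (intro conjI allI impI)
    show "length ?L = Suc n" using len by (simp add: f')
    fix j assume "j \<le> n"
    then have j: "j < length qs" using len by simp
    then have o: "qs ! j \<in> Ops P" using ops by auto
    then show "fst (?L ! j) \<in> Ops P" by (simp add: L[OF j])
    show a: "arity P (fst (?L ! j)) = length (snd (?L ! j))" by (simp add: L[OF j] del: upt_Suc)
    have "sorted_wrt (<) (snd (?L ! j))" unfolding L[OF j] snd_conv
      by (rule numbering_sorted[OF num]) (use j in \<open>simp add: cyc_leaves_iff\<close>)
    then have "sorted (snd (?L ! j))" "distinct (snd (?L ! j))" by (simp_all add: strict_sorted_iff)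
    moreover have "wt (\<lambda>_. ()) () (?L ! j)" using o a by (simp add: wt_single L[OF j])
    ultimately show "nrm (?L ! j) = ?L ! j" using nrm_sorted by blast
  qed (simp_all only: ms)
  have "restrict (\<lambda>(j, k). snd (?L ! j) ! (k - 1)) (set (cyc_leaves P qs)) = restrict lam (set (cyc_leaves P qs))"
  proof (rule restrict_eqI, clarify)
    fix j k assume "(j, k) \<in> set (cyc_leaves P qs)"
    then have "1 \<le> k" "k \<le> arity P (qs ! j)" "j < length qs" by (simp_all add: cyc_leaves_iff)
    then show "snd (?L ! j) ! (k - 1) = lam (j, k)"
      using L[of j] upt1_nth[of k "arity P (qs ! j)"] by (simp del: upt_Suc)
  qed
  also have "\<dots> = lam" using num by (intro extensional_restrict) (simp add: numbering_def)
  finally show "cyc_mk P ?L = f" unfolding cyc_mk_def fst_cyc_lab by (simp add: f')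
qed

lemma cyc_hom_mk:
  assumes L: "fam.mor n N L"
  shows "cyc_mk P L \<in> Hom (cyc_U P) n N" "cyc_lab P (cyc_mk P L) = L"
proof -
  define qs lam where "qs = map fst L" and "lam = snd (cyc_mk P L)"
  have mk: "cyc_mk P L = (qs, lam)" by (simp add: lam_def qs_def cyc_mk_def)
  have len: "length L = Suc n" by (rule fam.mor_len[OF L])
  then have lq: "length qs = Suc n" by (simp add: qs_def)
  have ar: "arity P (qs ! i) = length (snd (L ! i))" if "i < length qs" for i
    using wt_arity[OF fam.mor_wt[OF L, of i]] that len by (simp add: qs_def)
  have srt: "sorted_wrt (<) (snd (L ! i))" if "i < length qs" for i
    using nrm_fixed_sorted[OF fam.mor_nrm[OF L, of i]] fam.mor_distinct[OF L, of i] that len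
    by (simp add: strict_sorted_iff qs_def)
  have lam: "lam (i, k) = snd (L ! i) ! (k - 1)" if "(i, k) \<in> set (cyc_leaves P qs)" for i k
    using that by (simp add: lam_def cyc_mk_def qs_def)
  have lab_mk: "cyc_lab P (qs, lam) = L"
  proof (rule nth_equalityI)
    fix i assume "i < length (cyc_lab P (qs, lam))"
    then have i: "i < length qs" by simp
    have "map (\<lambda>k. lam (i, k)) [1..<Suc (arity P (qs ! i))] = snd (L ! i)"
    proof (rule nth_equalityI)
      show "length (map (\<lambda>k. lam (i, k)) [1..<Suc (arity P (qs ! i))]) = length (snd (L ! i))"
        using ar[OF i] by (simp del: upt_Suc)
      fix j assume "j < length (map (\<lambda>k. lam (i, k)) [1..<Suc (arity P (qs ! i))])"
      then have j: "Suc j \<le> arity P (qs ! i)" by (simp del: upt_Suc)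
      then have "lam (i, Suc j) = snd (L ! i) ! j" using lam[of i "Suc j"] i by (simp add: cyc_leaves_iff)
      then show "map (\<lambda>k. lam (i, k)) [1..<Suc (arity P (qs ! i))] ! j = snd (L ! i) ! j"
        using j by (simp add: nth_upt del: upt_Suc)
    qed
    then show "cyc_lab P (qs, lam) ! i = L ! i"
      using i cyc_lab_nth[of i "(qs, lam)" P] by (simp add: prod_eq_iff qs_def del: upt_Suc)
  qed (simp add: qs_def)
  then show "cyc_lab P (cyc_mk P L) = L" by (simp add: mk)
  have ml: "map lam (cyc_leaves P qs) = concat (map snd L)"
    using map_cyc_leaves[of "(qs, lam)" P] lab_mk by simp
  have ms: "mset (map lam (cyc_leaves P qs)) = mset_set {0..<Suc N}"
    unfolding ml fam.mor_mset[OF L] by (simp del: upt_Suc)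
  have ly: "length (cyc_leaves P qs) = Suc N" using arg_cong[OF ms, of size] by simp
  have num: "numbering (cyc_leaves P qs) {0..<length (cyc_leaves P qs)} lam"
    unfolding ly
  proof (rule numberingI[OF ms])
    show "lam \<in> extensional (set (cyc_leaves P qs))" by (simp add: lam_def cyc_mk_def qs_def)
    fix i k k' assume m: "(i, k) \<in> set (cyc_leaves P qs)" "(i, k') \<in> set (cyc_leaves P qs)" "k < k'"
    have i: "i < length qs" "1 \<le> k" "k' \<le> arity P (qs ! i)" using m by (auto simp: cyc_leaves_iff)
    then show "lam (i, k) < lam (i, k')"
      using sorted_wrt_nth_less[OF srt[OF i(1)], of "k - 1" "k' - 1"] m(3) ar[OF i(1)] lam m(1,2) by simp
  qed simp
  have "set qs \<subseteq> Ops P" using cat.mor_Ops[OF L] len by (simp add: qs_def image_subset_iff all_set_conv_all_nth less_Suc_eq_le)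
  then show "cyc_mk P L \<in> Hom (cyc_U P) n N" using lq ly num length_cyc_leaves[of P qs] by (simp add: cyc_hom mk)
qed

lemma cyc_comp_mk:
  assumes f: "f \<in> Hom (cyc_U P) n m" and g: "g \<in> Hom (cyc_U P) m l"
  shows "cyc_comp P g f = cyc_mk P (fam.cmp n l (cyc_lab P g) (cyc_lab P f))"
proof -
  obtain qs lam where f': "f = (qs, lam)" by (cases f)
  obtain rs mu where g': "g = (rs, mu)" by (cases g)
  define F G where "F = cyc_lab P f" and "G = cyc_lab P g"
  have F: "fam.mor n m F" and G: "fam.mor m l G" using cyc_hom_lab(1) f g by (simp_all add: F_def G_def)
  have lq: "length qs = Suc n" using fam.mor_len[OF F] by (simp add: F_def f')
  have lr: "length rs = Suc m" using fam.mor_len[OF G] by (simp add: G_def g')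
  have Fi: "F ! i = (qs ! i, map (\<lambda>k. lam (i, k)) [1..<Suc (arity P (qs ! i))])" if "i < length qs" for i
    using cyc_lab_nth[of i f P] that by (simp add: F_def f' del: upt_Suc)
  have Gw: "G ! w = (rs ! w, map (\<lambda>l. mu (w, l)) [1..<Suc (arity P (rs ! w))])" if "w < length rs" for w
    using cyc_lab_nth[of w g P] that by (simp add: G_def g' del: upt_Suc)
  let ?V = "fam.vert n l G F"
  have upper: "upper_vertex P g f i = fst (nrm (?V i))"
    "leaf_nums P g f i [1..<Suc (arity P (qs ! i))] = snd (?V i)"
    if i: "i < length qs" for i
  proof -
    let ?ks = "[1..<Suc (arity P (qs ! i))]"
    have w: "w < length rs" if "w \<in> set (map (\<lambda>k. lam (i, k)) ?ks)" for w
    proof -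
      have "w \<in> set (snd (F ! i))" using that unfolding Fi[OF i] snd_conv .
      then show ?thesis using fam.mor_label[OF F, of i w] i lq lr by simp
    qed
    have V: "?V i = (plug P (qs ! i) (map (\<lambda>w. fst (G ! w)) (map (\<lambda>k. lam (i, k)) ?ks)),
        concat (map (\<lambda>w. snd (G ! w)) (map (\<lambda>k. lam (i, k)) ?ks)))"
      by (simp add: fam.vert_def subst_def Fi[OF i] del: upt_Suc)
    have "map (\<lambda>k. map (\<lambda>l. mu (lam (i, k), l)) [1..<Suc (arity P (rs ! lam (i, k)))]) ?ks =
        map (\<lambda>w. snd (G ! w)) (map (\<lambda>k. lam (i, k)) ?ks)"
      unfolding map_map using w Gw by (intro map_cong refl) (simp del: upt_Suc)
    then show l: "leaf_nums P g f i ?ks = snd (?V i)"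
      unfolding V snd_conv leaf_nums_def f' g' fst_conv by (simp only:)
    have "map (\<lambda>w. fst (G ! w)) (map (\<lambda>k. lam (i, k)) ?ks) = map (\<lambda>k. rs ! lam (i, k)) ?ks"
      unfolding map_map using w Gw by (intro map_cong refl) (simp del: upt_Suc)
    then have "fst (?V i) = plug P (qs ! i) (map (\<lambda>k. rs ! lam (i, k)) ?ks)" unfolding V fst_conv by (simp only:)
    then show "upper_vertex P g f i = fst (nrm (?V i))"
      unfolding nrm_def fst_conv l[symmetric] upper_vertex_def Let_def f' g' snd_conv by (simp only:)
  qed
  let ?vs = "map (upper_vertex P g f) [0..<length (fst f)]"
  have vs: "map fst (fam.cmp n l G F) = ?vs"
    using upper(1) lq by (auto simp: fam.cmp_def f' simp del: upt_Suc)
  have "restrict (\<lambda>(j, k). sort (leaf_nums P g f j [1..<Suc (arity P (fst f ! j))]) ! (k - 1)) (set (cyc_leaves P ?vs)) =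
     restrict (\<lambda>(j, k). snd (fam.cmp n l G F ! j) ! (k - 1)) (set (cyc_leaves P ?vs))"
  proof (rule restrict_eqI, clarify)
    fix j k assume "(j, k) \<in> set (cyc_leaves P ?vs)"
    then have j: "j < length qs" "j \<le> n" using lq by (auto simp: cyc_leaves_iff f')
    then have "snd (fam.cmp n l G F ! j) = sort (snd (?V j))"
      using fam.cmp_nth[of j n l G F] by (simp add: nrm_def)
    then show "sort (leaf_nums P g f j [1..<Suc (arity P (fst f ! j))]) ! (k - 1) = snd (fam.cmp n l G F ! j) ! (k - 1)"
      using upper(2)[OF j(1)] by (simp add: f')
  qed
  then show ?thesis
    unfolding F_def[symmetric] G_def[symmetric] cyc_mk_def vs cyc_comp_def Let_def by simp
qed

lemma cyc_id_mk: "cyc_id P n = cyc_mk P (fam.idm n)"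
proof -
  let ?vs = "replicate (Suc n) (ident P ())"
  have m: "map fst (fam.idm n) = ?vs"
    unfolding fam.idm_def by (intro nth_equalityI) (auto simp del: upt_Suc replicate.simps)
  have "arity P (ident P ()) = 1" using ident[of "()"] by (simp add: arity_def)
  then have l: "set (cyc_leaves P ?vs) = {0..n} \<times> {1}"
  proof (intro set_eqI, clarify)
    fix i k assume "arity P (ident P ()) = 1"
    then show "(i, k) \<in> set (cyc_leaves P ?vs) \<longleftrightarrow> (i, k) \<in> {0..n} \<times> {1}"
      unfolding cyc_leaves_iff by (auto simp del: replicate.simps)
  qed
  have "restrict fst ({0..n} \<times> {1}) = restrict (\<lambda>(j, k). snd (fam.idm n ! j) ! (k - 1)) ({0..n} \<times> {1::nat})"
    by (rule restrict_eqI) (auto simp: cat.idm_nth)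
  then show ?thesis unfolding cyc_mk_def m l cyc_id_def by simp
qed

sublocale env: enveloping P relab nrm \<psi> "{}" "UNIV :: nat set" "\<lambda>n. n" "\<lambda>_ _. ()" "\<lambda>_. True"
  "cyc_U P" "cyc_lab P" "cyc_mk P" "cyc_trivial P"
proof unfold_locales
  show "Obj (cyc_U P) = UNIV" by (simp add: cyc_U_def)
  fix x y f
  { assume f: "f \<in> Hom (cyc_U P) x y"
    then show "fam.mor x y (cyc_lab P f) \<and> cyc_mk P (cyc_lab P f) = f \<and> map fst (cyc_lab P f) = fst f"
      using cyc_hom_lab fst_cyc_lab by blast
    show "cyc_trivial P f \<longleftrightarrow> concat (map snd (cyc_lab P f)) = [0..<Suc y]"
      unfolding cyc_trivial_def map_cyc_leaves cyc_hom_lab(3)[OF f] ..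
    fix z g assume "g \<in> Hom (cyc_U P) y z"
    then show "Cmp (cyc_U P) g f = cyc_mk P (fam.cmp x z (cyc_lab P g) (cyc_lab P f))"
      using cyc_comp_mk f by (simp add: cyc_U_def) }
  { fix L assume "fam.mor x y L"
    then show "cyc_mk P L \<in> Hom (cyc_U P) x y \<and> cyc_lab P (cyc_mk P L) = L" using cyc_hom_mk by blast }
  show "Idm (cyc_U P) x = cyc_mk P (fam.idm x)" using cyc_id_mk by (simp add: cyc_U_def)
qed

end

section \<open>Rerooting in cyclic operads\<close>

context cyclic_operad
begin

section \<open>Permutations of all legs\<close>

abbreviation ok :: "'o \<times> nat list \<Rightarrow> bool" where
  "ok X \<equiv> wt (\<lambda>_. ()) () X"

abbreviation un :: "nat \<Rightarrow> 'o \<times> nat list" where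
  "un \<equiv> unit_op (\<lambda>_. ())"

lemma ok_un: "ok (un x)"
  using wt_unit[of "\<lambda>_. ()" x] by simp

lemma ok_subst: "ok X \<Longrightarrow> (\<And>x. x \<in> set (snd X) \<Longrightarrow> ok (F x)) \<Longrightarrow> ok (subst X F)"
  by (rule wt_subst)

lemma ok_assoc:
  "ok X \<Longrightarrow> (\<And>x. x \<in> set (snd X) \<Longrightarrow> ok (F x)) \<Longrightarrow>
   (\<And>x y. x \<in> set (snd X) \<Longrightarrow> y \<in> set (snd (F x)) \<Longrightarrow> ok (G y)) \<Longrightarrow>
   subst (subst X F) G = subst X (\<lambda>x. subst (F x) G)"
  by (rule subst_assoc)

lemma subst_un: "ok X \<Longrightarrow> (\<And>x. x \<in> set (snd X) \<Longrightarrow> F x = un x) \<Longrightarrow> subst X F = X"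
  by (rule subst_unit')

lemma un_subst: "ok (F x) \<Longrightarrow> subst (un x) F = F x"
  by (rule unit_subst)

text \<open>The operation \<open>X\<close> with output labelled \<open>z\<close> becomes \<open>X'\<close> with output labelled \<open>z'\<close> under some
  permutation of all legs.\<close>

definition rerooted :: "nat \<Rightarrow> 'o \<times> nat list \<Rightarrow> nat \<Rightarrow> 'o \<times> nat list \<Rightarrow> bool" where
  "rerooted z X z' X' \<longleftrightarrow> (\<exists>\<sigma>. \<sigma> permutes {0..arity P (fst X)} \<and> fst X' = act P \<sigma> (fst X) \<and>
     length (snd X') = length (snd X) \<and>
     (\<forall>i\<le>arity P (fst X). (z' # snd X') ! \<sigma> i = (z # snd X) ! i))"

lemma rerooted_refl: "ok X \<Longrightarrow> rerooted z X z X"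
  unfolding rerooted_def by (intro exI[of _ id]) (simp add: act_id wt_def permutes_id)

lemma rerooted_ok: "ok X \<Longrightarrow> rerooted z X z' X' \<Longrightarrow> ok X'"
  unfolding rerooted_def wt_single using cyc_act by metis

lemma rerooted_sym:
  assumes X: "ok X" and r: "rerooted z X z' X'"
  shows "rerooted z' X' z X"
proof -
  let ?n = "arity P (fst X)"
  obtain \<sigma> where s: "\<sigma> permutes {0..?n}" "fst X' = act P \<sigma> (fst X)" "length (snd X') = length (snd X)"
    "\<And>i. i \<le> ?n \<Longrightarrow> (z' # snd X') ! \<sigma> i = (z # snd X) ! i" using r unfolding rerooted_def by blast
  have o: "fst X \<in> Ops P" using X by (simp add: wt_def)
  have a: "arity P (fst X') = ?n" using cyc_act[OF o s(1)] s(2) by simp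
  have i: "inv \<sigma> permutes {0..?n}" using permutes_inv[OF s(1)] .
  have "act P (inv \<sigma>) (fst X') = fst X"
    using cyc_act_comp[OF o i s(1)] permutes_inv_o(2)[OF s(1)] act_id[OF o] s(2) by simp
  moreover have "(z # snd X) ! inv \<sigma> k = (z' # snd X') ! k" if "k \<le> ?n" for k
    using s(4)[of "inv \<sigma> k"] permutes_in_image[OF i, of k] that permutes_inverses(1)[OF s(1)] by simp
  ultimately show ?thesis unfolding rerooted_def a using i s(3) by (intro exI[of _ "inv \<sigma>"]) simp
qed

lemma rerooted_trans:
  assumes X: "ok X" and r: "rerooted z X z' X'" and r': "rerooted z' X' z'' X''"
  shows "rerooted z X z'' X''"
proof -
  let ?n = "arity P (fst X)"
  obtain \<sigma> where s: "\<sigma> permutes {0..?n}" "fst X' = act P \<sigma> (fst X)" "length (snd X') = length (snd X)"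
    "\<And>i. i \<le> ?n \<Longrightarrow> (z' # snd X') ! \<sigma> i = (z # snd X) ! i" using r unfolding rerooted_def by blast
  have o: "fst X \<in> Ops P" using X by (simp add: wt_def)
  have a: "arity P (fst X') = ?n" using cyc_act[OF o s(1)] s(2) by simp
  obtain \<tau> where t: "\<tau> permutes {0..?n}" "fst X'' = act P \<tau> (fst X')" "length (snd X'') = length (snd X')"
    "\<And>i. i \<le> ?n \<Longrightarrow> (z'' # snd X'') ! \<tau> i = (z' # snd X') ! i" using r' unfolding rerooted_def a by blast
  have "(z'' # snd X'') ! (\<tau> \<circ> \<sigma>) i = (z # snd X) ! i" if "i \<le> ?n" for i
    using t(4)[of "\<sigma> i"] s(4)[OF that] permutes_in_image[OF s(1), of i] that by simp
  then show ?thesis unfolding rerooted_def using permutes_compose[OF s(1) t(1)] cyc_act_comp[OF o t(1) s(1)] s t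
    by (intro exI[of _ "\<tau> \<circ> \<sigma>"]) simp
qed

lemma rerooted_mset:
  assumes X: "ok X" and r: "rerooted z X z' X'"
  shows "mset (z' # snd X') = mset (z # snd X)"
proof -
  let ?n = "arity P (fst X)"
  obtain \<sigma> where s: "\<sigma> permutes {0..?n}" "length (snd X') = length (snd X)"
    "\<And>i. i \<le> ?n \<Longrightarrow> (z' # snd X') ! \<sigma> i = (z # snd X) ! i" using r unfolding rerooted_def by blast
  have l: "length (snd X) = ?n" using X by (simp add: wt_single)
  have p: "\<sigma> permutes {..<length (z' # snd X')}"
    using s l by (simp add: lessThan_Suc_atMost atMost_atLeast0)
  have "permute_list \<sigma> (z' # snd X') = z # snd X"
  proof (rule nth_equalityI)
    fix i assume "i < length (permute_list \<sigma> (z' # snd X'))"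
    then have "i < length (z' # snd X')" "i \<le> ?n" using s l by simp_all
    then show "permute_list \<sigma> (z' # snd X') ! i = (z # snd X) ! i"
      using permute_list_nth[OF p, of i] s(3) by metis
  qed (use s in simp)
  then show ?thesis using mset_permute_list[OF p] by metis
qed

lemma rerooted_distinct: "ok X \<Longrightarrow> rerooted z X z' X' \<Longrightarrow> distinct (z # snd X) \<Longrightarrow> distinct (z' # snd X')"
  using rerooted_mset mset_eq_imp_distinct_iff by metis

lemma rerooted_set: "ok X \<Longrightarrow> rerooted z X z' X' \<Longrightarrow> set (z' # snd X') = set (z # snd X)"
  using rerooted_mset mset_eq_setD by metis

text \<open>Since all permutations of the legs act, any arrangement of their names is attained, with
  any of them as the output.\<close>

lemma rerooted_exists:
  assumes X: "ok X" and m: "mset (z' # ys) = mset (z # snd X)"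
  obtains p where "rerooted z X z' (p, ys)"
proof -
  let ?n = "arity P (fst X)"
  have l: "length (snd X) = ?n" using X by (simp add: wt_single)
  have ly: "length ys = ?n" using arg_cong[OF m, of size] l by simp
  obtain \<sigma> where s: "\<sigma> permutes {..<length (z' # ys)}" "permute_list \<sigma> (z' # ys) = z # snd X"
    using mset_eq_permutation[OF m[symmetric]] by metis
  have p: "\<sigma> permutes {0..?n}" using s(1) ly by (simp add: lessThan_Suc_atMost atMost_atLeast0)
  have "(z' # ys) ! \<sigma> i = (z # snd X) ! i" if "i \<le> ?n" for i
    using permute_list_nth[OF s(1), of i] s(2) ly that by simp
  then have "rerooted z X z' (act P \<sigma> (fst X), ys)"
    unfolding rerooted_def using p ly l by (intro exI[of _ \<sigma>]) simp
  then show ?thesis by (rule that)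
qed

lemma relab_rr:
  assumes X: "ok X" and r: "relab X X'"
  shows "rerooted z X z X'"
proof -
  let ?n = "arity P (fst X)"
  obtain \<sigma> where s: "\<sigma> permutes {1..?n}" "fst X' = act P \<sigma> (fst X)" "length (snd X') = length (snd X)"
    "\<forall>i\<in>{1..?n}. snd X' ! (\<sigma> i - 1) = snd X ! (i - 1)" using r unfolding relab_def by blast
  have "(z # snd X') ! \<sigma> i = (z # snd X) ! i" if i: "i \<le> ?n" for i
  proof (cases i)
    case 0
    then show ?thesis using permutes_not_in[OF s(1), of 0] by simp
  next
    case (Suc k)
    then have k: "k < ?n" using i by simp
    from perm_range[OF s(1) k] obtain m where "\<sigma> (Suc k) = Suc m" by metis
    then show ?thesis using bspec[OF s(4), of "Suc k"] k Suc by simp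
  qed
  moreover have "\<sigma> permutes {0..?n}" using permutes_subset[OF s(1)] by simp
  ultimately show ?thesis unfolding rerooted_def using s by (intro exI[of _ \<sigma>]) simp
qed

text \<open>With distinct names, an unchanged name of the output forces the permutation to fix leg
  0, so it is a permutation of the inputs.\<close>

lemma rerooted_relab:
  assumes X: "ok X" and d: "distinct (z # snd X)" and r: "rerooted z X z X'"
  shows "relab X X'"
proof -
  let ?n = "arity P (fst X)"
  obtain \<sigma> where s: "\<sigma> permutes {0..?n}" "fst X' = act P \<sigma> (fst X)" "length (snd X') = length (snd X)"
    "\<And>i. i \<le> ?n \<Longrightarrow> (z # snd X') ! \<sigma> i = (z # snd X) ! i" using r unfolding rerooted_def by blast
  have l: "length (snd X) = ?n" using X by (simp add: wt_single)
  have im: "\<sigma> i \<le> ?n" if "i \<le> ?n" for i using permutes_in_image[OF s(1), of i] that by simp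
  have d': "distinct (z # snd X')" using rerooted_distinct[OF X r d] .
  have "(z # snd X') ! \<sigma> 0 = (z # snd X') ! 0" using s(4)[of 0] by simp
  then have s0: "\<sigma> 0 = 0" using nth_eq_iff_index_eq[OF d', of "\<sigma> 0" 0] im[of 0] s(3) l by simp
  have p: "\<sigma> permutes {1..?n}"
  proof (rule permutes_superset[OF s(1)])
    fix x assume "x \<in> {0..?n} - {1..?n}"
    then have "x = 0" by auto
    then show "\<sigma> x = x" using s0 by simp
  qed
  have "snd X' ! (\<sigma> i - 1) = snd X ! (i - 1)" if i: "i \<in> {1..?n}" for i
  proof -
    have "\<sigma> i \<in> {1..?n}" using permutes_in_image[OF p] i by blast
    then have "0 < \<sigma> i" "0 < i" "i \<le> ?n" using i by auto
    then show ?thesis using s(4)[of i] by (simp add: nth_Cons')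
  qed
  then show ?thesis unfolding relab_def using p s(2,3) by blast
qed

lemma rerooted_unique:
  assumes X: "ok X" and d: "distinct (z # snd X)" and r: "rerooted z X z X'" and e: "snd X' = snd X"
  shows "X' = X"
  using relab_unique[OF X rerooted_relab[OF X d r] _ e[symmetric]] d by simp

lemma rerooted_subst:
  assumes X: "ok X" and d: "distinct (z # snd X)" and r: "rerooted z X z X'"
    and F: "\<And>x. x \<in> set (snd X) \<Longrightarrow> ok (F x)" and F': "\<And>x. x \<in> set (snd X) \<Longrightarrow> relab (F x) (F' x)"
  shows "relab (subst X F) (subst X' F')"
  by (rule relab_subst[OF X _ rerooted_relab[OF X d r]]) (use F F' in auto)

section \<open>Rotations and substitution\<close>

lemma rot_permutes: "rot n permutes {0..n}"
proof -
  have "bij_betw (rot n) {0..n} {0..n}"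
    by (rule bij_betw_byWitness[where f' = "\<lambda>j. if j = 0 then n else j - 1"]) (auto simp: rot_def)
  then show ?thesis by (rule bij_imp_permutes) (auto simp: rot_def)
qed

text \<open>A rotation makes the last input the output and the old output the first input. Other
  rerootings are reduced to this one by first moving the chosen leg to the end.\<close>

lemma rerooted_rot:
  assumes "ok (p, xs @ [y])"
  shows "rerooted z (p, xs @ [y]) y (act P (rot (arity P p)) p, z # xs)"
proof -
  have a: "arity P p = Suc (length xs)" using assms by (simp add: wt_single)
  have "(y # z # xs) ! rot (arity P p) i = (z # xs @ [y]) ! i" if "i \<le> arity P p" for i
    using that a by (cases "i = arity P p") (auto simp: rot_def nth_append nth_Cons')
  then show ?thesis unfolding rerooted_def using rot_permutes[of "arity P p"] by (intro exI[of _ "rot (arity P p)"]) simp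
qed

lemma composable_single: "composable P p qs \<longleftrightarrow> p \<in> Ops P \<and> set qs \<subseteq> Ops P \<and> length qs = arity P p"
  unfolding composable_def arity_def by (auto intro: nth_equalityI dest: arg_cong[where f = length])

lemma id_single: "ident P c \<in> Ops P" "arity P (ident P c) = 1"
  using ident[of c] by (simp_all add: arity_def)

text \<open>An iteration of \<open>rot_inner\<close>. The last input, which becomes the output,
  holds an identity, and so does the first input after the rotation, the former output. Further
  identities serve the induction, which replaces them by \<open>plug_split\<close>.\<close>

lemma rot_plug:
  assumes p: "p \<in> Ops P" and qs: "set qs \<subseteq> Ops P" "arity P p = length qs + m + 1"
  shows "act P (rot ((\<Sum>q\<leftarrow>qs. arity P q) + m + 1)) (plug P p (qs @ replicate (Suc m) (ident P ()))) =
    plug P (act P (rot (arity P p)) p) (ident P () # qs @ replicate m (ident P ()))"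
  using qs
proof (induction qs arbitrary: m rule: rev_induct)
  case Nil
  have pp: "act P (rot (arity P p)) p \<in> Ops P" "arity P (act P (rot (arity P p)) p) = arity P p"
    using cyc_act[OF p rot_permutes] by simp_all
  have *: "replicate (arity P q) (ident P ()) = map (ident P) (ins P q)" for q
    by (intro nth_equalityI) (simp_all add: arity_def)
  show ?case using Nil unit[OF p] unit[OF pp(1)] *[of p] *[of "act P (rot (arity P p)) p"] pp(2) by simp
next
  case (snoc q qs)
  let ?e = "ident P ()" and ?S = "\<Sum>q\<leftarrow>qs. arity P q" and ?p = "act P (rot (arity P p)) p"
  let ?r = "plug P p (qs @ ?e # replicate (Suc m) ?e)"
  have pp: "?p \<in> Ops P" "arity P ?p = arity P p" using cyc_act[OF p rot_permutes] by simp_all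
  have q: "q \<in> Ops P" and qs: "set qs \<subseteq> Ops P" and a: "arity P p = length qs + Suc m + 1" using snoc.prems by simp_all
  have "composable P p (qs @ q # replicate (Suc m) ?e)" "composable P ?p ((?e # qs) @ q # replicate m ?e)"
    using p pp q qs a id_single by (auto simp: composable_single)
  note s1 = plug_split[OF this(1)] and s2 = plug_split[OF this(2)]
  have r: "?r \<in> Ops P" "arity P ?r = ?S + Suc (Suc m)"
  proof -
    show "?r \<in> Ops P" using plug[OF s1(2)] by simp
    have "arity P ?r = length (concat (map (ins P) (qs @ ?e # replicate (Suc m) ?e)))"
      using plug[OF s1(2)] by (simp add: arity_def)
    also have "\<dots> = ?S + Suc (Suc m)"
      using id_single(2) by (simp add: length_concat comp_def arity_def[symmetric] sum_list_replicate)
    finally show "arity P ?r = ?S + Suc (Suc m)" .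
  qed
  have "act P (rot (arity P ?r + arity P q - 1)) (pcomp P ?r (Suc ?S) q) =
      pcomp P (act P (rot (arity P ?r)) ?r) (Suc (Suc ?S)) q"
    by (rule rot_inner) (use r q in simp_all)
  also have "act P (rot (arity P ?r)) ?r = plug P ?p (?e # qs @ replicate (Suc m) ?e)"
    using snoc.IH[OF qs a] r(2) by simp
  also have "pcomp P \<dots> (Suc (Suc ?S)) q = plug P ?p (?e # qs @ q # replicate m ?e)"
    using s2(1) id_single(2) by simp
  finally show ?case using s1(1) r(2) by (simp add: add.commute add.left_commute)
qed

lemma remove_last:
  assumes "distinct xs" "x \<in> set xs"
  obtains ys where "mset xs = mset (ys @ [x])" "distinct ys" "x \<notin> set ys" "set xs = insert x (set ys)"
proof
  show "mset xs = mset (remove1 x xs @ [x])" using assms by simp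
  show "distinct (remove1 x xs)" "x \<notin> set (remove1 x xs)" "set xs = insert x (set (remove1 x xs))"
    using assms by auto
qed

text \<open>The new root is a leg of \<open>X\<close> left open by the substitution. With
  \<open>v\<close> moved to the last input, \<open>rot_plug\<close> applies; the old output
  \<open>z\<close> becomes an input of \<open>Y\<close>, and \<open>un u\<close> gives it the name
  that the output of the composite had.\<close>

lemma reroot_kept:
  assumes X: "ok X" and d: "distinct (z # snd X)" and v: "v \<in> set (snd X)" and r: "rerooted z X v Y"
    and F: "\<And>x. x \<in> set (snd X) \<Longrightarrow> ok (F x)" and Fv: "F v = un w"
  shows "rerooted u (subst X F) w (subst Y (F(z := un u)))"
proof -
  from v d obtain xs where xs: "mset (snd X) = mset (xs @ [v])" "distinct xs" "v \<notin> set xs" "set (snd X) = insert v (set xs)"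
    using remove_last[of "snd X" v] by (metis distinct.simps(2))
  have zx: "z \<notin> set xs" "z \<noteq> v" using d xs(4) by auto
  have "mset (z # xs @ [v]) = mset (z # snd X)" using xs(1) by simp
  then obtain p where p: "rerooted z X z (p, xs @ [v])" by (rule rerooted_exists[OF X])
  have okp: "ok (p, xs @ [v])" by (rule rerooted_ok[OF X p])
  let ?q = "act P (rot (arity P p)) p"
  have a: "arity P p = Suc (length xs)" and po: "p \<in> Ops P" using okp by (simp_all add: wt_single)
  have 1: "relab (subst X F) (subst (p, xs @ [v]) F)"
    by (rule rerooted_subst[OF X d p F]) (use F relab_refl in \<open>auto simp: wt_def\<close>)
  have q: "rerooted v Y v (?q, z # xs)"
    by (rule rerooted_trans[OF rerooted_ok[OF X r] rerooted_sym[OF X r] rerooted_trans[OF X p rerooted_rot[OF okp]]])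
  have Y: "ok Y" "distinct (v # snd Y)" using rerooted_ok[OF X r] rerooted_distinct[OF X r d] .
  have sY: "set (snd Y) \<subseteq> insert z (set (snd X))" using rerooted_set[OF X r] by auto
  have FY: "ok ((F(z := un u)) x)" if "x \<in> set (snd Y)" for x using that sY F ok_un by auto
  have 2: "relab (subst Y (F(z := un u))) (subst (?q, z # xs) (F(z := un u)))"
    by (rule rerooted_subst[OF Y q FY]) (use FY relab_refl in \<open>auto simp: wt_def\<close>)
  let ?S = "subst (p, xs @ [v]) F"
  have S: "ok ?S" using F xs(4) by (intro ok_subst[OF okp]) auto
  let ?qs = "map (\<lambda>x. fst (F x)) xs"
  have F1: "\<And>x. x \<in> set xs \<Longrightarrow> ok (F x)" using F xs(4) by simp
  have S1: "?S = (plug P p (?qs @ [ident P ()]), concat (map (\<lambda>x. snd (F x)) xs) @ [w])"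
    using Fv by (simp add: subst_def)
  have lab: "length (concat (map (\<lambda>x. snd (F x)) xs)) = (\<Sum>q\<leftarrow>?qs. arity P q)"
    using F1 by (auto simp: length_concat comp_def wt_single intro!: arg_cong[where f = sum_list])
  have aS: "arity P (fst ?S) = (\<Sum>q\<leftarrow>?qs. arity P q) + 0 + 1"
    using wt_arity[OF S] lab unfolding S1 by simp
  have "act P (rot (arity P (fst ?S))) (fst ?S) = plug P ?q (ident P () # ?qs)"
    unfolding aS using rot_plug[OF po, of ?qs 0] F1 a by (auto simp: S1 wt_def)
  moreover have "subst (?q, z # xs) (F(z := un u)) = (plug P ?q (ident P () # ?qs), u # concat (map (\<lambda>x. snd (F x)) xs))"
  proof -
    define F' where "F' = F(z := un u)"
    have "map (\<lambda>x. fst (F' x)) xs = ?qs" "map (\<lambda>x. snd (F' x)) xs = map (\<lambda>x. snd (F x)) xs" "F' z = un u"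
      using zx by (auto simp: F'_def)
    note m = this
    show ?thesis unfolding F'_def[symmetric] by (simp add: subst_def m(1) m(2) m(3))
  qed
  ultimately have "(act P (rot (arity P (fst ?S))) (fst ?S), u # concat (map (\<lambda>x. snd (F x)) xs)) = subst (?q, z # xs) (F(z := un u))"
    by simp
  then have 3: "rerooted u ?S w (subst (?q, z # xs) (F(z := un u)))"
    using rerooted_rot[of "plug P p (?qs @ [ident P ()])" "concat (map (\<lambda>x. snd (F x)) xs)" w u] S unfolding S1 by simp
  have oX: "ok (subst X F)" and oY: "ok (subst Y (F(z := un u)))" using ok_subst X F Y FY by auto
  show ?thesis
    by (rule rerooted_trans[OF oX rerooted_trans[OF oX relab_rr[OF oX 1] 3] rerooted_sym[OF oY relab_rr[OF oY 2]]])
qed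

text \<open>The new root lies on \<open>Y\<close>, which is glued to the input \<open>u\<close> of
  \<open>X\<close>. By \<open>rot_last\<close> the roles are exchanged: \<open>Y'\<close> goes to
  the bottom, and \<open>X'\<close> is plugged into the leg \<open>t\<close> that was the output of
  \<open>Y\<close>.\<close>

lemma reroot_glued:
  assumes X: "ok X" and d: "distinct (z # snd X)" and u: "u \<in> set (snd X)" and rX: "rerooted z X u X'"
    and Y: "ok Y" and e: "distinct (t # snd Y)" and y: "y \<in> set (snd Y)" and rY: "rerooted t Y y Y'"
  shows "rerooted z (subst X (un(u := Y))) y (subst Y' (un(t := X')))"
proof -
  from u d obtain xs where xs: "mset (snd X) = mset (xs @ [u])" "distinct xs" "u \<notin> set xs" "set (snd X) = insert u (set xs)"
    using remove_last[of "snd X" u] by (metis distinct.simps(2))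
  from y e obtain ys where ys: "mset (snd Y) = mset (ys @ [y])" "distinct ys" "y \<notin> set ys" "set (snd Y) = insert y (set ys)"
    using remove_last[of "snd Y" y] by (metis distinct.simps(2))
  have "mset (z # xs @ [u]) = mset (z # snd X)" using xs(1) by simp
  then obtain p where p: "rerooted z X z (p, xs @ [u])" by (rule rerooted_exists[OF X])
  have "mset (t # ys @ [y]) = mset (t # snd Y)" using ys(1) by simp
  then obtain q where q: "rerooted t Y t (q, ys @ [y])" by (rule rerooted_exists[OF Y])
  have okp: "ok (p, xs @ [u])" and okq: "ok (q, ys @ [y])" by (rule rerooted_ok[OF X p], rule rerooted_ok[OF Y q])
  have t: "t \<notin> set ys" using e ys(4) by auto
  let ?p = "act P (rot (arity P p)) p" and ?q = "act P (rot (arity P q)) q"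
  have a: "arity P p = Suc (length xs)" "p \<in> Ops P" "arity P q = Suc (length ys)" "q \<in> Ops P"
    using okp okq by (simp_all add: wt_single)
  have pp: "?p \<in> Ops P" "arity P ?p = arity P p" "?q \<in> Ops P" "arity P ?q = arity P q"
    using cyc_act[OF a(2) rot_permutes] cyc_act[OF a(4) rot_permutes] by simp_all
  have dX: "distinct (u # snd X')" "ok X'" using rerooted_distinct[OF X rX d] rerooted_ok[OF X rX] .
  have dY: "distinct (y # snd Y')" "ok Y'" using rerooted_distinct[OF Y rY e] rerooted_ok[OF Y rY] .
  have rp: "rerooted u X' u (?p, z # xs)"
    by (rule rerooted_trans[OF dX(2) rerooted_sym[OF X rX] rerooted_trans[OF X p rerooted_rot[OF okp]]])
  have rq: "rerooted y Y' y (?q, t # ys)"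
    by (rule rerooted_trans[OF dY(2) rerooted_sym[OF Y rY] rerooted_trans[OF Y q rerooted_rot[OF okq]]])
  have r1: "relab X' (?p, z # xs)" by (rule rerooted_relab[OF dX(2,1) rp])
  have un: "relab (un x) (un x)" for x using relab_refl ok_un[of x] by (simp add: wt_def)
  have 1: "relab (subst X (un(u := Y))) (subst (p, xs @ [u]) (un(u := (q, ys @ [y]))))"
  proof (rule rerooted_subst[OF X d p])
    fix x
    show "ok ((un(u := Y)) x)" using Y ok_un by simp
    show "relab ((un(u := Y)) x) ((un(u := (q, ys @ [y]))) x)" using rerooted_relab[OF Y e q] un by simp
  qed
  have 2: "relab (subst Y' (un(t := X'))) (subst (?q, t # ys) (un(t := (?p, z # xs))))"
  proof (rule rerooted_subst[OF dY(2,1) rq])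
    fix x
    show "ok ((un(t := X')) x)" using dX(2) ok_un by simp
    show "relab ((un(t := X')) x) ((un(t := (?p, z # xs))) x)" using r1 un by simp
  qed
  have rep: "map (\<lambda>x. fst ((un(v := Z)) x)) ws = replicate (length ws) (ident P ())"
    "concat (map (\<lambda>x. snd ((un(v := Z)) x)) ws) = ws" if "v \<notin> set ws" for v Z ws
    using that by (auto intro!: nth_equalityI concat_map_eq_singletons)
  have ins: "map (ident P) (ins P r) = replicate (arity P r) (ident P ())" for r
    by (intro nth_equalityI) (simp_all add: arity_def)
  have upd: "(replicate (Suc k) c)[k := b] = replicate k c @ [b]" for k and c b :: 'o
    by (induction k) simp_all
  let ?S = "subst (p, xs @ [u]) (un(u := (q, ys @ [y])))"
  have S1: "?S = (pcomp P p (arity P p) q, (xs @ ys) @ [y])"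
    using rep[OF xs(3)] a by (simp add: subst_def pcomp_def ins upd del: replicate.simps)
  have S2: "subst (?q, t # ys) (un(t := (?p, z # xs))) = (pcomp P ?q 1 ?p, z # xs @ ys)"
    using rep[OF t] a pp by (simp add: subst_def pcomp_def ins)
  have S: "ok ?S" using okq ok_un by (intro ok_subst[OF okp]) auto
  have aS: "arity P (fst ?S) = arity P p + arity P q - 1"
    using wt_arity[OF S] a unfolding S1 by simp
  have "act P (rot (arity P (fst ?S))) (fst ?S) = pcomp P ?q 1 ?p"
    unfolding aS using rot_last[OF a(2,4)] a by (simp add: S1)
  then have 3: "rerooted z ?S y (subst (?q, t # ys) (un(t := (?p, z # xs))))"
    using rerooted_rot[of "pcomp P p (arity P p) q" "xs @ ys" y z] S unfolding S1 S2 by simp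
  have oX: "ok (subst X (un(u := Y)))" using Y ok_un by (intro ok_subst[OF X]) simp
  have oY: "ok (subst Y' (un(t := X')))" using dX ok_un by (intro ok_subst[OF dY(2)]) simp
  show ?thesis
    by (rule rerooted_trans[OF oX rerooted_trans[OF oX relab_rr[OF oX 1] 3] rerooted_sym[OF oY relab_rr[OF oY 2]]])
qed

text \<open>The root is moved in two steps: to the edge \<open>x\<close> where \<open>F x\<close> is
  attached, with \<open>F x\<close> cut off, and then across that edge to \<open>y\<close> when
  \<open>F x\<close> is glued back.\<close>

lemma reroot:
  assumes X: "ok X" and d: "distinct (z # snd X)" and x: "x \<in> set (snd X)" and rX: "rerooted z X x B"
    and F: "\<And>i. i \<in> set (snd X) \<Longrightarrow> ok (F i)" and dF: "distinct (u # snd (subst X F))"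
    and e: "distinct (s # snd (F x))" and y: "y \<in> set (snd (F x))" and rY: "rerooted s (F x) y A"
  shows "rerooted u (subst X F) y (subst A (un(s := subst B (F(z := un u)))))"
proof -
  \<comment> \<open>A fresh name for the end of the cut edge.\<close>
  obtain w where w: "w \<notin> set (u # snd (subst X F))" using ex_new_if_finite[OF infinite_UNIV_nat finite_set] by blast
  have wF: "w \<notin> set (snd (F i))" if "i \<in> set (snd X)" for i using w that by auto
  let ?F = "F(x := un w)"
  have F0: "ok (?F i)" if "i \<in> set (snd X)" for i using F[OF that] ok_un by simp
  have Fx: "ok (F x)" by (rule F[OF x])
  obtain l r where lr: "snd X = l @ x # r" "x \<notin> set l" "x \<notin> set r"
    using x d by (metis split_list distinct.simps(2) not_distinct_conv_prefix distinct_append disjoint_iff list.set_intros(1))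
  have "snd (subst X ?F) = concat (map (\<lambda>i. snd (F i)) l) @ w # concat (map (\<lambda>i. snd (F i)) r)"
  proof -
    have "map (\<lambda>i. snd (?F i)) ws = map (\<lambda>i. snd (F i)) ws" if "x \<notin> set ws" for ws using that by auto
    note m = this[OF lr(2)] this[OF lr(3)]
    show ?thesis unfolding snd_subst lr(1) map_append list.map m by simp
  qed
  moreover have "snd (subst X F) = concat (map (\<lambda>i. snd (F i)) l) @ snd (F x) @ concat (map (\<lambda>i. snd (F i)) r)"
    unfolding snd_subst lr(1) by simp
  ultimately have d0: "distinct (u # snd (subst X ?F))" "w \<in> set (snd (subst X ?F))" using dF w by auto
  have 1: "rerooted u (subst X ?F) w (subst B (?F(z := un u)))"
    by (rule reroot_kept[OF X d x rX F0]) simp_all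
  have xB: "x \<notin> set (snd B)" using rerooted_distinct[OF X rX d] by simp
  have 2: "subst B (?F(z := un u)) = subst B (F(z := un u))" by (rule subst_cong) (use xB in auto)
  have "rerooted u (subst (subst X ?F) (un(w := F x))) y (subst A (un(s := subst B (F(z := un u)))))"
    by (rule reroot_glued[OF ok_subst[OF X F0] d0 1[unfolded 2] Fx e y rY])
  moreover have "subst (subst X ?F) (un(w := F x)) = subst X F"
  proof -
    have o: "ok ((un(w := F x)) i)" for i using Fx ok_un by simp
    have "subst (subst X ?F) (un(w := F x)) = subst X (\<lambda>i. subst (?F i) (un(w := F x)))"
      by (rule ok_assoc[OF X F0 o])
    also have "\<dots> = subst X F"
    proof (rule subst_cong)
      fix i assume i: "i \<in> set (snd X)"
      show "subst (?F i) (un(w := F x)) = F i"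
      proof (cases "i = x")
        case True
        then show ?thesis using un_subst[of "un(w := F x)" w] Fx by simp
      next
        case False
        then show ?thesis using subst_un[OF F[OF i], of "un(w := F x)"] wF[OF i] by (metis fun_upd_other)
      qed
    qed
    finally show ?thesis .
  qed
  ultimately show ?thesis by simp
qed

end

section \<open>The cyclic case\<close>

context graded_cyclic
begin

lemma rerooted_grading: "ok X \<Longrightarrow> rerooted z X z' X' \<Longrightarrow> \<psi> (fst X') = \<psi> (fst X)"
  unfolding rerooted_def wt_def using grading_act by metis

lemma mor_ok: "fam.mor n N F \<Longrightarrow> i \<le> n \<Longrightarrow> ok (F ! i)"
  using fam.mor_wt_upper[of n N F i] by simp

definition src :: "'o \<Rightarrow> 'o \<times> nat list" where
  "src p = (p, [1..<Suc (arity P p)])"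

lemma src_ok:
  assumes "p \<in> Ops P"
  shows "ok (src p)" "snd (src p) = [1..<Suc (arity P p)]" "fst (src p) = p"
  using assms unfolding wt_single by (simp_all add: src_def del: upt_Suc)

lemma src_labels: "0 # snd (src p) = [0..<Suc (arity P p)]"
  by (simp add: src_def upt_conv_Cons del: upt_Suc)

text \<open>The gluing with the vertex \<open>F ! j\<close> at the bottom, whose leaf \<open>a\<close> becomes the output. The auxiliary
  label \<open>s\<close> marks the leg 0 of that vertex.\<close>

definition glued :: "nat \<Rightarrow> 'o \<Rightarrow> ('o \<times> nat list) list \<Rightarrow> nat \<Rightarrow> 'o \<times> nat list \<Rightarrow> bool" where
  "glued s p F a Z \<longleftrightarrow> (\<exists>j B A. j \<le> arity P p \<and> a \<in> set (snd (F ! j)) \<and>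
     rerooted 0 (src p) j B \<and> rerooted s (F ! j) a A \<and> Z = subst A (un(s := subst B ((!) F))))"

text \<open>Rerooting changes neither the multiset of legs, output included, nor the grading. So
  both are computed from \<open>F ! j\<close> and the source as they are, and the result does not
  depend on \<open>j\<close> and \<open>a\<close>.\<close>

lemma glued_facts:
  assumes p: "p \<in> Ops P" and F: "fam.mor (arity P p) N F" and s: "N < s"
    and j: "j \<le> arity P p" and a: "a \<in> set (snd (F ! j))" and B: "rerooted 0 (src p) j B" and A: "rerooted s (F ! j) a A"
  shows "ok B" "distinct (j # snd B)" "ok A" "distinct (s # snd (F ! j))" "distinct (a # snd A)"
    and "ok (subst B ((!) F))" "\<And>v. ok ((un(s := subst B ((!) F))) v)"
    and "\<And>i. i \<in> set (snd B) \<Longrightarrow> i \<le> arity P p" "mset (j # snd B) = mset [0..<Suc (arity P p)]"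
    and "ok (subst A (un(s := subst B ((!) F))))"
    and "mset (a # snd (subst A (un(s := subst B ((!) F))))) = mset [0..<Suc N]"
    and "\<And>v. v \<in> set (snd (subst B ((!) F))) \<Longrightarrow> v \<le> N" "distinct (snd (subst B ((!) F)))"
    and "s \<noteq> a"
    and "\<psi> (fst (subst A (un(s := subst B ((!) F))))) = \<psi> p + (\<Sum>X\<leftarrow>F. \<psi> (fst X))"
proof -
  let ?n = "arity P p" and ?S = "subst B ((!) F)"
  note src = src_ok[OF p]
  have d0: "distinct (0 # snd (src p))" unfolding src_labels by (simp del: upt_Suc)
  show okB: "ok B" by (rule rerooted_ok[OF src(1) B])
  show "distinct (j # snd B)" by (rule rerooted_distinct[OF src(1) B d0])
  show mB: "mset (j # snd B) = mset [0..<Suc ?n]" using rerooted_mset[OF src(1) B] unfolding src_labels .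
  show iB: "i \<le> ?n" if "i \<in> set (snd B)" for i
  proof -
    have "i \<in> set (j # snd B)" using that by simp
    then have "i \<in> set [0..<Suc ?n]" unfolding mset_eq_setD[OF mB] .
    then show ?thesis by (simp del: upt_Suc)
  qed
  have okF: "ok (F ! i)" if "i \<le> ?n" for i by (rule mor_ok[OF F that])
  have lF: "v \<le> N" if "i \<le> ?n" "v \<in> set (snd (F ! i))" for i v using fam.mor_label[OF F that] .
  show okA: "ok A" by (rule rerooted_ok[OF okF[OF j] A])
  have "s \<notin> set (snd (F ! j))" using lF[OF j, of s] s by auto
  then show dF: "distinct (s # snd (F ! j))" using fam.mor_distinct[OF F j] by simp
  show dA: "distinct (a # snd A)" by (rule rerooted_distinct[OF okF[OF j] A dF])
  show okS: "ok ?S" by (rule ok_subst[OF okB okF[OF iB]])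
  show okH: "ok ((un(s := ?S)) v)" for v using okS ok_un by simp
  show "ok (subst A (un(s := ?S)))" by (rule ok_subst[OF okA okH])
  show sa: "s \<noteq> a" using lF[OF j a] s by auto
  have len: "length F = Suc ?n" by (rule fam.mor_len[OF F])
  have F': "map ((!) F) [0..<Suc ?n] = F" using len map_nth[of F] by simp
  have "mset (concat (map (\<lambda>i. snd (F ! i)) (j # snd B))) = mset (concat (map (\<lambda>i. snd (F ! i)) [0..<Suc ?n]))"
    by (rule mset_concat_map_cong[OF mB])
  also have "map (\<lambda>i. snd (F ! i)) [0..<Suc ?n] = map snd F"
    using arg_cong[OF F', of "map snd"] unfolding map_map comp_def .
  finally have mS: "mset (snd (F ! j)) + mset (snd ?S) = mset [0..<Suc N]"
    using fam.mor_mset[OF F] by (simp del: upt_Suc)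
  have "set (snd ?S) \<subseteq> set_mset (mset [0..<Suc N])" unfolding mS[symmetric] by simp
  then show lS: "v \<le> N" if "v \<in> set (snd ?S)" for v using that by (auto simp del: upt_Suc)
  have "distinct (snd (F ! j) @ snd ?S)"
    using mset_eq_imp_distinct_iff[of "snd (F ! j) @ snd ?S" "[0..<Suc N]"] mS by (simp del: upt_Suc)
  then show "distinct (snd ?S)" by simp
  let ?h = "\<lambda>v. snd ((un(s := ?S)) v)"
  have "mset (concat (map ?h (a # snd A))) = mset (concat (map ?h (s # snd (F ! j))))"
    by (rule mset_concat_map_cong[OF rerooted_mset[OF okF[OF j] A]])
  moreover have "concat (map ?h (snd (F ! j))) = snd (F ! j)"
    by (rule concat_map_eq_singletons) (use dF in auto)
  ultimately show "mset (a # snd (subst A (un(s := ?S)))) = mset [0..<Suc N]"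
    using sa mS by (simp add: union_commute del: upt_Suc)
  let ?g = "\<lambda>v. \<psi> (fst ((un(s := ?S)) v))"
  have gr': "planar_grading P \<psi>" using gr by (simp add: cyclic_grading_def)
  have u0: "\<psi> (ident P c) = 0" for c using gr' by (simp add: planar_grading_def)
  have sum_cong: "(\<Sum>x\<leftarrow>xs. h x) = (\<Sum>x\<leftarrow>ys. h x)" if "mset xs = mset ys" for xs ys and h :: "nat \<Rightarrow> int"
    using that by (metis mset_map sum_mset_sum_list)
  have "\<psi> (fst (subst A (un(s := ?S)))) = \<psi> (fst A) + (\<Sum>v\<leftarrow>snd A. ?g v)"
    by (rule grading_subst[OF gr' okA okH])
  also have "(\<Sum>v\<leftarrow>snd A. ?g v) = (\<Sum>v\<leftarrow>a # snd A. ?g v)" using sa u0 by simp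
  also have "\<dots> = (\<Sum>v\<leftarrow>s # snd (F ! j). ?g v)" by (rule sum_cong[OF rerooted_mset[OF okF[OF j] A]])
  also have "\<dots> = \<psi> (fst ?S) + (\<Sum>v\<leftarrow>snd (F ! j). ?g v)" by simp
  also have "(\<Sum>v\<leftarrow>snd (F ! j). ?g v) = 0"
    by (rule sum_list_0[THEN trans[rotated], OF arg_cong[where f = sum_list]], rule map_cong[OF refl]) (use dF u0 in auto)
  also have "\<psi> (fst ?S) = \<psi> (fst B) + (\<Sum>i\<leftarrow>snd B. \<psi> (fst (F ! i)))"
    by (rule grading_subst[OF gr' okB okF[OF iB]])
  also have "\<psi> (fst B) = \<psi> p" using rerooted_grading[OF src(1) B] src(3) by simp
  also have "\<psi> (fst A) = \<psi> (fst (F ! j))" by (rule rerooted_grading[OF okF[OF j] A])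
  finally have "\<psi> (fst (subst A (un(s := ?S)))) = \<psi> p + (\<Sum>i\<leftarrow>j # snd B. \<psi> (fst (F ! i)))"
    by (simp add: fun_upd_def)
  also have "(\<Sum>i\<leftarrow>j # snd B. \<psi> (fst (F ! i))) = (\<Sum>i\<leftarrow>[0..<Suc ?n]. \<psi> (fst (F ! i)))" by (rule sum_cong[OF mB])
  also have "map (\<lambda>i. \<psi> (fst (F ! i))) [0..<Suc ?n] = map (\<lambda>X. \<psi> (fst X)) F"
    using arg_cong[OF F', of "map (\<lambda>X. \<psi> (fst X))"] unfolding map_map comp_def .
  finally show "\<psi> (fst (subst A (un(s := ?S)))) = \<psi> p + (\<Sum>X\<leftarrow>F. \<psi> (fst X))" .
qed

lemma relab_ok: "ok X \<Longrightarrow> relab X X"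
  by (rule relab_refl) (simp add: wt_def)

text \<open>Both roots are leaves of the same vertex, so the root moves from \<open>a\<close> to
  \<open>a'\<close> inside that vertex, with the rest of the composite attached at \<open>s\<close>
  as before.\<close>

lemma glued_same:
  assumes p: "p \<in> Ops P" and F: "fam.mor (arity P p) N F" and s: "N < s" and j: "j \<le> arity P p"
    and a: "a \<in> set (snd (F ! j))" "rerooted s (F ! j) a A" "rerooted 0 (src p) j B"
    and a': "a' \<in> set (snd (F ! j))" "rerooted s (F ! j) a' A'" "rerooted 0 (src p) j B'"
  shows "rerooted a (subst A (un(s := subst B ((!) F)))) a' (subst A' (un(s := subst B' ((!) F))))"
proof -
  note f = glued_facts[OF p F s j a(1,3,2)] and f' = glued_facts[OF p F s j a'(1,3,2)]
  let ?H = "un(s := subst B ((!) F))" and ?H' = "un(s := subst B' ((!) F))"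
  have okF: "ok (F ! i)" if "i \<le> arity P p" for i by (rule mor_ok[OF F that])
  have "rerooted j B j B'" by (rule rerooted_trans[OF f(1) rerooted_sym[OF src_ok(1)[OF p] a(3)] a'(3)])
  then have "relab (subst B ((!) F)) (subst B' ((!) F))"
    using f(8) okF relab_ok by (intro rerooted_subst[OF f(1,2)]) auto
  then have H: "relab (?H v) (?H' v)" for v using relab_ok[OF ok_un] by simp
  have A: "rerooted a A a' A'" by (rule rerooted_trans[OF f(3) rerooted_sym[OF okF[OF j] a(2)] a'(2)])
  show ?thesis
  proof (cases "a = a'")
    case True
    have "rerooted a (subst A ?H) a (subst A' ?H')"
      by (rule relab_rr[OF f(10) rerooted_subst[OF f(3,5) A[folded True] f(7) H]])
    then show ?thesis using True by simp
  next
    case False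
    have "mset (a # snd A) = mset (s # snd (F ! j))" by (rule rerooted_mset[OF okF[OF j] a(2)])
    then have "set (a # snd A) = set (s # snd (F ! j))" by (rule mset_eq_setD)
    then have m: "a' \<in> set (snd A)" using a'(1) False by auto
    have "rerooted a (subst A ?H) a' (subst A' (?H(a := un a)))"
      by (rule reroot_kept[where F = ?H, OF f(3,5) m A f(7)]) (use f'(14) in simp)
    moreover have "?H(a := un a) = ?H" using f(14) by (intro ext) simp
    moreover have "rerooted a' (subst A' ?H) a' (subst A' ?H')"
      using relab_ok H f(7) by (intro relab_rr ok_subst[OF f'(3)] rerooted_subst[OF f'(3,5) rerooted_refl[OF f'(3)]])
    ultimately show ?thesis using rerooted_trans[OF f(10)] by simp
  qed
qed

text \<open>The root travels from \<open>a\<close> through the vertex \<open>F ! j\<close>, the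
  source and the vertex \<open>F ! j'\<close> to \<open>a'\<close>. Two uses of
  \<open>reroot\<close> follow this path, the inner one for the part attached at \<open>s\<close>,
  the outer one for the gluing at \<open>s\<close> itself.\<close>

lemma glued_different:
  assumes p: "p \<in> Ops P" and F: "fam.mor (arity P p) N F" and s: "N < s"
    and j: "j \<le> arity P p" "j' \<le> arity P p" "j \<noteq> j'"
    and a: "a \<in> set (snd (F ! j))" "rerooted s (F ! j) a A" "rerooted 0 (src p) j B"
    and a': "a' \<in> set (snd (F ! j'))" "rerooted s (F ! j') a' A'" "rerooted 0 (src p) j' B'"
  shows "rerooted a (subst A (un(s := subst B ((!) F)))) a' (subst A' (un(s := subst B' ((!) F))))"
proof -
  note f = glued_facts[OF p F s j(1) a(1,3,2)] and f' = glued_facts[OF p F s j(2) a'(1,3,2)]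
  let ?H = "un(s := subst B ((!) F))"
  \<comment> \<open>A second fresh label, for the leg of the source where \<open>F ! j\<close> is
    cut off; \<open>s\<close> remains the leg 0 of the vertex at the bottom.\<close>
  define t where "t = Suc s"
  have t: "N < t" "s \<noteq> t" "t \<noteq> s" using s by (simp_all add: t_def)
  have okF: "ok (F ! i)" if "i \<le> arity P p" for i by (rule mor_ok[OF F that])
  have lF: "v \<le> N" if "i \<le> arity P p" "v \<in> set (snd (F ! i))" for i v using fam.mor_label[OF F that] .
  have B: "rerooted j B j' B'" by (rule rerooted_trans[OF f(1) rerooted_sym[OF src_ok(1)[OF p] a(3)] a'(3)])
  have jB: "j' \<in> set (snd B)" using mset_eq_setD[OF f(9)] j by (auto simp del: upt_Suc)
  define K where "K = ((!) F)(j := un t)"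
  have okK: "ok (K i)" if "i \<in> set (snd B')" for i using okF[OF f'(8)[OF that]] ok_un by (simp add: K_def)
  have okBK: "ok (subst B' K)" by (rule ok_subst[OF f'(1) okK])
  define W where "W = subst A' (un(s := subst B' K))"
  have W: "rerooted t (subst B ((!) F)) a' W"
    unfolding W_def K_def
  proof (rule reroot[where F = "(!) F", OF f(1,2) jB B okF[OF f(8)] _ f'(4) a'(1,2)])
    show "distinct (t # snd (subst B ((!) F)))" using f(12)[of t] f(13) t(1) by force
  qed
  have sA: "s \<in> set (snd A)"
  proof -
    have "mset (a # snd A) = mset (s # snd (F ! j))" by (rule rerooted_mset[OF okF[OF j(1)] a(2)])
    then have "set (a # snd A) = set (s # snd (F ! j))" by (rule mset_eq_setD)
    then show ?thesis using f(14) by auto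
  qed
  have da: "distinct (a # snd (subst A ?H))" using mset_eq_imp_distinct_iff[OF f(11)] by simp
  have Hs: "?H s = subst B ((!) F)" by simp
  have aS: "a' \<in> set (snd (subst B ((!) F)))" unfolding snd_subst using jB a'(1) by auto
  \<comment> \<open>\<open>A\<close> rerooted at \<open>s\<close> is \<open>F ! j\<close> again,
    which now becomes an upper vertex at \<open>t\<close>.\<close>
  have "rerooted a (subst A ?H) a' (subst W (un(t := subst (F ! j) (?H(a := un a)))))"
  proof (rule reroot[where F = ?H, OF f(3,5) sA rerooted_sym[OF okF[OF j(1)] a(2)] f(7) da])
    show "distinct (t # snd (?H s))" unfolding Hs using f(12)[of t] f(13) t(1) by force
    show "a' \<in> set (snd (?H s))" unfolding Hs by (rule aS)
    show "rerooted t (?H s) a' W" unfolding Hs by (rule W)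
  qed
  moreover have "subst (F ! j) (?H(a := un a)) = F ! j"
  proof (rule subst_un[OF okF[OF j(1)]])
    fix v assume "v \<in> set (snd (F ! j))"
    then have "v \<noteq> s" using f(4) by auto
    then show "(?H(a := un a)) v = un v" by simp
  qed
  \<comment> \<open>Gluing \<open>F ! j\<close> back at \<open>t\<close> undoes the cut made by
    \<open>K\<close>.\<close>
  moreover have "subst W (un(t := F ! j)) = subst A' (un(s := subst B' ((!) F)))"
  proof -
    let ?L = "un(t := F ! j)"
    have okL: "ok (?L v)" for v using okF[OF j(1)] ok_un by simp
    have KL: "subst (K i) ?L = F ! i" if "i \<in> set (snd B')" for i
    proof (cases "i = j")
      case True
      then show ?thesis using un_subst[of ?L t] okF[OF j(1)] by (simp add: K_def)
    next
      case False
      have "subst (F ! i) ?L = F ! i"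
      proof (rule subst_un[OF okF[OF f'(8)[OF that]]])
        fix v assume "v \<in> set (snd (F ! i))"
        then have "v \<noteq> t" using lF[OF f'(8)[OF that]] t(1) by force
        then show "?L v = un v" by simp
      qed
      then show ?thesis using False by (simp add: K_def)
    qed
    have S: "subst (subst B' K) ?L = subst B' ((!) F)"
      by (rule trans[OF ok_assoc[OF f'(1) okK okL] subst_cong[OF KL]])
    have okH: "ok ((un(s := subst B' K)) v)" for v using okBK ok_un by simp
    have "subst W ?L = subst A' (\<lambda>v. subst ((un(s := subst B' K)) v) ?L)"
      unfolding W_def by (rule ok_assoc[OF f'(3) okH okL])
    also have "\<dots> = subst A' (un(s := subst B' ((!) F)))"
    proof (rule subst_cong)
      fix v assume v: "v \<in> set (snd A')"
      have "set (a' # snd A') = set (s # snd (F ! j'))" by (rule rerooted_set[OF okF[OF j(2)] a'(2)])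
      then have "v = s \<or> v \<in> set (snd (F ! j'))" using v by auto
      then have "v \<noteq> t" using lF[OF j(2), of v] t by auto
      then show "subst ((un(s := subst B' K)) v) ?L = (un(s := subst B' ((!) F))) v"
        using S un_subst[of ?L v] ok_un by (cases "v = s") simp_all
    qed
    finally show ?thesis .
  qed
  ultimately show ?thesis by simp
qed

lemma glued_unique:
  assumes "p \<in> Ops P" "fam.mor (arity P p) N F" "N < s" "glued s p F a Z" "glued s p F a' Z'"
  shows "rerooted a Z a' Z'"
proof -
  obtain j B A where j: "j \<le> arity P p" "a \<in> set (snd (F ! j))" "rerooted 0 (src p) j B" "rerooted s (F ! j) a A"
    "Z = subst A (un(s := subst B ((!) F)))" using assms(4) unfolding glued_def by blast
  obtain j' B' A' where j': "j' \<le> arity P p" "a' \<in> set (snd (F ! j'))" "rerooted 0 (src p) j' B'" "rerooted s (F ! j') a' A'"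
    "Z' = subst A' (un(s := subst B' ((!) F)))" using assms(5) unfolding glued_def by blast
  show ?thesis
  proof (cases "j = j'")
    case True
    show ?thesis unfolding j(5) j'(5) by (rule glued_same[OF assms(1-3) j(1,2,4,3) j'(2,4,3)[folded True]])
  next
    case False
    show ?thesis unfolding j(5) j'(5) by (rule glued_different[OF assms(1-3) j(1) j'(1) False j(2,4,3) j'(2,4,3)])
  qed
qed

text \<open>The defining formula is one instance of the gluing: its root is leg 1 of
  \<open>q_j\<close>, and \<open>B\<close> and \<open>A\<close> are produced by the two
  transpositions of legs.\<close>

lemma cyc_target_glued:
  assumes p: "p \<in> Ops P" and f: "f \<in> Hom (cyc_U P) (arity P p) N" and s: "N < s"
  obtains a Z where "glued s p (cyc_lab P f) a Z" "rerooted a Z 0 (cyc_target P p f, [1..<Suc N])"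
proof -
  obtain qs lam where f': "f = (qs, lam)" by (cases f)
  let ?n = "arity P p"
  define F where "F = cyc_lab P f"
  have F: "fam.mor ?n N F" unfolding F_def by (rule cyc_hom_lab(1)[OF f])
  have len: "length qs = Suc ?n" using fam.mor_len[OF F] by (simp add: F_def f')
  have Fi: "F ! i = (qs ! i, map (\<lambda>k. lam (i, k)) [1..<Suc (arity P (qs ! i))])" if "i \<le> ?n" for i
    using cyc_lab_nth[of i f P] that len by (simp add: F_def f' del: upt_Suc)
  have okF: "ok (F ! i)" if "i \<le> ?n" for i by (rule mor_ok[OF F that])
  define j where "j = (LEAST j. j < length qs \<and> 1 \<le> arity P (qs ! j))"
  \<comment> \<open>The leaf numbered 0 belongs to some vertex, so the least \<open>j\<close> in the
    definition of the target exists.\<close>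
  have "\<exists>j. j < length qs \<and> 1 \<le> arity P (qs ! j)"
  proof -
    obtain i where "i \<le> ?n" "0 \<in> set (snd (F ! i))" by (rule fam.mor_label_exists[OF F le0])
    then show ?thesis using Fi[of i] len by (intro exI[of _ i]) (cases "arity P (qs ! i)"; simp)
  qed
  from LeastI_ex[OF this] have j: "j \<le> ?n" "1 \<le> arity P (qs ! j)" "j < length qs" using len by (simp_all add: j_def)
  define r where "r = transpose 0 j"
  define a where "a = lam (j, 1)"
  have q: "qs ! j \<in> Ops P" using okF[OF j(1)] Fi[OF j(1)] by (simp add: wt_def)
  have up: "[1..<Suc (arity P (qs ! j))] = 1 # [2..<Suc (arity P (qs ! j))]"
    using j(2) by (subst upt_conv_Cons) (simp_all add: numeral_2_eq_2 del: upt_Suc)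
  define w where "w = map (\<lambda>k. lam (j, k)) [2..<Suc (arity P (qs ! j))]"
  have Fj: "F ! j = (qs ! j, a # w)" unfolding Fi[OF j(1)] up by (simp add: a_def w_def del: upt_Suc)
  have a: "a \<in> set (snd (F ! j))" unfolding Fj by simp
  define B where "B = (act P r p, map r [1..<Suc ?n])"
  define A where "A = (act P (transpose 0 1) (qs ! j), s # w)"
  have r0: "r permutes {0..?n}" unfolding r_def using j(1) by (intro permutes_swap_id) auto
  have B: "rerooted 0 (src p) j B"
    unfolding rerooted_def src_ok(3)[OF p] src_labels
  proof (intro exI[of _ r] conjI allI impI)
    fix i assume i: "i \<le> ?n"
    have ri: "r i \<le> ?n" using permutes_in_image[OF r0, of i] i by simp
    have "j # snd B = map r [0..<Suc ?n]" by (simp add: B_def r_def upt_conv_Cons del: upt_Suc)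
    then show "(j # snd B) ! r i = [0..<Suc ?n] ! i" using i ri by (simp add: r_def del: upt_Suc)
  qed (use r0 in \<open>simp_all add: B_def src_ok(2)[OF p]\<close>)
  have A: "rerooted s (F ! j) a A"
    unfolding rerooted_def Fj fst_conv snd_conv
  proof (intro exI[of _ "transpose 0 1"] conjI allI impI)
    show "transpose 0 1 permutes {0..arity P (qs ! j)}" using j(2) by (intro permutes_swap_id) auto
    fix i
    show "(a # snd A) ! transpose 0 1 i = (s # a # w) ! i"
      by (cases "i = 0 \<or> i = 1") (auto simp: A_def transpose_def nth_Cons')
  qed (simp_all add: A_def)
  define Z where "Z = subst A (un(s := subst B ((!) F)))"
  have g: "glued s p F a Z" unfolding glued_def Z_def using j(1) a B A by blast
  note gf = glued_facts[OF p F s j(1) a B A, folded Z_def]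
  have sw: "s \<notin> set w" using gf(4) unfolding Fj by simp
  let ?legs = "(j, 1) # concat (map (\<lambda>i. map (\<lambda>k. (r i, k)) [1..<Suc (arity P (qs ! r i))]) [1..<length qs]) @
            map (\<lambda>k. (j, k)) [2..<Suc (arity P (qs ! j))]"
  have rn: "r i \<le> ?n" if "i \<in> set [1..<length qs]" for i
    using permutes_in_image[OF r0, of i] that len by (auto simp del: upt_Suc)
  have SB: "subst B ((!) F) = (plug P (act P r p) (map (\<lambda>i. qs ! r i) [1..<length qs]),
      concat (map (\<lambda>i. map (\<lambda>k. lam (r i, k)) [1..<Suc (arity P (qs ! r i))]) [1..<length qs]))"
  proof -
    have "map (\<lambda>x. fst (F ! x)) (map r [1..<length qs]) = map (\<lambda>i. qs ! r i) [1..<length qs]"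
      "map (\<lambda>x. snd (F ! x)) (map r [1..<length qs]) = map (\<lambda>i. map (\<lambda>k. lam (r i, k)) [1..<Suc (arity P (qs ! r i))]) [1..<length qs]"
      unfolding map_map using Fi[OF rn] by (auto simp del: upt_Suc)
    note m = this
    show ?thesis unfolding subst_def B_def fst_conv snd_conv len[symmetric] m ..
  qed
  have s1: "concat (map (\<lambda>v. snd ((un(s := subst B ((!) F))) v)) w) = w"
    by (rule concat_map_eq_singletons) (use sw in auto)
  have s2: "map (\<lambda>v. fst ((un(s := subst B ((!) F))) v)) w = replicate (length w) (ident P ())"
    using sw by (auto intro!: nth_equalityI)
  have aA: "arity P (act P (transpose 0 1) (qs ! j)) = Suc (length w)"
    using gf(3) by (simp add: wt_single A_def)
  have ins: "map (ident P) (ins P q) = replicate (arity P q) (ident P ())" for q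
    by (intro nth_equalityI) (simp_all add: arity_def)
  have Z1: "fst Z = pcomp P (act P (transpose 0 1) (qs ! j)) 1 (fst (subst B ((!) F)))"
    using s2 aA unfolding Z_def subst_def[of A] pcomp_def ins by (simp add: A_def)
  have Z2: "a # snd Z = map lam ?legs"
    using s1 unfolding Z_def snd_subst by (simp add: A_def SB w_def a_def map_concat comp_def del: upt_Suc)
  have t: "cyc_target P p f = act P (place0 (a # snd Z)) (fst Z)"
    unfolding Z1 Z2 SB fst_conv f' cyc_target.simps Let_def j_def[symmetric] r_def[symmetric] ..
  have aZ: "length (a # snd Z) = Suc N" "arity P (fst Z) = N"
  proof -
    show l: "length (a # snd Z) = Suc N" using arg_cong[OF gf(11), of size] unfolding size_mset length_upt by simp
    show "arity P (fst Z) = N" using wt_arity[OF gf(10)] l by simp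
  qed
  have dZ: "distinct (a # snd Z)" using mset_eq_imp_distinct_iff[OF gf(11)] by simp
  have eZ: "set (a # snd Z) = {0..N}"
    unfolding mset_eq_setD[OF gf(11)] set_upt atLeastLessThanSuc_atLeastAtMost ..
  have pl: "place0 (a # snd Z) permutes {0..N}"
  proof (rule bij_imp_permutes)
    have "{0..N} = {..<length (a # snd Z)}" unfolding aZ(1) by auto
    then have b: "bij_betw ((!) (a # snd Z)) {0..N} {0..N}" by (rule bij_betw_nth[OF dZ _ eZ[symmetric]])
    have "place0 (a # snd Z) x = (a # snd Z) ! x" if "x \<in> {0..N}" for x
      using that aZ(1) unfolding place0_def by simp
    then show "bij_betw (place0 (a # snd Z)) {0..N} {0..N}" by (rule iffD2[OF bij_betw_cong b])
    show "place0 (a # snd Z) x = x" if "x \<notin> {0..N}" for x using that aZ(1) unfolding place0_def by simp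
  qed
  have "rerooted a Z 0 (cyc_target P p f, [1..<Suc N])"
    unfolding rerooted_def aZ(2)
  proof (intro exI[of _ "place0 (a # snd Z)"] conjI allI impI)
    fix i assume i: "i \<le> N"
    have "0 # [1..<Suc N] = [0..<Suc N]" by (simp add: upt_conv_Cons del: upt_Suc)
    moreover have "place0 (a # snd Z) i \<le> N" using permutes_in_image[OF pl, of i] i by simp
    ultimately show "(0 # snd (cyc_target P p f, [1..<Suc N])) ! place0 (a # snd Z) i = (a # snd Z) ! i"
      using i aZ(1) by (simp add: place0_def del: upt_Suc)
  qed (use pl t aZ in simp_all)
  then show ?thesis using that g unfolding F_def by blast
qed

text \<open>By \<open>glued_unique\<close> the target may be computed with any leaf as root, which
  allows the root to be chosen to suit each argument.\<close>

lemma cyc_target_rr: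
  assumes p: "p \<in> Ops P" and f: "f \<in> Hom (cyc_U P) (arity P p) N" and s: "N < s"
    and g: "glued s p (cyc_lab P f) a Z"
  shows "rerooted a Z 0 (cyc_target P p f, [1..<Suc N])" "ok Z" "distinct (a # snd Z)"
    and "\<psi> (fst Z) = \<psi> p + (\<Sum>q\<leftarrow>fst f. \<psi> q)"
proof -
  note F = cyc_hom_lab(1)[OF f]
  obtain j B A where j: "j \<le> arity P p" "a \<in> set (snd (cyc_lab P f ! j))" "rerooted 0 (src p) j B" "rerooted s (cyc_lab P f ! j) a A"
    "Z = subst A (un(s := subst B ((!) (cyc_lab P f))))" using g unfolding glued_def by blast
  note gf = glued_facts[OF p F s j(1-4), folded j(5)]
  show Z: "ok Z" by (rule gf(10))
  show "distinct (a # snd Z)" using mset_eq_imp_distinct_iff[OF gf(11)] by simp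
  have "(\<Sum>X\<leftarrow>cyc_lab P f. \<psi> (fst X)) = (\<Sum>q\<leftarrow>map fst (cyc_lab P f). \<psi> q)" by (simp add: comp_def)
  then show "\<psi> (fst Z) = \<psi> p + (\<Sum>q\<leftarrow>fst f. \<psi> q)" using gf(15) unfolding fst_cyc_lab by simp
  obtain a' Z' where "glued s p (cyc_lab P f) a' Z'" "rerooted a' Z' 0 (cyc_target P p f, [1..<Suc N])"
    by (rule cyc_target_glued[OF p f s])
  then show "rerooted a Z 0 (cyc_target P p f, [1..<Suc N])" using rerooted_trans[OF Z glued_unique[OF p F s g]] by blast
qed

section \<open>Targets of identities and composites\<close>

lemma glued_exists:
  assumes p: "p \<in> Ops P" and F: "fam.mor (arity P p) N F" and a: "a \<le> N"
  obtains j B A where "j \<le> arity P p" "a \<in> set (snd (F ! j))" "rerooted 0 (src p) j B" "rerooted s (F ! j) a A"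
proof -
  obtain j where j: "j \<le> arity P p" "a \<in> set (snd (F ! j))" by (rule fam.mor_label_exists[OF F a])
  have "j \<in> set (0 # snd (src p))" using j(1) unfolding src_labels by (simp del: upt_Suc)
  moreover have rem: "mset (v # remove1 v xs) = mset xs" if "v \<in> set xs" for v and xs :: "nat list"
    using that by simp
  ultimately have "mset (j # remove1 j (0 # snd (src p))) = mset (0 # snd (src p))" by blast
  then obtain b where b: "rerooted 0 (src p) j (b, remove1 j (0 # snd (src p)))" by (rule rerooted_exists[OF src_ok(1)[OF p]])
  have "mset (a # s # remove1 a (snd (F ! j))) = mset (s # snd (F ! j))" using j(2) by simp
  then obtain c where "rerooted s (F ! j) a (c, s # remove1 a (snd (F ! j)))" by (rule rerooted_exists[OF mor_ok[OF F j(1)]])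
  then show ?thesis using that j b by blast
qed

lemma cyc_target_obj:
  assumes p: "p \<in> Ops P" and f: "f \<in> Hom (cyc_U P) (arity P p) N"
  shows "cyc_target P p f \<in> Ops P" "arity P (cyc_target P p f) = N"
    "\<psi> (cyc_target P p f) = \<psi> p + (\<Sum>q\<leftarrow>fst f. \<psi> q)"
proof -
  obtain a Z where g: "glued (Suc N) p (cyc_lab P f) a Z" by (rule cyc_target_glued[OF p f lessI])
  note r = cyc_target_rr[OF p f lessI g]
  have "ok (cyc_target P p f, [1..<Suc N])" by (rule rerooted_ok[OF r(2,1)])
  then show "cyc_target P p f \<in> Ops P" "arity P (cyc_target P p f) = N" by (simp_all add: wt_single del: upt_Suc)
  show "\<psi> (cyc_target P p f) = \<psi> p + (\<Sum>q\<leftarrow>fst f. \<psi> q)" using rerooted_grading[OF r(2,1)] r(4) by simp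
qed

lemma src_unique:
  assumes "ok X" "distinct (z # snd X)" "rerooted z X 0 (t, [1..<Suc N])" "rerooted z X 0 (u, [1..<Suc N])"
  shows "t = u"
proof -
  have t: "ok (t, [1..<Suc N])" "distinct (0 # snd (t, [1..<Suc N]))"
    using rerooted_ok[OF assms(1,3)] rerooted_distinct[OF assms(1,3,2)] .
  have "rerooted 0 (t, [1..<Suc N]) 0 (u, [1..<Suc N])" by (rule rerooted_trans[OF t(1) rerooted_sym[OF assms(1,3)] assms(4)])
  from rerooted_unique[OF t this] show ?thesis by simp
qed

lemma cyc_target_idm:
  assumes p: "p \<in> Ops P"
  shows "cyc_target P p (Idm (cyc_U P) (arity P p)) = p"
proof -
  let ?n = "arity P p" and ?f = "Idm (cyc_U P) (arity P p)" and ?s = "Suc (arity P p)"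
  let ?F = "fam.idm ?n"
  have f: "?f \<in> Hom (cyc_U P) ?n ?n" by (rule env.U_idm_hom) simp
  have L: "cyc_lab P ?f = ?F"
    using env.U_idm[of ?n] env.hom_mk[OF _ _ cat.idm_mor[of ?n]] by simp
  have Fi: "?F ! i = un i" if "i \<le> ?n" for i using cat.idm_nth[OF that] .
  have o: "ok (ident P (), [] @ [0])" using ok_un[of 0] by (simp add: unit_op_def)
  \<comment> \<open>By \<open>rot_ident\<close> an identity may be turned upside down, so rooting at
    its leaf 0 leaves the source unchanged.\<close>
  have "rerooted ?s (un 0) 0 (un ?s)"
    using rerooted_rot[OF o, of ?s] rot_ident id_single(2)[of "()"] by (simp add: unit_op_def)
  then have "rerooted ?s (?F ! 0) 0 (un ?s)" using Fi[of 0] by simp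
  then have g: "glued ?s p ?F 0 (subst (un ?s) (un(?s := subst (src p) ((!) ?F))))"
    unfolding glued_def using rerooted_refl[OF src_ok(1)[OF p]] Fi[of 0]
    by (intro exI[of _ 0] exI[of _ "src p"] exI[of _ "un ?s"]) simp
  have S: "subst (src p) ((!) ?F) = src p"
    by (rule subst_un[OF src_ok(1)[OF p]]) (use Fi src_ok(2)[OF p] in auto)
  have "subst (un ?s) (un(?s := src p)) = src p" using un_subst[of "un(?s := src p)" ?s] src_ok(1)[OF p] by simp
  then have "glued ?s p ?F 0 (src p)" using g unfolding S by simp
  then have r: "rerooted 0 (src p) 0 (cyc_target P p ?f, [1..<Suc ?n])"
    using cyc_target_rr(1)[OF p f lessI] unfolding L by blast
  have "distinct (0 # snd (src p))" unfolding src_labels by (simp del: upt_Suc)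
  from rerooted_unique[OF src_ok(1)[OF p] this r] show ?thesis by (simp add: src_def)
qed

text \<open>The roots are chosen along one path: leaf 0 of the composite lies on
  \<open>G ! a\<close>, and leaf \<open>a\<close> of \<open>f\<close> lies on \<open>F ! j\<close>.
  Rooting \<open>f\<close> at \<open>a\<close>, and both \<open>g\<close> and the composite at 0,
  gives two substitutions of the same shape, with \<open>C\<close> at the bottom, \<open>A\<close>
  on it, and the source \<open>B\<close> on that.\<close>

lemma cyc_target_cmp:
  assumes p: "p \<in> Ops P" and f: "f \<in> Hom (cyc_U P) (arity P p) m" and g: "g \<in> Hom (cyc_U P) m l"
  shows "cyc_target P (cyc_target P p f) g = cyc_target P p (Cmp (cyc_U P) g f)"
proof -
  let ?n = "arity P p" and ?gf = "Cmp (cyc_U P) g f"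
  define F G where "F = cyc_lab P f" and "G = cyc_lab P g"
  define H where "H = fam.cmp ?n l G F"
  define t where "t = cyc_target P p f"
  define s r s' where "s = Suc m" and "r = Suc (Suc l)" and "s' = Suc l"
  have F: "fam.mor ?n m F" and G: "fam.mor m l G" using cyc_hom_lab(1) f g by (simp_all add: F_def G_def)
  have gf: "?gf \<in> Hom (cyc_U P) ?n l" and LH: "cyc_lab P ?gf = H"
    using env.U_comp[OF _ _ _ f g] env.lab_cmp[OF _ _ _ f g] by (simp_all add: H_def F_def G_def)
  have Hm: "fam.mor ?n l H" using cyc_hom_lab(1)[OF gf] unfolding LH .
  have t: "t \<in> Ops P" "arity P t = m" using cyc_target_obj[OF p f] by (simp_all add: t_def)
  have g': "g \<in> Hom (cyc_U P) (arity P t) l" and G': "fam.mor (arity P t) l G" using g G t(2) by simp_all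
  have okF: "ok (F ! i)" if "i \<le> ?n" for i by (rule mor_ok[OF F that])
  have okG: "ok (G ! i)" if "i \<le> m" for i by (rule mor_ok[OF G that])
  have okH: "ok (H ! i)" if "i \<le> ?n" for i by (rule mor_ok[OF Hm that])
  have lF: "v \<le> m" if "i \<le> ?n" "v \<in> set (snd (F ! i))" for i v using fam.mor_label[OF F that] .
  have lG: "v \<le> l" if "i \<le> m" "v \<in> set (snd (G ! i))" for i v using fam.mor_label[OF G that] .
  have HF: "relab (subst (F ! i) ((!) G)) (H ! i)" if "i \<le> ?n" for i
    using fam.cmp_E[OF F G _ _ that] by (simp add: fam.vert_def H_def)
  have okFG: "ok (subst (F ! i) ((!) G))" if "i \<le> ?n" for i
    by (rule ok_subst[OF okF[OF that] okG[OF lF[OF that]]])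
  \<comment> \<open>The leaf 0 is chosen because the target has leg 0 as its output.\<close>
  obtain a where a: "a \<le> m" "0 \<in> set (snd (G ! a))" by (rule fam.mor_label_exists[OF G le0])
  obtain j B A where j: "j \<le> ?n" "a \<in> set (snd (F ! j))" "rerooted 0 (src p) j B" "rerooted s (F ! j) a A"
    by (rule glued_exists[OF p F a(1)])
  have ms: "m < s" and lr: "l < r" and ls: "l < s'" and rs: "r \<noteq> s'" "s' \<noteq> r" by (simp_all add: s_def r_def s'_def)
  note f1 = glued_facts[OF p F ms j]
  define Z where "Z = subst A (un(s := subst B ((!) F)))"
  have gl: "glued s p F a Z" unfolding glued_def Z_def using j by blast
  have Zt: "rerooted a Z 0 (src t)" "ok Z"
    using cyc_target_rr(1,2)[OF p f ms gl[unfolded F_def]] t(2) by (simp_all add: src_def t_def)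
  have tZ: "rerooted 0 (src t) a Z" by (rule rerooted_sym[OF Zt(2,1)])
  have "mset (0 # r # remove1 0 (snd (G ! a))) = mset (r # snd (G ! a))" using a(2) by simp
  then obtain c where c: "rerooted r (G ! a) 0 (c, r # remove1 0 (snd (G ! a)))" by (rule rerooted_exists[OF okG[OF a(1)]])
  define C where "C = (c, r # remove1 0 (snd (G ! a)))"
  have C: "rerooted r (G ! a) 0 C" using c by (simp add: C_def)
  have at: "a \<le> arity P t" using a(1) t(2) by simp
  define Y where "Y = subst C (un(r := subst Z ((!) G)))"
  have gl2: "glued r t G 0 Y" unfolding glued_def Y_def using at a(2) tZ C by blast
  note f2 = glued_facts[OF t(1) G' lr at a(2) tZ C, folded Y_def]
  have Yu: "rerooted 0 Y 0 (cyc_target P t g, [1..<Suc l])"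
    by (rule cyc_target_rr(1)[OF t(1) g' lr gl2[unfolded G_def]])
  define M where "M = ((!) G)(s := un s')"
  define A3 where "A3 = subst C (un(r := subst A M))"
  have dG: "distinct (s' # snd (subst (F ! j) ((!) G)))"
  proof -
    have d: "distinct (snd (subst (F ! j) ((!) G)))" using fam.vert_distinct[OF F G j(1)] by (simp add: fam.vert_def)
    have "v \<le> l" if "v \<in> set (snd (subst (F ! j) ((!) G)))" for v
      using that lG lF[OF j(1)] unfolding snd_subst by auto
    then show ?thesis using d ls by force
  qed
  \<comment> \<open>Vertex \<open>j\<close> of the composite, before normalization, is rerooted at
    0: its root runs through \<open>F ! j\<close>, crosses the edge \<open>a\<close> and leaves
    through \<open>G ! a\<close>.\<close>
  have r1: "rerooted s' (subst (F ! j) ((!) G)) 0 A3"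
    unfolding A3_def M_def
    by (rule reroot[where F = "(!) G", OF okF[OF j(1)] f1(4) j(2) j(4) okG[OF lF[OF j(1)]] dG f2(4) a(2) C])
  have rH: "rerooted s' (H ! j) 0 A3"
    by (rule rerooted_trans[OF okH[OF j(1)] rerooted_sym[OF okFG[OF j(1)] relab_rr[OF okFG[OF j(1)] HF[OF j(1)]]] r1])
  have 0: "0 \<in> set (snd (H ! j))"
  proof -
    have "0 \<in> set (snd (subst (F ! j) ((!) G)))" unfolding snd_subst using j(2) a(2) by auto
    moreover have "mset (snd (H ! j)) = mset (snd (subst (F ! j) ((!) G)))"
      using relab_wt(2)[OF okFG[OF j(1)] HF[OF j(1)]] .
    ultimately show ?thesis by (metis set_mset_mset)
  qed
  define X where "X = subst A3 (un(s' := subst B ((!) H)))"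
  have gl3: "glued s' p H 0 X" unfolding glued_def X_def using j(1,3) 0 rH by blast
  note f3 = glued_facts[OF p Hm ls j(1) 0 j(3) rH]
  have Xu: "rerooted 0 X 0 (cyc_target P p ?gf, [1..<Suc l])"
    by (rule cyc_target_rr(1)[OF p gf ls]) (use gl3 LH in simp)
  let ?K = "un(s' := subst B ((!) H))"
  have lA: "v = s \<or> v \<le> m" if "v \<in> set (snd A)" for v
    using rerooted_set[OF okF[OF j(1)] j(4)] that lF[OF j(1)] by auto
  have lC: "v = r \<or> v \<le> l" if "v \<in> set (snd C)" for v
    using rerooted_set[OF okG[OF a(1)] C] that lG[OF a(1)] by auto
  have okM: "ok (M v)" if "v \<in> set (snd A)" for v using lA[OF that] okG ok_un by (auto simp: M_def)
  have okAM: "ok (subst A M)" by (rule ok_subst[OF f1(3) okM])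
  \<comment> \<open>The gluing at \<open>s'\<close> is pushed inward through \<open>C\<close> and
    \<open>A\<close> to the label \<open>s\<close>, so that \<open>X\<close> takes the shape of
    \<open>Y\<close>.\<close>
  have X1: "X = subst C (un(r := subst A (((!) G)(s := subst B ((!) H)))))"
  proof -
    have lM: "w \<noteq> s'" if "v \<noteq> s" "v \<in> set (snd A)" "w \<in> set (snd (M v))" for v w
      using that lA[OF that(2)] lG[of v w] ls by (auto simp: M_def)
    have MK: "subst (M v) ?K = (((!) G)(s := subst B ((!) H))) v" if v: "v \<in> set (snd A)" for v
    proof (cases "v = s")
      case True
      then show ?thesis using un_subst[of ?K s'] f3(6) by (simp add: M_def)
    next
      case False
      have "subst (M v) ?K = M v" using lM[OF False v] by (intro subst_un[OF okM[OF v]]) simp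
      then show ?thesis using False by (simp add: M_def)
    qed
    have S: "subst (subst A M) ?K = subst A (((!) G)(s := subst B ((!) H)))"
      by (rule trans[OF ok_assoc[OF f1(3) okM f3(7)] subst_cong[OF MK]])
    have o: "ok ((un(r := subst A M)) v)" for v using okAM ok_un by simp
    have "X = subst C (\<lambda>v. subst ((un(r := subst A M)) v) ?K)"
      unfolding X_def A3_def by (rule ok_assoc[OF f2(3) o f3(7)])
    also have "\<dots> = subst C (un(r := subst A (((!) G)(s := subst B ((!) H)))))"
    proof (rule subst_cong)
      fix v assume v: "v \<in> set (snd C)"
      show "subst ((un(r := subst A M)) v) ?K = (un(r := subst A (((!) G)(s := subst B ((!) H))))) v"
      proof (cases "v = r")
        case False
        then have "v \<noteq> s'" using lC[OF v] ls by auto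
        then show ?thesis using False un_subst[of ?K v] ok_un by simp
      qed (use S in simp)
    qed
    finally show ?thesis .
  qed
  have okG': "ok (G ! v)" if "v \<in> set (snd A)" "v \<noteq> s" for v using lA[OF that(1)] that(2) okG by blast
  have lSB: "v \<le> m" if "v \<in> set (snd (subst B ((!) F)))" for v using f1(12)[OF that] .
  have SBG: "subst (subst B ((!) F)) ((!) G) = subst B (\<lambda>i. subst (F ! i) ((!) G))"
    by (rule ok_assoc[OF f1(1) okF[OF f1(8)]]) (use okG lF f1(8) in blast)+
  let ?H = "un(s := subst B ((!) F))"
  have ZG: "subst Z ((!) G) = subst A (\<lambda>v. subst (?H v) ((!) G))"
    unfolding Z_def
  proof (rule ok_assoc[OF f1(3,7)])
    fix v y assume "v \<in> set (snd A)" "y \<in> set (snd (?H v))"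
    then have "y \<le> m" using lA[of v] lSB[of y] by (cases "v = s") auto
    then show "ok (G ! y)" by (rule okG)
  qed
  \<comment> \<open>The two sides differ only in the vertices over the source, where
    \<open>H\<close> has been normalized.\<close>
  have rel: "relab (subst Z ((!) G)) (subst A (((!) G)(s := subst B ((!) H))))"
    unfolding ZG
  proof (rule rerooted_subst[OF f1(3,5) rerooted_refl[OF f1(3)]])
    fix v assume v: "v \<in> set (snd A)"
    show "ok (subst (?H v) ((!) G))"
    proof (rule ok_subst[OF f1(7)])
      fix y assume "y \<in> set (snd (?H v))"
      then have "y \<le> m" using lA[OF v] lSB[of y] by (cases "v = s") auto
      then show "ok (G ! y)" by (rule okG)
    qed
    show "relab (subst (?H v) ((!) G)) ((((!) G)(s := subst B ((!) H))) v)"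
    proof (cases "v = s")
      case True
      have "relab (subst B (\<lambda>i. subst (F ! i) ((!) G))) (subst B ((!) H))"
        by (rule rerooted_subst[OF f1(1,2) rerooted_refl[OF f1(1)] okFG[OF f1(8)] HF[OF f1(8)]])
      then show ?thesis using True SBG by simp
    next
      case False
      then have "subst (?H v) ((!) G) = G ! v" using un_subst[of "(!) G" v] okG'[OF v] by simp
      then show ?thesis using False relab_ok[OF okG'[OF v False]] by simp
    qed
  qed
  have YX: "relab Y X"
    unfolding Y_def X1
  proof (rule rerooted_subst[OF f2(3,5) rerooted_refl[OF f2(3)] f2(7)])
    fix v show "relab ((un(r := subst Z ((!) G))) v) ((un(r := subst A (((!) G)(s := subst B ((!) H))))) v)"
      using rel relab_ok[OF ok_un] by simp
  qed
  have "distinct (0 # snd Y)" using mset_eq_imp_distinct_iff[OF f2(11)] by simp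
  moreover have "rerooted 0 Y 0 (cyc_target P p ?gf, [1..<Suc l])"
    by (rule rerooted_trans[OF f2(10) relab_rr[OF f2(10) YX] Xu])
  ultimately show ?thesis using src_unique[OF f2(10) _ Yu] unfolding t_def by blast
qed

sublocale tw: twisted P relab nrm \<psi> "{}" "UNIV :: nat set" "\<lambda>n. n" "\<lambda>_ _. ()" "\<lambda>_. True"
  "cyc_U P" "cyc_lab P" "cyc_mk P" "cyc_trivial P" "cyc_Tw P" "arity P" "cyc_target P"
proof unfold_locales
  have O: "Obj (cyc_Tw P) = Ops P" by (simp add: cyc_Tw_def)
  show "Obj (cyc_Tw P) = Ops P" by (rule O)
  show "Cmp (cyc_Tw P) = Cmp (cyc_U P)" by (simp add: cyc_Tw_def cyc_U_def)
  fix p assume p: "p \<in> Obj (cyc_Tw P)"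
  then have p': "p \<in> Ops P" using O by simp
  show "Idm (cyc_Tw P) p = Idm (cyc_U P) (arity P p)" by (simp add: cyc_Tw_def cyc_U_def)
  show "cyc_target P p (Idm (cyc_U P) (arity P p)) = p" by (rule cyc_target_idm[OF p'])
  { fix y f assume f: "f \<in> Hom (cyc_U P) (arity P p) y"
    show "cyc_target P p f \<in> Obj (cyc_Tw P) \<and> arity P (cyc_target P p f) = y"
      using cyc_target_obj[OF p' f] O by simp
    fix z g assume "g \<in> Hom (cyc_U P) y z"
    then show "cyc_target P (cyc_target P p f) g = cyc_target P p (Cmp (cyc_U P) g f)"
      by (rule cyc_target_cmp[OF p' f]) }
  fix t f assume "t \<in> Obj (cyc_Tw P)"
  show "f \<in> Hom (cyc_Tw P) p t \<longleftrightarrow> f \<in> Hom (cyc_U P) (arity P p) (arity P t) \<and> cyc_target P p f = t"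
  proof
    assume "f \<in> Hom (cyc_Tw P) p t"
    then have c: "cyc_tuple P (arity P p) f" "cyc_target P p f = t" by (simp_all add: cyc_Tw_def)
    \<comment> \<open>A tuple has at least one leaf by definition, so the number of its leaves is
      \<open>Suc N\<close> for an object \<open>N\<close>.\<close>
    have "1 \<le> length (cyc_leaves P (fst f))" using c(1) by (cases f) (simp add: length_cyc_leaves)
    then obtain N where "length (cyc_leaves P (fst f)) = Suc N" by (cases "length (cyc_leaves P (fst f))") auto
    then have h: "f \<in> Hom (cyc_U P) (arity P p) N" using c(1) by (simp add: cyc_hom)
    show "f \<in> Hom (cyc_U P) (arity P p) (arity P t) \<and> cyc_target P p f = t"
      using h cyc_target_obj(2)[OF p' h] c(2) by simp
  next
    assume "f \<in> Hom (cyc_U P) (arity P p) (arity P t) \<and> cyc_target P p f = t"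
    then show "f \<in> Hom (cyc_Tw P) p t" by (simp add: cyc_hom cyc_Tw_def)
  qed
next
  fix p y f assume "p \<in> Ops P" "f \<in> Hom (cyc_U P) (arity P p) y"
  then show "\<psi> (cyc_target P p f) = \<psi> p + (\<Sum>q\<leftarrow>fst f. \<psi> q)" by (rule cyc_target_obj(3))
next
  fix p p' assume p: "p \<in> Ops P" "p' \<in> Ops P" and a: "arity P p = arity P p'"
  have "ins P p = ins P p'" by (rule nth_equalityI) (use a in \<open>simp_all add: arity_def\<close>)
  then have "mset (ins P p) = mset (ins P p') \<and> out P p = out P p'" by simp
  from dep[unfolded grading_depends_on_colours_def, rule_format, OF p this] show "\<psi> p = \<psi> p'" .
qed simp_all

end

theorem theorem2p56:
  shows
   "(\<forall>(P :: ('c, 'o) operad) \<psi>.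
       planar_operad P \<and> planar_grading P \<psi> \<and> nice P \<psi> \<and> grading_depends_on_colours P \<psi> \<longrightarrow>
       (let Tw = pl_Tw P; U = pl_U P; pr = profile P; V = V_of U P pr; deg = fibre_degree P \<psi> pr;
            Rm = R_minus P \<psi> (pl_trivial P) U; Rp = R_plus \<psi> U
        in discrete_opfibration Tw U pr id \<and>
           (\<forall>p\<in>Ops P. deg (pr p) = \<psi> p) \<and>
           orthogonal_factorization_system U Rm Rp \<and>
           orthogonal_factorization_system V Rm Rp \<and>
           (generalized_reedy V Rm Rp deg \<longleftrightarrow> grading0_groupoid P \<psi>) \<and>
           (grading0_groupoid P \<psi> \<longrightarrow>
              discrete_opfibration Tw V pr id \<and>
              generalized_reedy_map Tw (R_minus P \<psi> (pl_trivial P) Tw) (R_plus \<psi> Tw) \<psi>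
                V Rm Rp deg pr id)))
  \<and> (\<forall>(P :: ('c, 'o) sym_operad) \<psi>.
       symmetric_operad P \<and> symmetric_grading P \<psi> \<and> nice P \<psi> \<and> grading_depends_on_colours P \<psi> \<longrightarrow>
       (let Tw = sym_Tw P; U = sym_U P; pr = profile P; V = V_of U P pr; deg = fibre_degree P \<psi> pr;
            Rm = R_minus P \<psi> (sym_trivial P) U; Rp = R_plus \<psi> U
        in discrete_opfibration Tw U pr id \<and>
           (\<forall>p\<in>Ops P. deg (pr p) = \<psi> p) \<and>
           orthogonal_factorization_system U Rm Rp \<and>
           orthogonal_factorization_system V Rm Rp \<and>
           (generalized_reedy V Rm Rp deg \<longleftrightarrow> grading0_groupoid P \<psi>) \<and>
           (grading0_groupoid P \<psi> \<longrightarrow>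
              discrete_opfibration Tw V pr id \<and>
              generalized_reedy_map Tw (R_minus P \<psi> (sym_trivial P) Tw) (R_plus \<psi> Tw) \<psi>
                V Rm Rp deg pr id)))
  \<and> (\<forall>(P :: (unit, 'o) sym_operad) \<psi>.
       cyclic_operad P \<and> cyclic_grading P \<psi> \<and> nice P \<psi> \<and> grading_depends_on_colours P \<psi> \<longrightarrow>
       (let Tw = cyc_Tw P; U = cyc_U P; pr = arity P; V = V_of U P pr; deg = fibre_degree P \<psi> pr;
            Rm = R_minus P \<psi> (cyc_trivial P) U; Rp = R_plus \<psi> U
        in discrete_opfibration Tw U pr id \<and>
           (\<forall>p\<in>Ops P. deg (pr p) = \<psi> p) \<and>
           orthogonal_factorization_system U Rm Rp \<and>
           orthogonal_factorization_system V Rm Rp \<and>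
           (generalized_reedy V Rm Rp deg \<longleftrightarrow> grading0_groupoid P \<psi>) \<and>
           (grading0_groupoid P \<psi> \<longrightarrow>
              discrete_opfibration Tw V pr id \<and>
              generalized_reedy_map Tw (R_minus P \<psi> (cyc_trivial P) Tw) (R_plus \<psi> Tw) \<psi>
                V Rm Rp deg pr id)))"
proof (intro conjI allI impI, goal_cases)
  case (1 P \<psi>)
  then interpret graded_planar P \<psi>
    by (intro graded_planar.intro graded_planar_axioms.intro) simp_all
  show ?case unfolding Let_def by (rule tw.reedy_main)
next
  case (2 P \<psi>)
  then interpret graded_symmetric P \<psi>
    by (intro graded_symmetric.intro graded_symmetric_axioms.intro) simp_all
  show ?case unfolding Let_def by (rule tw.reedy_main)
next
  case (3 P \<psi>)
  then interpret graded_cyclic P \<psi>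
    by (intro graded_cyclic.intro graded_cyclic_axioms.intro) simp_all
  show ?case unfolding Let_def by (rule tw.reedy_main)
qed

end
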